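(* Let $\Omega\subset\mathbb{R}^n$ be a bounded domain, $p\in(1,\infty)$ and $s\in(0,1)$. Assume $g\in W^{s,p}_0(\Omega)$ and define $\mu_{s,p}:=\lambda_{s,p}^{\frac1{p-1}}$. Then for any weak solution $v$ of $$\begin{cases}|v_t|^{p-2}v_t+(-\Delta_p)^s v=0, & \Omega\times(0,\infty),\\ v=0, & (\mathbb{R}^n\setminus\Omega)\times[0,\infty),\\ v=g, & \Omega\times\{0\},\end{cases}$$ the limit $$w(x):=\lim_{t\to\infty}e^{\mu_{s,p}t}v(x,t)$$ exists in $W^{s,p}(\mathbb{R}^n)$ and is a ground state for $(-\Delta_p)^s$, provided it is not identically zero. In this case, $v(\cdot,t)\ne0$ for $t\ge0$ and $$\lambda_{s,p}=\lim_{t\to\infty}\frac{\displaystyle\int_{\mathbb{R}^n}\int_{\mathbb{R}^n}\frac{|v(x,t)-v(y,t)|^p}{|x-y|^{n+sp}}\,dx\,dy}{\displaystyle\int_\Omega|v(x,t)|^p\,dx}.$$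
   Context: Fractional Sobolev spaces: $[u]^p_{W^{s,p}(\mathbb{R}^n)}=\int_{\mathbb{R}^n}\int_{\mathbb{R}^n}\frac{|u(x)-u(y)|^p}{|x-y|^{n+sp}}\,dx\,dy$, $\|u\|^p_{W^{s,p}(\mathbb{R}^n)}=[u]^p_{W^{s,p}(\mathbb{R}^n)}+\|u\|^p_{L^p(\mathbb{R}^n)}$, and $W^{s,p}_0(\Omega)$ is the closure of $C_0^\infty(\Omega)$ in this norm. Set $$\lambda_{s,p}=\inf_{u\in W^{s,p}_0(\Omega)\setminus\{0\}}\frac{[u]^p_{W^{s,p}(\mathbb{R}^n)}}{\int_\Omega|u|^p\,dx}.$$ A ground state for $(-\Delta_p)^s$ is a minimizer $u\in W^{s,p}_0(\Omega)\setminus\{0\}$ of this Rayleigh quotient. Here $(-\Delta_p)^s$ denotes the fractional $p$-Laplacian, $(-\Delta_p)^su(x)=2\,\mathrm{P.V.}\int_{\mathbb{R}^n}\frac{|u(x)-u(x+y)|^{p-2}(u(x)-u(x+y))}{|y|^{n+sp}}dy$. Weak solution: write $\mathcal{J}_p(t)=|t|^{p-2}t$. A function $v$ is a weak solution of the initial value problem above if $v\in L^\infty([0,\infty);W^{s,p}_0(\Omega))$, $v_t\in L^p(\Omega\times[0,\infty))$, $$\int_\Omega|v_t(x,t)|^{p-2}v_t(x,t)\phi(x)\,dx+\int_{\mathbb{R}^n}\int_{\mathbb{R}^n}\frac{\mathcal{J}_p(v(x,t)-v(y,t))(\phi(x)-\phi(y))}{|x-y|^{n+sp}}\,dx\,dy=0$$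 for each $\phi\in W^{s,p}_0(\Omega)$ and a.e. $t>0$, and $v(x,0)=g(x)$ (meaningful since $t\mapsto v(\cdot,t)$ is absolutely continuous with values in $L^p(\Omega)$). *)

theory Defs
  imports "HOL-Analysis.Analysis"
begin

text \<open>
  The space \<open>\<real>\<^sup>n\<close> is a type of class \<open>euclidean_space\<close> with \<open>n = DIM('a)\<close>.  Elements of
  Lebesgue and Sobolev spaces are represented by functions; two functions represent the same
  element iff they agree almost everywhere.  Norms and energies take values in \<open>ennreal\<close>,
  so that an infinite value is never confused with a finite one.
\<close>

subsection \<open>Test functions\<close>

primrec C_diff :: "nat \<Rightarrow> ('b::euclidean_space \<Rightarrow> real) \<Rightarrow> bool" where
  "C_diff 0 f \<longleftrightarrow> continuous_on UNIV f"
| "C_diff (Suc k) f \<longleftrightarrow>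
     (\<forall>x. f differentiable (at x)) \<and> (\<forall>h. C_diff k (\<lambda>x. frechet_derivative f (at x) h))"

definition test_functions :: "'b::euclidean_space set \<Rightarrow> ('b \<Rightarrow> real) set" where
  "test_functions U =
     {\<phi>. (\<forall>k. C_diff k \<phi>) \<and> compact (closure {x. \<phi> x \<noteq> 0}) \<and> closure {x. \<phi> x \<noteq> 0} \<subseteq> U}"

subsection \<open>Lebesgue and fractional Sobolev spaces\<close>

definition Lp_energy :: "'b measure \<Rightarrow> real \<Rightarrow> ('b \<Rightarrow> real) \<Rightarrow> ennreal" where
  "Lp_energy M p u = (\<integral>\<^sup>+ x. ennreal (\<bar>u x\<bar> powr p) \<partial>M)"

definition Lp_space :: "'b measure \<Rightarrow> real \<Rightarrow> ('b \<Rightarrow> real) set" where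
  "Lp_space M p = {u \<in> borel_measurable M. Lp_energy M p u < \<infinity>}"

text \<open>The \<open>p\<close>-th power of the Gagliardo seminorm.\<close>

definition gagliardo :: "real \<Rightarrow> real \<Rightarrow> ('a::euclidean_space \<Rightarrow> real) \<Rightarrow> ennreal" where
  "gagliardo s p u =
     (\<integral>\<^sup>+ x. (\<integral>\<^sup>+ y. ennreal (\<bar>u x - u y\<bar> powr p / norm (x - y) powr (real DIM('a) + s * p))
        \<partial>lebesgue) \<partial>lebesgue)"

definition ennreal_powr :: "ennreal \<Rightarrow> real \<Rightarrow> ennreal" where
  "ennreal_powr a r = (if a = \<infinity> then \<infinity> else ennreal (enn2real a powr r))"

definition Wsp_norm :: "real \<Rightarrow> real \<Rightarrow> ('a::euclidean_space \<Rightarrow> real) \<Rightarrow> ennreal" where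
  "Wsp_norm s p u = ennreal_powr (gagliardo s p u + Lp_energy lebesgue p u) (1 / p)"

definition Wsp :: "real \<Rightarrow> real \<Rightarrow> ('a::euclidean_space \<Rightarrow> real) set" where
  "Wsp s p = {u \<in> borel_measurable lebesgue. Wsp_norm s p u < \<infinity>}"

definition Wsp0 :: "'a::euclidean_space set \<Rightarrow> real \<Rightarrow> real \<Rightarrow> ('a \<Rightarrow> real) set" where
  "Wsp0 \<Omega> s p =
     {u \<in> Wsp s p. \<forall>\<epsilon>>0. \<exists>\<phi>\<in>test_functions \<Omega>. Wsp_norm s p (\<lambda>x. u x - \<phi> x) < \<epsilon>}"

subsection \<open>Rayleigh quotient and ground states\<close>

definition ae_zero :: "('a::euclidean_space \<Rightarrow> real) \<Rightarrow> bool" where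
  "ae_zero u \<longleftrightarrow> (AE x in lebesgue. u x = 0)"

definition rayleigh :: "'a::euclidean_space set \<Rightarrow> real \<Rightarrow> real \<Rightarrow> ('a \<Rightarrow> real) \<Rightarrow> ennreal" where
  "rayleigh \<Omega> s p u = gagliardo s p u / Lp_energy (lebesgue_on \<Omega>) p u"

definition lambda_sp :: "'a::euclidean_space set \<Rightarrow> real \<Rightarrow> real \<Rightarrow> ennreal" where
  "lambda_sp \<Omega> s p = (INF u \<in> {u \<in> Wsp0 \<Omega> s p. \<not> ae_zero u}. rayleigh \<Omega> s p u)"

text \<open>For nonempty open \<open>\<Omega>\<close> the infimum is finite, so \<open>enn2real\<close> loses nothing.\<close>

definition mu_sp :: "'a::euclidean_space set \<Rightarrow> real \<Rightarrow> real \<Rightarrow> real" where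
  "mu_sp \<Omega> s p = enn2real (lambda_sp \<Omega> s p) powr (1 / (p - 1))"

definition ground_state :: "'a::euclidean_space set \<Rightarrow> real \<Rightarrow> real \<Rightarrow> ('a \<Rightarrow> real) \<Rightarrow> bool" where
  "ground_state \<Omega> s p u \<longleftrightarrow>
     is_arg_min (rayleigh \<Omega> s p) (\<lambda>u. u \<in> Wsp0 \<Omega> s p \<and> \<not> ae_zero u) u"

subsection \<open>Weak solutions\<close>

definition J_op :: "real \<Rightarrow> real \<Rightarrow> real" where
  "J_op p t = \<bar>t\<bar> powr (p - 2) * t"

text \<open>
  Membership in the Bochner space \<open>L\<^sup>\<infinity>([0,\<infinity>); W\<^sub>0\<^sup>s\<^sup>,\<^sup>p(\<Omega>))\<close>: strong measurability (almost everywhere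
  limit of simple functions with values in the space) and essential boundedness.
\<close>

definition Linf_Wsp0 :: "'a::euclidean_space set \<Rightarrow> real \<Rightarrow> real \<Rightarrow> (real \<Rightarrow> 'a \<Rightarrow> real) \<Rightarrow> bool" where
  "Linf_Wsp0 \<Omega> s p v \<longleftrightarrow>
     (AE t in lebesgue_on {0..}. v t \<in> Wsp0 \<Omega> s p) \<and>
     (\<exists>S :: nat \<Rightarrow> real \<Rightarrow> 'a \<Rightarrow> real.
        (\<forall>k. simple_function (lebesgue_on {0..}) (S k)) \<and>
        (\<forall>k. \<forall>t\<ge>0. S k t \<in> Wsp0 \<Omega> s p) \<and>
        (AE t in lebesgue_on {0..}. (\<lambda>k. Wsp_norm s p (\<lambda>x. S k t x - v t x)) \<longlonglongrightarrow> 0)) \<and>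
     (\<exists>C::real. AE t in lebesgue_on {0..}. Wsp_norm s p (v t) \<le> ennreal C)"

text \<open>
  The distributional derivative in time on \<open>\<Omega> \<times> (0,\<infinity>)\<close>; points of space-time are written
  \<open>(x, t)\<close>.  The integral of \<open>v \<partial>\<^sub>t\<phi>\<close> is iterated because \<open>v\<close> is given as a curve \<open>t \<mapsto> v t\<close>
  of spatial functions.
\<close>

definition weak_time_deriv ::
  "'a::euclidean_space set \<Rightarrow> (real \<Rightarrow> 'a \<Rightarrow> real) \<Rightarrow> ('a \<times> real \<Rightarrow> real) \<Rightarrow> bool" where
  "weak_time_deriv \<Omega> v vt \<longleftrightarrow>
     (\<forall>\<phi>\<in>test_functions (\<Omega> \<times> {0<..}).
        (LINT t|lebesgue_on {0..}. (LINT x|lebesgue_on \<Omega>. v t x * deriv (\<lambda>\<tau>. \<phi> (x, \<tau>)) t))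
        = - (LINT z|lebesgue_on (\<Omega> \<times> {0..}). vt z * \<phi> z))"

text \<open>
  The clauses \<open>v t \<in> L\<^sup>p(\<Omega>)\<close> and continuity in time select the representative of \<open>v\<close> that is
  continuous with values in \<open>L\<^sup>p(\<Omega>)\<close>; for it the initial value and the values at single times
  make sense.  Its absolute continuity follows from \<open>v\<^sub>t \<in> L\<^sup>p(\<Omega> \<times> [0,\<infinity>))\<close>.
\<close>

definition weak_solution ::
  "'a::euclidean_space set \<Rightarrow> real \<Rightarrow> real \<Rightarrow> ('a \<Rightarrow> real) \<Rightarrow> (real \<Rightarrow> 'a \<Rightarrow> real) \<Rightarrow> bool" where
  "weak_solution \<Omega> s p g v \<longleftrightarrow>
     Linf_Wsp0 \<Omega> s p v \<and>
     (\<forall>t\<ge>0. v t \<in> Lp_space (lebesgue_on \<Omega>) p) \<and>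
     (\<forall>t\<ge>0. ((\<lambda>\<tau>. Lp_energy (lebesgue_on \<Omega>) p (\<lambda>x. v \<tau> x - v t x)) \<longlongrightarrow> 0) (at t within {0..})) \<and>
     (\<forall>t\<ge>0. AE x in lebesgue. x \<notin> \<Omega> \<longrightarrow> v t x = 0) \<and>
     (AE x in lebesgue_on \<Omega>. v 0 x = g x) \<and>
     (\<exists>vt \<in> Lp_space (lebesgue_on (\<Omega> \<times> {0..})) p.
        weak_time_deriv \<Omega> v vt \<and>
        (\<forall>\<phi>\<in>Wsp0 \<Omega> s p. AE t in lebesgue_on {0<..}.
           (LINT x|lebesgue_on \<Omega>. J_op p (vt (x, t)) * \<phi> x)
           + (LINT x|lebesgue. (LINT y|lebesgue.
                J_op p (v t x - v t y) * (\<phi> x - \<phi> y)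
                  / norm (x - y) powr (real DIM('a) + s * p))) = 0))"

end

theory Submission
  imports Defs "HOL-Library.Diagonal_Subsequence"
begin

text \<open>
  Write \<open>P t\<close> for the seminorm power \<open>[v(t)]\<^sup>p\<close>, \<open>\<lambda>\<close> for \<open>lambda_sp\<close> and \<open>\<mu>\<close> for \<open>mu_sp\<close>.
  Testing the equation with increments \<open>v(t + h) - v(t)\<close> and using convexity of the energy gives
  \<open>P b + p \<integral>\<^sub>a\<^sup>b \<parallel>v\<^sub>t\<parallel>\<^sup>p \<le> P a\<close>, without differentiating \<open>P\<close>.  Testing with \<open>v(t)\<close> gives
  \<open>\<parallel>v\<^sub>t\<parallel>\<^sup>p \<ge> \<mu> P\<close>, so \<open>e\<^bsup>p \<mu> t\<^esup> P t\<close> decreases to a limit \<open>S\<close>, and the integral of \<open>\<bar>e\<^bsup>\<mu> t\<^esup> v(t)\<bar>\<^sup>p\<close>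
  tends to \<open>S / \<lambda>\<close>.  If \<open>S > 0\<close>, compactness and uniform convexity show that the subsequential limits
  of \<open>e\<^bsup>\<mu> t\<^esup> v(t)\<close> are minimisers of energy \<open>S\<close>.  By hidden convexity (the pointwise \<open>p\<close>-mean of two
  minimisers is a minimiser) these are unique up to sign, with no appeal to positivity of minimisers,
  and continuity in time selects the sign.
\<close>

subsection \<open>Elementary inequalities for powers\<close>

text \<open>For each test function the equation holds at almost every time, but the increments used
  as test functions change with the time. The simple functions witnessing strong measurability of
  \<open>v\<close> have countably many values; these lead to one set \<open>A\<close> of full
  measure on which all the tests are allowed. Energy estimates are proved on \<open>A\<close> and
  reach other times by lower semicontinuity. Over a step \<open>h\<close> the increment is
  \<open>h\<close> times a time average of \<open>v\<^sub>t\<close>, so continuity of translations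
  in space-time replaces differentiation. Monotonicity only gives the limit \<open>S\<close> of the
  weighted energy. For the weighted integral of the \<open>p\<close>-th power, Poincare gives the
  upper bound and the lower bound is the hard half: the weighted excess of
  \<open>\<parallel>v\<^sub>t\<parallel>\<^sup>p\<close> over \<open>mu * P\<close> is integrable,
  hence small somewhere in every short late window, and the norm cannot fall much across such a
  window. The ratio of the two limits is then \<open>l\<close>, so the rescaled flow is a minimising
  family. For \<open>S = 0\<close> its limit is zero.\<close>

lemma abs_J_op: "\<bar>J_op p t\<bar> = \<bar>t\<bar> powr (p - 1)"
proof (cases "t = 0")
  case False
  then have "\<bar>t\<bar> powr (p - 1) = \<bar>t\<bar> powr (p - 2) * \<bar>t\<bar> powr 1"
    unfolding powr_add[symmetric] by simp
  with False show ?thesis by (simp add: J_op_def abs_mult)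
qed (simp add: J_op_def)

lemma J_op_mult_self: "J_op p t * t = \<bar>t\<bar> powr p"
proof (cases "t = 0")
  case False
  then have "\<bar>t\<bar> powr p = \<bar>t\<bar> powr (p - 2) * \<bar>t\<bar> powr 2"
    unfolding powr_add[symmetric] by simp
  also have "\<bar>t\<bar> powr 2 = t * t"
    using False by (simp add: power2_eq_square)
  finally show ?thesis by (simp add: J_op_def)
qed (simp add: J_op_def)

lemma J_op_measurable [measurable]: "J_op p \<in> borel_measurable borel"
  unfolding J_op_def by measurable

lemma J_op_0 [simp]: "J_op p 0 = 0"
  by (simp add: J_op_def)

text \<open>The larger of \<open>\<bar>a\<bar>\<close> and \<open>\<bar>b\<bar>\<close> carries at
  least half of the sum. The constant is not sharp, but it is the one that recurs in the triangle
  inequalities for \<open>Ip\<close> and \<open>Gag\<close>.\<close>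

lemma abs_add_powr_le:
  fixes a b :: real
  assumes "0 \<le> p"
  shows "\<bar>a + b\<bar> powr p \<le> 2 powr p * (\<bar>a\<bar> powr p + \<bar>b\<bar> powr p)"
proof -
  have "\<bar>a + b\<bar> powr p \<le> (2 * max \<bar>a\<bar> \<bar>b\<bar>) powr p"
    using assms by (intro powr_mono2) auto
  also have "\<dots> = 2 powr p * (max \<bar>a\<bar> \<bar>b\<bar>) powr p"
    by (simp add: powr_mult)
  also have "\<dots> \<le> 2 powr p * (\<bar>a\<bar> powr p + \<bar>b\<bar> powr p)"
    by (intro mult_left_mono) (auto simp: max_def)
  finally show ?thesis .
qed

lemma abs_diff_powr_le:
  fixes a b :: real
  assumes "0 \<le> p"
  shows "\<bar>a - b\<bar> powr p \<le> 2 powr p * (\<bar>a\<bar> powr p + \<bar>b\<bar> powr p)"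
  using abs_add_powr_le[OF assms, of a "- b"] by simp

text \<open>Strict concavity of the logarithm: \<open>ln x \<le> x - 1\<close> is applied to
  \<open>u / m\<close> and \<open>v / m\<close>, with \<open>m\<close> the weighted arithmetic mean,
  and it is strict at \<open>u / m\<close> because \<open>u \<noteq> m\<close>.\<close>

lemma Young_strict:
  fixes u v \<alpha> :: real
  assumes "0 < u" "0 < v" "u \<noteq> v" "0 < \<alpha>" "\<alpha> < 1"
  shows "u powr \<alpha> * v powr (1 - \<alpha>) < \<alpha> * u + (1 - \<alpha>) * v"
proof -
  define m where "m = \<alpha> * u + (1 - \<alpha>) * v"
  have m: "0 < m" using assms by (auto simp: m_def intro!: add_pos_pos)
  have "u \<noteq> m"
  proof
    assume "u = m"
    then have "(1 - \<alpha>) * (u - v) = 0" by (simp add: m_def algebra_simps)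
    with assms show False by simp
  qed
  have ln_less: "ln x < x - 1" if "0 < x" "x \<noteq> 1" for x :: real
    using ln_eq_minus_one[of x] ln_le_minus_one[of x] that by force
  have "ln (u / m) < u / m - 1"
    using assms m \<open>u \<noteq> m\<close> by (intro ln_less) auto
  moreover have "ln (v / m) \<le> v / m - 1"
    using assms m by (intro ln_le_minus_one) auto
  ultimately have "\<alpha> * ln (u / m) + (1 - \<alpha>) * ln (v / m)
      < \<alpha> * (u / m - 1) + (1 - \<alpha>) * (v / m - 1)"
    using assms by (intro add_less_le_mono mult_strict_left_mono mult_left_mono) auto
  also have "\<dots> = (\<alpha> * u + (1 - \<alpha>) * v) / m - 1"
    using m by (simp add: field_simps)
  also have "\<dots> = 0" using m by (simp add: m_def)
  finally have "\<alpha> * ln u + (1 - \<alpha>) * ln v < ln m"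
    using assms m by (simp add: ln_div algebra_simps)
  then have "exp (\<alpha> * ln u + (1 - \<alpha>) * ln v) < m"
    using m by (metis exp_less_mono exp_ln)
  then show ?thesis
    using assms by (simp add: powr_def exp_add m_def)
qed

text \<open>A strictly convex function lies above its tangents away from the point of contact. No
  derivative is taken: after rearrangement the claim is Young's inequality for
  \<open>\<bar>b\<bar> powr p\<close> and \<open>\<bar>a\<bar> powr p\<close> with weights
  \<open>1 / p\<close> and \<open>1 - 1 / p\<close>.\<close>

lemma abs_powr_tangent_less:
  fixes a b p :: real
  assumes "1 < p" "a \<noteq> b"
  shows "\<bar>a\<bar> powr p + p * (J_op p a * (b - a)) < \<bar>b\<bar> powr p"
proof -
  have *: "p * (J_op p a * b) < \<bar>b\<bar> powr p + (p - 1) * \<bar>a\<bar> powr p"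
  proof (cases "a = 0 \<or> b = 0")
    case True
    with assms show ?thesis by (auto simp: J_op_def)
  next
    case False
    show ?thesis
    proof (cases "\<bar>a\<bar> = \<bar>b\<bar>")
      \<comment> \<open>Young's inequality is not strict here, but \<open>b = - a\<close> makes the
        left-hand side negative.\<close>
      case True
      then have "b = - a" using assms by (auto simp: abs_if split: if_splits)
      then have "p * (J_op p a * b) = - (p * \<bar>a\<bar> powr p)"
        by (simp add: J_op_mult_self)
      also have "\<dots> < 0" using assms False by simp
      also have "0 < \<bar>b\<bar> powr p + (p - 1) * \<bar>a\<bar> powr p"
        using assms False by (intro add_pos_nonneg) auto
      finally show ?thesis .
    next
      case neq: False
      have np: "\<bar>b\<bar> powr p \<noteq> \<bar>a\<bar> powr p"
      proof
        assume "\<bar>b\<bar> powr p = \<bar>a\<bar> powr p"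
        then have "(\<bar>b\<bar> powr p) powr (1 / p) = (\<bar>a\<bar> powr p) powr (1 / p)" by simp
        with neq assms show False by (simp add: powr_powr)
      qed
      have "J_op p a * b \<le> \<bar>a\<bar> powr (p - 1) * \<bar>b\<bar>"
        using abs_J_op[of p a] by (metis abs_ge_self abs_mult)
      also have "\<dots> = (\<bar>b\<bar> powr p) powr (1 / p) * (\<bar>a\<bar> powr p) powr (1 - 1 / p)"
        using assms by (simp add: powr_powr right_diff_distrib)
      also have "\<dots> < 1 / p * \<bar>b\<bar> powr p + (1 - 1 / p) * \<bar>a\<bar> powr p"
        using assms False np by (intro Young_strict) auto
      finally have "p * (J_op p a * b) < p * (1 / p * \<bar>b\<bar> powr p + (1 - 1 / p) * \<bar>a\<bar> powr p)"
        using assms by (intro mult_strict_left_mono) auto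
      also have "\<dots> = \<bar>b\<bar> powr p + (p - 1) * \<bar>a\<bar> powr p"
        using assms by (simp add: algebra_simps)
      finally show ?thesis .
    qed
  qed
  have "p * (J_op p a * (b - a)) = p * (J_op p a * b) - p * \<bar>a\<bar> powr p"
    by (simp add: right_diff_distrib J_op_mult_self)
  with * show ?thesis by (simp add: left_diff_distrib)
qed

lemma abs_powr_tangent:
  fixes a b p :: real
  assumes "1 < p"
  shows "\<bar>a\<bar> powr p + p * (J_op p a * (b - a)) \<le> \<bar>b\<bar> powr p"
  using abs_powr_tangent_less[OF assms, of a b] by (cases "a = b") auto

text \<open>The tangent at the convex combination \<open>m\<close> lies strictly below both end
  values; averaging the two tangent inequalities cancels the linear terms.\<close>

lemma abs_powr_convex_less:
  fixes x y p \<theta> :: real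
  assumes "1 < p" "x \<noteq> y" "0 < \<theta>" "\<theta> < 1"
  shows "\<bar>\<theta> * x + (1 - \<theta>) * y\<bar> powr p < \<theta> * \<bar>x\<bar> powr p + (1 - \<theta>) * \<bar>y\<bar> powr p"
proof -
  define m where "m = \<theta> * x + (1 - \<theta>) * y"
  have "m - x = (1 - \<theta>) * (y - x)" "m - y = \<theta> * (x - y)"
    by (simp_all add: m_def algebra_simps)
  then have "m \<noteq> x" "m \<noteq> y" using assms by auto
  then have "\<theta> * (\<bar>m\<bar> powr p + p * (J_op p m * (x - m))) + (1 - \<theta>) * (\<bar>m\<bar> powr p + p * (J_op p m * (y - m)))
    < \<theta> * \<bar>x\<bar> powr p + (1 - \<theta>) * \<bar>y\<bar> powr p"
    using assms by (intro add_strict_mono mult_strict_left_mono abs_powr_tangent_less) auto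
  moreover have "\<theta> * (\<bar>m\<bar> powr p + p * (J_op p m * (x - m))) + (1 - \<theta>) * (\<bar>m\<bar> powr p + p * (J_op p m * (y - m)))
     = \<bar>m\<bar> powr p + p * (J_op p m * (\<theta> * x + (1 - \<theta>) * y - m))"
    by (simp add: algebra_simps)
  moreover have "\<theta> * x + (1 - \<theta>) * y - m = 0" by (simp add: m_def)
  ultimately show ?thesis by (simp add: m_def)
qed

lemma abs_powr_convex:
  fixes x y p \<theta> :: real
  assumes "1 < p" "0 \<le> \<theta>" "\<theta> \<le> 1"
  shows "\<bar>\<theta> * x + (1 - \<theta>) * y\<bar> powr p \<le> \<theta> * \<bar>x\<bar> powr p + (1 - \<theta>) * \<bar>y\<bar> powr p"
proof (cases "x = y \<or> \<theta> = 0 \<or> \<theta> = 1")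
  case True
  have "\<theta> * x + (1 - \<theta>) * x = x" "\<theta> * \<bar>x\<bar> powr p + (1 - \<theta>) * \<bar>x\<bar> powr p = \<bar>x\<bar> powr p"
    by (simp_all add: algebra_simps)
  with True show ?thesis by auto
next
  case False
  with assms show ?thesis by (intro less_imp_le abs_powr_convex_less) auto
qed

text \<open>Compactness of the unit sphere turns strict convexity into a uniform estimate.\<close>

lemma abs_powr_uniformly_convex:
  fixes p \<epsilon> :: real
  assumes "1 < p" "0 < \<epsilon>"
  obtains C where "0 \<le> C"
    "\<And>a b :: real. \<bar>a - b\<bar> powr p \<le> \<epsilon> * (\<bar>a\<bar> powr p + \<bar>b\<bar> powr p)
       + C * ((\<bar>a\<bar> powr p + \<bar>b\<bar> powr p) / 2 - \<bar>(a + b) / 2\<bar> powr p)"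
proof -
  define d where "d = (\<lambda>z :: real \<times> real. (\<bar>fst z\<bar> powr p + \<bar>snd z\<bar> powr p) / 2 - \<bar>(fst z + snd z) / 2\<bar> powr p)"
  \<comment> \<open>The normalised pairs at a distance bounded below. They lie off the diagonal, so
    \<open>d\<close> has a positive lower bound \<open>\<delta>\<close> on \<open>K\<close>.\<close>
  define K where "K = {z :: real \<times> real. \<bar>fst z\<bar> powr p + \<bar>snd z\<bar> powr p = 1} \<inter> {z. \<epsilon> \<le> \<bar>fst z - snd z\<bar> powr p}"
  have dge0: "0 \<le> d z" for z
    using abs_powr_convex[OF assms(1), of "1/2" "fst z" "snd z"]
    by (simp add: d_def add_divide_distrib)
  have le1: "\<bar>x\<bar> \<le> 1" if "\<bar>x\<bar> powr p \<le> 1" for x :: real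
  proof (rule ccontr)
    assume "\<not> \<bar>x\<bar> \<le> 1"
    then have "1 < \<bar>x\<bar> powr p" using assms by (intro gr_one_powr) auto
    with that show False by simp
  qed
  have cont: "continuous_on UNIV (\<lambda>z::real\<times>real. \<bar>fst z\<bar> powr p)" "continuous_on UNIV (\<lambda>z::real\<times>real. \<bar>snd z\<bar> powr p)"
     "continuous_on UNIV (\<lambda>z::real\<times>real. \<bar>fst z - snd z\<bar> powr p)" "continuous_on UNIV d"
    unfolding d_def using assms by (auto intro!: continuous_intros continuous_on_powr')
  have "K \<subseteq> cbox (-1, -1) (1, 1)"
  proof
    fix z assume z: "z \<in> K"
    then have "\<bar>fst z\<bar> powr p \<le> 1" "\<bar>snd z\<bar> powr p \<le> 1"
      unfolding K_def by (smt (verit) IntE mem_Collect_eq powr_ge_zero)+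
    then have "\<bar>fst z\<bar> \<le> 1" "\<bar>snd z\<bar> \<le> 1" using le1 by auto
    then show "z \<in> cbox (-1, -1) (1, 1)"
      by (cases z) (auto simp: cbox_Pair_eq)
  qed
  then have "bounded K" using bounded_cbox bounded_subset by blast
  moreover have "closed K"
    unfolding K_def
    by (intro closed_Int closed_Collect_eq closed_Collect_le continuous_on_add continuous_on_const cont)
  ultimately have "compact K" by (simp add: compact_eq_bounded_closed)
  have "\<exists>\<delta>>0. \<forall>z\<in>K. \<delta> \<le> d z"
  proof (cases "K = {}")
    case False
    then obtain z where z: "z \<in> K" "\<forall>y\<in>K. d z \<le> d y"
      using continuous_attains_inf[OF \<open>compact K\<close> _ continuous_on_subset[OF cont(4)]] by auto
    have "fst z \<noteq> snd z" using z(1) assms by (auto simp: K_def)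
    then have "0 < d z"
      using abs_powr_convex_less[OF assms(1), of "fst z" "snd z" "1/2"]
      by (simp add: d_def add_divide_distrib)
    with z show ?thesis by blast
  qed (auto intro: exI[of _ 1])
  then obtain \<delta> where \<delta>: "0 < \<delta>" "\<And>z. z \<in> K \<Longrightarrow> \<delta> \<le> d z" by blast
  \<comment> \<open>Far pairs satisfy \<open>\<bar>a - b\<bar> powr p \<le> 2 powr p = C * \<delta>
    \<le> C * d (a, b)\<close>; near pairs are paid for by \<open>\<epsilon>\<close>.\<close>
  define C where "C = 2 powr p / \<delta>"
  have C: "0 \<le> C" using \<delta> by (simp add: C_def)
  have unit: "\<bar>a - b\<bar> powr p \<le> \<epsilon> + C * d (a, b)" if "\<bar>a\<bar> powr p + \<bar>b\<bar> powr p = 1" for a b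
  proof (cases "\<epsilon> \<le> \<bar>a - b\<bar> powr p")
    case True
    then have "\<delta> \<le> d (a, b)" using that by (intro \<delta>) (auto simp: K_def)
    have "\<bar>a - b\<bar> powr p \<le> 2 powr p * 1"
      using abs_diff_powr_le[of p a b] that assms by simp
    also have "\<dots> = C * \<delta>" using \<delta> by (simp add: C_def)
    also have "\<dots> \<le> C * d (a, b)" using C \<open>\<delta> \<le> _\<close> by (intro mult_left_mono)
    finally show ?thesis using assms by simp
  next
    case False
    then show ?thesis using C dge0[of "(a, b)"]
      by (smt (verit) mult_nonneg_nonneg)
  qed
  show ?thesis
  proof (rule that[OF C])
    fix a b :: real
    show "\<bar>a - b\<bar> powr p \<le> \<epsilon> * (\<bar>a\<bar> powr p + \<bar>b\<bar> powr p)
       + C * ((\<bar>a\<bar> powr p + \<bar>b\<bar> powr p) / 2 - \<bar>(a + b) / 2\<bar> powr p)"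
    proof (cases "a = 0 \<and> b = 0")
      case False
      define q where "q = \<bar>a\<bar> powr p + \<bar>b\<bar> powr p"
      have q: "0 < q" using False unfolding q_def
        by (cases "a = 0") (auto intro: add_pos_nonneg add_nonneg_pos)
      \<comment> \<open>Both sides are homogeneous of degree \<open>p\<close>, so division by
        \<open>r\<close> reduces to a normalised pair.\<close>
      define r where "r = q powr (1 / p)"
      have r: "0 < r" "r powr p = q" using q assms by (auto simp: r_def powr_powr)
      have s: "\<bar>x / r\<bar> powr p = \<bar>x\<bar> powr p / q" for x
        using r by (simp add: powr_divide)
      have "\<bar>(a - b) / r\<bar> powr p \<le> \<epsilon> + C * d (a / r, b / r)"
      proof -
        have "\<bar>a / r\<bar> powr p + \<bar>b / r\<bar> powr p = 1"
          unfolding s using q unfolding q_def by (simp only: add_divide_distrib[symmetric] divide_self_if) simp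
        from unit[OF this] show ?thesis by (simp only: diff_divide_distrib)
      qed
      moreover have "d (a / r, b / r) = d (a, b) / q"
      proof -
        have *: "(a / r + b / r) / 2 = ((a + b) / 2) / r" by (simp add: add_divide_distrib)
        have "\<bar>(a / r + b / r) / 2\<bar> powr p = \<bar>(a + b) / 2\<bar> powr p / q" unfolding * by (rule s)
        then show ?thesis unfolding d_def fst_conv snd_conv
          by (simp only: s) (simp add: add_divide_distrib diff_divide_distrib mult.commute)
      qed
      ultimately have "\<bar>a - b\<bar> powr p / q \<le> (\<epsilon> * q + C * d (a, b)) / q"
        unfolding s using q by (simp add: add_divide_distrib)
      then have "\<bar>a - b\<bar> powr p \<le> \<epsilon> * q + C * d (a, b)"
        using q by (simp add: divide_le_cancel)
      then show ?thesis by (simp add: d_def q_def)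
    qed simp
  qed
qed

subsection \<open>The \<open>p\<close>-energy on a general measure space\<close>

text \<open>The real-valued form of \<open>Lp_energy\<close>. The two agree on
  \<open>Lp_space\<close>; for a measurable function outside it the Bochner integral defaults to 0,
  so bounds on \<open>Ip\<close> are accompanied by membership.\<close>

definition Ip :: "'b measure \<Rightarrow> real \<Rightarrow> ('b \<Rightarrow> real) \<Rightarrow> real" where
  "Ip M p f = (LINT x|M. \<bar>f x\<bar> powr p)"

lemma Ip_nonneg [simp]: "0 \<le> Ip M p f"
  by (simp add: Ip_def)

lemma Lp_space_iff:
  "f \<in> Lp_space M p \<longleftrightarrow> f \<in> borel_measurable M \<and> integrable M (\<lambda>x. \<bar>f x\<bar> powr p)"
  by (auto simp: Lp_space_def Lp_energy_def integrable_iff_bounded top.not_eq_extremum)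

lemma Lp_spaceD:
  assumes "f \<in> Lp_space M p"
  shows "f \<in> borel_measurable M" "integrable M (\<lambda>x. \<bar>f x\<bar> powr p)"
  using assms by (auto simp: Lp_space_iff)

lemma Lp_energy_eq:
  assumes "f \<in> Lp_space M p"
  shows "Lp_energy M p f = ennreal (Ip M p f)"
  unfolding Lp_energy_def Ip_def
  by (rule nn_integral_eq_integral[OF Lp_spaceD(2)[OF assms]]) simp

lemma Lp_energy_less_top:
  assumes "f \<in> borel_measurable M" "Lp_energy M p f \<le> ennreal c" "0 \<le> c"
  shows "f \<in> Lp_space M p" "Ip M p f \<le> c"
proof -
  show *: "f \<in> Lp_space M p"
    using assms by (auto simp: Lp_space_def intro: le_less_trans)
  show "Ip M p f \<le> c"
    using assms Lp_energy_eq[OF *] by simp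
qed

lemma Lp_space_cong_AE:
  assumes "AE x in M. f x = g x" "f \<in> Lp_space M p" "g \<in> borel_measurable M"
  shows "g \<in> Lp_space M p"
proof -
  note [measurable] = Lp_spaceD(1)[OF assms(2)] assms(3)
  have "integrable M (\<lambda>x. \<bar>f x\<bar> powr p) \<longleftrightarrow> integrable M (\<lambda>x. \<bar>g x\<bar> powr p)"
    using assms(1) by (intro integrable_cong_AE) auto
  then show ?thesis using assms by (simp add: Lp_space_iff)
qed

lemma Ip_cong_AE:
  assumes "AE x in M. f x = g x" "f \<in> borel_measurable M" "g \<in> borel_measurable M"
  shows "Ip M p f = Ip M p g"
  unfolding Ip_def using assms by (intro integral_cong_AE) auto

lemma Lp_energy_cong_AE:
  assumes "AE x in M. f x = g x"
  shows "Lp_energy M p f = Lp_energy M p g"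
  unfolding Lp_energy_def using assms by (intro nn_integral_cong_AE) auto

lemma Lp_space_dominated:
  assumes "f \<in> Lp_space M p" "g \<in> borel_measurable M" "AE x in M. \<bar>g x\<bar> \<le> \<bar>f x\<bar>" "0 \<le> p"
  shows "g \<in> Lp_space M p" "Ip M p g \<le> Ip M p f"
proof -
  note [measurable] = Lp_spaceD(1)[OF assms(1)] assms(2)
  have le: "AE x in M. \<bar>g x\<bar> powr p \<le> \<bar>f x\<bar> powr p"
    using assms(3) by eventually_elim (auto intro: powr_mono2 assms)
  have i: "integrable M (\<lambda>x. \<bar>g x\<bar> powr p)"
    by (rule Bochner_Integration.integrable_bound[OF Lp_spaceD(2)[OF assms(1)]])
       (use le in auto)
  then show "g \<in> Lp_space M p" using assms by (simp add: Lp_space_iff)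
  show "Ip M p g \<le> Ip M p f"
    unfolding Ip_def by (rule integral_mono_AE[OF i Lp_spaceD(2)[OF assms(1)] le])
qed

lemma Lp_space_zero [simp]: "(\<lambda>x. 0) \<in> Lp_space M p"
  by (simp add: Lp_space_iff)

lemma Ip_zero [simp]: "Ip M p (\<lambda>x. 0) = 0"
  by (simp add: Ip_def)

lemma Lp_space_cmult:
  assumes "f \<in> Lp_space M p"
  shows "(\<lambda>x. c * f x) \<in> Lp_space M p"
  using assms by (auto simp: Lp_space_iff abs_mult powr_mult)

lemma Ip_cmult: "Ip M p (\<lambda>x. c * f x) = \<bar>c\<bar> powr p * Ip M p f"
  by (simp add: Ip_def abs_mult powr_mult)

lemma Ip_uminus: "Ip M p (\<lambda>x. - f x) = Ip M p f"
  by (simp add: Ip_def)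

lemma Ip_minus_commute: "Ip M p (\<lambda>x. f x - g x) = Ip M p (\<lambda>x. g x - f x)"
  by (simp add: Ip_def abs_minus_commute)

lemma Lp_space_add:
  assumes "f \<in> Lp_space M p" "g \<in> Lp_space M p" "0 \<le> p"
  shows "(\<lambda>x. f x + g x) \<in> Lp_space M p"
    and "Ip M p (\<lambda>x. f x + g x) \<le> 2 powr p * (Ip M p f + Ip M p g)"
proof -
  note [measurable] = Lp_spaceD(1)[OF assms(1)] Lp_spaceD(1)[OF assms(2)]
  have i: "integrable M (\<lambda>x. 2 powr p * (\<bar>f x\<bar> powr p + \<bar>g x\<bar> powr p))"
    using assms by (auto simp: Lp_space_iff)
  have i': "integrable M (\<lambda>x. \<bar>f x + g x\<bar> powr p)"
    by (rule Bochner_Integration.integrable_bound[OF i]) (use abs_add_powr_le[OF assms(3)] in auto)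
  then show "(\<lambda>x. f x + g x) \<in> Lp_space M p" by (simp add: Lp_space_iff)
  have "Ip M p (\<lambda>x. f x + g x) \<le> (LINT x|M. 2 powr p * (\<bar>f x\<bar> powr p + \<bar>g x\<bar> powr p))"
    unfolding Ip_def by (rule integral_mono[OF i' i]) (use abs_add_powr_le[OF assms(3)] in auto)
  also have "\<dots> = 2 powr p * (Ip M p f + Ip M p g)"
    using assms by (simp add: Ip_def Lp_space_iff)
  finally show "Ip M p (\<lambda>x. f x + g x) \<le> 2 powr p * (Ip M p f + Ip M p g)" .
qed

lemma Lp_space_uminus:
  assumes "f \<in> Lp_space M p"
  shows "(\<lambda>x. - f x) \<in> Lp_space M p"
  using Lp_space_cmult[OF assms, of "-1"] by simp

lemma Lp_space_diff:
  assumes "f \<in> Lp_space M p" "g \<in> Lp_space M p" "0 \<le> p"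
  shows "(\<lambda>x. f x - g x) \<in> Lp_space M p"
    and "Ip M p (\<lambda>x. f x - g x) \<le> 2 powr p * (Ip M p f + Ip M p g)"
  using Lp_space_add[OF assms(1) Lp_space_uminus[OF assms(2)] assms(3)]
  by (simp_all add: Ip_uminus)

lemma Ip_eq_0_iff:
  assumes "f \<in> Lp_space M p"
  shows "Ip M p f = 0 \<longleftrightarrow> (AE x in M. f x = 0)"
  unfolding Ip_def
  by (subst integral_nonneg_eq_0_iff_AE[OF Lp_spaceD(2)[OF assms]]) auto

text \<open>Hoelder's inequality for the exponents \<open>p / (p - 1)\<close> and \<open>p\<close>.
  Writing the dual factor as \<open>J_op p (f x)\<close> turns its norm into a power of
  \<open>Ip M p f\<close>, so the conjugate exponent never appears. The estimate is Young's
  inequality after both energies are normalised to 1.\<close>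

lemma Holder_J_op:
  assumes p: "1 < p" and f: "f \<in> Lp_space M p" and g: "g \<in> Lp_space M p"
  shows "integrable M (\<lambda>x. J_op p (f x) * g x)"
    and "(LINT x|M. \<bar>J_op p (f x) * g x\<bar>) \<le> Ip M p f powr (1 - 1 / p) * Ip M p g powr (1 / p)"
proof -
  note [measurable] = Lp_spaceD(1)[OF f] Lp_spaceD(1)[OF g]
  note fi = Lp_spaceD(2)[OF f] and gi = Lp_spaceD(2)[OF g]
  have Y: "x powr (1 - 1 / p) * y powr (1 / p) \<le> (1 - 1 / p) * x + (1 / p) * y" if "0 \<le> x" "0 \<le> y" for x y
  proof (cases "x = 0 \<or> y = 0")
    case False
    with that p show ?thesis by (intro Youngs_inequality_0) auto
  next
    case True
    then have "x powr (1 - 1 / p) * y powr (1 / p) = 0" using p by auto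
    also have "0 \<le> (1 - 1 / p) * x + (1 / p) * y"
      using that p by (intro add_nonneg_nonneg mult_nonneg_nonneg) auto
    finally show ?thesis .
  qed
  have J: "\<bar>J_op p a * b\<bar> = (\<bar>a\<bar> powr p) powr (1 - 1 / p) * (\<bar>b\<bar> powr p) powr (1 / p)" for a b
    using p by (simp add: abs_mult abs_J_op powr_powr right_diff_distrib)
  show i: "integrable M (\<lambda>x. J_op p (f x) * g x)"
  proof (rule Bochner_Integration.integrable_bound)
    show "integrable M (\<lambda>x. (1 - 1 / p) * \<bar>f x\<bar> powr p + (1 / p) * \<bar>g x\<bar> powr p)"
      using fi gi by simp
    show "AE x in M. norm (J_op p (f x) * g x) \<le> norm ((1 - 1 / p) * \<bar>f x\<bar> powr p + (1 / p) * \<bar>g x\<bar> powr p)"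
      unfolding real_norm_def J using Y by (intro AE_I2) (smt (verit) powr_ge_zero)
  qed measurable
  define A where "A = Ip M p f"
  define B where "B = Ip M p g"
  show "(LINT x|M. \<bar>J_op p (f x) * g x\<bar>) \<le> Ip M p f powr (1 - 1 / p) * Ip M p g powr (1 / p)"
  proof (cases "A = 0 \<or> B = 0")
    case True
    then have "AE x in M. J_op p (f x) * g x = 0"
      using Ip_eq_0_iff[OF f] Ip_eq_0_iff[OF g] by (auto simp: A_def B_def)
    then have "(LINT x|M. \<bar>J_op p (f x) * g x\<bar>) = (LINT x|M. 0)"
      by (intro integral_cong_AE) auto
    then show ?thesis by simp
  next
    case False
    then have AB: "0 < A" "0 < B"
      by (auto simp: A_def B_def less_le)
    define c where "c = A powr (1 - 1 / p) * B powr (1 / p)"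
    have le: "\<bar>J_op p (f x) * g x\<bar> \<le> c * ((1 - 1 / p) / A * \<bar>f x\<bar> powr p + (1 / p) / B * \<bar>g x\<bar> powr p)" for x
    proof -
      have "\<bar>J_op p (f x) * g x\<bar> = c * ((\<bar>f x\<bar> powr p / A) powr (1 - 1 / p) * (\<bar>g x\<bar> powr p / B) powr (1 / p))"
        unfolding J c_def using AB by (simp add: powr_divide)
      also have "\<dots> \<le> c * ((1 - 1 / p) * (\<bar>f x\<bar> powr p / A) + (1 / p) * (\<bar>g x\<bar> powr p / B))"
        using AB by (intro mult_left_mono Y) (auto simp: c_def)
      finally show ?thesis by simp
    qed
    have "(LINT x|M. \<bar>J_op p (f x) * g x\<bar>) \<le> (LINT x|M. c * ((1 - 1 / p) / A * \<bar>f x\<bar> powr p + (1 / p) / B * \<bar>g x\<bar> powr p))"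
      using i fi gi by (intro integral_mono le) auto
    also have "\<dots> = c * ((1 - 1 / p) / A * A + (1 / p) / B * B)"
      using fi gi by (simp add: A_def B_def Ip_def)
    also have "\<dots> = c" using AB p by simp
    finally show ?thesis by (simp add: c_def A_def B_def)
  qed
qed

lemma Holder_J_op_abs:
  assumes "1 < p" "f \<in> Lp_space M p" "g \<in> Lp_space M p"
  shows "\<bar>LINT x|M. J_op p (f x) * g x\<bar> \<le> Ip M p f powr (1 - 1 / p) * Ip M p g powr (1 / p)"
  using Holder_J_op[OF assms] integral_abs_bound[of M "\<lambda>x. J_op p (f x) * g x"] by linarith

text \<open>The integrated tangent inequality. It turns the weak equation into an energy estimate,
  because the pairing with \<open>J_op p (f x)\<close> is what the equation controls.\<close>

lemma Ip_tangent:
  assumes "1 < p" "f \<in> Lp_space M p" "g \<in> Lp_space M p"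
  shows "Ip M p f + p * (LINT x|M. J_op p (f x) * (g x - f x)) \<le> Ip M p g"
proof -
  have i: "integrable M (\<lambda>x. J_op p (f x) * (g x - f x))"
    using assms by (intro Holder_J_op Lp_space_diff) auto
  note fi = Lp_spaceD(2)[OF assms(2)] and gi = Lp_spaceD(2)[OF assms(3)]
  have "(LINT x|M. \<bar>f x\<bar> powr p + p * (J_op p (f x) * (g x - f x))) \<le> Ip M p g"
    unfolding Ip_def using i fi gi assms by (intro integral_mono abs_powr_tangent) auto
  then show ?thesis using i fi by (simp add: Ip_def)
qed

text \<open>With \<open>h\<close> the sum, \<open>\<bar>h x\<bar> powr p = J_op p (h x) * f x + J_op
  p (h x) * g x\<close>; Hoelder's inequality leaves the factor \<open>H powr (1 - 1 / p)\<close>,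
  which is divided out.\<close>

lemma Minkowski_Ip:
  assumes p: "1 < p" and f: "f \<in> Lp_space M p" and g: "g \<in> Lp_space M p"
  shows "Ip M p (\<lambda>x. f x + g x) powr (1 / p) \<le> Ip M p f powr (1 / p) + Ip M p g powr (1 / p)"
proof -
  define h where "h = (\<lambda>x. f x + g x)"
  have h: "h \<in> Lp_space M p" unfolding h_def using p by (intro Lp_space_add f g) auto
  define H where "H = Ip M p h"
  show ?thesis
  proof (cases "H = 0")
    case False
    then have H: "0 < H" using Ip_nonneg[of M p h] unfolding H_def by linarith
    have "H = (LINT x|M. J_op p (h x) * f x + J_op p (h x) * g x)"
      unfolding H_def Ip_def by (intro Bochner_Integration.integral_cong) (auto simp: h_def J_op_mult_self[symmetric] distrib_left)
    also have "\<dots> = (LINT x|M. J_op p (h x) * f x) + (LINT x|M. J_op p (h x) * g x)"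
      using Holder_J_op(1)[OF p h] f g by (intro Bochner_Integration.integral_add) auto
    also have "\<dots> \<le> H powr (1 - 1 / p) * Ip M p f powr (1 / p) + H powr (1 - 1 / p) * Ip M p g powr (1 / p)"
      using Holder_J_op_abs[OF p h f] Holder_J_op_abs[OF p h g] unfolding H_def by linarith
    finally have *: "H \<le> H powr (1 - 1 / p) * (Ip M p f powr (1 / p) + Ip M p g powr (1 / p))"
      by (simp add: distrib_left)
    have "H = H powr (1 - 1 / p) * H powr (1 / p)"
      using H by (simp add: powr_add[symmetric])
    with * have "H powr (1 - 1 / p) * H powr (1 / p) \<le> H powr (1 - 1 / p) * (Ip M p f powr (1 / p) + Ip M p g powr (1 / p))"
      by linarith
    then have "H powr (1 / p) \<le> Ip M p f powr (1 / p) + Ip M p g powr (1 / p)"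
      using H by (subst (asm) mult_le_cancel_left_pos) auto
    then show ?thesis by (simp add: H_def h_def)
  next
    case True
    then show ?thesis by (simp add: H_def h_def)
  qed
qed

lemma Minkowski_Ip_diff:
  assumes p: "1 < p" and f: "f \<in> Lp_space M p" and g: "g \<in> Lp_space M p"
  shows "\<bar>Ip M p f powr (1 / p) - Ip M p g powr (1 / p)\<bar> \<le> Ip M p (\<lambda>x. f x - g x) powr (1 / p)"
proof -
  have d: "(\<lambda>x. f x - g x) \<in> Lp_space M p" "(\<lambda>x. g x - f x) \<in> Lp_space M p"
    using p by (auto intro: Lp_space_diff f g)
  show ?thesis
    using Minkowski_Ip[OF p d(1) g] Minkowski_Ip[OF p d(2) f] Ip_minus_commute[of M p f g] by simp
qed

lemma tendsto_powr_inverse_iff: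
  fixes a :: "'c \<Rightarrow> real"
  assumes "1 < p" "\<And>k. 0 \<le> a k" "0 \<le> l"
  shows "((\<lambda>k. a k powr (1 / p)) \<longlongrightarrow> l powr (1 / p)) F \<longleftrightarrow> (a \<longlongrightarrow> l) F"
proof
  assume "((\<lambda>k. a k powr (1 / p)) \<longlongrightarrow> l powr (1 / p)) F"
  then have "((\<lambda>k. (a k powr (1 / p)) powr p) \<longlongrightarrow> (l powr (1 / p)) powr p) F"
    by (rule tendsto_powr'[OF _ tendsto_const]) (use assms in auto)
  moreover have id: "(x powr (1 / p)) powr p = x" if "0 \<le> x" for x
    using that assms(1) by (simp add: powr_powr)
  ultimately show "(a \<longlongrightarrow> l) F" by (simp only: id[OF assms(2)] id[OF assms(3)])
next
  assume "(a \<longlongrightarrow> l) F"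
  then show "((\<lambda>k. a k powr (1 / p)) \<longlongrightarrow> l powr (1 / p)) F"
    using assms by (intro tendsto_powr') auto
qed

lemma Lp_tendsto_Ip:
  assumes p: "1 < p" and f: "\<forall>\<^sub>F k in F. f k \<in> Lp_space M p" and g: "g \<in> Lp_space M p"
    and lim: "((\<lambda>k. Ip M p (\<lambda>x. f k x - g x)) \<longlongrightarrow> 0) F"
  shows "((\<lambda>k. Ip M p (f k)) \<longlongrightarrow> Ip M p g) F"
proof -
  have "((\<lambda>k. Ip M p (\<lambda>x. f k x - g x) powr (1 / p)) \<longlongrightarrow> 0 powr (1 / p)) F"
    by (subst tendsto_powr_inverse_iff) (use p lim in auto)
  then have "((\<lambda>k. Ip M p (\<lambda>x. f k x - g x) powr (1 / p)) \<longlongrightarrow> 0) F" using p by simp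
  then have "((\<lambda>k. Ip M p (f k) powr (1 / p) - Ip M p g powr (1 / p)) \<longlongrightarrow> 0) F"
    by (rule Lim_null_comparison[rotated]) (use f in eventually_elim, use Minkowski_Ip_diff[OF p _ g] in auto)
  then have "((\<lambda>k. Ip M p (f k) powr (1 / p)) \<longlongrightarrow> Ip M p g powr (1 / p)) F"
    by (simp add: LIM_zero_iff)
  then show ?thesis
    by (subst (asm) tendsto_powr_inverse_iff) (use p in auto)
qed

lemma Ip_midpoint_le:
  assumes p: "1 < p" and f: "f \<in> Lp_space M p" and g: "g \<in> Lp_space M p"
  shows "Ip M p (\<lambda>x. (f x + g x) / 2) \<le> (Ip M p f + Ip M p g) / 2"
proof -
  have h: "(\<lambda>x. (f x + g x) / 2) \<in> Lp_space M p"
    using Lp_space_cmult[OF Lp_space_add(1)[OF f g], of "1/2"] p by simp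
  have "Ip M p (\<lambda>x. (f x + g x) / 2) \<le> (LINT x|M. (\<bar>f x\<bar> powr p + \<bar>g x\<bar> powr p) / 2)"
    unfolding Ip_def using Lp_spaceD(2)[OF h] Lp_spaceD(2)[OF f] Lp_spaceD(2)[OF g]
    by (intro integral_mono) (use abs_powr_convex[OF p, of "1/2"] in \<open>auto simp: add_divide_distrib\<close>)
  then show ?thesis using Lp_spaceD(2)[OF f] Lp_spaceD(2)[OF g] by (simp add: Ip_def)
qed

text \<open>A vanishing midpoint defect forces the two families together as long as their energies
  stay bounded: the pointwise uniform convexity estimate costs \<open>\<epsilon>\<close> times the
  energies plus \<open>C\<close> times the defect.\<close>

lemma Ip_uniformly_convex:
  assumes p: "1 < p" and fg: "\<forall>\<^sub>F k in F. f k \<in> Lp_space M p \<and> g k \<in> Lp_space M p"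
    and bd: "\<forall>\<^sub>F k in F. Ip M p (f k) + Ip M p (g k) \<le> K"
    and lim: "((\<lambda>k. (Ip M p (f k) + Ip M p (g k)) / 2 - Ip M p (\<lambda>x. (f k x + g k x) / 2)) \<longlongrightarrow> 0) F"
  shows "((\<lambda>k. Ip M p (\<lambda>x. f k x - g k x)) \<longlongrightarrow> 0) F"
proof (rule tendstoI)
  fix e :: real assume e: "0 < e"
  \<comment> \<open>Chosen so that the energy term stays at most \<open>e / 2\<close>;
    \<open>\<bar>K\<bar> + 1\<close> avoids division by zero.\<close>
  define \<epsilon> where "\<epsilon> = e / (2 * (\<bar>K\<bar> + 1))"
  have "0 < \<epsilon>" using e by (simp add: \<epsilon>_def)
  from abs_powr_uniformly_convex[OF p this] obtain C where C: "0 \<le> C"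
    "\<And>a b :: real. \<bar>a - b\<bar> powr p \<le> \<epsilon> * (\<bar>a\<bar> powr p + \<bar>b\<bar> powr p)
       + C * ((\<bar>a\<bar> powr p + \<bar>b\<bar> powr p) / 2 - \<bar>(a + b) / 2\<bar> powr p)" by metis
  have "((\<lambda>k. C * ((Ip M p (f k) + Ip M p (g k)) / 2 - Ip M p (\<lambda>x. (f k x + g k x) / 2))) \<longlongrightarrow> 0) F"
    using tendsto_mult_right_zero[OF lim] by simp
  then have "\<forall>\<^sub>F k in F. C * ((Ip M p (f k) + Ip M p (g k)) / 2 - Ip M p (\<lambda>x. (f k x + g k x) / 2)) < e / 2"
    using e by (intro order_tendstoD) auto
  then show "\<forall>\<^sub>F k in F. dist (Ip M p (\<lambda>x. f k x - g k x)) 0 < e"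
    using fg bd
  proof eventually_elim
    case (elim k)
    have f: "f k \<in> Lp_space M p" and g: "g k \<in> Lp_space M p" using elim by auto
    have h: "(\<lambda>x. (f k x + g k x) / 2) \<in> Lp_space M p"
      using Lp_space_cmult[OF Lp_space_add(1)[OF f g], of "1/2"] p by simp
    have d: "(\<lambda>x. f k x - g k x) \<in> Lp_space M p" using p by (intro Lp_space_diff f g) auto
    note i = Lp_spaceD(2)[OF f] Lp_spaceD(2)[OF g] Lp_spaceD(2)[OF h] Lp_spaceD(2)[OF d]
    have "Ip M p (\<lambda>x. f k x - g k x) \<le> (LINT x|M. \<epsilon> * (\<bar>f k x\<bar> powr p + \<bar>g k x\<bar> powr p)
       + C * ((\<bar>f k x\<bar> powr p + \<bar>g k x\<bar> powr p) / 2 - \<bar>(f k x + g k x) / 2\<bar> powr p))"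
      unfolding Ip_def using i by (intro integral_mono C) auto
    also have "\<dots> = \<epsilon> * (Ip M p (f k) + Ip M p (g k)) + C * ((Ip M p (f k) + Ip M p (g k)) / 2 - Ip M p (\<lambda>x. (f k x + g k x) / 2))"
      using i by (simp add: Ip_def)
    also have "\<dots> < \<epsilon> * (\<bar>K\<bar> + 1) + e / 2"
      using elim \<open>0 < \<epsilon>\<close> by (intro add_le_less_mono mult_left_mono) auto
    also have "\<dots> = e" by (simp add: \<epsilon>_def field_simps)
    finally show ?case by simp
  qed
qed

text \<open>Dominated convergence in which one part \<open>r k\<close> of the majorant is small only
  in mean. Since \<open>e k x \<le> r k x + min (e k x) (H x)\<close>, the fixed function
  \<open>H\<close> dominates what remains.\<close>

lemma Ip_tendsto_0_dominated:
  assumes e: "\<And>k. e k \<in> borel_measurable M" "\<And>k x. 0 \<le> e k x"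
    and lim: "AE x in M. (\<lambda>k. e k x) \<longlonglongrightarrow> 0"
    and r: "\<And>k. integrable M (r k)" "(\<lambda>k. LINT x|M. r k x) \<longlonglongrightarrow> 0" and H: "integrable M H"
    and rp: "\<And>k x. 0 \<le> r k x" and Hp: "\<And>x. 0 \<le> H x"
    and le: "\<And>k. AE x in M. e k x \<le> r k x + H x"
  shows "(\<lambda>k. LINT x|M. e k x) \<longlonglongrightarrow> (0 :: real)"
proof -
  note [measurable] = e(1) borel_measurable_integrable[OF r(1)] borel_measurable_integrable[OF H]
  have "(\<lambda>k. LINT x|M. min (e k x) (H x)) \<longlonglongrightarrow> (LINT x|M. 0)"
  proof (rule integral_dominated_convergence[OF _ _ H])
    show "AE x in M. (\<lambda>k. min (e k x) (H x)) \<longlonglongrightarrow> 0"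
      using lim
    proof eventually_elim
      case (elim x)
      show ?case
        by (rule tendsto_sandwich[OF _ _ tendsto_const elim]) (auto simp: e Hp)
    qed
  qed (auto simp: e Hp)
  then have "(\<lambda>k. (LINT x|M. r k x) + (LINT x|M. min (e k x) (H x))) \<longlonglongrightarrow> 0 + 0"
    using r(2) by (intro tendsto_add) auto
  then have lim0: "(\<lambda>k. (LINT x|M. r k x) + (LINT x|M. min (e k x) (H x))) \<longlonglongrightarrow> 0" by simp
  have im: "integrable M (\<lambda>x. min (e k x) (H x))" for k
    by (rule Bochner_Integration.integrable_bound[OF H]) (auto simp: e Hp)
  show ?thesis
  proof (rule tendsto_sandwich[OF _ _ tendsto_const lim0])
    show "\<forall>\<^sub>F k in sequentially. (LINT x|M. e k x) \<le> (LINT x|M. r k x) + (LINT x|M. min (e k x) (H x))"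
    proof (intro always_eventually allI)
      fix k
      have "integrable M (e k)"
        by (rule Bochner_Integration.integrable_bound[OF Bochner_Integration.integrable_add[OF r(1)[of k] H]])
           (use le[of k] in \<open>auto simp: e rp Hp\<close>)
      then have "(LINT x|M. e k x) \<le> (LINT x|M. r k x + min (e k x) (H x))"
        using r im by (intro integral_mono_AE) (use le[of k] in \<open>auto simp: rp min_def\<close>)
      then show "(LINT x|M. e k x) \<le> (LINT x|M. r k x) + (LINT x|M. min (e k x) (H x))"
        using r im by simp
    qed
  qed (auto simp: e)
qed

lemma Lp_tendsto_AE_subseq:
  assumes "\<And>k. f k \<in> borel_measurable M" "\<And>k. integrable M (\<lambda>x. \<bar>f k x - g x\<bar> powr p)" "0 < p"
    and "(\<lambda>k. Ip M p (\<lambda>x. f k x - g x)) \<longlonglongrightarrow> 0"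
  obtains r where "strict_mono (r :: nat \<Rightarrow> nat)" "AE x in M. (\<lambda>k. f (r k) x) \<longlonglongrightarrow> g x"
proof -
  have "(\<lambda>k. LINT x|M. norm (\<bar>f k x - g x\<bar> powr p)) \<longlonglongrightarrow> 0"
    using assms(4) by (simp add: Ip_def)
  from tendsto_L1_AE_subseq[OF assms(2) this] obtain r
    where r: "strict_mono r" "AE x in M. (\<lambda>k. \<bar>f (r k) x - g x\<bar> powr p) \<longlonglongrightarrow> 0" by auto
  have "AE x in M. (\<lambda>k. f (r k) x) \<longlonglongrightarrow> g x"
    using r(2)
  proof eventually_elim
    case (elim x)
    then have "(\<lambda>k. (\<bar>f (r k) x - g x\<bar> powr p) powr (1 / p)) \<longlonglongrightarrow> 0 powr (1 / p)"
      using assms by (intro tendsto_powr') auto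
    then have "(\<lambda>k. \<bar>f (r k) x - g x\<bar>) \<longlonglongrightarrow> 0" using assms by (simp add: powr_powr)
    then show ?case by (simp add: tendsto_rabs_zero_iff LIM_zero_iff)
  qed
  with r that show ?thesis by blast
qed

text \<open>Fatou's lemma, stated so that membership of the limit is part of the conclusion. Limits
  enter \<open>Wsp\<close> this way, and energy bounds are carried from \<open>A\<close> to the
  remaining times.\<close>

lemma Ip_Fatou:
  assumes "\<And>k. f k \<in> borel_measurable M" "g \<in> borel_measurable M" "AE x in M. (\<lambda>k. f k x) \<longlonglongrightarrow> g x"
    and "\<And>k. f k \<in> Lp_space M p" "\<forall>\<^sub>F k in sequentially. Ip M p (f k) \<le> c" "0 < p"
  shows "g \<in> Lp_space M p" "Ip M p g \<le> c"
proof -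
  obtain k where "Ip M p (f k) \<le> c" using assms(5) by (auto simp: eventually_sequentially)
  then have "0 \<le> c" using Ip_nonneg[of M p "f k"] by linarith
  note [measurable] = assms(1,2)
  have "Lp_energy M p g = (\<integral>\<^sup>+ x. liminf (\<lambda>k. ennreal (\<bar>f k x\<bar> powr p)) \<partial>M)"
    unfolding Lp_energy_def
  proof (intro nn_integral_cong_AE)
    show "AE x in M. ennreal (\<bar>g x\<bar> powr p) = liminf (\<lambda>k. ennreal (\<bar>f k x\<bar> powr p))"
      using assms(3)
    proof eventually_elim
      case (elim x)
      then have "(\<lambda>k. ennreal (\<bar>f k x\<bar> powr p)) \<longlonglongrightarrow> ennreal (\<bar>g x\<bar> powr p)"
        using assms(6) by (intro tendsto_ennrealI tendsto_powr' tendsto_rabs) auto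
      then show ?case by (intro lim_imp_Liminf[symmetric]) auto
    qed
  qed
  also have "\<dots> \<le> liminf (\<lambda>k. Lp_energy M p (f k))"
    unfolding Lp_energy_def by (intro nn_integral_liminf) auto
  also have "\<dots> \<le> ennreal c"
  proof (rule Liminf_le)
    show "\<forall>\<^sub>F k in sequentially. Lp_energy M p (f k) \<le> ennreal c"
      using assms(5) by eventually_elim (auto simp: Lp_energy_eq[OF assms(4)] intro: ennreal_leI)
  qed simp
  finally have "Lp_energy M p g \<le> ennreal c" .
  from Lp_energy_less_top[OF assms(2) this \<open>0 \<le> c\<close>]
  show "g \<in> Lp_space M p" "Ip M p g \<le> c" .
qed

subsection \<open>Smooth functions and test functions\<close>

text \<open>By uniqueness of derivatives an explicit family \<open>f'\<close> can stand in for the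
  chosen \<open>frechet_derivative\<close>, so the recursion of \<open>C_diff\<close> runs on
  concrete formulas.\<close>

lemma C_diff_SucI:
  assumes "\<And>x. (f has_derivative f' x) (at x)" "\<And>h. C_diff k (\<lambda>x. f' x h)"
  shows "C_diff (Suc k) f"
proof -
  have "frechet_derivative f (at x) = f' x" for x
    using frechet_derivative_at[OF assms(1)] by simp
  moreover have "f differentiable (at x)" for x
    using assms(1) by (auto simp: differentiable_def)
  ultimately show ?thesis using assms(2) by simp
qed

lemma C_diff_SucD:
  assumes "C_diff (Suc k) f"
  shows "(f has_derivative frechet_derivative f (at x)) (at x)"
    and "C_diff k (\<lambda>x. frechet_derivative f (at x) h)"
  using assms by (auto simp: frechet_derivative_works)

lemma C_diff_continuous: "C_diff k f \<Longrightarrow> continuous_on UNIV f"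
  by (cases k) (auto simp: continuous_on_eq_continuous_within intro: differentiable_imp_continuous_within)

lemma C_diff_Suc_imp: "C_diff (Suc k) f \<Longrightarrow> C_diff k f"
proof (induction k arbitrary: f)
  case 0
  then show ?case using C_diff_continuous[of "Suc 0" f] by simp
next
  case (Suc k)
  show ?case
    by (rule C_diff_SucI[OF C_diff_SucD(1)[OF Suc.prems]]) (rule Suc.IH[OF C_diff_SucD(2)[OF Suc.prems]])
qed

lemma C_diff_const: "C_diff k (\<lambda>x. c)"
proof (induction k arbitrary: c)
  case (Suc k)
  show ?case by (rule C_diff_SucI[where f' = "\<lambda>x h. 0"]) (auto intro: Suc.IH)
qed simp

lemma C_diff_add:
  "C_diff k f \<Longrightarrow> C_diff k g \<Longrightarrow> C_diff k (\<lambda>x. f x + g x)"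
proof (induction k arbitrary: f g)
  case (Suc k)
  show ?case
    by (rule C_diff_SucI[OF has_derivative_add[OF C_diff_SucD(1)[OF Suc.prems(1)] C_diff_SucD(1)[OF Suc.prems(2)]]])
       (rule Suc.IH[OF C_diff_SucD(2)[OF Suc.prems(1)] C_diff_SucD(2)[OF Suc.prems(2)]])
qed (auto intro: continuous_intros)

lemma C_diff_mult:
  "C_diff k f \<Longrightarrow> C_diff k g \<Longrightarrow> C_diff k (\<lambda>x. f x * g x)"
proof (induction k arbitrary: f g)
  case (Suc k)
  note f = Suc.prems(1) and g = Suc.prems(2)
  show ?case
    by (rule C_diff_SucI[OF has_derivative_mult[OF C_diff_SucD(1)[OF f] C_diff_SucD(1)[OF g]]])
       (intro C_diff_add Suc.IH C_diff_SucD(2)[OF f] C_diff_SucD(2)[OF g] C_diff_Suc_imp[OF f] C_diff_Suc_imp[OF g])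
qed (auto intro: continuous_intros)

lemma C_diff_diff:
  assumes "C_diff k f" "C_diff k g"
  shows "C_diff k (\<lambda>x. f x - g x)"
  using C_diff_add[OF assms(1) C_diff_mult[OF C_diff_const[of k "-1"] assms(2)]] by simp

lemma C_diff_sum: "(\<And>i. i \<in> I \<Longrightarrow> C_diff k (f i)) \<Longrightarrow> C_diff k (\<lambda>x. \<Sum>i\<in>I. f i x)"
  by (induction I rule: infinite_finite_induct) (auto intro: C_diff_const C_diff_add)

lemma C_diff_compose_affine:
  fixes L :: "'a::euclidean_space \<Rightarrow> 'b::euclidean_space"
  assumes L: "bounded_linear L"
  shows "C_diff k g \<Longrightarrow> C_diff k (\<lambda>x. g (L x + c))"
proof (induction k arbitrary: g)
  case 0
  then show ?case
    using linear_continuous_on[OF L, of UNIV]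
    by (auto intro!: continuous_on_compose2[of UNIV g] continuous_intros)
next
  case (Suc k)
  have "((\<lambda>x. g (L x + c)) has_derivative (\<lambda>h. frechet_derivative g (at (L x + c)) (L h))) (at x)" for x
  proof -
    have "((\<lambda>x. L x + c) has_derivative L) (at x)"
      using bounded_linear_imp_has_derivative[OF L] by (auto intro!: derivative_eq_intros)
    from has_derivative_compose[OF this C_diff_SucD(1)[OF Suc.prems]] show ?thesis .
  qed
  then show ?case
    by (rule C_diff_SucI) (rule Suc.IH[OF C_diff_SucD(2)[OF Suc.prems]])
qed

lemma C_diff_powr:
  "C_diff k f \<Longrightarrow> (\<And>x. 0 < f x) \<Longrightarrow> C_diff k (\<lambda>x. f x powr r)"
proof (induction k arbitrary: f r)
  case 0
  then show ?case by (auto intro!: continuous_intros simp: less_imp_neq[THEN not_sym] order_less_imp_not_eq2)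
next
  case (Suc k)
  have "((\<lambda>x. f x powr r) has_derivative (\<lambda>h. frechet_derivative f (at x) h * (r * f x powr (r - 1)))) (at x)" for x
    by (rule DERIV_compose_FDERIV[OF has_real_derivative_powr[OF Suc.prems(2)] C_diff_SucD(1)[OF Suc.prems(1)]])
  then show ?case
    by (rule C_diff_SucI)
       (intro C_diff_mult C_diff_const Suc.IH C_diff_SucD(2)[OF Suc.prems(1)] C_diff_Suc_imp[OF Suc.prems(1)] Suc.prems(2))
qed

lemma C_diff_linear:
  assumes "bounded_linear L"
  shows "C_diff k L"
proof (cases k)
  case 0
  then show ?thesis using linear_continuous_on[OF assms, of UNIV] by simp
next
  case (Suc l)
  then show ?thesis
    using C_diff_SucI[OF bounded_linear_imp_has_derivative[OF assms] C_diff_const] by simp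
qed

lemma C_diff_sqnorm: "C_diff k (\<lambda>x :: 'a::euclidean_space. (x - c) \<bullet> (x - c))"
proof (cases k)
  case 0
  then show ?thesis by (auto intro!: continuous_intros)
next
  case (Suc l)
  have "((\<lambda>x. (x - c) \<bullet> (x - c)) has_derivative (\<lambda>h. (x - c) \<bullet> h + h \<bullet> (x - c))) (at x)" for x :: 'a
    by (auto intro!: derivative_eq_intros)
  moreover have "C_diff l (\<lambda>x. (x - c) \<bullet> h + h \<bullet> (x - c))" for h :: 'a
  proof -
    have "C_diff l (\<lambda>x. 2 * (h \<bullet> x) - 2 * (h \<bullet> c))"
      by (intro C_diff_diff C_diff_mult C_diff_const C_diff_linear bounded_linear_inner_right)
    then show ?thesis by (simp add: inner_diff_left inner_diff_right inner_commute algebra_simps)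
  qed
  ultimately show ?thesis unfolding Suc by (rule C_diff_SucI)
qed

text \<open>The flat function \<open>exp (- 1 / t)\<close> together with its multiples by powers of
  \<open>1 / t\<close>. Differentiation maps this family into its own linear span, so smoothness of
  all members follows by one induction.\<close>

definition flat_exp :: "nat \<Rightarrow> real \<Rightarrow> real" where
  "flat_exp n t = (if 0 < t then (1 / t) ^ n * exp (- (1 / t)) else 0)"

lemma flat_exp_tendsto_0: "(flat_exp n \<longlongrightarrow> 0) (at 0)"
proof -
  have "((\<lambda>x :: real. x ^ n / exp x) \<longlongrightarrow> 0) at_top" by (rule tendsto_power_div_exp_0)
  from filterlim_compose[OF this filterlim_inverse_at_top_right]
  have "((\<lambda>t :: real. (inverse t) ^ n / exp (inverse t)) \<longlongrightarrow> 0) (at_right 0)" .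
  then have "(flat_exp n \<longlongrightarrow> 0) (at_right 0)"
    by (rule Lim_transform_eventually)
       (auto simp: eventually_at_filter flat_exp_def exp_minus inverse_eq_divide intro!: always_eventually)
  moreover have "(flat_exp n \<longlongrightarrow> 0) (at_left 0)"
    by (rule Lim_transform_eventually[OF tendsto_const])
       (auto simp: eventually_at_filter flat_exp_def intro!: always_eventually)
  ultimately show ?thesis by (simp add: filterlim_split_at)
qed

lemma flat_exp_deriv:
  "(flat_exp n has_real_derivative flat_exp (n + 2) t - real n * flat_exp (n + 1) t) (at t)"
proof (cases t "0 :: real" rule: linorder_cases)
  case less
  have "((\<lambda>t. 0) has_real_derivative 0) (at t)" by simp
  then have "(flat_exp n has_real_derivative 0) (at t)"
    by (rule has_field_derivative_transform_within_open[where S = "{..<0}"])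
       (use less in \<open>auto simp: flat_exp_def\<close>)
  with less show ?thesis by (simp add: flat_exp_def)
next
  case equal
  \<comment> \<open>Division by \<open>h\<close> raises the index by one: the difference quotient at
    0 is \<open>flat_exp (Suc n)\<close> itself.\<close>
  have "((\<lambda>h. (flat_exp n (0 + h) - flat_exp n 0) / h) \<longlongrightarrow> 0) (at 0)"
    by (rule Lim_transform_eventually[OF flat_exp_tendsto_0[of "Suc n"]])
       (auto simp: eventually_at_filter flat_exp_def intro!: always_eventually)
  then have "(flat_exp n has_real_derivative 0) (at 0)"
    unfolding DERIV_def by simp
  then show ?thesis using equal by (simp add: flat_exp_def)
next
  case greater
  have "((\<lambda>t. (1 / t) ^ n * exp (- (1 / t))) has_real_derivative
      (1 / t) ^ (n + 2) * exp (- (1 / t)) - real n * ((1 / t) ^ (n + 1) * exp (- (1 / t)))) (at t)"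
    using greater
    by (cases n) (auto intro!: derivative_eq_intros simp: field_simps power2_eq_square,
        metis One_nat_def mult.commute not_gr_zero power_minus_mult)
  then have "(flat_exp n has_real_derivative
      (1 / t) ^ (n + 2) * exp (- (1 / t)) - real n * ((1 / t) ^ (n + 1) * exp (- (1 / t)))) (at t)"
    by (rule has_field_derivative_transform_within_open[where S = "{0<..}"])
       (use greater in \<open>auto simp: flat_exp_def\<close>)
  with greater show ?thesis by (simp add: flat_exp_def)
qed

lemma C_diff_real_SucI:
  fixes f :: "real \<Rightarrow> real"
  assumes "\<And>x. (f has_real_derivative f' x) (at x)" "C_diff k f'"
  shows "C_diff (Suc k) f"
proof (rule C_diff_SucI)
  show "(f has_derivative (\<lambda>h. h * f' x)) (at x)" for x
    using assms(1)[of x] by (simp add: has_field_derivative_def mult_commute_abs)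
  show "C_diff k (\<lambda>x. h * f' x)" for h
    using assms(2) by (intro C_diff_mult C_diff_const)
qed

lemma C_diff_flat_exp: "C_diff k (flat_exp n)"
proof (induction k arbitrary: n)
  case 0
  then show ?case
    using flat_exp_deriv by (auto simp: continuous_on_eq_continuous_within intro: DERIV_isCont)
next
  case (Suc k)
  show ?case
    by (rule C_diff_real_SucI[OF flat_exp_deriv]) (intro C_diff_diff C_diff_mult C_diff_const Suc.IH)
qed

lemma flat_exp_0_pos_iff [simp]: "0 < flat_exp 0 t \<longleftrightarrow> 0 < t"
  and flat_exp_0_nonneg [simp]: "0 \<le> flat_exp 0 t"
  and flat_exp_0_eq_0: "t \<le> 0 \<Longrightarrow> flat_exp 0 t = 0"
  by (auto simp: flat_exp_def)

text \<open>The standard smooth transition from 0 to 1 on the unit interval. The quotient is written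
  with \<open>powr (- 1)\<close> so that \<open>C_diff_powr\<close> applies to it.\<close>

definition smooth_step :: "real \<Rightarrow> real" where
  "smooth_step t = flat_exp 0 t * (flat_exp 0 t + flat_exp 0 (1 - t)) powr (- 1)"

lemma smooth_step_denom_pos: "0 < flat_exp 0 t + flat_exp 0 (1 - t)"
  by (cases "0 < t") (auto intro: add_pos_nonneg add_nonneg_pos)

lemma C_diff_smooth_step: "C_diff k smooth_step"
proof -
  have "C_diff k (\<lambda>t. flat_exp 0 (- t + 1))"
    by (rule C_diff_compose_affine[OF _ C_diff_flat_exp]) (rule bounded_linear_minus[OF bounded_linear_ident])
  then have "C_diff k (\<lambda>t. flat_exp 0 (1 - t))" by (simp add: algebra_simps)
  then have "C_diff k (\<lambda>t. flat_exp 0 t * (flat_exp 0 t + flat_exp 0 (1 - t)) powr (- 1))"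
    by (intro C_diff_mult C_diff_powr C_diff_add C_diff_flat_exp smooth_step_denom_pos)
  then show ?thesis by (simp add: smooth_step_def[abs_def])
qed

lemma smooth_step_le_0: "t \<le> 0 \<Longrightarrow> smooth_step t = 0"
  by (simp add: smooth_step_def flat_exp_0_eq_0)

lemma smooth_step_ge_1: "1 \<le> t \<Longrightarrow> smooth_step t = 1"
  using smooth_step_denom_pos[of t]
  by (simp add: smooth_step_def flat_exp_0_eq_0 powr_minus right_inverse del: flat_exp_0_pos_iff)

lemma smooth_step_bounds: "0 \<le> smooth_step t" "smooth_step t \<le> 1"
  using smooth_step_denom_pos[of t] flat_exp_0_nonneg[of "1 - t"]
  by (auto simp: smooth_step_def powr_minus divide_inverse[symmetric] divide_le_eq_1)

lemma smooth_step_deriv: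
  "(smooth_step has_real_derivative deriv smooth_step t) (at t)"
  "continuous_on UNIV (deriv smooth_step)"
proof -
  have "smooth_step differentiable (at t)" for t
    using C_diff_smooth_step[of "Suc 0"] by simp
  then have d: "(smooth_step has_real_derivative deriv smooth_step t) (at t)" for t
    by (metis DERIV_deriv_iff_real_differentiable)
  then show "(smooth_step has_real_derivative deriv smooth_step t) (at t)" .
  have "frechet_derivative smooth_step (at t) 1 = deriv smooth_step t" for t
    using frechet_derivative_at[OF d[of t, unfolded has_field_derivative_def]] by (metis mult.right_neutral)
  moreover have "continuous_on UNIV (\<lambda>t. frechet_derivative smooth_step (at t) 1)"
    using C_diff_smooth_step[of "Suc 0"] by simp
  ultimately show "continuous_on UNIV (deriv smooth_step)" by simp
qed

section \<open>Test functions: supports, products and approximation of indicators\<close>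

lemma test_functionsI:
  assumes "\<And>k. C_diff k \<phi>" "compact K" "K \<subseteq> U" "\<And>x. x \<notin> K \<Longrightarrow> \<phi> x = 0"
  shows "\<phi> \<in> test_functions U"
proof -
  have "closure {x. \<phi> x \<noteq> 0} \<subseteq> K"
    using assms by (intro closure_minimal compact_imp_closed) auto
  moreover from this have "compact (closure {x. \<phi> x \<noteq> 0})"
    using assms(2) by (metis closed_closure compact_Int_closed inf.absorb2)
  ultimately show ?thesis using assms by (auto simp: test_functions_def)
qed

lemma test_functionsD:
  assumes "\<phi> \<in> test_functions U"
  shows "C_diff k \<phi>" "compact (closure {x. \<phi> x \<noteq> 0})" "closure {x. \<phi> x \<noteq> 0} \<subseteq> U"
    "x \<notin> closure {x. \<phi> x \<noteq> 0} \<Longrightarrow> \<phi> x = 0"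
  using assms closure_subset[of "{x. \<phi> x \<noteq> 0}"] by (auto simp: test_functions_def)

lemma test_functions_outside: "\<phi> \<in> test_functions U \<Longrightarrow> x \<notin> U \<Longrightarrow> \<phi> x = 0"
  using test_functionsD(3,4) by blast

lemma test_functions_measurable:
  "\<phi> \<in> test_functions U \<Longrightarrow> \<phi> \<in> borel_measurable borel"
  using C_diff_continuous[OF test_functionsD(1)[of _ _ 0]] by (intro borel_measurable_continuous_onI)

lemma test_functions_bounded:
  assumes "\<phi> \<in> test_functions U"
  obtains B where "\<And>x. \<bar>\<phi> x\<bar> \<le> B"
proof -
  let ?K = "closure {x. \<phi> x \<noteq> 0}"
  have "compact (\<phi> ` ?K)"
    using C_diff_continuous[OF test_functionsD(1)[OF assms, of 0]] test_functionsD(2)[OF assms]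
    by (intro compact_continuous_image) (auto intro: continuous_on_subset)
  then have "bounded (\<phi> ` ?K)" by (rule compact_imp_bounded)
  then obtain B where "\<And>x. x \<in> ?K \<Longrightarrow> \<bar>\<phi> x\<bar> \<le> B" unfolding bounded_iff by auto
  then have "\<bar>\<phi> x\<bar> \<le> max B 0" for x
    using test_functionsD(4)[OF assms, of x] by (cases "x \<in> ?K") force+
  then show ?thesis using that by blast
qed

lemma test_functions_Times:
  fixes U :: "'a::euclidean_space set" and V :: "'b::euclidean_space set"
  assumes "\<phi> \<in> test_functions U" "\<eta> \<in> test_functions V"
  shows "(\<lambda>z. \<phi> (fst z) * \<eta> (snd z)) \<in> test_functions (U \<times> V)"
proof (rule test_functionsI[where K = "closure {x. \<phi> x \<noteq> 0} \<times> closure {x. \<eta> x \<noteq> 0}"])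
  fix k
  have "C_diff k (\<lambda>z :: 'a \<times> 'b. \<phi> (fst z + 0))" "C_diff k (\<lambda>z :: 'a \<times> 'b. \<eta> (snd z + 0))"
    by (rule C_diff_compose_affine[OF bounded_linear_fst test_functionsD(1)[OF assms(1)]],
        rule C_diff_compose_affine[OF bounded_linear_snd test_functionsD(1)[OF assms(2)]])
  then show "C_diff k (\<lambda>z :: 'a \<times> 'b. \<phi> (fst z) * \<eta> (snd z))"
    by (intro C_diff_mult) simp_all
next
  show "compact (closure {x. \<phi> x \<noteq> 0} \<times> closure {x. \<eta> x \<noteq> 0})"
    using assms by (intro compact_Times test_functionsD(2))
  show "closure {x. \<phi> x \<noteq> 0} \<times> closure {x. \<eta> x \<noteq> 0} \<subseteq> U \<times> V"
    using assms[THEN test_functionsD(3)] by blast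
  fix z :: "'a \<times> 'b"
  assume "z \<notin> closure {x. \<phi> x \<noteq> 0} \<times> closure {x. \<eta> x \<noteq> 0}"
  then show "\<phi> (fst z) * \<eta> (snd z) = 0"
    using test_functionsD(4)[OF assms(1), of "fst z"] test_functionsD(4)[OF assms(2), of "snd z"]
    by (cases z) auto
qed

text \<open>Countably many balls, with their closed balls inside \<open>U\<close>, cover
  \<open>U\<close>. The partial sums \<open>\<Psi> n\<close> of bumps on them become positive at
  each point of \<open>U\<close> and stay 0 elsewhere, so the smooth quotients
  \<open>\<Psi> n x / (\<Psi> n x + 1 / real (Suc n))\<close> stay between 0 and 1 and converge to
  the indicator.\<close>

lemma test_functions_approx_indicator:
  fixes U :: "'a::euclidean_space set"
  assumes "open U"
  obtains \<Phi> :: "nat \<Rightarrow> 'a \<Rightarrow> real" where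
    "\<And>n. \<Phi> n \<in> test_functions U" "\<And>n x. 0 \<le> \<Phi> n x" "\<And>n x. \<Phi> n x \<le> 1"
    "\<And>x. (\<lambda>n. \<Phi> n x) \<longlonglongrightarrow> indicator U x"
proof (cases "U = {}")
  case True
  show ?thesis
    by (rule that[of "\<lambda>n x. 0"]) (auto simp: True intro!: test_functionsI[where K = "{}"] C_diff_const)
next
  case False
  define FF where "FF = {ball c r | c r. cball c r \<subseteq> U}"
  have "\<And>S. S \<in> FF \<Longrightarrow> open S" by (auto simp: FF_def)
  from Lindelof[OF this] obtain G where G: "G \<subseteq> FF" "countable G" "\<Union>G = \<Union>FF" by metis
  have UFF: "\<Union>FF = U"
  proof
    show "\<Union>FF \<subseteq> U" using ball_subset_cball by (fastforce simp: FF_def)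
    show "U \<subseteq> \<Union>FF"
    proof
      fix x assume "x \<in> U"
      then obtain e where "0 < e" "cball x e \<subseteq> U" using assms open_contains_cball by blast
      then show "x \<in> \<Union>FF" by (auto simp: FF_def intro!: exI[of _ "ball x e"])
    qed
  qed
  with G False have "G \<noteq> {}" by auto
  have "\<forall>i. \<exists>c r. from_nat_into G i = ball c r \<and> cball c r \<subseteq> U"
    using from_nat_into[OF \<open>G \<noteq> {}\<close>] G(1) by (fastforce simp: FF_def)
  then obtain c r where cr: "\<And>i. from_nat_into G i = ball (c i) (r i)" "\<And>i. cball (c i) (r i) \<subseteq> U" by metis
  have cover: "\<exists>i. x \<in> ball (c i) (r i) \<and> 0 < r i" if "x \<in> U" for x
  proof -
    from that UFF G(3) obtain S where "S \<in> G" "x \<in> S" by blast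
    moreover obtain i where "from_nat_into G i = S"
      using from_nat_into_surj[OF G(2) \<open>S \<in> G\<close>] by blast
    ultimately have "x \<in> ball (c i) (r i)" using cr by auto
    moreover from this have "0 < r i" by (smt (verit) mem_ball zero_le_dist)
    ultimately show ?thesis by blast
  qed
  \<comment> \<open>A square of the norm compared with a square of the radius, composed with
    \<open>flat_exp 0\<close>. The radius of an empty ball may be negative, and its square would
    then give a spurious bump; hence the case distinction.\<close>
  define B where "B = (\<lambda>i x. if 0 < r i then flat_exp 0 ((r i)\<^sup>2 - (x - c i) \<bullet> (x - c i)) else 0)"
  have Bsm: "C_diff k (B i)" for k i
  proof -
    have "C_diff k (\<lambda>x. (r i)\<^sup>2 - (x - c i) \<bullet> (x - c i))"
      by (intro C_diff_diff C_diff_const C_diff_sqnorm)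
    moreover have "C_diff k f \<Longrightarrow> C_diff k (\<lambda>x. flat_exp n (f x))" for f :: "'a \<Rightarrow> real" and n
    proof (induction k arbitrary: f n)
      case 0
      then show ?case using C_diff_flat_exp[of 0 n] by (auto intro!: continuous_on_compose2[of UNIV "flat_exp n"])
    next
      case (Suc k)
      have "((\<lambda>x. flat_exp n (f x)) has_derivative (\<lambda>h. frechet_derivative f (at x) h *
         (flat_exp (n + 2) (f x) - real n * flat_exp (n + 1) (f x)))) (at x)" for x
        by (rule DERIV_compose_FDERIV[OF flat_exp_deriv C_diff_SucD(1)[OF Suc.prems(1)]])
      then show ?case
        by (rule C_diff_SucI)
           (intro C_diff_mult C_diff_diff C_diff_const Suc.IH C_diff_SucD(2)[OF Suc.prems(1)] C_diff_Suc_imp[OF Suc.prems(1)])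
    qed
    ultimately show ?thesis unfolding B_def by (cases "0 < r i") (auto intro: C_diff_const)
  qed
  have Bpos: "0 \<le> B i x" for i x by (simp add: B_def)
  have Bin: "0 < B i x" if "x \<in> ball (c i) (r i)" "0 < r i" for i x
  proof -
    have "norm (x - c i) < r i" using that by (simp add: dist_norm norm_minus_commute)
    then have "(norm (x - c i))\<^sup>2 < (r i)\<^sup>2" by (intro power_strict_mono) auto
    then show ?thesis using that by (simp add: B_def dot_square_norm)
  qed
  have Bout: "B i x = 0" if "x \<notin> cball (c i) (r i)" for i x
  proof (cases "0 < r i")
    case True
    have "r i \<le> norm (x - c i)" using that by (simp add: dist_norm norm_minus_commute)
    then have "(r i)\<^sup>2 \<le> (norm (x - c i))\<^sup>2" using True by (intro power_mono) auto
    then show ?thesis using that by (simp add: B_def dot_square_norm flat_exp_0_eq_0)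
  qed (simp add: B_def)
  define \<Psi> where "\<Psi> = (\<lambda>n x. \<Sum>i\<le>n. B i x)"
  have \<Psi>pos: "0 \<le> \<Psi> n x" for n x unfolding \<Psi>_def by (intro sum_nonneg Bpos)
  have pos: "0 < \<Psi> n x + 1 / real (Suc n)" for n x using \<Psi>pos[of n x] by (intro add_nonneg_pos) auto
  define \<Phi> where "\<Phi> = (\<lambda>n x. \<Psi> n x * (\<Psi> n x + 1 / real (Suc n)) powr (- 1))"
  have \<Phi>_eq: "\<Phi> n x = \<Psi> n x / (\<Psi> n x + 1 / real (Suc n))" for n x
    using pos[of n x] by (simp add: \<Phi>_def powr_minus divide_inverse)
  show ?thesis
  proof (rule that[of \<Phi>])
    fix n x
    show "\<Phi> n \<in> test_functions U"
    proof (rule test_functionsI[where K = "\<Union>i\<le>n. cball (c i) (r i)"])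
      show "C_diff k (\<Phi> n)" for k
        unfolding \<Phi>_def \<Psi>_def
        by (intro C_diff_mult C_diff_powr C_diff_add C_diff_const C_diff_sum Bsm pos[unfolded \<Psi>_def])
      show "\<Phi> n x = 0" if "x \<notin> (\<Union>i\<le>n. cball (c i) (r i))" for x
        using that Bout by (auto simp: \<Phi>_def \<Psi>_def intro!: sum.neutral)
    qed (use cr in auto)
    show "0 \<le> \<Phi> n x" "\<Phi> n x \<le> 1" using \<Psi>pos[of n x] pos[of n x] by (auto simp: \<Phi>_eq divide_le_eq_1)
  next
    fix x
    show "(\<lambda>n. \<Phi> n x) \<longlonglongrightarrow> indicator U x"
    proof (cases "x \<in> U")
      case True
      then obtain i where i: "x \<in> ball (c i) (r i)" "0 < r i" using cover by blast
      define b where "b = B i x"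
      have b: "0 < b" using Bin[OF i] by (simp add: b_def)
      have ge: "b \<le> \<Psi> n x" if "i \<le> n" for n
        unfolding \<Psi>_def b_def using that by (intro member_le_sum) (auto simp: Bpos)
      have "(\<lambda>n. b / (b + 1 / real (Suc n))) \<longlonglongrightarrow> b / (b + 0)"
        using b by (intro tendsto_intros LIMSEQ_Suc[OF lim_1_over_n]) auto
      then have l: "(\<lambda>n. b / (b + 1 / real (Suc n))) \<longlonglongrightarrow> 1" using b by simp
      have "(\<lambda>n. \<Phi> n x) \<longlonglongrightarrow> 1"
      proof (rule tendsto_sandwich[OF _ _ l tendsto_const])
        show "\<forall>\<^sub>F n in sequentially. b / (b + 1 / real (Suc n)) \<le> \<Phi> n x"
          using eventually_ge_at_top[of i]
        proof eventually_elim
          case (elim n)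
          have "b * (\<Psi> n x + 1 / real (Suc n)) \<le> \<Psi> n x * (b + 1 / real (Suc n))"
            using ge[OF elim] by (simp add: distrib_left mult.commute divide_right_mono)
          then show ?case unfolding \<Phi>_eq using pos[of n x] b
            by (subst frac_le_eq, simp_all add: add_pos_pos less_imp_neq[THEN not_sym] divide_le_0_iff)
        qed
        show "\<forall>\<^sub>F n in sequentially. \<Phi> n x \<le> 1"
          using \<Psi>pos[of _ x] pos[of _ x] by (auto simp: \<Phi>_eq divide_le_eq_1)
      qed
      with True show ?thesis by simp
    next
      case False
      then have "B i x = 0" for i using Bout cr by blast
      then show ?thesis using False by (simp add: \<Phi>_def \<Psi>_def)
    qed
  qed
qed

text \<open>A smoothed indicator of an interval. Its support lies in \<open>{a..b + e}\<close>, and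
  \<open>0 < a\<close> keeps that away from time 0; for windows starting at 0 this forces a shift by
  \<open>e\<close>.\<close>

lemma smooth_window_test_function:
  assumes "0 < a" "a \<le> b" "0 < e"
  shows "(\<lambda>t. smooth_step ((t - a) / e) - smooth_step ((t - b) / e)) \<in> test_functions {0<..}"
proof (rule test_functionsI[where K = "{a..b + e}"])
  fix k
  have *: "C_diff k (\<lambda>t. smooth_step ((t - c) / e))" for c
  proof -
    have "bounded_linear (\<lambda>t :: real. t / e)" by (rule bounded_linear_divide)
    from C_diff_compose_affine[OF this C_diff_smooth_step, of k "- c / e"]
    show ?thesis by (simp add: diff_divide_distrib)
  qed
  show "C_diff k (\<lambda>t. smooth_step ((t - a) / e) - smooth_step ((t - b) / e))"
    by (intro C_diff_diff *)
next
  fix t assume t: "t \<notin> {a..b + e}"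
  show "smooth_step ((t - a) / e) - smooth_step ((t - b) / e) = 0"
  proof (cases "t < a")
    case True
    then have "(t - a) / e \<le> 0" "(t - b) / e \<le> 0" using assms by (auto simp: divide_le_0_iff)
    then show ?thesis by (simp add: smooth_step_le_0)
  next
    case False
    then have "1 \<le> (t - a) / e" "1 \<le> (t - b) / e" using assms t by (auto simp: field_simps)
    then show ?thesis by (simp add: smooth_step_ge_1)
  qed
qed (use assms in auto)

subsection \<open>The Gagliardo seminorm as an \<open>L\<^sup>p\<close> norm of differences\<close>

lemma sigma_finite_lebesgue: "sigma_finite_measure (lebesgue :: 'a::euclidean_space measure)"
proof
  obtain A :: "'a set set" where A: "countable A" "A \<subseteq> sets lborel" "\<Union>A = space lborel" "\<forall>a\<in>A. emeasure lborel a \<noteq> \<infinity>"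
    using lborel.sigma_finite_countable by blast
  show "\<exists>A :: 'a set set. countable A \<and> A \<subseteq> sets lebesgue \<and> \<Union>A = space lebesgue \<and> (\<forall>a\<in>A. emeasure lebesgue a \<noteq> \<infinity>)"
    using A by (intro exI[of _ A]) (auto simp: subset_eq)
qed

interpretation leb: sigma_finite_measure "lebesgue :: 'a::euclidean_space measure"
  by (rule sigma_finite_lebesgue)

interpretation leb_pair: pair_sigma_finite "lebesgue :: 'a::euclidean_space measure" "lebesgue :: 'b::euclidean_space measure"
  by unfold_locales

text \<open>Against this measure the Gagliardo energy of \<open>u\<close> is an ordinary
  \<open>Ip\<close> of the difference function \<open>Dq u\<close>, so every lemma on general
  measure spaces applies to the seminorm. On the diagonal the density is \<open>1 / 0 = 0\<close>,
  which is harmless because \<open>Dq u\<close> vanishes there.\<close>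

definition gag_measure :: "real \<Rightarrow> real \<Rightarrow> ('a::euclidean_space \<times> 'a) measure" where
  "gag_measure s p = density (lebesgue \<Otimes>\<^sub>M lebesgue)
     (\<lambda>z. ennreal (1 / norm (fst z - snd z) powr (real DIM('a) + s * p)))"

definition Dq :: "('a \<Rightarrow> real) \<Rightarrow> 'a \<times> 'a \<Rightarrow> real" where
  "Dq u z = u (fst z) - u (snd z)"

definition Gag :: "real \<Rightarrow> real \<Rightarrow> ('a::euclidean_space \<Rightarrow> real) \<Rightarrow> real" where
  "Gag s p u = Ip (gag_measure s p) p (Dq u)"

lemma Gag_nonneg [simp]: "0 \<le> Gag s p u"
  by (simp add: Gag_def)

lemma measurable_fst_lebesgue [measurable]:
  "fst \<in> (lebesgue :: 'a::euclidean_space measure) \<Otimes>\<^sub>M (lebesgue :: 'b::euclidean_space measure) \<rightarrow>\<^sub>M borel"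
  by (rule measurable_compose[OF measurable_fst]) (rule measurable_completion, simp)

lemma measurable_snd_lebesgue [measurable]:
  "snd \<in> (lebesgue :: 'a::euclidean_space measure) \<Otimes>\<^sub>M (lebesgue :: 'b::euclidean_space measure) \<rightarrow>\<^sub>M borel"
  by (rule measurable_compose[OF measurable_snd]) (rule measurable_completion, simp)

lemma sets_gag_measure [simp, measurable_cong]: "sets (gag_measure s p) = sets (lebesgue \<Otimes>\<^sub>M lebesgue)"
  by (simp add: gag_measure_def)

lemma Dq_measurable:
  assumes [measurable]: "u \<in> borel_measurable lebesgue"
  shows "Dq u \<in> borel_measurable (lebesgue \<Otimes>\<^sub>M lebesgue)"
  unfolding Dq_def[abs_def] by measurable

lemma Dq_measurable_gag:
  "u \<in> borel_measurable lebesgue \<Longrightarrow> Dq u \<in> borel_measurable (gag_measure s p)"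
  using Dq_measurable[of u] by simp

lemma AE_pair_lebesgueI:
  assumes "AE x in (lebesgue :: 'a::euclidean_space measure). P x"
  shows "AE z in (lebesgue :: 'a::euclidean_space measure) \<Otimes>\<^sub>M (lebesgue :: 'b::euclidean_space measure). P (fst z)"
    and "AE z in (lebesgue :: 'b::euclidean_space measure) \<Otimes>\<^sub>M (lebesgue :: 'a::euclidean_space measure). P (snd z)"
proof -
  obtain N where N: "N \<in> null_sets lebesgue" "{x. \<not> P x} \<subseteq> N"
    using assms by (auto simp: eventually_ae_filter)
  have [measurable]: "N \<in> sets lebesgue" using N by auto
  have A: "N \<times> UNIV \<in> null_sets ((lebesgue :: 'a measure) \<Otimes>\<^sub>M (lebesgue :: 'b measure))"
  proof (rule null_setsI)
    have "emeasure (lebesgue \<Otimes>\<^sub>M lebesgue) (N \<times> (UNIV :: 'b set)) = emeasure lebesgue N * emeasure lebesgue (UNIV :: 'b set)"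
      by (rule leb.emeasure_pair_measure_Times) (auto simp: \<open>N \<in> sets lebesgue\<close>)
    then show "emeasure (lebesgue \<Otimes>\<^sub>M lebesgue) (N \<times> (UNIV :: 'b set)) = 0" using N by (simp add: null_setsD1)
  qed (intro pair_measureI, auto)
  have B: "UNIV \<times> N \<in> null_sets ((lebesgue :: 'b measure) \<Otimes>\<^sub>M (lebesgue :: 'a measure))"
  proof (rule null_setsI)
    have "emeasure (lebesgue \<Otimes>\<^sub>M lebesgue) ((UNIV :: 'b set) \<times> N) = emeasure lebesgue (UNIV :: 'b set) * emeasure lebesgue N"
      by (rule leb.emeasure_pair_measure_Times) (auto simp: \<open>N \<in> sets lebesgue\<close>)
    then show "emeasure (lebesgue \<Otimes>\<^sub>M lebesgue) ((UNIV :: 'b set) \<times> N) = 0" using N by (simp add: null_setsD1)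
  qed (intro pair_measureI, auto)
  show "AE z in (lebesgue :: 'a measure) \<Otimes>\<^sub>M (lebesgue :: 'b measure). P (fst z)"
    by (rule AE_I'[OF A]) (use N(2) in auto)
  show "AE z in (lebesgue :: 'b measure) \<Otimes>\<^sub>M (lebesgue :: 'a measure). P (snd z)"
    by (rule AE_I'[OF B]) (use N(2) in auto)
qed

lemma AE_gagI:
  assumes "AE z in lebesgue \<Otimes>\<^sub>M lebesgue. P z"
  shows "AE z in gag_measure s p. P z"
  unfolding gag_measure_def by (subst AE_density) (use assms in auto)

text \<open>The density is positive only off the diagonal, whence the side condition.\<close>

lemma AE_gagD:
  assumes "AE z in gag_measure s p. P z"
  shows "AE z in lebesgue \<Otimes>\<^sub>M lebesgue. fst z \<noteq> snd z \<longrightarrow> P z"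
proof -
  have "AE z in lebesgue \<Otimes>\<^sub>M lebesgue. 0 < ennreal (1 / norm (fst z - snd z) powr (real DIM('a) + s * p)) \<longrightarrow> P z"
    using assms unfolding gag_measure_def by (subst (asm) AE_density) auto
  then show ?thesis by eventually_elim auto
qed

lemma AE_gag_Dq:
  assumes "AE x in lebesgue. u x = v x"
  shows "AE z in gag_measure s p. Dq u z = Dq v z"
proof (rule AE_gagI)
  show "AE z in lebesgue \<Otimes>\<^sub>M lebesgue. Dq u z = Dq v z"
    using AE_pair_lebesgueI(1)[OF assms] AE_pair_lebesgueI(2)[OF assms] by eventually_elim (simp add: Dq_def)
qed

lemma gagliardo_eq:
  assumes [measurable]: "u \<in> borel_measurable lebesgue"
  shows "gagliardo s p u = Lp_energy (gag_measure s p) p (Dq u)"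
proof -
  note [measurable] = Dq_measurable[OF assms]
  have "Lp_energy (gag_measure s p) p (Dq u)
    = (\<integral>\<^sup>+ z. ennreal (1 / norm (fst z - snd z) powr (real DIM('a) + s * p)) * ennreal (\<bar>Dq u z\<bar> powr p) \<partial>(lebesgue \<Otimes>\<^sub>M lebesgue))"
    unfolding Lp_energy_def gag_measure_def by (subst nn_integral_density) auto
  also have "\<dots> = (\<integral>\<^sup>+ z. ennreal (\<bar>Dq u z\<bar> powr p / norm (fst z - snd z) powr (real DIM('a) + s * p)) \<partial>(lebesgue \<Otimes>\<^sub>M lebesgue))"
    by (simp add: ennreal_mult[symmetric])
  also have "\<dots> = gagliardo s p u"
    unfolding gagliardo_def by (subst leb.nn_integral_fst[symmetric]) (auto simp: Dq_def)
  finally show ?thesis ..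
qed

lemma Dq_add: "Dq (\<lambda>x. u x + v x) = (\<lambda>z. Dq u z + Dq v z)"
  and Dq_diff: "Dq (\<lambda>x. u x - v x) = (\<lambda>z. Dq u z - Dq v z)"
  and Dq_cmult: "Dq (\<lambda>x. c * u x) = (\<lambda>z. c * Dq u z)"
  and Dq_zero: "Dq (\<lambda>x. 0) = (\<lambda>z. 0)"
  by (auto simp: Dq_def fun_eq_iff algebra_simps)

subsection \<open>Fractional Sobolev spaces\<close>

lemma ennreal_powr_less_top_iff [simp]: "ennreal_powr a r < top \<longleftrightarrow> a < top"
  by (auto simp: ennreal_powr_def top.not_eq_extremum)

lemma Wsp_iff:
  "u \<in> Wsp s p \<longleftrightarrow> u \<in> Lp_space lebesgue p \<and> Dq u \<in> Lp_space (gag_measure s p) p"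
  using Dq_measurable_gag[of u s p]
  by (auto simp: Wsp_def Wsp_norm_def Lp_space_def gagliardo_eq)

lemma WspD:
  assumes "u \<in> Wsp s p"
  shows "u \<in> Lp_space lebesgue p" "Dq u \<in> Lp_space (gag_measure s p) p" "u \<in> borel_measurable lebesgue"
  using assms by (auto simp: Wsp_iff Lp_space_iff)

lemma gagliardo_Wsp: "u \<in> Wsp s p \<Longrightarrow> gagliardo s p u = ennreal (Gag s p u)"
  by (simp add: gagliardo_eq WspD Lp_energy_eq Gag_def)

lemma Wsp_norm_eq:
  assumes "u \<in> Wsp s p"
  shows "Wsp_norm s p u = ennreal ((Gag s p u + Ip lebesgue p u) powr (1 / p))"
  unfolding Wsp_norm_def gagliardo_Wsp[OF assms] Lp_energy_eq[OF WspD(1)[OF assms]] ennreal_powr_def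
  by (simp add: ennreal_plus[symmetric] del: ennreal_plus)

lemma Wsp_cong_AE:
  assumes "AE x in lebesgue. u x = v x" "u \<in> Wsp s p" "v \<in> borel_measurable lebesgue"
  shows "v \<in> Wsp s p" "Gag s p v = Gag s p u"
proof -
  note D = Dq_measurable_gag[OF assms(3), of s p]
  show "v \<in> Wsp s p"
    using Lp_space_cong_AE[OF assms(1) WspD(1)[OF assms(2)] assms(3)]
      Lp_space_cong_AE[OF AE_gag_Dq[OF assms(1)] WspD(2)[OF assms(2)] D] by (simp add: Wsp_iff)
  show "Gag s p v = Gag s p u"
    unfolding Gag_def using Ip_cong_AE[OF AE_gag_Dq[OF assms(1)] Lp_spaceD(1)[OF WspD(2)[OF assms(2)]] D] by simp
qed

lemma Wsp_add:
  assumes "u \<in> Wsp s p" "v \<in> Wsp s p" "0 \<le> p"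
  shows "(\<lambda>x. u x + v x) \<in> Wsp s p"
  using assms by (auto simp: Wsp_iff Dq_add intro: Lp_space_add)

lemma Wsp_diff:
  assumes "u \<in> Wsp s p" "v \<in> Wsp s p" "0 \<le> p"
  shows "(\<lambda>x. u x - v x) \<in> Wsp s p"
  using assms by (auto simp: Wsp_iff Dq_diff intro: Lp_space_diff)

lemma Wsp_cmult:
  assumes "u \<in> Wsp s p"
  shows "(\<lambda>x. c * u x) \<in> Wsp s p"
  using assms by (auto simp: Wsp_iff Dq_cmult intro: Lp_space_cmult)

lemma Wsp_zero: "(\<lambda>x. 0) \<in> Wsp s p"
  by (simp add: Wsp_iff Dq_zero)

lemma Gag_cmult: "Gag s p (\<lambda>x. c * u x) = \<bar>c\<bar> powr p * Gag s p u"
  by (simp add: Gag_def Dq_cmult Ip_cmult)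

lemma Gag_minus_commute: "Gag s p (\<lambda>x. u x - v x) = Gag s p (\<lambda>x. v x - u x)"
  unfolding Gag_def Dq_diff by (rule Ip_minus_commute)

lemma diff_triangle_Ip:
  assumes "u \<in> Lp_space M p" "v \<in> Lp_space M p" "w \<in> Lp_space M p" "0 \<le> p"
  shows "Ip M p (\<lambda>x. u x - w x) \<le> 2 powr p * (Ip M p (\<lambda>x. u x - v x) + Ip M p (\<lambda>x. v x - w x))"
  using Lp_space_add(2)[OF Lp_space_diff(1)[OF assms(1,2,4)] Lp_space_diff(1)[OF assms(2,3,4)] assms(4)]
  by simp

lemma diff_triangle_Gag:
  assumes "u \<in> Wsp s p" "v \<in> Wsp s p" "w \<in> Wsp s p" "0 \<le> p"
  shows "Gag s p (\<lambda>x. u x - w x) \<le> 2 powr p * (Gag s p (\<lambda>x. u x - v x) + Gag s p (\<lambda>x. v x - w x))"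
  unfolding Gag_def Dq_diff by (intro diff_triangle_Ip WspD assms)

text \<open>Separates the \<open>ennreal\<close>-valued norm of the definitions into two real
  limits, the form in which all convergence is proved.\<close>

lemma Wsp_norm_tendsto_0_iff:
  assumes p: "1 < p" and f: "\<forall>\<^sub>F k in F. f k \<in> Wsp s p"
  shows "((\<lambda>k. Wsp_norm s p (f k)) \<longlongrightarrow> 0) F \<longleftrightarrow>
    ((\<lambda>k. Gag s p (f k)) \<longlongrightarrow> 0) F \<and> ((\<lambda>k. Ip lebesgue p (f k)) \<longlongrightarrow> 0) F"
proof -
  have "((\<lambda>k. Wsp_norm s p (f k)) \<longlongrightarrow> 0) F \<longleftrightarrow> ((\<lambda>k. ennreal ((Gag s p (f k) + Ip lebesgue p (f k)) powr (1 / p))) \<longlongrightarrow> ennreal 0) F"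
    using f by (intro filterlim_cong) (auto elim!: eventually_mono simp: Wsp_norm_eq)
  also have "\<dots> \<longleftrightarrow> ((\<lambda>k. (Gag s p (f k) + Ip lebesgue p (f k)) powr (1 / p)) \<longlongrightarrow> 0) F"
    by (rule tendsto_ennreal_iff) auto
  also have "\<dots> \<longleftrightarrow> ((\<lambda>k. Gag s p (f k) + Ip lebesgue p (f k)) \<longlongrightarrow> 0) F"
    using tendsto_powr_inverse_iff[OF p, of "\<lambda>k. Gag s p (f k) + Ip lebesgue p (f k)" 0 F] p by simp
  also have "\<dots> \<longleftrightarrow> ((\<lambda>k. Gag s p (f k)) \<longlongrightarrow> 0) F \<and> ((\<lambda>k. Ip lebesgue p (f k)) \<longlongrightarrow> 0) F"
  proof safe
    assume *: "((\<lambda>k. Gag s p (f k) + Ip lebesgue p (f k)) \<longlongrightarrow> 0) F"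
    show "((\<lambda>k. Gag s p (f k)) \<longlongrightarrow> 0) F" "((\<lambda>k. Ip lebesgue p (f k)) \<longlongrightarrow> 0) F"
      by (rule tendsto_sandwich[OF _ _ tendsto_const *]; simp)+
  next
    assume "((\<lambda>k. Gag s p (f k)) \<longlongrightarrow> 0) F" "((\<lambda>k. Ip lebesgue p (f k)) \<longlongrightarrow> 0) F"
    from tendsto_add[OF this] show "((\<lambda>k. Gag s p (f k) + Ip lebesgue p (f k)) \<longlongrightarrow> 0) F" by simp
  qed
  finally show ?thesis .
qed

lemma Wsp_norm_less_imp:
  assumes u: "u \<in> Wsp s p" and e: "0 < e" "1 < p" and l: "Wsp_norm s p u < ennreal (e powr (1 / p))"
  shows "Gag s p u < e" "Ip lebesgue p u < e"
proof -
  have "(Gag s p u + Ip lebesgue p u) powr (1 / p) < e powr (1 / p)"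
    using l unfolding Wsp_norm_eq[OF u] by (subst (asm) ennreal_less_iff) auto
  then have "Gag s p u + Ip lebesgue p u < e"
    using e powr_mono2[of "1 / p" e "Gag s p u + Ip lebesgue p u"] by force
  then show "Gag s p u < e" "Ip lebesgue p u < e"
    using Gag_nonneg[of s p u] Ip_nonneg[of lebesgue p u] by linarith+
qed

lemma Wsp0_imp_Wsp: "u \<in> Wsp0 \<Omega> s p \<Longrightarrow> u \<in> Wsp s p"
  by (simp add: Wsp0_def)

lemma Wsp0_test_sequence:
  assumes u: "u \<in> Wsp0 \<Omega> s p" and p: "1 < p"
  obtains \<phi> :: "nat \<Rightarrow> 'a::euclidean_space \<Rightarrow> real" where
    "\<And>k. \<phi> k \<in> test_functions \<Omega>" "\<And>k. \<phi> k \<in> Wsp s p"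
    "(\<lambda>k. Gag s p (\<lambda>x. \<phi> k x - u x)) \<longlonglongrightarrow> 0" "(\<lambda>k. Ip lebesgue p (\<lambda>x. \<phi> k x - u x)) \<longlonglongrightarrow> 0"
proof -
  note uW = Wsp0_imp_Wsp[OF u]
  have "\<exists>\<phi>\<in>test_functions \<Omega>. Wsp_norm s p (\<lambda>x. u x - \<phi> x) < ennreal ((1 / real (Suc k)) powr (1 / p))" for k
    using u unfolding Wsp0_def by simp
  then obtain \<phi> where \<phi>: "\<And>k. \<phi> k \<in> test_functions \<Omega>"
    "\<And>k. Wsp_norm s p (\<lambda>x. u x - \<phi> k x) < ennreal ((1 / real (Suc k)) powr (1 / p))" by metis
  have dW: "(\<lambda>x. u x - \<phi> k x) \<in> Wsp s p" for k
  proof -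
    have [measurable]: "\<phi> k \<in> borel_measurable lebesgue" "u \<in> borel_measurable lebesgue"
      using test_functions_measurable[OF \<phi>(1)] WspD(3)[OF uW] by (auto intro: measurable_completion)
    have "(\<lambda>x. u x - \<phi> k x) \<in> borel_measurable lebesgue" by measurable
    then show ?thesis using order.strict_trans2[OF \<phi>(2)[of k]] by (auto simp: Wsp_def intro: order.strict_trans)
  qed
  have W: "\<phi> k \<in> Wsp s p" for k
    using Wsp_diff[OF uW dW[of k]] p by simp
  have *: "Gag s p (\<lambda>x. \<phi> k x - u x) < 1 / real (Suc k)" "Ip lebesgue p (\<lambda>x. \<phi> k x - u x) < 1 / real (Suc k)" for k
    using Wsp_norm_less_imp[OF dW _ p \<phi>(2), of k]
    unfolding Gag_minus_commute[of s p u "\<phi> k"] Ip_minus_commute[of lebesgue p u "\<phi> k"] by auto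
  show ?thesis
  proof (rule that[OF \<phi>(1) W])
    show "(\<lambda>k. Gag s p (\<lambda>x. \<phi> k x - u x)) \<longlonglongrightarrow> 0"
      by (rule tendsto_sandwich[OF _ _ tendsto_const LIMSEQ_Suc[OF lim_1_over_n]])
         (use *(1) in \<open>auto intro!: always_eventually less_imp_le\<close>)
    show "(\<lambda>k. Ip lebesgue p (\<lambda>x. \<phi> k x - u x)) \<longlonglongrightarrow> 0"
      by (rule tendsto_sandwich[OF _ _ tendsto_const LIMSEQ_Suc[OF lim_1_over_n]])
         (use *(2) in \<open>auto intro!: always_eventually less_imp_le\<close>)
  qed
qed

text \<open>Approximability is measured by a real number, the \<open>p\<close>-th power of the norm,
  so that density arguments run without \<open>ennreal\<close> arithmetic.\<close>

lemma Wsp0I_test_sequence: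
  fixes u :: "'a::euclidean_space \<Rightarrow> real"
  assumes p: "1 < p" and u: "u \<in> Wsp s p"
    and \<phi>: "\<And>e :: real. 0 < e \<Longrightarrow> \<exists>\<phi>\<in>test_functions \<Omega>. \<phi> \<in> Wsp s p \<and> Gag s p (\<lambda>x. u x - \<phi> x) + Ip lebesgue p (\<lambda>x. u x - \<phi> x) < e"
  shows "u \<in> Wsp0 \<Omega> s p"
  unfolding Wsp0_def
proof (intro CollectI conjI u allI impI)
  fix \<epsilon> :: ennreal assume "0 < \<epsilon>"
  obtain e where e: "0 < e" "ennreal e < \<epsilon>"
  proof (cases \<epsilon>)
    case (real r)
    with \<open>0 < \<epsilon>\<close> that[of "r / 2"] show ?thesis by (auto simp: ennreal_less_iff)
  next
    case top
    with that[of 1] show ?thesis by auto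
  qed
  then obtain \<psi> where \<psi>: "\<psi> \<in> test_functions \<Omega>" "\<psi> \<in> Wsp s p" "Gag s p (\<lambda>x. u x - \<psi> x) + Ip lebesgue p (\<lambda>x. u x - \<psi> x) < e powr p"
    using \<phi>[of "e powr p"] by auto
  have dW: "(\<lambda>x. u x - \<psi> x) \<in> Wsp s p" using p by (intro Wsp_diff u \<psi>) auto
  have "(Gag s p (\<lambda>x. u x - \<psi> x) + Ip lebesgue p (\<lambda>x. u x - \<psi> x)) powr (1 / p) \<le> (e powr p) powr (1 / p)"
    using \<psi>(3) p by (intro powr_mono2) auto
  also have "\<dots> = e" using e p by (simp add: powr_powr)
  finally have "Wsp_norm s p (\<lambda>x. u x - \<psi> x) \<le> ennreal e"
    unfolding Wsp_norm_eq[OF dW] by (rule ennreal_leI)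
  with e \<psi> show "\<exists>\<phi>\<in>test_functions \<Omega>. Wsp_norm s p (\<lambda>x. u x - \<phi> x) < \<epsilon>"
    by (intro bexI[of _ \<psi>]) auto
qed

lemma Wsp0_approx:
  assumes u: "u \<in> Wsp0 \<Omega> s p" and p: "1 < p" and e: "0 < e"
  obtains \<phi> where "\<phi> \<in> test_functions \<Omega>" "\<phi> \<in> Wsp s p" "Gag s p (\<lambda>x. u x - \<phi> x) + Ip lebesgue p (\<lambda>x. u x - \<phi> x) < e"
proof -
  obtain \<phi> where \<phi>: "\<And>k. \<phi> k \<in> test_functions \<Omega>" "\<And>k. \<phi> k \<in> Wsp s p"
    "(\<lambda>k. Gag s p (\<lambda>x. \<phi> k x - u x)) \<longlonglongrightarrow> 0" "(\<lambda>k. Ip lebesgue p (\<lambda>x. \<phi> k x - u x)) \<longlonglongrightarrow> 0"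
    by (rule Wsp0_test_sequence[OF u p]) blast
  from tendsto_add[OF \<phi>(3,4)] have "\<forall>\<^sub>F k in sequentially. Gag s p (\<lambda>x. \<phi> k x - u x) + Ip lebesgue p (\<lambda>x. \<phi> k x - u x) < e"
    using e by (intro order_tendstoD) auto
  then obtain k where "Gag s p (\<lambda>x. \<phi> k x - u x) + Ip lebesgue p (\<lambda>x. \<phi> k x - u x) < e"
    by (auto simp: eventually_sequentially)
  then show ?thesis
    using that[OF \<phi>(1,2)[of k]] Gag_minus_commute[of s p u "\<phi> k"] Ip_minus_commute[of lebesgue p u "\<phi> k"] by simp
qed

lemma Wsp0_closed:
  assumes p: "1 < p" and u: "u \<in> Wsp s p"
    and v: "\<And>e :: real. 0 < e \<Longrightarrow> \<exists>v\<in>Wsp0 \<Omega> s p. Gag s p (\<lambda>x. u x - v x) + Ip lebesgue p (\<lambda>x. u x - v x) < e"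
  shows "u \<in> Wsp0 \<Omega> s p"
proof (rule Wsp0I_test_sequence[OF p u])
  fix e :: real assume e: "0 < e"
  \<comment> \<open>The factor \<open>2 powr p\<close> is the constant of
    \<open>diff_triangle_Ip\<close> and \<open>diff_triangle_Gag\<close>; two distances below
    \<open>d\<close> are added.\<close>
  define d where "d = e / (2 * 2 powr p)"
  have d: "0 < d" using e by (simp add: d_def)
  obtain w where w: "w \<in> Wsp0 \<Omega> s p" "Gag s p (\<lambda>x. u x - w x) + Ip lebesgue p (\<lambda>x. u x - w x) < d"
    using v[OF d] by blast
  obtain \<phi> where \<phi>: "\<phi> \<in> test_functions \<Omega>" "\<phi> \<in> Wsp s p" "Gag s p (\<lambda>x. w x - \<phi> x) + Ip lebesgue p (\<lambda>x. w x - \<phi> x) < d"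
    by (rule Wsp0_approx[OF w(1) p d])
  have W: "w \<in> Wsp s p" using w by (simp add: Wsp0_imp_Wsp)
  have "Gag s p (\<lambda>x. u x - \<phi> x) + Ip lebesgue p (\<lambda>x. u x - \<phi> x)
     \<le> 2 powr p * (Gag s p (\<lambda>x. u x - w x) + Gag s p (\<lambda>x. w x - \<phi> x)) + 2 powr p * (Ip lebesgue p (\<lambda>x. u x - w x) + Ip lebesgue p (\<lambda>x. w x - \<phi> x))"
    using p by (intro add_mono diff_triangle_Gag diff_triangle_Ip WspD(1)[where s = s] u W \<phi>) auto
  also have "\<dots> = 2 powr p * ((Gag s p (\<lambda>x. u x - w x) + Ip lebesgue p (\<lambda>x. u x - w x)) + (Gag s p (\<lambda>x. w x - \<phi> x) + Ip lebesgue p (\<lambda>x. w x - \<phi> x)))"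
    by (simp add: algebra_simps)
  also have "\<dots> < 2 powr p * (d + d)"
    using w(2) \<phi>(3) by (intro mult_strict_left_mono add_strict_mono) auto
  also have "\<dots> = e" by (simp add: d_def)
  finally show "\<exists>\<phi>\<in>test_functions \<Omega>. \<phi> \<in> Wsp s p \<and> Gag s p (\<lambda>x. u x - \<phi> x) + Ip lebesgue p (\<lambda>x. u x - \<phi> x) < e"
    using \<phi> by blast
qed

lemma test_in_Wsp0:
  assumes "1 < p" "\<phi> \<in> test_functions \<Omega>" "\<phi> \<in> Wsp s p"
  shows "\<phi> \<in> Wsp0 \<Omega> s p"
  by (rule Wsp0I_test_sequence[OF assms(1,3)])
     (auto intro!: bexI[OF _ assms(2)] simp: assms Gag_def Dq_zero)

section \<open>Linear structure of \<open>Wsp0\<close> and vanishing outside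
  \<open>\<Omega>\<close>\<close>

lemma test_functions_add:
  assumes "\<phi> \<in> test_functions U" "\<psi> \<in> test_functions U"
  shows "(\<lambda>x. \<phi> x + \<psi> x) \<in> test_functions U"
proof (rule test_functionsI[where K = "closure {x. \<phi> x \<noteq> 0} \<union> closure {x. \<psi> x \<noteq> 0}"])
  show "C_diff k (\<lambda>x. \<phi> x + \<psi> x)" for k
    by (intro C_diff_add test_functionsD(1)[OF assms(1)] test_functionsD(1)[OF assms(2)])
  show "compact (closure {x. \<phi> x \<noteq> 0} \<union> closure {x. \<psi> x \<noteq> 0})"
    by (intro compact_Un test_functionsD(2)[OF assms(1)] test_functionsD(2)[OF assms(2)])
  show "closure {x. \<phi> x \<noteq> 0} \<union> closure {x. \<psi> x \<noteq> 0} \<subseteq> U"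
    using test_functionsD(3)[OF assms(1)] test_functionsD(3)[OF assms(2)] by blast
  show "\<phi> x + \<psi> x = 0" if "x \<notin> closure {x. \<phi> x \<noteq> 0} \<union> closure {x. \<psi> x \<noteq> 0}" for x
    using that test_functionsD(4)[OF assms(1), of x] test_functionsD(4)[OF assms(2), of x] by simp
qed

lemma test_functions_cmult:
  assumes "\<phi> \<in> test_functions U"
  shows "(\<lambda>x. c * \<phi> x) \<in> test_functions U"
proof (rule test_functionsI[where K = "closure {x. \<phi> x \<noteq> 0}"])
  show "C_diff k (\<lambda>x. c * \<phi> x)" for k
    by (intro C_diff_mult C_diff_const test_functionsD(1)[OF assms])
  show "c * \<phi> x = 0" if "x \<notin> closure {x. \<phi> x \<noteq> 0}" for x
    using that test_functionsD(4)[OF assms, of x] by simp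
qed (use test_functionsD(2,3)[OF assms] in auto)

lemma Wsp0_add:
  assumes u: "u \<in> Wsp0 \<Omega> s p" and v: "v \<in> Wsp0 \<Omega> s p" and p: "1 < p"
  shows "(\<lambda>x. u x + v x) \<in> Wsp0 \<Omega> s p"
proof (rule Wsp0I_test_sequence[OF p])
  note uW = Wsp0_imp_Wsp[OF u] and vW = Wsp0_imp_Wsp[OF v]
  show "(\<lambda>x. u x + v x) \<in> Wsp s p" using p by (intro Wsp_add uW vW) auto
  fix e :: real assume e: "0 < e"
  define d where "d = e / (2 * 2 powr p)"
  have d: "0 < d" using e by (simp add: d_def)
  obtain \<phi> where \<phi>: "\<phi> \<in> test_functions \<Omega>" "\<phi> \<in> Wsp s p" "Gag s p (\<lambda>x. u x - \<phi> x) + Ip lebesgue p (\<lambda>x. u x - \<phi> x) < d"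
    by (rule Wsp0_approx[OF u p d])
  obtain \<psi> where \<psi>: "\<psi> \<in> test_functions \<Omega>" "\<psi> \<in> Wsp s p" "Gag s p (\<lambda>x. v x - \<psi> x) + Ip lebesgue p (\<lambda>x. v x - \<psi> x) < d"
    by (rule Wsp0_approx[OF v p d])
  have "Gag s p (\<lambda>x. (u x + v x) - (\<phi> x + \<psi> x)) \<le> 2 powr p * (Gag s p (\<lambda>x. u x - \<phi> x) + Gag s p (\<lambda>x. v x - \<psi> x))"
  proof -
    have "Dq (\<lambda>x. (u x + v x) - (\<phi> x + \<psi> x)) = (\<lambda>z. Dq (\<lambda>x. u x - \<phi> x) z + Dq (\<lambda>x. v x - \<psi> x) z)"
      by (auto simp: Dq_def fun_eq_iff)
    then show ?thesis unfolding Gag_def using p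
      by (auto intro!: Lp_space_add(2) WspD(2) Wsp_diff uW vW \<phi> \<psi>)
  qed
  moreover have "Ip lebesgue p (\<lambda>x. (u x + v x) - (\<phi> x + \<psi> x)) \<le> 2 powr p * (Ip lebesgue p (\<lambda>x. u x - \<phi> x) + Ip lebesgue p (\<lambda>x. v x - \<psi> x))"
  proof -
    have "(\<lambda>x. (u x + v x) - (\<phi> x + \<psi> x)) = (\<lambda>x. (u x - \<phi> x) + (v x - \<psi> x))" by auto
    then show ?thesis using p
      by (auto intro!: Lp_space_add(2) Lp_space_diff(1) WspD(1)[OF uW] WspD(1)[OF vW] WspD(1)[OF \<phi>(2)] WspD(1)[OF \<psi>(2)])
  qed
  ultimately have "Gag s p (\<lambda>x. (u x + v x) - (\<phi> x + \<psi> x)) + Ip lebesgue p (\<lambda>x. (u x + v x) - (\<phi> x + \<psi> x))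
     \<le> 2 powr p * ((Gag s p (\<lambda>x. u x - \<phi> x) + Ip lebesgue p (\<lambda>x. u x - \<phi> x)) + (Gag s p (\<lambda>x. v x - \<psi> x) + Ip lebesgue p (\<lambda>x. v x - \<psi> x)))"
    by (simp add: algebra_simps)
  also have "\<dots> < 2 powr p * (d + d)"
    using \<phi>(3) \<psi>(3) by (intro mult_strict_left_mono add_strict_mono) auto
  also have "\<dots> = e" by (simp add: d_def)
  finally show "\<exists>\<phi>\<in>test_functions \<Omega>. \<phi> \<in> Wsp s p \<and> Gag s p (\<lambda>x. u x + v x - \<phi> x) + Ip lebesgue p (\<lambda>x. u x + v x - \<phi> x) < e"
    using \<phi> \<psi> p by (intro bexI[of _ "\<lambda>x. \<phi> x + \<psi> x"] conjI test_functions_add Wsp_add) auto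
qed

lemma Wsp0_zero:
  assumes "1 < p"
  shows "(\<lambda>x. 0) \<in> Wsp0 \<Omega> s p"
  by (rule test_in_Wsp0[OF assms _ Wsp_zero]) (auto intro!: test_functionsI[where K = "{}"] C_diff_const)

lemma Wsp0_cmult:
  assumes u: "u \<in> Wsp0 \<Omega> s p" and p: "1 < p"
  shows "(\<lambda>x. c * u x) \<in> Wsp0 \<Omega> s p"
proof (cases "c = 0")
  case True
  then show ?thesis using Wsp0_zero[OF p] by simp
next
  case False
  show ?thesis
  proof (rule Wsp0I_test_sequence[OF p Wsp_cmult[OF Wsp0_imp_Wsp[OF u]]])
    fix e :: real assume e: "0 < e"
    then have d: "0 < e / \<bar>c\<bar> powr p" using False by simp
    obtain \<phi> where \<phi>: "\<phi> \<in> test_functions \<Omega>" "\<phi> \<in> Wsp s p" "Gag s p (\<lambda>x. u x - \<phi> x) + Ip lebesgue p (\<lambda>x. u x - \<phi> x) < e / \<bar>c\<bar> powr p"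
      by (rule Wsp0_approx[OF u p d])
    have "(\<lambda>x. c * u x - c * \<phi> x) = (\<lambda>x. c * (u x - \<phi> x))" by (auto simp: algebra_simps)
    then have "Gag s p (\<lambda>x. c * u x - c * \<phi> x) + Ip lebesgue p (\<lambda>x. c * u x - c * \<phi> x) < e"
      using \<phi>(3) False by (simp add: Gag_cmult Ip_cmult pos_less_divide_eq distrib_left mult.commute)
    then show "\<exists>\<phi>\<in>test_functions \<Omega>. \<phi> \<in> Wsp s p \<and> Gag s p (\<lambda>x. c * u x - \<phi> x) + Ip lebesgue p (\<lambda>x. c * u x - \<phi> x) < e"
      using \<phi> by (intro bexI[of _ "\<lambda>x. c * \<phi> x"] conjI test_functions_cmult Wsp_cmult) auto
  qed
qed

text \<open>Test functions vanish outside \<open>\<Omega>\<close> at every point, and a subsequence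
  of the approximating ones converges almost everywhere.\<close>

lemma Wsp0_vanishes_outside:
  assumes u: "u \<in> Wsp0 \<Omega> s p" and p: "1 < p" and \<Omega>: "open \<Omega>"
  shows "AE x in lebesgue. x \<notin> \<Omega> \<longrightarrow> u x = 0"
proof -
  note uL = WspD(1)[OF Wsp0_imp_Wsp[OF u]]
  obtain \<phi> where \<phi>: "\<And>k. \<phi> k \<in> test_functions \<Omega>" "\<And>k. \<phi> k \<in> Wsp s p"
    "(\<lambda>k. Gag s p (\<lambda>x. \<phi> k x - u x)) \<longlonglongrightarrow> 0" "(\<lambda>k. Ip lebesgue p (\<lambda>x. \<phi> k x - u x)) \<longlonglongrightarrow> 0"
    by (rule Wsp0_test_sequence[OF u p]) blast
  have "integrable lebesgue (\<lambda>x. \<bar>\<phi> k x - u x\<bar> powr p)" for k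
    using Lp_spaceD(2)[OF Lp_space_diff(1)[OF WspD(1)[OF \<phi>(2)] uL]] p by simp
  then obtain r where r: "strict_mono (r :: nat \<Rightarrow> nat)" "AE x in lebesgue. (\<lambda>k. \<phi> (r k) x) \<longlonglongrightarrow> u x"
    using Lp_tendsto_AE_subseq[OF WspD(3)[OF \<phi>(2)] _ _ \<phi>(4)] p by auto
  from r(2) show ?thesis
  proof eventually_elim
    case (elim x)
    show ?case
    proof
      assume "x \<notin> \<Omega>"
      then have "\<phi> (r k) x = 0" for k using test_functions_outside[OF \<phi>(1)] by blast
      with elim show "u x = 0" using LIMSEQ_unique[OF _ tendsto_const] by fastforce
    qed
  qed
qed

lemma Lp_energy_lebesgue_on:
  assumes "\<Omega> \<in> sets lebesgue" "AE x in lebesgue. x \<notin> \<Omega> \<longrightarrow> u x = 0"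
  shows "Lp_energy (lebesgue_on \<Omega>) p u = Lp_energy lebesgue p u"
  unfolding Lp_energy_def using assms
  by (subst nn_integral_restrict_space) (auto intro!: nn_integral_cong_AE elim!: eventually_mono split: split_indicator)

subsection \<open>The pointwise \<open>p\<close>-mean of two functions\<close>

text \<open>The \<open>p\<close>-norm of the vector \<open>(a, b)\<close> in the plane, normalised
  so that \<open>pmean p a a = a\<close> for \<open>0 \<le> a\<close>. Its triangle inequality is
  the source of hidden convexity.\<close>

definition pmean :: "real \<Rightarrow> real \<Rightarrow> real \<Rightarrow> real" where
  "pmean p a b = ((\<bar>a\<bar> powr p + \<bar>b\<bar> powr p) / 2) powr (1 / p)"

lemma pmean_nonneg [simp]: "0 \<le> pmean p a b"
  by (simp add: pmean_def)

lemma pmean_powr: "0 < p \<Longrightarrow> pmean p a b powr p = (\<bar>a\<bar> powr p + \<bar>b\<bar> powr p) / 2"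
  by (simp add: pmean_def powr_powr)

lemma pmean_eq_0_iff: "pmean p a b = 0 \<longleftrightarrow> a = 0 \<and> b = 0"
proof -
  have "\<bar>a\<bar> powr p + \<bar>b\<bar> powr p = 0 \<longleftrightarrow> \<bar>a\<bar> powr p = 0 \<and> \<bar>b\<bar> powr p = 0"
    by (rule add_nonneg_eq_0_iff) auto
  then show ?thesis by (simp add: pmean_def)
qed

lemma pmean_measurable [measurable]:
  assumes [measurable]: "f \<in> borel_measurable M" "g \<in> borel_measurable M"
  shows "(\<lambda>x. pmean p (f x) (g x)) \<in> borel_measurable M"
  unfolding pmean_def by measurable

lemma pmean_same: "0 < p \<Longrightarrow> 0 \<le> a \<Longrightarrow> pmean p a a = a"
  by (simp add: pmean_def powr_powr)

text \<open>Minkowski's inequality in the plane, from convexity of the \<open>p\<close>-th power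
  applied to the two vectors scaled to norm 1. Strict convexity makes it strict unless the scaled
  vectors coincide, so equality forces \<open>(a, b)\<close> and \<open>(c, d)\<close> to be
  parallel.\<close>

lemma pmean_triangle:
  assumes p: "1 < p"
  shows "pmean p (a + c) (b + d) \<le> pmean p a b + pmean p c d"
    and "pmean p (a + c) (b + d) = pmean p a b + pmean p c d \<Longrightarrow> a * d = b * c"
proof -
  define \<alpha> where "\<alpha> = pmean p a b"
  define \<gamma> where "\<gamma> = pmean p c d"
  have main: "pmean p (a + c) (b + d) \<le> \<alpha> + \<gamma>"
    "a / \<alpha> \<noteq> c / \<gamma> \<or> b / \<alpha> \<noteq> d / \<gamma> \<Longrightarrow> pmean p (a + c) (b + d) < \<alpha> + \<gamma>"
    if pos: "0 < \<alpha>" "0 < \<gamma>"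
  proof -
    \<comment> \<open>Weights proportional to the norms: the scaled sum then becomes a convex
      combination of the scaled vectors.\<close>
    define \<theta> where "\<theta> = \<alpha> / (\<alpha> + \<gamma>)"
    have \<theta>: "0 < \<theta>" "\<theta> < 1" "1 - \<theta> = \<gamma> / (\<alpha> + \<gamma>)"
      using pos by (auto simp: \<theta>_def field_simps)
    have split: "(x + y) / (\<alpha> + \<gamma>) = \<theta> * (x / \<alpha>) + (1 - \<theta>) * (y / \<gamma>)" for x y
      unfolding \<theta>(3) using pos by (simp add: \<theta>_def add_divide_distrib)
    have norm1: "(\<bar>a / \<alpha>\<bar> powr p + \<bar>b / \<alpha>\<bar> powr p) / 2 = 1" "(\<bar>c / \<gamma>\<bar> powr p + \<bar>d / \<gamma>\<bar> powr p) / 2 = 1"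
    proof -
      have scale: "(\<bar>x / r\<bar> powr p + \<bar>y / r\<bar> powr p) / 2 = ((\<bar>x\<bar> powr p + \<bar>y\<bar> powr p) / 2) / r powr p" if "0 < r" for x y r
        using that by (simp add: powr_divide add_divide_distrib)
      have "\<alpha> powr p = (\<bar>a\<bar> powr p + \<bar>b\<bar> powr p) / 2" "\<gamma> powr p = (\<bar>c\<bar> powr p + \<bar>d\<bar> powr p) / 2"
        using p by (simp_all add: \<alpha>_def \<gamma>_def pmean_powr)
      then show "(\<bar>a / \<alpha>\<bar> powr p + \<bar>b / \<alpha>\<bar> powr p) / 2 = 1" "(\<bar>c / \<gamma>\<bar> powr p + \<bar>d / \<gamma>\<bar> powr p) / 2 = 1"
        unfolding scale[OF pos(1)] scale[OF pos(2)] using pos by (metis divide_self_if less_irrefl powr_gt_zero)+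
    qed
    have le: "\<bar>(x + y) / (\<alpha> + \<gamma>)\<bar> powr p \<le> \<theta> * \<bar>x / \<alpha>\<bar> powr p + (1 - \<theta>) * \<bar>y / \<gamma>\<bar> powr p" for x y
      unfolding split using \<theta> p by (intro abs_powr_convex) auto
    have less: "\<bar>(x + y) / (\<alpha> + \<gamma>)\<bar> powr p < \<theta> * \<bar>x / \<alpha>\<bar> powr p + (1 - \<theta>) * \<bar>y / \<gamma>\<bar> powr p"
      if "x / \<alpha> \<noteq> y / \<gamma>" for x y
      unfolding split using \<theta> p that by (intro abs_powr_convex_less) auto
    have one: "\<theta> * \<bar>a / \<alpha>\<bar> powr p + (1 - \<theta>) * \<bar>c / \<gamma>\<bar> powr p + (\<theta> * \<bar>b / \<alpha>\<bar> powr p + (1 - \<theta>) * \<bar>d / \<gamma>\<bar> powr p) = 2"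
    proof -
      have gen: "\<theta> * A + (1 - \<theta>) * B + (\<theta> * C + (1 - \<theta>) * D) = \<theta> * (A + C) + (1 - \<theta>) * (B + D)" for A B C D
        by (simp add: algebra_simps)
      have dbl: "x = 2" if "x / 2 = 1" for x :: real using that by simp
      have "\<bar>a / \<alpha>\<bar> powr p + \<bar>b / \<alpha>\<bar> powr p = 2" by (rule dbl[OF norm1(1)])
      moreover have "\<bar>c / \<gamma>\<bar> powr p + \<bar>d / \<gamma>\<bar> powr p = 2" by (rule dbl[OF norm1(2)])
      ultimately show ?thesis unfolding gen by (simp only:) simp
    qed
    have eq: "pmean p (a + c) (b + d) powr p = (\<alpha> + \<gamma>) powr p * ((\<bar>(a + c) / (\<alpha> + \<gamma>)\<bar> powr p + \<bar>(b + d) / (\<alpha> + \<gamma>)\<bar> powr p) / 2)"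
    proof -
      have "(\<alpha> + \<gamma>) powr p * \<bar>x / (\<alpha> + \<gamma>)\<bar> powr p = \<bar>x\<bar> powr p" for x
        using pos by (simp add: powr_divide)
      then show ?thesis using p
        by (simp only: pmean_powr[OF less_trans[OF zero_less_one p]] times_divide_eq_right distrib_left)
    qed
    show "pmean p (a + c) (b + d) \<le> \<alpha> + \<gamma>"
    proof (rule ccontr)
      assume "\<not> ?thesis"
      then have "(\<alpha> + \<gamma>) powr p < pmean p (a + c) (b + d) powr p"
        using pos p by (intro powr_less_mono2) auto
      moreover have "pmean p (a + c) (b + d) powr p \<le> (\<alpha> + \<gamma>) powr p * 1"
        unfolding eq using add_mono[OF le[of a c] le[of b d]] unfolding one by (intro mult_left_mono) auto
      ultimately show False by simp
    qed
    show "pmean p (a + c) (b + d) < \<alpha> + \<gamma>" if "a / \<alpha> \<noteq> c / \<gamma> \<or> b / \<alpha> \<noteq> d / \<gamma>"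
    proof (rule ccontr)
      assume "\<not> ?thesis"
      then have "(\<alpha> + \<gamma>) powr p \<le> pmean p (a + c) (b + d) powr p"
        using pos p by (intro powr_mono2) auto
      moreover have "\<bar>(a + c) / (\<alpha> + \<gamma>)\<bar> powr p + \<bar>(b + d) / (\<alpha> + \<gamma>)\<bar> powr p < 2"
        using that
      proof
        assume "a / \<alpha> \<noteq> c / \<gamma>"
        from add_less_le_mono[OF less[OF this] le[of b d]] show ?thesis unfolding one .
      next
        assume "b / \<alpha> \<noteq> d / \<gamma>"
        from add_le_less_mono[OF le[of a c] less[OF this]] show ?thesis unfolding one .
      qed
      then have "pmean p (a + c) (b + d) powr p < (\<alpha> + \<gamma>) powr p * 1"
        unfolding eq using pos by (intro mult_strict_left_mono) auto
      ultimately show False by simp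
    qed
  qed
  show "pmean p (a + c) (b + d) \<le> pmean p a b + pmean p c d"
  proof (cases "\<alpha> = 0 \<or> \<gamma> = 0")
    case True
    then show ?thesis using pmean_eq_0_iff[of p a b] pmean_eq_0_iff[of p c d] by (auto simp: \<alpha>_def \<gamma>_def)
  next
    case False
    then show ?thesis using main(1) pmean_nonneg[of p a b] pmean_nonneg[of p c d]
      by (auto simp: \<alpha>_def \<gamma>_def less_le)
  qed
  show "a * d = b * c" if "pmean p (a + c) (b + d) = pmean p a b + pmean p c d"
  proof (cases "\<alpha> = 0 \<or> \<gamma> = 0")
    case True
    then show ?thesis using pmean_eq_0_iff[of p a b] pmean_eq_0_iff[of p c d] by (auto simp: \<alpha>_def \<gamma>_def)
  next
    case False
    then have pos: "0 < \<alpha>" "0 < \<gamma>" by (auto simp: \<alpha>_def \<gamma>_def less_le)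
    then have "a / \<alpha> = c / \<gamma>" "b / \<alpha> = d / \<gamma>"
      using main(2)[OF pos] that by (auto simp: \<alpha>_def \<gamma>_def)
    then have "a / \<alpha> * (d / \<gamma>) = b / \<alpha> * (c / \<gamma>)" by simp
    then show ?thesis using pos by simp
  qed
qed

lemma pmean_minus: "pmean p (- a) (- b) = pmean p a b"
  by (simp add: pmean_def)

lemma pmean_diff:
  assumes p: "1 < p"
  shows "\<bar>pmean p a b - pmean p c d\<bar> \<le> pmean p (a - c) (b - d)"
    and "\<bar>pmean p a b - pmean p c d\<bar> = pmean p (a - c) (b - d) \<Longrightarrow> a * d = b * c"
proof -
  have m: "pmean p (c - a) (d - b) = pmean p (a - c) (b - d)"
    using pmean_minus[of p "a - c" "b - d"] by simp
  have 1: "pmean p a b \<le> pmean p (a - c) (b - d) + pmean p c d"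
    using pmean_triangle(1)[OF p, of "a - c" c "b - d" d] by simp
  have 2: "pmean p c d \<le> pmean p (a - c) (b - d) + pmean p a b"
    using pmean_triangle(1)[OF p, of "c - a" a "d - b" b] by (simp add: m)
  show "\<bar>pmean p a b - pmean p c d\<bar> \<le> pmean p (a - c) (b - d)"
    using 1 2 by linarith
  assume "\<bar>pmean p a b - pmean p c d\<bar> = pmean p (a - c) (b - d)"
  then consider "pmean p a b = pmean p (a - c) (b - d) + pmean p c d" | "pmean p c d = pmean p (c - a) (d - b) + pmean p a b"
    using m by linarith
  then show "a * d = b * c"
  proof cases
    case 1
    then have "(a - c) * d = (b - d) * c" using pmean_triangle(2)[OF p, of "a - c" c "b - d" d] by simp
    then show ?thesis by (simp add: algebra_simps)
  next
    case 2
    then have "(c - a) * b = (d - b) * a" using pmean_triangle(2)[OF p, of "c - a" a "d - b" b] by simp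
    then show ?thesis by (simp add: algebra_simps)
  qed
qed

lemma pmean_diff_powr:
  assumes p: "1 < p"
  shows "\<bar>pmean p a b - pmean p c d\<bar> powr p \<le> (\<bar>a - c\<bar> powr p + \<bar>b - d\<bar> powr p) / 2"
    and "\<bar>pmean p a b - pmean p c d\<bar> powr p = (\<bar>a - c\<bar> powr p + \<bar>b - d\<bar> powr p) / 2 \<Longrightarrow> a * d = b * c"
proof -
  note * = pmean_powr[of p "a - c" "b - d"]
  show "\<bar>pmean p a b - pmean p c d\<bar> powr p \<le> (\<bar>a - c\<bar> powr p + \<bar>b - d\<bar> powr p) / 2"
    unfolding *[OF less_trans[OF zero_less_one p], symmetric] using p by (intro powr_mono2 pmean_diff) auto
  assume "\<bar>pmean p a b - pmean p c d\<bar> powr p = (\<bar>a - c\<bar> powr p + \<bar>b - d\<bar> powr p) / 2"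
  then have "\<bar>pmean p a b - pmean p c d\<bar> powr p = pmean p (a - c) (b - d) powr p" using * p by simp
  then have "(\<bar>pmean p a b - pmean p c d\<bar> powr p) powr (1 / p) = (pmean p (a - c) (b - d) powr p) powr (1 / p)" by simp
  then have "\<bar>pmean p a b - pmean p c d\<bar> = pmean p (a - c) (b - d)" using p by (simp add: powr_powr)
  then show "a * d = b * c" by (rule pmean_diff(2)[OF p])
qed

text \<open>A smooth substitute for \<open>pmean\<close>. Replacing \<open>\<bar>a\<bar>\<close> by
  \<open>sqrt (a\<^sup>2 + e\<^sup>2)\<close> keeps the powers away from 0, and subtracting
  \<open>e\<close> restores the value 0 at the origin, so test functions are mapped to test
  functions; the Lipschitz estimate of \<open>pmean\<close> survives.\<close>

definition pmean_reg :: "real \<Rightarrow> real \<Rightarrow> real \<Rightarrow> real \<Rightarrow> real" where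
  "pmean_reg p e a b = pmean p (sqrt (a\<^sup>2 + e\<^sup>2)) (sqrt (b\<^sup>2 + e\<^sup>2)) - e"

lemma pmean_reg_zero: "0 < p \<Longrightarrow> 0 \<le> e \<Longrightarrow> pmean_reg p e 0 0 = 0"
  by (simp add: pmean_reg_def pmean_same)

lemma sqrt_sum_squares_diff_le: "\<bar>sqrt (a\<^sup>2 + e\<^sup>2) - sqrt (c\<^sup>2 + e\<^sup>2)\<bar> \<le> \<bar>a - c :: real\<bar>"
  using norm_triangle_ineq3[of "(a, e)" "(c, e)"] by (simp add: norm_Pair)

lemma pmean_reg_diff_powr:
  assumes p: "1 < p"
  shows "\<bar>pmean_reg p e a b - pmean_reg p e c d\<bar> powr p \<le> (\<bar>a - c\<bar> powr p + \<bar>b - d\<bar> powr p) / 2"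
proof -
  have "\<bar>pmean_reg p e a b - pmean_reg p e c d\<bar> powr p \<le>
     (\<bar>sqrt (a\<^sup>2 + e\<^sup>2) - sqrt (c\<^sup>2 + e\<^sup>2)\<bar> powr p + \<bar>sqrt (b\<^sup>2 + e\<^sup>2) - sqrt (d\<^sup>2 + e\<^sup>2)\<bar> powr p) / 2"
    using pmean_diff_powr(1)[OF p] by (simp add: pmean_reg_def)
  also have "\<dots> \<le> (\<bar>a - c\<bar> powr p + \<bar>b - d\<bar> powr p) / 2"
    using p by (intro divide_right_mono add_mono powr_mono2 sqrt_sum_squares_diff_le) auto
  finally show ?thesis .
qed

lemma pmean_reg_powr_le:
  assumes p: "1 < p" and e: "0 \<le> e"
  shows "\<bar>pmean_reg p e a b\<bar> powr p \<le> (\<bar>a\<bar> powr p + \<bar>b\<bar> powr p) / 2"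
  using pmean_reg_diff_powr[OF p, of e a b 0 0] pmean_reg_zero[of p e] assms by simp

lemma pmean_reg_tendsto:
  assumes "1 < p" "(e \<longlonglongrightarrow> 0)" "a \<longlonglongrightarrow> a'" "b \<longlonglongrightarrow> b'"
  shows "(\<lambda>k. pmean_reg p (e k) (a k) (b k)) \<longlonglongrightarrow> pmean p a' b'"
proof -
  have "(\<lambda>k. pmean_reg p (e k) (a k) (b k)) \<longlonglongrightarrow> pmean p (sqrt (a'\<^sup>2 + 0\<^sup>2)) (sqrt (b'\<^sup>2 + 0\<^sup>2)) - 0"
    unfolding pmean_reg_def pmean_def using assms
    by (intro tendsto_intros tendsto_powr') (auto simp: divide_nonneg_nonneg)
  then show ?thesis by (simp add: pmean_def)
qed

lemma pmean_reg_test_function: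
  assumes p: "1 < p" and e: "0 < e" and f: "\<phi> \<in> test_functions U" "\<psi> \<in> test_functions U"
  shows "(\<lambda>x. pmean_reg p e (\<phi> x) (\<psi> x)) \<in> test_functions U"
proof (rule test_functionsI[where K = "closure {x. \<phi> x \<noteq> 0} \<union> closure {x. \<psi> x \<noteq> 0}"])
  fix k
  have sq: "\<bar>sqrt (a\<^sup>2 + e\<^sup>2)\<bar> powr p = (a * a + e * e) powr (p / 2)" for a :: real
    by (simp add: powr_half_sqrt[symmetric] powr_powr power2_eq_square)
  have pos: "0 < a * a + e * e" for a :: real using e by (intro add_nonneg_pos) auto
  have "C_diff k (\<lambda>x. (1 / 2 * ((\<phi> x * \<phi> x + e * e) powr (p / 2) + (\<psi> x * \<psi> x + e * e) powr (p / 2))) powr (1 / p) - e)"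
    by (intro C_diff_diff C_diff_powr C_diff_add C_diff_mult C_diff_const test_functionsD(1)[OF f(1)] test_functionsD(1)[OF f(2)] pos
      mult_pos_pos add_pos_pos) (use e in auto)
  then show "C_diff k (\<lambda>x. pmean_reg p e (\<phi> x) (\<psi> x))"
    unfolding pmean_reg_def pmean_def sq by simp
next
  show "compact (closure {x. \<phi> x \<noteq> 0} \<union> closure {x. \<psi> x \<noteq> 0})"
    by (intro compact_Un test_functionsD(2)[OF f(1)] test_functionsD(2)[OF f(2)])
  show "closure {x. \<phi> x \<noteq> 0} \<union> closure {x. \<psi> x \<noteq> 0} \<subseteq> U"
    using test_functionsD(3)[OF f(1)] test_functionsD(3)[OF f(2)] by blast
  show "pmean_reg p e (\<phi> x) (\<psi> x) = 0" if "x \<notin> closure {x. \<phi> x \<noteq> 0} \<union> closure {x. \<psi> x \<noteq> 0}" for x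
    using that test_functionsD(4)[OF f(1), of x] test_functionsD(4)[OF f(2), of x] p e pmean_reg_zero[of p e] by simp
qed

text \<open>The majorants of \<open>f k\<close> vary with \<open>k\<close>, so ordinary dominated
  convergence does not apply. They are split into \<open>\<bar>a k x - a' x\<bar> powr p\<close> and
  its analogue for \<open>b\<close>, which vanish in mean, and a fixed integrable part.\<close>

lemma Ip_tendsto_0_pmean_dominated:
  assumes p: "1 < p"
    and f: "\<And>k. f k \<in> borel_measurable M" "g \<in> borel_measurable M"
    and ab: "\<And>k. a k \<in> Lp_space M p" "\<And>k. b k \<in> Lp_space M p" "a' \<in> Lp_space M p" "b' \<in> Lp_space M p"
    and fle: "\<And>k x. \<bar>f k x\<bar> powr p \<le> (\<bar>a k x\<bar> powr p + \<bar>b k x\<bar> powr p) / 2"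
    and gle: "\<And>x. \<bar>g x\<bar> powr p \<le> (\<bar>a' x\<bar> powr p + \<bar>b' x\<bar> powr p) / 2"
    and lim: "AE x in M. (\<lambda>k. f k x) \<longlonglongrightarrow> g x"
    and conv: "(\<lambda>k. Ip M p (\<lambda>x. a k x - a' x)) \<longlonglongrightarrow> 0" "(\<lambda>k. Ip M p (\<lambda>x. b k x - b' x)) \<longlonglongrightarrow> 0"
  shows "(\<lambda>k. Ip M p (\<lambda>x. f k x - g x)) \<longlonglongrightarrow> 0"
proof -
  define C where "C = (2 :: real) powr p"
  have C: "0 \<le> C" by (simp add: C_def)
  define r where "r = (\<lambda>k x. C * C * (\<bar>a k x - a' x\<bar> powr p + \<bar>b k x - b' x\<bar> powr p))"
  define H where "H = (\<lambda>x. C * (C * (\<bar>a' x\<bar> powr p + \<bar>b' x\<bar> powr p) + (\<bar>a' x\<bar> powr p + \<bar>b' x\<bar> powr p)))"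
  have p0: "0 \<le> p" using p by simp
  note di = Lp_spaceD(2)[OF Lp_space_diff(1)[OF ab(1) ab(3) p0]] Lp_spaceD(2)[OF Lp_space_diff(1)[OF ab(2) ab(4) p0]]
  show ?thesis unfolding Ip_def
  proof (rule Ip_tendsto_0_dominated[where r = r and H = H])
    show "(\<lambda>x. \<bar>f k x - g x\<bar> powr p) \<in> borel_measurable M" for k
    proof -
      note [measurable] = f
      show ?thesis by measurable
    qed
    show "AE x in M. (\<lambda>k. \<bar>f k x - g x\<bar> powr p) \<longlonglongrightarrow> 0"
      using lim
    proof eventually_elim
      case (elim x)
      then have "(\<lambda>k. \<bar>f k x - g x\<bar> powr p) \<longlonglongrightarrow> \<bar>g x - g x\<bar> powr p"
        using p by (intro tendsto_powr' tendsto_intros) auto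
      then show ?case by simp
    qed
    show "integrable M (r k)" for k unfolding r_def using di by auto
    show "integrable M H" unfolding H_def using Lp_spaceD(2)[OF ab(3)] Lp_spaceD(2)[OF ab(4)] by auto
    have "(\<lambda>k. C * C * (Ip M p (\<lambda>x. a k x - a' x) + Ip M p (\<lambda>x. b k x - b' x))) \<longlonglongrightarrow> C * C * (0 + 0)"
      by (intro tendsto_intros conv)
    moreover have "(LINT x|M. r k x) = C * C * (Ip M p (\<lambda>x. a k x - a' x) + Ip M p (\<lambda>x. b k x - b' x))" for k
      unfolding r_def Ip_def using di[of k] by simp
    ultimately show "(\<lambda>k. LINT x|M. r k x) \<longlonglongrightarrow> 0" by simp
    show "AE x in M. \<bar>f k x - g x\<bar> powr p \<le> r k x + H x" for k
    proof (rule AE_I2)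
      fix x
      have 1: "\<bar>f k x - g x\<bar> powr p \<le> C * (\<bar>f k x\<bar> powr p + \<bar>g x\<bar> powr p)"
        unfolding C_def by (rule abs_diff_powr_le[OF p0])
      have "\<bar>a k x\<bar> powr p \<le> C * (\<bar>a k x - a' x\<bar> powr p + \<bar>a' x\<bar> powr p)"
        "\<bar>b k x\<bar> powr p \<le> C * (\<bar>b k x - b' x\<bar> powr p + \<bar>b' x\<bar> powr p)"
        unfolding C_def using abs_add_powr_le[OF p0, of "a k x - a' x" "a' x"] abs_add_powr_le[OF p0, of "b k x - b' x" "b' x"] by simp_all
      then have "\<bar>f k x\<bar> powr p \<le> (C * (\<bar>a k x - a' x\<bar> powr p + \<bar>a' x\<bar> powr p) + C * (\<bar>b k x - b' x\<bar> powr p + \<bar>b' x\<bar> powr p)) / 2"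
        by (intro order_trans[OF fle] divide_right_mono add_mono) auto
      also have "\<dots> \<le> C * (\<bar>a k x - a' x\<bar> powr p + \<bar>a' x\<bar> powr p) + C * (\<bar>b k x - b' x\<bar> powr p + \<bar>b' x\<bar> powr p)"
        using C by simp
      finally have 2: "\<bar>f k x\<bar> powr p \<le> C * (\<bar>a k x - a' x\<bar> powr p + \<bar>a' x\<bar> powr p) + C * (\<bar>b k x - b' x\<bar> powr p + \<bar>b' x\<bar> powr p)" .
      have 3: "\<bar>g x\<bar> powr p \<le> \<bar>a' x\<bar> powr p + \<bar>b' x\<bar> powr p"
        by (rule order_trans[OF gle]) simp
      have "C * (\<bar>f k x\<bar> powr p + \<bar>g x\<bar> powr p) \<le> C * ((C * (\<bar>a k x - a' x\<bar> powr p + \<bar>a' x\<bar> powr p) + C * (\<bar>b k x - b' x\<bar> powr p + \<bar>b' x\<bar> powr p)) + (\<bar>a' x\<bar> powr p + \<bar>b' x\<bar> powr p))"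
        using C by (intro mult_left_mono add_mono 2 3)
      also have "\<dots> = r k x + H x" by (simp add: r_def H_def algebra_simps)
      finally show "\<bar>f k x - g x\<bar> powr p \<le> r k x + H x" using 1 by linarith
    qed
  qed (auto simp: r_def H_def C)
qed

lemma Dq_pmean_powr_le:
  assumes "1 < p"
  shows "\<bar>Dq (\<lambda>x. pmean p (u x) (v x)) z\<bar> powr p \<le> (\<bar>Dq u z\<bar> powr p + \<bar>Dq v z\<bar> powr p) / 2"
  unfolding Dq_def by (rule pmean_diff_powr(1)[OF assms])

lemma Lp_space_powr_leI:
  assumes f: "f \<in> borel_measurable M" and ab: "a \<in> Lp_space M p" "b \<in> Lp_space M p"
    and le: "\<And>x. \<bar>f x\<bar> powr p \<le> (\<bar>a x\<bar> powr p + \<bar>b x\<bar> powr p) / 2"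
  shows "f \<in> Lp_space M p"
proof -
  note [measurable] = f
  have "integrable M (\<lambda>x. (\<bar>a x\<bar> powr p + \<bar>b x\<bar> powr p) / 2)"
    using ab[THEN Lp_spaceD(2)] by simp
  then have "integrable M (\<lambda>x. \<bar>f x\<bar> powr p)"
    by (rule Bochner_Integration.integrable_bound) (use le in auto)
  then show ?thesis using f by (simp add: Lp_space_iff)
qed

lemma pmean_Wsp:
  assumes p: "1 < p" and u: "u \<in> Wsp s p" and v: "v \<in> Wsp s p"
  shows "(\<lambda>x. pmean p (u x) (v x)) \<in> Wsp s p"
proof -
  note [measurable] = WspD(3)[OF u] WspD(3)[OF v]
  have m: "(\<lambda>x. pmean p (u x) (v x)) \<in> borel_measurable lebesgue" by measurable
  have "(\<lambda>x. pmean p (u x) (v x)) \<in> Lp_space lebesgue p"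
    by (rule Lp_space_powr_leI[OF m WspD(1)[OF u] WspD(1)[OF v]]) (use p in \<open>simp add: pmean_powr\<close>)
  moreover have "Dq (\<lambda>x. pmean p (u x) (v x)) \<in> Lp_space (gag_measure s p) p"
    by (rule Lp_space_powr_leI[OF Dq_measurable_gag[OF m] WspD(2)[OF u] WspD(2)[OF v] Dq_pmean_powr_le[OF p]])
  ultimately show ?thesis by (simp add: Wsp_iff)
qed

text \<open>Approximating \<open>u\<close> and \<open>v\<close> by test functions and regularising
  the mean with a vanishing parameter gives test functions that converge almost everywhere along a
  common subsequence. The contraction estimates dominate both them and their difference functions,
  so the convergence holds in norm.\<close>

lemma pmean_Wsp0:
  fixes u v :: "'a::euclidean_space \<Rightarrow> real"
  assumes p: "1 < p" and u: "u \<in> Wsp0 \<Omega> s p" and v: "v \<in> Wsp0 \<Omega> s p"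
  shows "(\<lambda>x. pmean p (u x) (v x)) \<in> Wsp0 \<Omega> s p"
proof -
  note uW = Wsp0_imp_Wsp[OF u] and vW = Wsp0_imp_Wsp[OF v]
  note p0 = less_imp_le[OF less_trans[OF zero_less_one p]]
  obtain \<phi> where \<phi>: "\<And>k. \<phi> k \<in> test_functions \<Omega>" "\<And>k. \<phi> k \<in> Wsp s p"
    "(\<lambda>k. Gag s p (\<lambda>x. \<phi> k x - u x)) \<longlonglongrightarrow> 0" "(\<lambda>k. Ip lebesgue p (\<lambda>x. \<phi> k x - u x)) \<longlonglongrightarrow> 0"
    by (rule Wsp0_test_sequence[OF u p]) blast
  obtain \<psi> where \<psi>: "\<And>k. \<psi> k \<in> test_functions \<Omega>" "\<And>k. \<psi> k \<in> Wsp s p"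
    "(\<lambda>k. Gag s p (\<lambda>x. \<psi> k x - v x)) \<longlonglongrightarrow> 0" "(\<lambda>k. Ip lebesgue p (\<lambda>x. \<psi> k x - v x)) \<longlonglongrightarrow> 0"
    by (rule Wsp0_test_sequence[OF v p]) blast
  have i: "integrable lebesgue (\<lambda>x. \<bar>\<phi> k x - u x\<bar> powr p)" "integrable lebesgue (\<lambda>x. \<bar>\<psi> k x - v x\<bar> powr p)" for k
    using Lp_spaceD(2)[OF Lp_space_diff(1)[OF WspD(1)[OF \<phi>(2)] WspD(1)[OF uW] p0]]
      Lp_spaceD(2)[OF Lp_space_diff(1)[OF WspD(1)[OF \<psi>(2)] WspD(1)[OF vW] p0]] by auto
  obtain q1 where q1: "strict_mono (q1 :: nat \<Rightarrow> nat)" "AE x in lebesgue. (\<lambda>k. \<phi> (q1 k) x) \<longlonglongrightarrow> u x"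
    using Lp_tendsto_AE_subseq[OF WspD(3)[OF \<phi>(2)] i(1) _ \<phi>(4)] p by auto
  have "(\<lambda>k. Ip lebesgue p (\<lambda>x. \<psi> (q1 k) x - v x)) \<longlonglongrightarrow> 0"
    using LIMSEQ_subseq_LIMSEQ[OF \<psi>(4) q1(1)] by (simp add: o_def)
  then obtain q2 where q2: "strict_mono (q2 :: nat \<Rightarrow> nat)" "AE x in lebesgue. (\<lambda>k. \<psi> (q1 (q2 k)) x) \<longlonglongrightarrow> v x"
    using Lp_tendsto_AE_subseq[where f = "\<lambda>k. \<psi> (q1 k)" and g = v and M = lebesgue and p = p, OF WspD(3)[OF \<psi>(2)] i(2)] p by auto
  define q where "q = q1 \<circ> q2"
  have q: "strict_mono q" using q1 q2 by (simp add: q_def strict_mono_o)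
  have q\<phi>: "AE x in lebesgue. (\<lambda>k. \<phi> (q k) x) \<longlonglongrightarrow> u x"
    using q1(2) by eventually_elim (auto simp: q_def o_def dest: LIMSEQ_subseq_LIMSEQ[OF _ q2(1)])
  have q\<psi>: "AE x in lebesgue. (\<lambda>k. \<psi> (q k) x) \<longlonglongrightarrow> v x"
    using q2(2) by (simp add: q_def)
  define e where "e = (\<lambda>k. 1 / real (Suc k))"
  have e: "0 < e k" "e \<longlonglongrightarrow> 0" for k unfolding e_def by (simp, rule LIMSEQ_Suc[OF lim_1_over_n])
  define f where "f = (\<lambda>k x. pmean_reg p (e k) (\<phi> (q k) x) (\<psi> (q k) x))"
  have ft: "f k \<in> test_functions \<Omega>" for k
    unfolding f_def by (rule pmean_reg_test_function[OF p e(1) \<phi>(1) \<psi>(1)])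
  have fm: "f k \<in> borel_measurable lebesgue" for k
    using test_functions_measurable[OF ft] by (auto intro: measurable_completion)
  have fle: "\<bar>f k x\<bar> powr p \<le> (\<bar>\<phi> (q k) x\<bar> powr p + \<bar>\<psi> (q k) x\<bar> powr p) / 2" for k x
    unfolding f_def by (rule pmean_reg_powr_le[OF p less_imp_le[OF e(1)]])
  have Dfle: "\<bar>Dq (f k) z\<bar> powr p \<le> (\<bar>Dq (\<phi> (q k)) z\<bar> powr p + \<bar>Dq (\<psi> (q k)) z\<bar> powr p) / 2" for k z
    unfolding f_def Dq_def by (rule pmean_reg_diff_powr[OF p])
  have fW: "f k \<in> Wsp s p" for k
    unfolding Wsp_iff
    using Lp_space_powr_leI[OF fm WspD(1)[OF \<phi>(2)] WspD(1)[OF \<psi>(2)] fle]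
      Lp_space_powr_leI[OF Dq_measurable_gag[OF fm] WspD(2)[OF \<phi>(2)] WspD(2)[OF \<psi>(2)] Dfle] by blast
  define g where "g = (\<lambda>x. pmean p (u x) (v x))"
  have gW: "g \<in> Wsp s p" unfolding g_def by (rule pmean_Wsp[OF p uW vW])
  have lim: "AE x in lebesgue. (\<lambda>k. f k x) \<longlonglongrightarrow> g x"
    using q\<phi> q\<psi> by eventually_elim (auto simp: f_def g_def intro!: pmean_reg_tendsto p e)
  have limD: "AE z in gag_measure s p. (\<lambda>k. Dq (f k) z) \<longlonglongrightarrow> Dq g z"
    by (rule AE_gagI)
       (use AE_pair_lebesgueI(1)[OF lim] AE_pair_lebesgueI(2)[OF lim] in eventually_elim, auto simp: Dq_def intro: tendsto_diff)
  have c1: "(\<lambda>k. Ip lebesgue p (\<lambda>x. f k x - g x)) \<longlonglongrightarrow> 0"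
  proof (rule Ip_tendsto_0_pmean_dominated[OF p fm WspD(3)[OF gW] WspD(1)[OF \<phi>(2)] WspD(1)[OF \<psi>(2)] WspD(1)[OF uW] WspD(1)[OF vW] fle _ lim])
    show "\<bar>g x\<bar> powr p \<le> (\<bar>u x\<bar> powr p + \<bar>v x\<bar> powr p) / 2" for x using p by (simp add: g_def pmean_powr)
    show "(\<lambda>k. Ip lebesgue p (\<lambda>x. \<phi> (q k) x - u x)) \<longlonglongrightarrow> 0" "(\<lambda>k. Ip lebesgue p (\<lambda>x. \<psi> (q k) x - v x)) \<longlonglongrightarrow> 0"
      using LIMSEQ_subseq_LIMSEQ[OF \<phi>(4) q] LIMSEQ_subseq_LIMSEQ[OF \<psi>(4) q] by (simp_all add: o_def)
  qed
  have c2: "(\<lambda>k. Ip (gag_measure s p) p (\<lambda>z. Dq (f k) z - Dq g z)) \<longlonglongrightarrow> 0"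
  proof (rule Ip_tendsto_0_pmean_dominated[OF p Dq_measurable_gag[OF fm] Dq_measurable_gag[OF WspD(3)[OF gW]] WspD(2)[OF \<phi>(2)] WspD(2)[OF \<psi>(2)] WspD(2)[OF uW] WspD(2)[OF vW] Dfle _ limD])
    show "\<bar>Dq g z\<bar> powr p \<le> (\<bar>Dq u z\<bar> powr p + \<bar>Dq v z\<bar> powr p) / 2" for z
      unfolding g_def by (rule Dq_pmean_powr_le[OF p])
    show "(\<lambda>k. Ip (gag_measure s p) p (\<lambda>z. Dq (\<phi> (q k)) z - Dq u z)) \<longlonglongrightarrow> 0" "(\<lambda>k. Ip (gag_measure s p) p (\<lambda>z. Dq (\<psi> (q k)) z - Dq v z)) \<longlonglongrightarrow> 0"
      using LIMSEQ_subseq_LIMSEQ[OF \<phi>(3) q] LIMSEQ_subseq_LIMSEQ[OF \<psi>(3) q] by (simp_all add: o_def Gag_def Dq_diff)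
  qed
  have "(\<lambda>k. Gag s p (\<lambda>x. f k x - g x) + Ip lebesgue p (\<lambda>x. f k x - g x)) \<longlonglongrightarrow> 0 + 0"
    using c1 c2 by (intro tendsto_add) (auto simp: Gag_def Dq_diff)
  then have tot: "(\<lambda>k. Gag s p (\<lambda>x. f k x - g x) + Ip lebesgue p (\<lambda>x. f k x - g x)) \<longlonglongrightarrow> 0" by simp
  have "g \<in> Wsp0 \<Omega> s p"
  proof (rule Wsp0I_test_sequence[OF p gW])
    fix d :: real assume "0 < d"
    then have "\<forall>\<^sub>F k in sequentially. Gag s p (\<lambda>x. f k x - g x) + Ip lebesgue p (\<lambda>x. f k x - g x) < d"
      using tot by (intro order_tendstoD) auto
    then obtain k where "Gag s p (\<lambda>x. f k x - g x) + Ip lebesgue p (\<lambda>x. f k x - g x) < d"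
      by (auto simp: eventually_sequentially)
    then show "\<exists>\<phi>\<in>test_functions \<Omega>. \<phi> \<in> Wsp s p \<and> Gag s p (\<lambda>x. g x - \<phi> x) + Ip lebesgue p (\<lambda>x. g x - \<phi> x) < d"
      using ft[of k] fW[of k] Gag_minus_commute[of s p g "f k"] Ip_minus_commute[of lebesgue p g "f k"]
      by (intro bexI[of _ "f k"]) auto
  qed
  then show ?thesis by (simp add: g_def)
qed

subsection \<open>The Poincare inequality and the first eigenvalue\<close>

text \<open>In the Gagliardo integral only those \<open>y\<close> are kept that lie in a ball
  \<open>B\<close> disjoint from \<open>\<Omega>\<close>. There \<open>u y = 0\<close> almost
  everywhere and the kernel is bounded below, so the inner integral is at least a constant times
  \<open>\<bar>u x\<bar> powr p\<close>.\<close>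

lemma Poincare_Wsp0:
  fixes \<Omega> :: "'a::euclidean_space set"
  assumes \<Omega>: "open \<Omega>" "bounded \<Omega>" and p: "1 < p" and s: "0 < s"
  obtains c where "0 < c" "\<And>u. u \<in> Wsp0 \<Omega> s p \<Longrightarrow> c * Ip lebesgue p u \<le> Gag s p u"
proof -
  obtain R where R: "0 < R" "\<And>x. x \<in> \<Omega> \<Longrightarrow> norm x < R"
    using \<Omega>(2) by (metis bounded_pos_less)
  obtain e :: 'a where e: "e \<in> Basis" using nonempty_Basis by blast
  \<comment> \<open>With its centre at distance \<open>3 * R\<close> and radius \<open>R\<close>,
    the ball lies between the radii \<open>2 * R\<close> and \<open>4 * R\<close>. It avoids
    \<open>\<Omega>\<close>, and its points are within \<open>5 * R\<close> of each point of
    \<open>\<Omega>\<close>.\<close>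
  define B where "B = ball ((3 * R) *\<^sub>R e) R"
  have B: "0 < measure lebesgue B" "emeasure lebesgue B = ennreal (measure lebesgue B)" "B \<in> sets lebesgue"
  proof -
    show "0 < measure lebesgue B" unfolding B_def using R by (simp add: content_ball_pos)
    have "emeasure lebesgue B < \<infinity>" unfolding B_def using emeasure_lborel_ball_finite by simp
    then show "emeasure lebesgue B = ennreal (measure lebesgue B)"
      by (intro emeasure_eq_ennreal_measure) auto
  qed (simp add: B_def)
  have B\<Omega>: "y \<notin> \<Omega>" "norm y < 4 * R" if "y \<in> B" for y
  proof -
    have d: "norm ((3 * R) *\<^sub>R e - y) < R" using that by (simp add: B_def dist_norm)
    have n: "norm ((3 * R) *\<^sub>R e) = 3 * R" using e R by simp
    have "3 * R \<le> norm y + norm ((3 * R) *\<^sub>R e - y)"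
      using norm_triangle_ineq[of y "(3 * R) *\<^sub>R e - y"] n by simp
    with d R(2)[of y] R(1) show "y \<notin> \<Omega>" by force
    show "norm y < 4 * R"
      using norm_triangle_ineq4[of "(3 * R) *\<^sub>R e" "(3 * R) *\<^sub>R e - y"] n d by simp
  qed
  define \<alpha> where "\<alpha> = real DIM('a) + s * p"
  have \<alpha>: "0 < \<alpha>" using p s by (auto simp: \<alpha>_def intro!: add_pos_pos)
  define k where "k = 1 / (5 * R) powr \<alpha>"
  have k: "0 < k" using R by (simp add: k_def)
  show ?thesis
  proof (rule that[of "k * measure lebesgue B"])
    show "0 < k * measure lebesgue B" using k B by simp
    fix u assume u: "u \<in> Wsp0 \<Omega> s p"
    note uW = Wsp0_imp_Wsp[OF u]
    note [measurable] = WspD(3)[OF uW] B(3)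
    have u0: "AE x in lebesgue. x \<notin> \<Omega> \<longrightarrow> u x = 0"
      by (rule Wsp0_vanishes_outside[OF u p \<Omega>(1)])
    have inner: "ennreal (k * \<bar>u x\<bar> powr p * measure lebesgue B) \<le> (\<integral>\<^sup>+ y. ennreal (\<bar>u x - u y\<bar> powr p / norm (x - y) powr \<alpha>) \<partial>lebesgue)"
      if x: "x \<in> \<Omega>" for x
    proof -
      have "ennreal (k * \<bar>u x\<bar> powr p * measure lebesgue B) = (\<integral>\<^sup>+ y. ennreal (k * \<bar>u x\<bar> powr p) * indicator B y \<partial>lebesgue)"
        using k B by (simp add: nn_integral_cmult_indicator ennreal_mult)
      also have "\<dots> \<le> (\<integral>\<^sup>+ y. ennreal (\<bar>u x - u y\<bar> powr p / norm (x - y) powr \<alpha>) \<partial>lebesgue)"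
      proof (rule nn_integral_mono_AE)
        show "AE y in lebesgue. ennreal (k * \<bar>u x\<bar> powr p) * indicator B y \<le> ennreal (\<bar>u x - u y\<bar> powr p / norm (x - y) powr \<alpha>)"
          using u0
        proof eventually_elim
          case (elim y)
          show ?case
          proof (cases "y \<in> B")
            case True
            then have uy: "u y = 0" using elim B\<Omega> by auto
            have xy: "x \<noteq> y" using x B\<Omega>[OF True] by auto
            have "norm (x - y) \<le> 5 * R"
              using norm_triangle_ineq4[of x y] R(2)[OF x] B\<Omega>(2)[OF True] by linarith
            then have "norm (x - y) powr \<alpha> \<le> (5 * R) powr \<alpha>" using \<alpha> by (intro powr_mono2) auto
            then have "k \<le> 1 / norm (x - y) powr \<alpha>" unfolding k_def using xy R by (intro divide_left_mono mult_pos_pos) auto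
            then have "k * \<bar>u x\<bar> powr p \<le> 1 / norm (x - y) powr \<alpha> * \<bar>u x\<bar> powr p" by (intro mult_right_mono) auto
            then show ?thesis using True uy by (auto intro!: ennreal_leI)
          qed simp
        qed
      qed
      finally show ?thesis .
    qed
    have "ennreal (k * measure lebesgue B * Ip lebesgue p u) = ennreal (k * measure lebesgue B) * Lp_energy lebesgue p u"
      using k by (simp add: Lp_energy_eq[OF WspD(1)[OF uW]] ennreal_mult)
    also have "\<dots> = (\<integral>\<^sup>+ x. ennreal (k * \<bar>u x\<bar> powr p * measure lebesgue B) \<partial>lebesgue)"
      unfolding Lp_energy_def using k
      by (subst nn_integral_cmult[symmetric]) (auto simp: ennreal_mult[symmetric] mult_ac intro!: nn_integral_cong)
    also have "\<dots> \<le> gagliardo s p u"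
      unfolding gagliardo_def \<alpha>_def[symmetric]
    proof (rule nn_integral_mono_AE)
      show "AE x in lebesgue. ennreal (k * \<bar>u x\<bar> powr p * measure lebesgue B) \<le> (\<integral>\<^sup>+ y. ennreal (\<bar>u x - u y\<bar> powr p / norm (x - y) powr \<alpha>) \<partial>lebesgue)"
        using u0 by eventually_elim (use inner in force)
    qed
    also have "\<dots> = ennreal (Gag s p u)" by (rule gagliardo_Wsp[OF uW])
    finally show "k * measure lebesgue B * Ip lebesgue p u \<le> Gag s p u" by simp
  qed
qed

lemma rayleigh_Wsp0:
  assumes "open \<Omega>" "1 < p" "u \<in> Wsp0 \<Omega> s p"
  shows "rayleigh \<Omega> s p u = ennreal (Gag s p u) / ennreal (Ip lebesgue p u)"
proof -
  have "Lp_energy (lebesgue_on \<Omega>) p u = Lp_energy lebesgue p u"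
    using assms by (intro Lp_energy_lebesgue_on Wsp0_vanishes_outside) auto
  then show ?thesis
    using assms by (simp add: rayleigh_def gagliardo_Wsp Wsp0_imp_Wsp Lp_energy_eq[OF WspD(1)[OF Wsp0_imp_Wsp[OF assms(3)]]])
qed

lemma Ip_pos_iff_not_ae_zero:
  assumes "u \<in> Lp_space lebesgue p"
  shows "0 < Ip lebesgue p u \<longleftrightarrow> \<not> ae_zero u"
  using Ip_eq_0_iff[OF assms] Ip_nonneg[of lebesgue p u] by (auto simp: ae_zero_def less_le)

text \<open>Poincare's inequality bounds the infimum below by a positive constant, and the quotient
  of \<open>u0\<close> keeps it finite.\<close>

lemma lambda_sp_properties:
  fixes \<Omega> :: "'a::euclidean_space set"
  assumes \<Omega>: "open \<Omega>" "bounded \<Omega>" and p: "1 < p" and s: "0 < s"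
    and nontrivial: "u0 \<in> Wsp0 \<Omega> s p" "\<not> ae_zero u0"
  obtains l where "0 < l" "lambda_sp \<Omega> s p = ennreal l"
    "\<And>u. u \<in> Wsp0 \<Omega> s p \<Longrightarrow> l * Ip lebesgue p u \<le> Gag s p u"
proof -
  have le: "lambda_sp \<Omega> s p \<le> ennreal (Gag s p u / Ip lebesgue p u)" if "u \<in> Wsp0 \<Omega> s p" "\<not> ae_zero u" for u
  proof -
    have "0 < Ip lebesgue p u" using that Ip_pos_iff_not_ae_zero[OF WspD(1)[OF Wsp0_imp_Wsp]] by blast
    then have "rayleigh \<Omega> s p u = ennreal (Gag s p u / Ip lebesgue p u)"
      using rayleigh_Wsp0[OF \<Omega>(1) p that(1)] by (simp add: divide_ennreal)
    then show ?thesis unfolding lambda_sp_def using that by (intro INF_lower2[of u]) auto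
  qed
  obtain c where c: "0 < c" "\<And>u. u \<in> Wsp0 \<Omega> s p \<Longrightarrow> c * Ip lebesgue p u \<le> Gag s p u"
    by (rule Poincare_Wsp0[OF \<Omega> p s]) blast
  have "ennreal c \<le> lambda_sp \<Omega> s p"
    unfolding lambda_sp_def
  proof (rule INF_greatest)
    fix u assume "u \<in> {u \<in> Wsp0 \<Omega> s p. \<not> ae_zero u}"
    then have u: "u \<in> Wsp0 \<Omega> s p" "\<not> ae_zero u" by auto
    have pos: "0 < Ip lebesgue p u" using u Ip_pos_iff_not_ae_zero[OF WspD(1)[OF Wsp0_imp_Wsp]] by blast
    then show "ennreal c \<le> rayleigh \<Omega> s p u"
      unfolding rayleigh_Wsp0[OF \<Omega>(1) p u(1)] using c(2)[OF u(1)]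
      by (simp add: divide_ennreal pos_le_divide_eq ennreal_leI)
  qed
  moreover obtain l where l: "lambda_sp \<Omega> s p = ennreal l" "0 \<le> l"
    using le[OF nontrivial] by (cases "lambda_sp \<Omega> s p") (auto simp: top_unique)
  ultimately have "c \<le> l" using c by simp
  show ?thesis
  proof (rule that[of l])
    show "0 < l" using c \<open>c \<le> l\<close> by simp
    show "lambda_sp \<Omega> s p = ennreal l" by fact
    fix u assume u: "u \<in> Wsp0 \<Omega> s p"
    show "l * Ip lebesgue p u \<le> Gag s p u"
    proof (cases "ae_zero u")
      case True
      then have "Ip lebesgue p u = 0" using Ip_pos_iff_not_ae_zero[OF WspD(1)[OF Wsp0_imp_Wsp[OF u]]] Ip_nonneg[of lebesgue p u] by linarith
      then show ?thesis by simp
    next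
      case False
      then have "0 < Ip lebesgue p u" using u Ip_pos_iff_not_ae_zero[OF WspD(1)[OF Wsp0_imp_Wsp]] by blast
      then show ?thesis using le[OF u False] l by (simp add: pos_le_divide_eq)
    qed
  qed
qed

text \<open>
  For two minimisers \<open>u\<close>, \<open>v\<close> with the same \<open>L\<^sup>p\<close> norm the function \<open>pmean p u v\<close> is a minimiser as
  well.  Equality in the reverse triangle inequality for \<open>(u x, v x)\<close> and \<open>(u y, v y)\<close> makes these
  vectors parallel for almost all pairs \<open>(x, y)\<close>.
\<close>

lemma minimisers_unique_up_to_sign:
  fixes \<Omega> :: "'a::euclidean_space set"
  assumes p: "1 < p"
    and l: "\<And>u. u \<in> Wsp0 \<Omega> s p \<Longrightarrow> l * Ip lebesgue p u \<le> Gag s p u"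
    and u: "u \<in> Wsp0 \<Omega> s p" and v: "v \<in> Wsp0 \<Omega> s p"
    and m: "0 < m" "Ip lebesgue p u = m" "Ip lebesgue p v = m" "Gag s p u = l * m" "Gag s p v = l * m"
  shows "(AE x in lebesgue. u x = v x) \<or> (AE x in lebesgue. u x = - v x)"
proof -
  note uW = Wsp0_imp_Wsp[OF u] and vW = Wsp0_imp_Wsp[OF v]
  define \<sigma> where "\<sigma> = (\<lambda>x. pmean p (u x) (v x))"
  have \<sigma>: "\<sigma> \<in> Wsp0 \<Omega> s p" unfolding \<sigma>_def by (rule pmean_Wsp0[OF p u v])
  note \<sigma>W = Wsp0_imp_Wsp[OF \<sigma>]
  \<comment> \<open>The \<open>p\<close>-th power of \<open>\<sigma> x\<close> is the average of
    those of \<open>u x\<close> and \<open>v x\<close>, so \<open>\<sigma>\<close> has the same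
    \<open>L\<^sup>p\<close> energy while its seminorm cannot exceed the average of the two seminorm
    powers.\<close>
  have "Ip lebesgue p \<sigma> = (Ip lebesgue p u + Ip lebesgue p v) / 2"
    unfolding Ip_def \<sigma>_def using p Lp_spaceD(2)[OF WspD(1)[OF uW]] Lp_spaceD(2)[OF WspD(1)[OF vW]]
    by (simp add: pmean_powr)
  then have "Ip lebesgue p \<sigma> = m" using m by simp
  with l[OF \<sigma>] have ge: "l * m \<le> Gag s p \<sigma>" by simp
  define M where "M = (gag_measure s p :: ('a \<times> 'a) measure)"
  note iu = Lp_spaceD(2)[OF WspD(2)[OF uW], folded M_def] and iv = Lp_spaceD(2)[OF WspD(2)[OF vW], folded M_def]
    and i\<sigma> = Lp_spaceD(2)[OF WspD(2)[OF \<sigma>W], folded M_def]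
  have le: "\<bar>Dq \<sigma> z\<bar> powr p \<le> (\<bar>Dq u z\<bar> powr p + \<bar>Dq v z\<bar> powr p) / 2" for z
    unfolding \<sigma>_def by (rule Dq_pmean_powr_le[OF p])
  have i2: "integrable M (\<lambda>z. (\<bar>Dq u z\<bar> powr p + \<bar>Dq v z\<bar> powr p) / 2)" using iu iv by simp
  have "(LINT z|M. (\<bar>Dq u z\<bar> powr p + \<bar>Dq v z\<bar> powr p) / 2) = l * m"
    using iu iv m by (simp add: Gag_def Ip_def M_def)
  moreover have "(LINT z|M. \<bar>Dq \<sigma> z\<bar> powr p) \<le> (LINT z|M. (\<bar>Dq u z\<bar> powr p + \<bar>Dq v z\<bar> powr p) / 2)"
    by (rule integral_mono[OF i\<sigma> i2 le])
  ultimately have "(LINT z|M. \<bar>Dq \<sigma> z\<bar> powr p) = (LINT z|M. (\<bar>Dq u z\<bar> powr p + \<bar>Dq v z\<bar> powr p) / 2)"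
    using ge by (simp add: Gag_def Ip_def M_def)
  then have "AE z in M. \<bar>Dq \<sigma> z\<bar> powr p = (\<bar>Dq u z\<bar> powr p + \<bar>Dq v z\<bar> powr p) / 2"
  proof -
    assume *: "(LINT z|M. \<bar>Dq \<sigma> z\<bar> powr p) = (LINT z|M. (\<bar>Dq u z\<bar> powr p + \<bar>Dq v z\<bar> powr p) / 2)"
    have "(LINT z|M. (\<bar>Dq u z\<bar> powr p + \<bar>Dq v z\<bar> powr p) / 2 - \<bar>Dq \<sigma> z\<bar> powr p) = 0"
      using * by (simp add: Bochner_Integration.integral_diff[OF i2 i\<sigma>])
    then have "AE z in M. (\<bar>Dq u z\<bar> powr p + \<bar>Dq v z\<bar> powr p) / 2 - \<bar>Dq \<sigma> z\<bar> powr p = 0"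
      by (subst (asm) integral_nonneg_eq_0_iff_AE) (use le i2 i\<sigma> in auto)
    then show ?thesis by eventually_elim simp
  qed
  then have "AE z in lebesgue \<Otimes>\<^sub>M lebesgue. fst z \<noteq> snd z \<longrightarrow> \<bar>Dq \<sigma> z\<bar> powr p = (\<bar>Dq u z\<bar> powr p + \<bar>Dq v z\<bar> powr p) / 2"
    unfolding M_def by (rule AE_gagD)
  then have "AE z in lebesgue \<Otimes>\<^sub>M lebesgue. u (fst z) * v (snd z) = v (fst z) * u (snd z)"
  proof eventually_elim
    case (elim z)
    show ?case
    \<comment> \<open>On the diagonal, where \<open>gag_measure\<close> carries no information, the
      claim is just commutativity.\<close>
    proof (cases "fst z = snd z")
      case False
      then show ?thesis using elim by (intro pmean_diff_powr(2)[OF p]) (simp add: Dq_def \<sigma>_def)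
    qed (simp add: mult.commute)
  qed
  from leb_pair.AE_pair[OF this] have par: "AE x in lebesgue. AE y in lebesgue. u x * v y = v x * u y" by simp
  have nz: "\<not> (AE x in lebesgue. v x = 0)"
    using Ip_eq_0_iff[OF WspD(1)[OF vW]] m by auto
  \<comment> \<open>Freezing a single point with \<open>v x \<noteq> 0\<close> exhibits
    \<open>u\<close> as a constant multiple of \<open>v\<close>; equality of the norms then fixes
    the modulus of the constant.\<close>
  obtain x where x: "v x \<noteq> 0" "AE y in lebesgue. u x * v y = v x * u y"
  proof -
    have "\<not> (\<forall>x. (AE y in lebesgue. u x * v y = v x * u y) \<longrightarrow> v x = 0)"
    proof
      assume *: "\<forall>x. (AE y in lebesgue. u x * v y = v x * u y) \<longrightarrow> v x = 0"
      have "AE x in lebesgue. v x = 0" using par by eventually_elim (use * in blast)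
      with nz show False by blast
    qed
    then show ?thesis using that by blast
  qed
  define c where "c = u x / v x"
  have uc: "AE y in lebesgue. u y = c * v y"
    using x(2) by eventually_elim (use x(1) in \<open>simp add: c_def field_simps\<close>)
  note [measurable] = WspD(3)[OF uW] WspD(3)[OF vW]
  have "Ip lebesgue p u = Ip lebesgue p (\<lambda>y. c * v y)"
    by (rule Ip_cong_AE[OF uc]) measurable
  then have "\<bar>c\<bar> powr p = 1" using m by (simp add: Ip_cmult)
  then have "(\<bar>c\<bar> powr p) powr (1 / p) = 1" by simp
  then have "\<bar>c\<bar> = 1" using p by (simp add: powr_powr)
  then have "c = 1 \<or> c = -1" by linarith
  then show ?thesis
  proof
    assume "c = 1"
    then show ?thesis using uc by simp
  next
    assume "c = - 1"
    then have "AE x in lebesgue. u x = - v x" using uc by (auto elim: eventually_mono)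
    then show ?thesis ..
  qed
qed

subsection \<open>Completeness and compactness\<close>

text \<open>Hoelder's inequality against the indicator of \<open>A\<close>, which is fixed by
  \<open>J_op p\<close> and has energy \<open>measure M A\<close>.\<close>

lemma Ip_indicator_integral_le:
  assumes p: "1 < p" and A: "A \<in> sets M" "emeasure M A < \<infinity>"
    and g: "(\<lambda>x. indicator A x * g x) \<in> Lp_space M p"
  shows "\<bar>LINT x|M. indicator A x * g x\<bar> powr p \<le> measure M A powr (p - 1) * Ip M p (\<lambda>x. indicator A x * g x)"
    and "integrable M (\<lambda>x. indicator A x * g x)"
proof -
  have i: "(indicator A :: _ \<Rightarrow> real) \<in> Lp_space M p" "Ip M p (indicator A) = measure M A"
  proof -
    have *: "(\<lambda>x. \<bar>indicator A x :: real\<bar> powr p) = indicator A"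
      by (auto simp: indicator_def fun_eq_iff)
    show "(indicator A :: _ \<Rightarrow> real) \<in> Lp_space M p" "Ip M p (indicator A) = measure M A"
      unfolding Lp_space_iff Ip_def * using A sets.sets_into_space[OF A(1)] by (auto simp: Int_absorb2)
  qed
  have J: "J_op p (indicator A x) * (indicator A x * g x) = indicator A x * g x" for x
    by (simp add: J_op_def indicator_def)
  show "integrable M (\<lambda>x. indicator A x * g x)" using Holder_J_op(1)[OF p i(1) g] unfolding J .
  have "\<bar>LINT x|M. indicator A x * g x\<bar> \<le> measure M A powr (1 - 1 / p) * Ip M p (\<lambda>x. indicator A x * g x) powr (1 / p)"
    using Holder_J_op_abs[OF p i(1) g] unfolding J i(2) .
  then have "\<bar>LINT x|M. indicator A x * g x\<bar> powr p \<le> (measure M A powr (1 - 1 / p) * Ip M p (\<lambda>x. indicator A x * g x) powr (1 / p)) powr p"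
    using p by (intro powr_mono2) auto
  also have "\<dots> = measure M A powr (p - 1) * Ip M p (\<lambda>x. indicator A x * g x)"
    using p by (simp add: powr_mult powr_powr left_diff_distrib)
  finally show "\<bar>LINT x|M. indicator A x * g x\<bar> powr p \<le> measure M A powr (p - 1) * Ip M p (\<lambda>x. indicator A x * g x)" .
qed

text \<open>The Riesz-Fischer argument: a rapidly converging subsequence converges almost
  everywhere, and Fatou's lemma identifies the limit as the limit in energy of the whole
  sequence.\<close>

lemma Lp_complete:
  assumes p: "1 < p" and f: "\<And>k. f k \<in> Lp_space M p"
    and cauchy: "\<And>e. 0 < e \<Longrightarrow> \<exists>K. \<forall>k\<ge>K. \<forall>l\<ge>K. Ip M p (\<lambda>x. f k x - f l x) < e"
  obtains g where "g \<in> Lp_space M p" "(\<lambda>k. Ip M p (\<lambda>x. f k x - g x)) \<longlonglongrightarrow> 0"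
proof -
  have p0: "0 \<le> p" using p by simp
  note fm [measurable] = Lp_spaceD(1)[OF f]
  \<comment> \<open>The rate \<open>(1 / 4) ^ j\<close> leaves room for the weight
    \<open>2 ^ j\<close> below: the weighted series still has a finite integral, and its finiteness
    at a point forces geometric decay of the differences there.\<close>
  have "\<forall>j. \<exists>K. \<forall>k\<ge>K. \<forall>l\<ge>K. Ip M p (\<lambda>x. f k x - f l x) < (1 / 4) ^ j"
    using cauchy by simp
  then obtain K where K: "\<And>j k l. K j \<le> k \<Longrightarrow> K j \<le> l \<Longrightarrow> Ip M p (\<lambda>x. f k x - f l x) < (1 / 4) ^ j" by metis
  define r where "r = (\<lambda>j. (\<Sum>i\<le>j. K i) + j)"
  have rK: "K j \<le> r j" for j
    unfolding r_def by (rule trans_le_add1) (rule member_le_sum, auto)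
  have r: "strict_mono r"
    unfolding strict_mono_Suc_iff by (simp add: r_def)
  define d where "d = (\<lambda>j x. f (r (Suc j)) x - f (r j) x)"
  have dL: "d j \<in> Lp_space M p" for j unfolding d_def by (rule Lp_space_diff(1)[OF f f p0])
  note [measurable] = Lp_spaceD(1)[OF dL]
  have dI: "Ip M p (d j) \<le> (1 / 4) ^ j" for j
    unfolding d_def using K[of j "r (Suc j)" "r j"] rK[of j] strict_mono_less[OF r, of j "Suc j"] by simp
  have "(\<integral>\<^sup>+ x. (\<Sum>j. ennreal (2 ^ j * \<bar>d j x\<bar> powr p)) \<partial>M) = (\<Sum>j. \<integral>\<^sup>+ x. ennreal (2 ^ j * \<bar>d j x\<bar> powr p) \<partial>M)"
    by (rule nn_integral_suminf) measurable
  also have "\<dots> \<le> (\<Sum>j. ennreal ((1 / 2) ^ j))"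
  proof (rule suminf_le)
    fix j
    have "(\<integral>\<^sup>+ x. ennreal (2 ^ j * \<bar>d j x\<bar> powr p) \<partial>M) = ennreal (2 ^ j) * Lp_energy M p (d j)"
      unfolding Lp_energy_def by (subst nn_integral_cmult[symmetric]) (auto simp: ennreal_mult)
    also have "\<dots> = ennreal (2 ^ j * Ip M p (d j))"
      by (simp add: Lp_energy_eq[OF dL] ennreal_mult)
    also have "\<dots> \<le> ennreal (2 ^ j * (1 / 4) ^ j)"
      by (intro ennreal_leI mult_left_mono dI) auto
    also have "2 ^ j * (1 / 4) ^ j = (1 / 2 :: real) ^ j"
      by (simp add: power_mult_distrib[symmetric])
    finally show "(\<integral>\<^sup>+ x. ennreal (2 ^ j * \<bar>d j x\<bar> powr p) \<partial>M) \<le> ennreal ((1 / 2) ^ j)" .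
  qed auto
  also have "\<dots> = ennreal (\<Sum>j. (1 / 2) ^ j)"
    by (rule suminf_ennreal2) (auto intro: summable_geometric)
  finally have "(\<integral>\<^sup>+ x. (\<Sum>j. ennreal (2 ^ j * \<bar>d j x\<bar> powr p)) \<partial>M) \<noteq> \<infinity>"
    by (auto simp: top_unique)
  then have fin: "AE x in M. (\<Sum>j. ennreal (2 ^ j * \<bar>d j x\<bar> powr p)) \<noteq> \<infinity>"
    by (intro nn_integral_PInf_AE) measurable
  have conv: "AE x in M. convergent (\<lambda>j. f (r j) x)"
    using fin
  proof eventually_elim
    case (elim x)
    then obtain C where C: "(\<Sum>j. ennreal (2 ^ j * \<bar>d j x\<bar> powr p)) = ennreal C" "0 \<le> C"
      by (metis ennreal_cases infinity_ennreal_def)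
    have le: "2 ^ j * \<bar>d j x\<bar> powr p \<le> C" for j
    proof -
      have "ennreal (2 ^ j * \<bar>d j x\<bar> powr p) \<le> (\<Sum>j. ennreal (2 ^ j * \<bar>d j x\<bar> powr p))"
        by (rule order_trans[OF _ sum_le_suminf[of "\<lambda>j. ennreal (2 ^ j * \<bar>d j x\<bar> powr p)" "{j}"]]) auto
      then show ?thesis unfolding C(1) using C(2) by (subst (asm) ennreal_le_iff)
    qed
    have dle: "norm (d j x) \<le> C powr (1 / p) * ((1 / 2) powr (1 / p)) ^ j" for j
    proof -
      have "\<bar>d j x\<bar> powr p \<le> C * (1 / 2) ^ j"
      proof -
        have "(1 / 2) ^ j * (2 ^ j * \<bar>d j x\<bar> powr p) \<le> (1 / 2) ^ j * C"
          by (intro mult_left_mono le) auto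
        moreover have "(1 / 2 :: real) ^ j * 2 ^ j = 1" by (simp add: power_mult_distrib[symmetric])
        ultimately show ?thesis by (simp only: mult.assoc[symmetric]) (simp add: mult.commute)
      qed
      then have "(\<bar>d j x\<bar> powr p) powr (1 / p) \<le> (C * (1 / 2) ^ j) powr (1 / p)"
        using p by (intro powr_mono2) auto
      also have "\<dots> = C powr (1 / p) * ((1 / 2) powr (1 / p)) ^ j"
      proof -
        have "((1 / 2 :: real) ^ j) powr (1 / p) = ((1 / 2) powr (1 / p)) ^ j"
          by (simp add: powr_realpow[symmetric] powr_powr mult.commute)
        then show ?thesis using C by (simp only: powr_mult)
      qed
      finally show ?thesis using p by (simp add: powr_powr)
    qed
    have "(1 / 2 :: real) powr (1 / p) < 1"
      using p powr_less_mono2[of "1 / p" "1 / 2 :: real" 1] by simp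
    then have "summable (\<lambda>j. C powr (1 / p) * ((1 / 2) powr (1 / p)) ^ j)"
      by (intro summable_mult summable_geometric) auto
    then have "summable (\<lambda>j. d j x)"
      by (rule summable_comparison_test'[where N = 0]) (use dle in auto)
    then have "convergent (\<lambda>n. \<Sum>j<n. d j x)" by (simp add: summable_iff_convergent)
    moreover have "(\<Sum>j<n. d j x) = f (r n) x - f (r 0) x" for n
      unfolding d_def by (rule sum_lessThan_telescope)
    ultimately have "convergent (\<lambda>n. f (r n) x - f (r 0) x)" by simp
    from convergent_add[OF this convergent_const[of "f (r 0) x"]] show ?case by simp
  qed
  define g where "g = (\<lambda>x. lim (\<lambda>j. f (r j) x))"
  have gm [measurable]: "g \<in> borel_measurable M" unfolding g_def by measurable
  have lim: "AE x in M. (\<lambda>j. f (r j) x) \<longlonglongrightarrow> g x"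
    using conv by eventually_elim (simp add: g_def convergent_LIMSEQ_iff)
  \<comment> \<open>Fatou's lemma in the second index of the Cauchy condition.\<close>
  have key: "(\<lambda>x. f k x - g x) \<in> Lp_space M p \<and> Ip M p (\<lambda>x. f k x - g x) \<le> e"
    if "0 < e" "\<forall>k\<ge>N. \<forall>l\<ge>N. Ip M p (\<lambda>x. f k x - f l x) < e" "N \<le> k" for e N k
  proof -
    have l: "AE x in M. (\<lambda>j. f k x - f (r j) x) \<longlonglongrightarrow> f k x - g x"
      using lim by eventually_elim (intro tendsto_intros)
    have ev: "\<forall>\<^sub>F j in sequentially. Ip M p (\<lambda>x. f k x - f (r j) x) \<le> e"
      unfolding eventually_sequentially
      using that seq_suble[OF r] by (intro exI[of _ N]) (meson less_imp_le order_trans)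
    have fL: "(\<lambda>x. f k x - f (r j) x) \<in> Lp_space M p" for j by (rule Lp_space_diff(1)[OF f f p0])
    have m: "(\<lambda>x. f k x - g x) \<in> borel_measurable M" by measurable
    show ?thesis
      using Ip_Fatou[OF Lp_spaceD(1)[OF fL] m l fL ev] p by auto
  qed
  obtain N where N: "\<forall>k\<ge>N. \<forall>l\<ge>N. Ip M p (\<lambda>x. f k x - f l x) < 1" using cauchy[of 1] by auto
  have "(\<lambda>x. f N x - (f N x - g x)) \<in> Lp_space M p"
    by (rule Lp_space_diff(1)[OF f _ p0]) (use key[OF _ N order_refl] in auto)
  then have gL: "g \<in> Lp_space M p" by simp
  have "(\<lambda>k. Ip M p (\<lambda>x. f k x - g x)) \<longlonglongrightarrow> 0"
  proof (rule LIMSEQ_I)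
    fix e :: real assume e: "0 < e"
    then obtain N where N: "\<forall>k\<ge>N. \<forall>l\<ge>N. Ip M p (\<lambda>x. f k x - f l x) < e / 2" using cauchy[of "e / 2"] by auto
    have "norm (Ip M p (\<lambda>x. f k x - g x) - 0) < e" if "N \<le> k" for k
      using key[OF _ N that] e by simp
    then show "\<exists>N. \<forall>k\<ge>N. norm (Ip M p (\<lambda>x. f k x - g x) - 0) < e" by blast
  qed
  with gL that show ?thesis by blast
qed

text \<open>An integer label for the half-open grid cube of side \<open>1 / real (Suc N)\<close>
  that contains \<open>x\<close>, not a point of that cube. Two points share a cube exactly when
  their labels agree, and countably many labels occur.\<close>

definition cell :: "nat \<Rightarrow> 'a::euclidean_space \<Rightarrow> 'a" where
  "cell N x = (\<Sum>i\<in>Basis. of_int \<lfloor>real (Suc N) * (x \<bullet> i)\<rfloor> *\<^sub>R i)"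

lemma cell_inner: "i \<in> Basis \<Longrightarrow> cell N x \<bullet> i = of_int \<lfloor>real (Suc N) * (x \<bullet> i)\<rfloor>"
  by (simp add: cell_def inner_sum_left inner_Basis if_distrib cong: if_cong)

lemma cell_measurable [measurable]: "cell N \<in> borel_measurable borel"
  unfolding cell_def[abs_def] by measurable

lemma countable_range_cell: "countable (range (cell N :: 'a::euclidean_space \<Rightarrow> 'a))"
proof (rule countable_subset)
  show "range (cell N :: 'a \<Rightarrow> 'a) \<subseteq> (\<lambda>f. \<Sum>i\<in>Basis. of_int (f i) *\<^sub>R i) ` (Basis \<rightarrow>\<^sub>E (UNIV :: int set))"
  proof
    fix z :: 'a assume "z \<in> range (cell N)"
    then obtain x where x: "z = cell N x" by auto
    show "z \<in> (\<lambda>f. \<Sum>i\<in>Basis. of_int (f i) *\<^sub>R i) ` (Basis \<rightarrow>\<^sub>E (UNIV :: int set))"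
      unfolding x cell_def
      by (rule image_eqI[of _ _ "restrict (\<lambda>i. \<lfloor>real (Suc N) * (x \<bullet> i)\<rfloor>) Basis"]) auto
  qed
  show "countable ((\<lambda>f. \<Sum>i\<in>Basis. of_int (f i) *\<^sub>R i :: 'a) ` (Basis \<rightarrow>\<^sub>E (UNIV :: int set)))"
    by (intro countable_image countable_PiE) auto
qed

text \<open>The Euclidean norm is bounded by the sum of the coordinates' moduli, whence the factor
  \<open>DIM('a)\<close> instead of its square root.\<close>

lemma same_cell_norm_le:
  fixes x y :: "'a::euclidean_space"
  assumes "cell N x = cell N y"
  shows "norm (x - y) \<le> real DIM('a) / real (Suc N)"
proof -
  have "\<bar>(x - y) \<bullet> i\<bar> \<le> 1 / real (Suc N)" if i: "i \<in> Basis" for i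
  proof -
    have "\<lfloor>real (Suc N) * (x \<bullet> i)\<rfloor> = \<lfloor>real (Suc N) * (y \<bullet> i)\<rfloor>"
      using cell_inner[OF i, of N x] cell_inner[OF i, of N y] assms by simp
    then have "\<bar>real (Suc N) * (x \<bullet> i) - real (Suc N) * (y \<bullet> i)\<bar> \<le> 1" by linarith
    then have "real (Suc N) * \<bar>(x - y) \<bullet> i\<bar> \<le> 1"
      by (simp add: inner_diff_left abs_mult[symmetric] right_diff_distrib[symmetric] del: of_nat_Suc)
    then show ?thesis by (simp add: pos_le_divide_eq mult.commute)
  qed
  then have "(\<Sum>i\<in>Basis. \<bar>(x - y) \<bullet> i\<bar>) \<le> real DIM('a) * (1 / real (Suc N))"
    by (rule sum_bounded_above)
  with norm_le_l1[of "x - y"] show ?thesis by simp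
qed

lemma cell_emeasure:
  fixes x :: "'a::euclidean_space"
  shows "emeasure lebesgue {y. cell N y = cell N x} = ennreal ((1 / real (Suc N)) ^ DIM('a))"
    and "{y. cell N y = cell N x} \<in> sets lebesgue"
proof -
  define M where "M = real (Suc N)"
  have M: "0 < M" by (simp add: M_def)
  define a where "a = cell N x /\<^sub>R M"
  define b where "b = a + (\<Sum>i\<in>Basis. (1 / M) *\<^sub>R i)"
  have bi: "b \<bullet> i = a \<bullet> i + 1 / M" if "i \<in> Basis" for i
    using that by (simp add: b_def inner_add_left)
  have ai: "M * (a \<bullet> i) = of_int \<lfloor>M * (x \<bullet> i)\<rfloor>" if "i \<in> Basis" for i
    using cell_inner[OF that, of N x] M by (simp add: a_def M_def)
  have iff: "cell N y = cell N x \<longleftrightarrow> (\<forall>i\<in>Basis. a \<bullet> i \<le> y \<bullet> i \<and> y \<bullet> i < b \<bullet> i)" for y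
  proof -
    have "cell N y = cell N x \<longleftrightarrow> (\<forall>i\<in>Basis. \<lfloor>M * (y \<bullet> i)\<rfloor> = \<lfloor>M * (x \<bullet> i)\<rfloor>)"
      by (subst euclidean_eq_iff) (auto simp: cell_inner M_def)
    also have "\<dots> \<longleftrightarrow> (\<forall>i\<in>Basis. a \<bullet> i \<le> y \<bullet> i \<and> y \<bullet> i < b \<bullet> i)"
    proof (intro ball_cong refl)
      fix i :: 'a assume i: "i \<in> Basis"
      have "\<lfloor>M * (y \<bullet> i)\<rfloor> = \<lfloor>M * (x \<bullet> i)\<rfloor> \<longleftrightarrow> M * (a \<bullet> i) \<le> M * (y \<bullet> i) \<and> M * (y \<bullet> i) < M * (a \<bullet> i) + 1"
        unfolding ai[OF i] by (simp add: floor_eq_iff)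
      also have "M * (a \<bullet> i) + 1 = M * (b \<bullet> i)" using M by (simp add: bi[OF i] distrib_left)
      finally show "\<lfloor>M * (y \<bullet> i)\<rfloor> = \<lfloor>M * (x \<bullet> i)\<rfloor> \<longleftrightarrow> a \<bullet> i \<le> y \<bullet> i \<and> y \<bullet> i < b \<bullet> i"
        using M by simp
    qed
    finally show ?thesis .
  qed
  have sub: "box a b \<subseteq> {y. cell N y = cell N x}" "{y. cell N y = cell N x} \<subseteq> cbox a b"
    by (auto simp: iff mem_box less_imp_le)
  have [measurable]: "{y. cell N y = cell N x} \<in> sets (borel :: 'a measure)" by measurable
  have ab: "\<And>i. i \<in> Basis \<Longrightarrow> a \<bullet> i \<le> b \<bullet> i" using bi M by simp
  have pr: "(\<Prod>i\<in>Basis. (b - a) \<bullet> i) = (1 / M) ^ DIM('a)"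
    by (simp add: inner_diff_left bi)
  have "emeasure lborel {y. cell N y = cell N x} \<le> ennreal ((1 / M) ^ DIM('a))"
    using emeasure_mono[OF sub(2), of lborel] emeasure_lborel_cbox[OF ab] by (simp add: pr)
  moreover have "ennreal ((1 / M) ^ DIM('a)) \<le> emeasure lborel {y. cell N y = cell N x}"
    using emeasure_mono[OF sub(1), of lborel] emeasure_lborel_box[OF ab] by (simp add: pr)
  ultimately show "emeasure lebesgue {y. cell N y = cell N x} = ennreal ((1 / real (Suc N)) ^ DIM('a))"
    by (simp add: M_def)
  show "{y. cell N y = cell N x} \<in> sets lebesgue" by simp
qed

text \<open>The prefactor is the reciprocal of the volume of a cube.\<close>

definition cell_avg :: "nat \<Rightarrow> ('a::euclidean_space \<Rightarrow> real) \<Rightarrow> 'a \<Rightarrow> real" where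
  "cell_avg N u x = real (Suc N) ^ DIM('a) * (LINT y|lebesgue. indicator {y. cell N y = cell N x} y * u y)"

lemma cell_avg_measurable:
  fixes u :: "'a::euclidean_space \<Rightarrow> real"
  assumes [measurable]: "u \<in> borel_measurable lebesgue"
  shows "cell_avg N u \<in> borel_measurable lebesgue"
proof -
  have c [measurable]: "(\<lambda>z. cell N (fst z)) \<in> borel_measurable (lebesgue \<Otimes>\<^sub>M (lebesgue :: 'a measure))"
    "(\<lambda>z. cell N (snd z)) \<in> borel_measurable ((lebesgue :: 'a measure) \<Otimes>\<^sub>M lebesgue)"
    by (auto intro: measurable_compose[OF measurable_fst_lebesgue cell_measurable] measurable_compose[OF measurable_snd_lebesgue cell_measurable])
  have "{z \<in> space ((lebesgue :: 'a measure) \<Otimes>\<^sub>M (lebesgue :: 'a measure)). cell N (snd z) = cell N (fst z)} \<in> sets (lebesgue \<Otimes>\<^sub>M lebesgue)"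
    by measurable
  then have S: "{z. cell N (snd z) = cell N (fst z)} \<in> sets ((lebesgue :: 'a measure) \<Otimes>\<^sub>M lebesgue)"
    by (simp add: space_pair_measure)
  have "(\<lambda>z. indicator {z. cell N (snd z) = cell N (fst z)} z * u (snd z)) \<in> borel_measurable ((lebesgue :: 'a measure) \<Otimes>\<^sub>M lebesgue)"
    using S by measurable
  then have "case_prod (\<lambda>x y. indicator {y. cell N y = cell N x} y * u y) \<in> borel_measurable ((lebesgue :: 'a measure) \<Otimes>\<^sub>M lebesgue)"
    by (simp add: case_prod_beta' indicator_def)
  from leb.borel_measurable_lebesgue_integral[OF this] show ?thesis
    unfolding cell_avg_def by simp
qed

text \<open>Hoelder's inequality on a cube bounds the error at \<open>x\<close> by the mean of
  \<open>\<bar>u x - u y\<bar> powr p\<close>. Inside a cube \<open>norm (x - y)\<close> is at most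
  \<open>n / M\<close>, so inserting the Gagliardo kernel costs
  \<open>(n / M) powr (n + s * p)\<close>. The reciprocal volume \<open>M powr n\<close> takes up
  part of this gain, and \<open>M powr (- (s * p))\<close> remains: an error uniform over bounded
  seminorms.\<close>

lemma cell_avg_error:
  fixes u :: "'a::euclidean_space \<Rightarrow> real"
  assumes p: "1 < p" and s: "0 < s" and u: "u \<in> Wsp s p"
  shows "(\<lambda>x. u x - cell_avg N u x) \<in> Lp_space lebesgue p"
    and "Ip lebesgue p (\<lambda>x. u x - cell_avg N u x) \<le> real DIM('a) powr (real DIM('a) + s * p) * real (Suc N) powr (- (s * p)) * Gag s p u"
proof -
  define n where "n = real DIM('a)"
  define M where "M = real (Suc N)"
  define \<alpha> where "\<alpha> = n + s * p"
  have M: "0 < M" by (simp add: M_def)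
  have n: "0 < n" by (simp add: n_def)
  have \<alpha>: "0 < \<alpha>" using p s n by (auto simp: \<alpha>_def intro!: add_pos_pos)
  have Mn: "M ^ DIM('a) = M powr n" using M by (simp add: n_def powr_realpow)
  note [measurable] = WspD(3)[OF u] cell_avg_measurable[OF WspD(3)[OF u]]
  define K where "K = n powr \<alpha> * M powr (- (s * p))"
  have K_eq: "M powr n * (n / M) powr \<alpha> = K"
  proof -
    have "M powr n * (n / M) powr \<alpha> = n powr \<alpha> * (M powr n * M powr (- \<alpha>))"
    proof -
      have "(n / M) powr \<alpha> = n powr \<alpha> / M powr \<alpha>" using M n by (simp add: powr_divide)
      then show ?thesis by (simp add: powr_minus divide_inverse)
    qed
    also have "M powr n * M powr (- \<alpha>) = M powr (- (s * p))"
      by (simp add: powr_add[symmetric] \<alpha>_def)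
    finally show ?thesis by (simp add: K_def)
  qed
  have pt: "ennreal (\<bar>u x - cell_avg N u x\<bar> powr p) \<le> ennreal K * (\<integral>\<^sup>+ y. ennreal (\<bar>u x - u y\<bar> powr p / norm (x - y) powr \<alpha>) \<partial>lebesgue)" for x
  proof -
    define Q where "Q = {y :: 'a. cell N y = cell N x}"
    have Q: "Q \<in> sets lebesgue" "emeasure lebesgue Q = ennreal (M powr (- n))"
      using cell_emeasure[of N x, folded M_def] M
      by (simp_all add: Q_def n_def powr_minus powr_realpow power_one_over inverse_eq_divide)
    note [measurable] = Q(1)
    have mQ: "measure lebesgue Q = M powr (- n)" using Q(2) by (simp add: measure_def)
    have "(\<lambda>y. indicator Q y * u y) \<in> Lp_space lebesgue p"
      by (rule Lp_space_dominated(1)[OF WspD(1)[OF u]]) (use p in \<open>auto simp: indicator_def\<close>)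
    then have iu: "integrable lebesgue (\<lambda>y. indicator Q y * u y)" 
      using Ip_indicator_integral_le(2)[OF p Q(1), of u] Q(2) by simp
    have cL: "(\<lambda>y. indicator Q y * u x) \<in> Lp_space lebesgue p"
    proof -
      have *: "(\<lambda>y. \<bar>indicator Q y * u x\<bar> powr p) = (\<lambda>y. \<bar>u x\<bar> powr p * indicator Q y)"
        by (auto simp: indicator_def fun_eq_iff)
      have "integrable lebesgue (\<lambda>y. \<bar>u x\<bar> powr p * indicator Q y :: real)"
        using Q by (intro integrable_mult_right integrable_real_indicator) auto
      then show ?thesis unfolding Lp_space_iff * by simp
    qed
    have dL: "(\<lambda>y. indicator Q y * (u x - u y)) \<in> Lp_space lebesgue p"
      using Lp_space_diff(1)[OF cL \<open>(\<lambda>y. indicator Q y * u y) \<in> Lp_space lebesgue p\<close>] p by (simp add: right_diff_distrib)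
    have "(LINT y|lebesgue. indicator Q y * (u x - u y)) = (LINT y|lebesgue. indicator Q y * u x) - (LINT y|lebesgue. indicator Q y * u y)"
      using iu Ip_indicator_integral_le(2)[OF p Q(1) _ cL] Q(2) by (simp add: right_diff_distrib)
    also have "(LINT y|lebesgue. indicator Q y * u x) = M powr (- n) * u x"
      using mQ by simp
    finally have X: "(LINT y|lebesgue. indicator Q y * (u x - u y)) = M powr (- n) * u x - (LINT y|lebesgue. indicator Q y * u y)" .
    have avg: "cell_avg N u x = M powr n * (LINT y|lebesgue. indicator Q y * u y)"
      unfolding cell_avg_def Q_def[symmetric] M_def[symmetric] Mn ..
    have "M powr n * M powr (- n) = 1" using M by (simp add: powr_add[symmetric])
    then have "M powr n * (LINT y|lebesgue. indicator Q y * (u x - u y)) = u x - cell_avg N u x"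
      unfolding X avg by (simp add: right_diff_distrib mult.assoc[symmetric])
    then have "\<bar>u x - cell_avg N u x\<bar> powr p = (M powr n) powr p * \<bar>LINT y|lebesgue. indicator Q y * (u x - u y)\<bar> powr p"
      by (metis abs_mult abs_of_nonneg powr_ge_zero powr_mult abs_ge_zero)
    also have "\<dots> \<le> (M powr n) powr p * (measure lebesgue Q powr (p - 1) * Ip lebesgue p (\<lambda>y. indicator Q y * (u x - u y)))"
      using Q(2) by (intro mult_left_mono Ip_indicator_integral_le(1)[OF p Q(1) _ dL]) auto
    also have "\<dots> = M powr n * Ip lebesgue p (\<lambda>y. indicator Q y * (u x - u y))"
      unfolding mQ by (simp add: powr_powr powr_add[symmetric] mult.assoc[symmetric] algebra_simps)
    finally have "ennreal (\<bar>u x - cell_avg N u x\<bar> powr p) \<le> ennreal (M powr n) * Lp_energy lebesgue p (\<lambda>y. indicator Q y * (u x - u y))"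
      by (simp add: Lp_energy_eq[OF dL] ennreal_mult[symmetric] ennreal_leI)
    also have "Lp_energy lebesgue p (\<lambda>y. indicator Q y * (u x - u y)) \<le>
      (\<integral>\<^sup>+ y. ennreal ((n / M) powr \<alpha>) * ennreal (\<bar>u x - u y\<bar> powr p / norm (x - y) powr \<alpha>) \<partial>lebesgue)"
      unfolding Lp_energy_def
    proof (rule nn_integral_mono)
      fix y
      show "ennreal (\<bar>indicator Q y * (u x - u y)\<bar> powr p) \<le> ennreal ((n / M) powr \<alpha>) * ennreal (\<bar>u x - u y\<bar> powr p / norm (x - y) powr \<alpha>)"
      proof (cases "y \<in> Q \<and> x \<noteq> y")
        case True
        have "norm (x - y) \<le> n / M"
          using same_cell_norm_le[of N x y] True by (simp add: Q_def n_def M_def)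
        then have "norm (x - y) powr \<alpha> \<le> (n / M) powr \<alpha>" using \<alpha> by (intro powr_mono2) auto
        then have "\<bar>u x - u y\<bar> powr p * norm (x - y) powr \<alpha> \<le> \<bar>u x - u y\<bar> powr p * (n / M) powr \<alpha>"
          by (intro mult_left_mono) auto
        then have "\<bar>u x - u y\<bar> powr p \<le> (n / M) powr \<alpha> * (\<bar>u x - u y\<bar> powr p / norm (x - y) powr \<alpha>)"
          using True by (simp add: pos_le_divide_eq mult.commute)
        then show ?thesis using True by (simp add: ennreal_mult[symmetric] ennreal_leI)
      next
        case False
        then have z: "indicator Q y * (u x - u y) = 0" by (auto simp: indicator_def)
        show ?thesis unfolding z by simp
      qed
    qed
    also have "\<dots> = ennreal ((n / M) powr \<alpha>) * (\<integral>\<^sup>+ y. ennreal (\<bar>u x - u y\<bar> powr p / norm (x - y) powr \<alpha>) \<partial>lebesgue)"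
    proof (rule nn_integral_cmult)
      have [measurable]: "(\<lambda>y. y) \<in> lebesgue \<rightarrow>\<^sub>M (borel :: 'a measure)" by (rule measurable_completion) simp
      show "(\<lambda>y. ennreal (\<bar>u x - u y\<bar> powr p / norm (x - y) powr \<alpha>)) \<in> borel_measurable lebesgue" by measurable
    qed
    finally show ?thesis
      unfolding K_eq[symmetric] by (simp add: ennreal_mult mult.assoc mult_left_mono)
  qed
  have "Lp_energy lebesgue p (\<lambda>x. u x - cell_avg N u x) \<le> (\<integral>\<^sup>+ x. ennreal K * (\<integral>\<^sup>+ y. ennreal (\<bar>u x - u y\<bar> powr p / norm (x - y) powr \<alpha>) \<partial>lebesgue) \<partial>lebesgue)"
    unfolding Lp_energy_def by (rule nn_integral_mono) (rule pt)
  also have "\<dots> = ennreal K * gagliardo s p u"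
    unfolding gagliardo_def \<alpha>_def n_def
  proof (rule nn_integral_cmult)
    have "case_prod (\<lambda>x y. ennreal (\<bar>u x - u y\<bar> powr p / norm (x - y) powr (real DIM('a) + s * p))) \<in> borel_measurable (lebesgue \<Otimes>\<^sub>M lebesgue)"
      unfolding case_prod_beta' by measurable
    from leb.borel_measurable_nn_integral[OF this]
    show "(\<lambda>x. \<integral>\<^sup>+ y. ennreal (\<bar>u x - u y\<bar> powr p / norm (x - y) powr (real DIM('a) + s * p)) \<partial>lebesgue) \<in> borel_measurable lebesgue" by simp
  qed
  also have "\<dots> = ennreal (K * Gag s p u)"
    by (simp add: gagliardo_Wsp[OF u] ennreal_mult K_def)
  finally have "Lp_energy lebesgue p (\<lambda>x. u x - cell_avg N u x) \<le> ennreal (K * Gag s p u)" .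
  from Lp_energy_less_top[OF _ this]
  have "(\<lambda>x. u x - cell_avg N u x) \<in> Lp_space lebesgue p \<and> Ip lebesgue p (\<lambda>x. u x - cell_avg N u x) \<le> K * Gag s p u"
    by (simp add: K_def)
  then show "(\<lambda>x. u x - cell_avg N u x) \<in> Lp_space lebesgue p"
    "Ip lebesgue p (\<lambda>x. u x - cell_avg N u x) \<le> real DIM('a) powr (real DIM('a) + s * p) * real (Suc N) powr (- (s * p)) * Gag s p u"
    by (auto simp: K_def n_def M_def \<alpha>_def)
qed

text \<open>Bolzano-Weierstrass at each point of \<open>S\<close>, followed by a diagonal sequence,
  which from index \<open>Suc n\<close> on is a subsequence of the \<open>n\<close>-th one.\<close>

lemma convergent_subsequence_countable:
  fixes a :: "nat \<Rightarrow> 'b \<Rightarrow> real"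
  assumes S: "countable S" and bd: "\<And>k z. z \<in> S \<Longrightarrow> \<bar>a k z\<bar> \<le> B"
  obtains r :: "nat \<Rightarrow> nat" where "strict_mono r" "\<And>z. z \<in> S \<Longrightarrow> convergent (\<lambda>k. a (r k) z)"
proof (cases "S = {}")
  case True
  then show ?thesis using that[of id] by (simp add: strict_mono_def)
next
  case False
  define P where "P = (\<lambda>n (q :: nat \<Rightarrow> nat). convergent (\<lambda>k. a (q k) (from_nat_into S n)))"
  have PI: "P n q \<longleftrightarrow> convergent (\<lambda>k. a (q k) (from_nat_into S n))" for n q
    by (simp add: P_def)
  interpret subseqs P
  proof
    fix n and q :: "nat \<Rightarrow> nat" assume "strict_mono q"
    have "bounded (range (\<lambda>k. a (q k) (from_nat_into S n)))"
      using bd[OF from_nat_into[OF False]] by (auto simp: bounded_iff)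
    from bounded_imp_convergent_subsequence[OF this] obtain l r where "strict_mono r" "((\<lambda>k. a (q k) (from_nat_into S n)) \<circ> r) \<longlonglongrightarrow> l"
      by blast
    then show "\<exists>r'. strict_mono r' \<and> P n (q \<circ> r')"
      by (auto simp: PI o_def convergent_def)
  qed
  define dd where "dd = diagseq"
  have "P n (dd \<circ> ((+) (Suc n)))" for n :: nat
  unfolding dd_def
  proof (rule diagseq_holds)
    fix r s :: "nat \<Rightarrow> nat" and n assume "strict_mono r" "P n s"
    then show "P n (s \<circ> r)"
      using convergent_subseq_convergent[of "\<lambda>k. a (s k) (from_nat_into S n)" r] by (simp add: PI o_def)
  qed
  then have "convergent (\<lambda>k. a (dd (Suc n + k)) (from_nat_into S n))" for n
    by (simp only: PI o_def)
  then have "convergent (\<lambda>k. a (dd (k + Suc n)) (from_nat_into S n))" for n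
    by (simp only: add.commute[of _ "Suc n"])
  then have "P n dd" for n
    unfolding PI using convergent_ignore_initial_segment[of "\<lambda>k. a (dd k) (from_nat_into S n)" "Suc n"] by simp
  then have "convergent (\<lambda>k. a (dd k) z)" if "z \<in> S" for z
    using from_nat_into_surj[OF S that] by (auto simp: PI)
  with subseq_diagseq[folded dd_def] that show ?thesis by blast
qed

lemma Lp_indicator_mult:
  assumes "f \<in> Lp_space M p" "A \<in> sets M" "0 \<le> p"
  shows "(\<lambda>x. indicator A x * f x) \<in> Lp_space M p" "Ip M p (\<lambda>x. indicator A x * f x) \<le> Ip M p f"
proof -
  note [measurable] = Lp_spaceD(1)[OF assms(1)] assms(2)
  show "(\<lambda>x. indicator A x * f x) \<in> Lp_space M p" "Ip M p (\<lambda>x. indicator A x * f x) \<le> Ip M p f"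
    by (rule Lp_space_dominated[OF assms(1) _ _ assms(3)]; auto simp: indicator_def)+
qed

text \<open>Rellich compactness by discretisation. For each grid the cell averages converge along a
  suitable subsequence, and they do so in \<open>L\<^sup>p\<close> on the bounded set
  \<open>\<Omega>\<close> by dominated convergence. Since \<open>cell_avg_error\<close> is uniform
  in \<open>k\<close>, a fine grid makes the functions themselves Cauchy.\<close>

lemma Lp_compactness:
  fixes \<Omega> :: "'a::euclidean_space set"
  assumes \<Omega>: "open \<Omega>" "bounded \<Omega>" and p: "1 < p" and s: "0 < s"
    and u: "\<And>k. u k \<in> Wsp s p" "\<And>k. AE x in lebesgue. x \<notin> \<Omega> \<longrightarrow> u k x = 0"
    and bd: "\<And>k. Gag s p (u k) \<le> C" "\<And>k. Ip lebesgue p (u k) \<le> C"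
  obtains r g where "strict_mono (r :: nat \<Rightarrow> nat)" "g \<in> Lp_space lebesgue p"
    "(\<lambda>k. Ip lebesgue p (\<lambda>x. u (r k) x - g x)) \<longlonglongrightarrow> 0"
proof -
  have p0: "0 \<le> p" using p by simp
  have C: "0 \<le> C" using bd(1)[of 0] Gag_nonneg[of s p "u 0"] by linarith
  note uL = WspD(1)[OF u(1)]
  \<comment> \<open>All cubes of all grids at once, so that a single subsequence serves every
    \<open>N\<close>.\<close>
  define S where "S = (SIGMA N : UNIV. range (cell N :: 'a \<Rightarrow> 'a))"
  have S: "countable S" unfolding S_def by (intro countable_SIGMA countable_range_cell) auto
  define a where "a = (\<lambda>k z. LINT y|lebesgue. indicator {y. cell (fst z) y = snd z} y * u k y)"
  have abd: "\<bar>a k z\<bar> \<le> C powr (1 / p)" if z: "z \<in> S" for k z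
  proof -
    obtain N x where x: "z = (N, cell N x)" using z by (auto simp: S_def)
    define Q where "Q = {y :: 'a. cell N y = cell N x}"
    have Q: "Q \<in> sets lebesgue" "emeasure lebesgue Q = ennreal ((1 / real (Suc N)) ^ DIM('a))"
      using cell_emeasure[of N x] by (simp_all add: Q_def)
    have mQ: "measure lebesgue Q \<le> 1"
      using Q(2) by (simp add: measure_def del: of_nat_Suc) (simp add: power_le_one)
    have "\<bar>a k z\<bar> powr p \<le> measure lebesgue Q powr (p - 1) * Ip lebesgue p (\<lambda>x. indicator Q x * u k x)"
      unfolding a_def x fst_conv snd_conv Q_def[symmetric]
      using Q by (intro Ip_indicator_integral_le(1)[OF p Q(1)] Lp_indicator_mult(1) uL p0) auto
    also have "\<dots> \<le> 1 powr (p - 1) * C"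
      using mQ p C Lp_indicator_mult(2)[OF uL Q(1) p0, of k] bd(2)[of k]
      by (intro mult_mono powr_mono2) auto
    finally have "(\<bar>a k z\<bar> powr p) powr (1 / p) \<le> C powr (1 / p)"
      using p by (intro powr_mono2) auto
    then show ?thesis using p by (simp add: powr_powr)
  qed
  obtain r where r: "strict_mono r" "\<And>z. z \<in> S \<Longrightarrow> convergent (\<lambda>k. a (r k) z)"
    by (rule convergent_subsequence_countable[of S a, OF S abd]) blast+
  define w where "w = (\<lambda>k. u (r k))"
  have wW: "w k \<in> Wsp s p" and w0: "AE x in lebesgue. x \<notin> \<Omega> \<longrightarrow> w k x = 0"
    and wbd: "Gag s p (w k) \<le> C" "Ip lebesgue p (w k) \<le> C" for k
    unfolding w_def by (rule u bd)+
  note wL = WspD(1)[OF wW]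
  define K where "K = (\<lambda>N. real DIM('a) powr (real DIM('a) + s * p) * real (Suc N) powr (- (s * p)))"
  have K0: "0 \<le> K N" for N by (simp add: K_def)
  have err: "(\<lambda>x. w k x - cell_avg N (w k) x) \<in> Lp_space lebesgue p" "Ip lebesgue p (\<lambda>x. w k x - cell_avg N (w k) x) \<le> K N * C" for k N
  proof -
    show "(\<lambda>x. w k x - cell_avg N (w k) x) \<in> Lp_space lebesgue p" by (rule cell_avg_error(1)[OF p s wW])
    have "Ip lebesgue p (\<lambda>x. w k x - cell_avg N (w k) x) \<le> K N * Gag s p (w k)"
      unfolding K_def by (rule cell_avg_error(2)[OF p s wW])
    also have "\<dots> \<le> K N * C" by (intro mult_left_mono wbd K0)
    finally show "Ip lebesgue p (\<lambda>x. w k x - cell_avg N (w k) x) \<le> K N * C" .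
  qed
  have cL: "(\<lambda>x. cell_avg N (w k) x) \<in> Lp_space lebesgue p" for k N
    using Lp_space_diff(1)[OF wL[of k] err(1)[of k N] p0] by simp
  have Klim: "K \<longlonglongrightarrow> 0"
  proof -
    have "(\<lambda>N. real (Suc N) powr (- (s * p))) \<longlonglongrightarrow> 0"
      using p s by (intro tendsto_neg_powr filterlim_compose[OF filterlim_real_sequentially filterlim_Suc]) auto
    then show ?thesis unfolding K_def by (intro tendsto_mult_right_zero)
  qed
  have \<Omega>s [measurable]: "\<Omega> \<in> sets lebesgue" using \<Omega>(1) by simp
  have \<Omega>f: "emeasure lebesgue \<Omega> < \<infinity>" using emeasure_bounded_finite[OF \<Omega>(2)] \<Omega>(1) by simp
  have avg_conv: "\<exists>b. b \<in> borel_measurable lebesgue \<and> (\<lambda>x. indicator \<Omega> x * b x) \<in> Lp_space lebesgue p \<and>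
      (\<lambda>k. Ip lebesgue p (\<lambda>x. indicator \<Omega> x * (cell_avg N (w k) x - b x))) \<longlonglongrightarrow> 0" for N
  proof -
    define b where "b = (\<lambda>x. lim (\<lambda>k. cell_avg N (w k) x))"
    have m [measurable]: "cell_avg N (w k) \<in> borel_measurable lebesgue" for k
      by (rule cell_avg_measurable[OF WspD(3)[OF wW]])
    have bm [measurable]: "b \<in> borel_measurable lebesgue" unfolding b_def by measurable
    define B where "B = real (Suc N) ^ DIM('a) * C powr (1 / p)"
    have B: "0 \<le> B" by (simp add: B_def)
    have avg: "cell_avg N (w k) x = real (Suc N) ^ DIM('a) * a (r k) (N, cell N x)" for k x
      by (simp add: cell_avg_def a_def w_def)
    have inS: "(N, cell N x) \<in> S" for x by (auto simp: S_def)
    have lim: "(\<lambda>k. cell_avg N (w k) x) \<longlonglongrightarrow> b x" for x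
    proof -
      have "convergent (\<lambda>k. cell_avg N (w k) x)"
        unfolding avg using r(2)[OF inS] by (intro convergent_mult convergent_const)
      then show ?thesis by (simp add: b_def convergent_LIMSEQ_iff)
    qed
    have bound: "\<bar>cell_avg N (w k) x\<bar> \<le> B" for k x
      unfolding avg B_def abs_mult using abd[OF inS] by (intro mult_mono) auto
    have bb: "\<bar>b x\<bar> \<le> B" for x
      by (rule LIMSEQ_le_const2[OF tendsto_rabs[OF lim]]) (use bound in auto)
    have cI: "integrable lebesgue (\<lambda>x. (2 * B) powr p * indicator \<Omega> x :: real)"
      using \<Omega>f by (intro integrable_mult_right integrable_real_indicator) auto
    have bL: "(\<lambda>x. indicator \<Omega> x * b x) \<in> Lp_space lebesgue p"
    proof -
      have "integrable lebesgue (\<lambda>x. \<bar>indicator \<Omega> x * b x\<bar> powr p)"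
        by (rule Bochner_Integration.integrable_bound[OF cI])
           (use bb B p in \<open>auto simp: indicator_def intro!: powr_mono2 order_trans[OF bb]\<close>)
      then show ?thesis by (simp add: Lp_space_iff)
    qed
    have "(\<lambda>k. LINT x|lebesgue. \<bar>indicator \<Omega> x * (cell_avg N (w k) x - b x)\<bar> powr p) \<longlonglongrightarrow> (LINT x|(lebesgue :: 'a measure). 0 :: real)"
    proof (rule integral_dominated_convergence[OF _ _ cI])
      show "AE x in lebesgue. (\<lambda>k. \<bar>indicator \<Omega> x * (cell_avg N (w k) x - b x)\<bar> powr p) \<longlonglongrightarrow> 0"
      proof (rule AE_I2)
        fix x
        have "(\<lambda>k. \<bar>indicator \<Omega> x * (cell_avg N (w k) x - b x)\<bar> powr p) \<longlonglongrightarrow> \<bar>indicator \<Omega> x * (b x - b x)\<bar> powr p"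
          using p by (intro tendsto_powr' tendsto_intros lim) auto
        then show "(\<lambda>k. \<bar>indicator \<Omega> x * (cell_avg N (w k) x - b x)\<bar> powr p) \<longlonglongrightarrow> 0" by simp
      qed
      show "AE x in lebesgue. norm (\<bar>indicator \<Omega> x * (cell_avg N (w k) x - b x)\<bar> powr p) \<le> (2 * B) powr p * indicator \<Omega> x" for k
      proof (rule AE_I2)
        fix x
        have "\<bar>cell_avg N (w k) x - b x\<bar> \<le> 2 * B"
          using bound[of k x] bb[of x] by linarith
        then show "norm (\<bar>indicator \<Omega> x * (cell_avg N (w k) x - b x)\<bar> powr p) \<le> (2 * B) powr p * indicator \<Omega> x"
          using p by (auto simp: indicator_def intro!: powr_mono2)
      qed
    qed auto
    then have "(\<lambda>k. Ip lebesgue p (\<lambda>x. indicator \<Omega> x * (cell_avg N (w k) x - b x))) \<longlonglongrightarrow> 0"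
      by (simp add: Ip_def)
    with bL bm show ?thesis by blast
  qed
  have cauchy: "\<exists>K. \<forall>k\<ge>K. \<forall>l\<ge>K. Ip lebesgue p (\<lambda>x. w k x - w l x) < e" if e: "0 < e" for e
  proof -
    define c where "c = (2 :: real) powr p"
    have c: "0 < c" by (simp add: c_def)
    \<comment> \<open>The constant \<open>c\<close> enters twice, inside each \<open>h k\<close> and
      between \<open>h k\<close> and \<open>h l\<close>:
      \<open>c * (c * (d + d) + c * (d + d)) = e\<close>.\<close>
    define d where "d = e / (4 * c * c)"
    have d: "0 < d" using e c by (simp add: d_def)
    have "(\<lambda>N. K N * C) \<longlonglongrightarrow> 0" using tendsto_mult_left_zero[OF Klim] by simp
    then have "\<forall>\<^sub>F N in sequentially. K N * C < d" using d by (intro order_tendstoD) auto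
    then obtain N where N: "K N * C < d" by (auto simp: eventually_sequentially)
    obtain b where b: "b \<in> borel_measurable lebesgue" "(\<lambda>x. indicator \<Omega> x * b x) \<in> Lp_space lebesgue p"
      "(\<lambda>k. Ip lebesgue p (\<lambda>x. indicator \<Omega> x * (cell_avg N (w k) x - b x))) \<longlonglongrightarrow> 0" using avg_conv by blast
    note bm [measurable] = b(1)
    from b(3) have "\<forall>\<^sub>F k in sequentially. Ip lebesgue p (\<lambda>x. indicator \<Omega> x * (cell_avg N (w k) x - b x)) < d"
      using d by (intro order_tendstoD) auto
    then obtain k0 where k0: "\<And>k. k0 \<le> k \<Longrightarrow> Ip lebesgue p (\<lambda>x. indicator \<Omega> x * (cell_avg N (w k) x - b x)) < d"
      by (auto simp: eventually_sequentially)
    define h where "h = (\<lambda>k x. indicator \<Omega> x * (w k x - b x))"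
    have h: "h k \<in> Lp_space lebesgue p \<and> Ip lebesgue p (h k) < c * (d + d)" if k: "k0 \<le> k" for k
    proof -
      have A: "(\<lambda>x. indicator \<Omega> x * (w k x - cell_avg N (w k) x)) \<in> Lp_space lebesgue p"
        "Ip lebesgue p (\<lambda>x. indicator \<Omega> x * (w k x - cell_avg N (w k) x)) < d"
        using Lp_indicator_mult[OF err(1)[of k N] \<Omega>s p0] err(2)[of k N] N by auto
      have "(\<lambda>x. indicator \<Omega> x * cell_avg N (w k) x - indicator \<Omega> x * b x) \<in> Lp_space lebesgue p"
        by (intro Lp_space_diff(1) Lp_indicator_mult(1) cL \<Omega>s p0 b)
      then have B: "(\<lambda>x. indicator \<Omega> x * (cell_avg N (w k) x - b x)) \<in> Lp_space lebesgue p"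
        by (simp add: right_diff_distrib)
      have eq: "h k = (\<lambda>x. indicator \<Omega> x * (w k x - cell_avg N (w k) x) + indicator \<Omega> x * (cell_avg N (w k) x - b x))"
        by (auto simp: h_def fun_eq_iff algebra_simps)
      have "h k \<in> Lp_space lebesgue p" unfolding eq by (rule Lp_space_add(1)[OF A(1) B p0])
      moreover have "Ip lebesgue p (h k) \<le> c * (Ip lebesgue p (\<lambda>x. indicator \<Omega> x * (w k x - cell_avg N (w k) x)) + Ip lebesgue p (\<lambda>x. indicator \<Omega> x * (cell_avg N (w k) x - b x)))"
        unfolding eq c_def by (rule Lp_space_add(2)[OF A(1) B p0])
      moreover have "\<dots> < c * (d + d)" using A(2) k0[OF k] c by (intro mult_strict_left_mono add_strict_mono)
      ultimately show ?thesis by linarith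
    qed
    have "Ip lebesgue p (\<lambda>x. w k x - w l x) < e" if k: "k0 \<le> k" and l: "k0 \<le> l" for k l
    proof -
      note [measurable] = WspD(3)[OF wW]
      have "AE x in lebesgue. w k x - w l x = h k x - h l x"
        using w0[of k] w0[of l] by eventually_elim (auto simp: h_def indicator_def)
      then have "Ip lebesgue p (\<lambda>x. w k x - w l x) = Ip lebesgue p (\<lambda>x. h k x - h l x)"
        by (rule Ip_cong_AE) (auto simp: h_def)
      also have "\<dots> \<le> c * (Ip lebesgue p (h k) + Ip lebesgue p (h l))"
        unfolding c_def using h[OF k] h[OF l] by (intro Lp_space_diff(2) p0) auto
      also have "\<dots> < c * (c * (d + d) + c * (d + d))"
        using h[OF k] h[OF l] c by (intro mult_strict_left_mono add_strict_mono) auto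
      also have "\<dots> = e" using c by (simp add: d_def field_simps)
      finally show ?thesis .
    qed
    then show ?thesis by blast
  qed
  obtain g where "g \<in> Lp_space lebesgue p" "(\<lambda>k. Ip lebesgue p (\<lambda>x. w k x - g x)) \<longlonglongrightarrow> 0"
    by (rule Lp_complete[OF p wL cauchy]) blast+
  then show ?thesis using that[OF r(1)] by (simp add: w_def)
qed

subsection \<open>Minimising sequences\<close>

text \<open>Upgrades \<open>L\<^sup>p\<close> information to the seminorm. The midpoint is
  admissible, so its energy is at least \<open>l\<close> times its \<open>L\<^sup>p\<close> part,
  which tends to \<open>l * m\<close>; this is also the limit of the average energy. The midpoint
  defect therefore vanishes and uniform convexity applies.\<close>

lemma minimising_Gag_tendsto_0:
  assumes p: "1 < p"
    and l: "\<And>u. u \<in> Wsp0 \<Omega> s p \<Longrightarrow> l * Ip lebesgue p u \<le> Gag s p u"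
    and fg: "\<forall>\<^sub>F k in F. f k \<in> Wsp0 \<Omega> s p \<and> g k \<in> Wsp0 \<Omega> s p"
    and f: "((\<lambda>k. Gag s p (f k)) \<longlongrightarrow> l * m) F" and g: "((\<lambda>k. Gag s p (g k)) \<longlongrightarrow> l * m) F"
    and mid: "((\<lambda>k. Ip lebesgue p (\<lambda>x. (f k x + g k x) / 2)) \<longlongrightarrow> m) F"
  shows "((\<lambda>k. Gag s p (\<lambda>x. f k x - g k x)) \<longlongrightarrow> 0) F"
  unfolding Gag_def Dq_diff
proof (rule Ip_uniformly_convex[OF p])
  show "\<forall>\<^sub>F k in F. Dq (f k) \<in> Lp_space (gag_measure s p) p \<and> Dq (g k) \<in> Lp_space (gag_measure s p) p"
    using fg by eventually_elim (auto intro: WspD Wsp0_imp_Wsp)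
  have "((\<lambda>k. Gag s p (f k) + Gag s p (g k)) \<longlongrightarrow> l * m + l * m) F" by (intro tendsto_intros f g)
  then have "\<forall>\<^sub>F k in F. Gag s p (f k) + Gag s p (g k) < l * m + l * m + 1" by (intro order_tendstoD) auto
  then show "\<forall>\<^sub>F k in F. Ip (gag_measure s p) p (Dq (f k)) + Ip (gag_measure s p) p (Dq (g k)) \<le> l * m + l * m + 1"
    by eventually_elim (simp add: Gag_def)
  have "((\<lambda>k. (Gag s p (f k) + Gag s p (g k)) / 2 - l * Ip lebesgue p (\<lambda>x. (f k x + g k x) / 2)) \<longlongrightarrow> (l * m + l * m) / 2 - l * m) F"
    by (intro tendsto_intros f g mid) auto
  then have up: "((\<lambda>k. (Gag s p (f k) + Gag s p (g k)) / 2 - l * Ip lebesgue p (\<lambda>x. (f k x + g k x) / 2)) \<longlongrightarrow> 0) F" by simp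
  have D: "Dq (\<lambda>x. (f k x + g k x) / 2) = (\<lambda>z. (Dq (f k) z + Dq (g k) z) / 2)" for k
    by (auto simp: Dq_def fun_eq_iff field_simps)
  show "((\<lambda>k. (Ip (gag_measure s p) p (Dq (f k)) + Ip (gag_measure s p) p (Dq (g k))) / 2 -
      Ip (gag_measure s p) p (\<lambda>z. (Dq (f k) z + Dq (g k) z) / 2)) \<longlongrightarrow> 0) F"
  proof (rule tendsto_sandwich[OF _ _ tendsto_const up])
    show "\<forall>\<^sub>F k in F. 0 \<le> (Ip (gag_measure s p) p (Dq (f k)) + Ip (gag_measure s p) p (Dq (g k))) / 2 -
      Ip (gag_measure s p) p (\<lambda>z. (Dq (f k) z + Dq (g k) z) / 2)"
      using fg
    proof eventually_elim
      case (elim k)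
      then show ?case
        using Ip_midpoint_le[OF p WspD(2)[OF Wsp0_imp_Wsp] WspD(2)[OF Wsp0_imp_Wsp]] by fastforce
    qed
    show "\<forall>\<^sub>F k in F. (Ip (gag_measure s p) p (Dq (f k)) + Ip (gag_measure s p) p (Dq (g k))) / 2 -
      Ip (gag_measure s p) p (\<lambda>z. (Dq (f k) z + Dq (g k) z) / 2)
      \<le> (Gag s p (f k) + Gag s p (g k)) / 2 - l * Ip lebesgue p (\<lambda>x. (f k x + g k x) / 2)"
      using fg
    proof eventually_elim
      case (elim k)
      then have "(\<lambda>x. (f k x + g k x) / 2) \<in> Wsp0 \<Omega> s p"
        using Wsp0_cmult[OF Wsp0_add[OF _ _ p] p, of "f k" \<Omega> s "g k" "1 / 2"] by simp
      from l[OF this] show ?case by (simp add: Gag_def D)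
    qed
  qed
qed

text \<open>Compactness gives an \<open>L\<^sup>p\<close> limit \<open>g\<close>. Midpoints of two
  late members also converge to \<open>g\<close>, so the previous lemma makes the sequence Cauchy in
  the seminorm, and Fatou's lemma along an almost everywhere convergent subsequence identifies its
  limit as \<open>g\<close>.\<close>

lemma minimising_sequence_compact:
  fixes \<Omega> :: "'a::euclidean_space set"
  assumes \<Omega>: "open \<Omega>" "bounded \<Omega>" and p: "1 < p" and s: "0 < s"
    and l: "\<And>u. u \<in> Wsp0 \<Omega> s p \<Longrightarrow> l * Ip lebesgue p u \<le> Gag s p u"
    and u: "\<And>k. u k \<in> Wsp0 \<Omega> s p"
    and lim: "(\<lambda>k. Gag s p (u k)) \<longlonglongrightarrow> l * m" "(\<lambda>k. Ip lebesgue p (u k)) \<longlonglongrightarrow> m"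
  obtains r g where "strict_mono (r :: nat \<Rightarrow> nat)" "g \<in> Wsp0 \<Omega> s p"
    "(\<lambda>k. Ip lebesgue p (\<lambda>x. u (r k) x - g x)) \<longlonglongrightarrow> 0" "Gag s p g = l * m" "Ip lebesgue p g = m"
proof -
  have p0: "0 \<le> p" using p by simp
  have "Bseq (\<lambda>k. Gag s p (u k))" "Bseq (\<lambda>k. Ip lebesgue p (u k))"
    by (rule convergent_imp_Bseq[OF convergentI[OF lim(1)]], rule convergent_imp_Bseq[OF convergentI[OF lim(2)]])
  then obtain C1 C2 where C12: "\<And>k. norm (Gag s p (u k)) \<le> C1" "\<And>k. norm (Ip lebesgue p (u k)) \<le> C2"
    by (meson BseqE)
  define C where "C = max C1 C2"
  have C: "Gag s p (u k) \<le> C" "Ip lebesgue p (u k) \<le> C" for k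
    using C12[of k] by (auto simp: C_def)
  obtain r g where r: "strict_mono (r :: nat \<Rightarrow> nat)" and g: "g \<in> Lp_space lebesgue p"
    and conv: "(\<lambda>k. Ip lebesgue p (\<lambda>x. u (r k) x - g x)) \<longlonglongrightarrow> 0"
    by (rule Lp_compactness[where u = u, OF \<Omega> p s Wsp0_imp_Wsp[OF u] Wsp0_vanishes_outside[OF u p \<Omega>(1)] C]) blast
  define w where "w = (\<lambda>k. u (r k))"
  have w0: "w k \<in> Wsp0 \<Omega> s p" for k unfolding w_def by (rule u)
  note wW = Wsp0_imp_Wsp[OF w0]
  note wL = WspD(1)[OF wW]
  have wc: "(\<lambda>k. Ip lebesgue p (\<lambda>x. w k x - g x)) \<longlonglongrightarrow> 0" using conv by (simp add: w_def)
  have wG: "(\<lambda>k. Gag s p (w k)) \<longlonglongrightarrow> l * m" and wI: "(\<lambda>k. Ip lebesgue p (w k)) \<longlonglongrightarrow> m"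
    unfolding w_def using LIMSEQ_subseq_LIMSEQ[OF lim(1) r] LIMSEQ_subseq_LIMSEQ[OF lim(2) r] by (simp_all add: o_def)
  have "(\<lambda>k. Ip lebesgue p (w k)) \<longlonglongrightarrow> Ip lebesgue p g"
    by (rule Lp_tendsto_Ip[OF p _ g wc]) (simp add: wL)
  then have gm: "Ip lebesgue p g = m" using wI LIMSEQ_unique by blast
  \<comment> \<open>A limit along the product filter expresses the Cauchy property without choosing
    indices.\<close>
  let ?F = "sequentially \<times>\<^sub>F sequentially"
  have fst: "filterlim fst sequentially ?F" and snd: "filterlim snd sequentially ?F"
    by (rule filterlim_fst, rule filterlim_snd)
  have mid: "((\<lambda>z. Ip lebesgue p (\<lambda>x. (w (fst z) x + w (snd z) x) / 2)) \<longlongrightarrow> m) ?F"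
  proof -
    have "((\<lambda>z. 2 powr p * (Ip lebesgue p (\<lambda>x. w (fst z) x - g x) + Ip lebesgue p (\<lambda>x. w (snd z) x - g x))) \<longlongrightarrow> 2 powr p * (0 + 0)) ?F"
      by (intro tendsto_intros filterlim_compose[OF wc fst] filterlim_compose[OF wc snd])
    then have up: "((\<lambda>z. 2 powr p * (Ip lebesgue p (\<lambda>x. w (fst z) x - g x) + Ip lebesgue p (\<lambda>x. w (snd z) x - g x))) \<longlongrightarrow> 0) ?F" by simp
    have "((\<lambda>z. Ip lebesgue p (\<lambda>x. (w (fst z) x + w (snd z) x) / 2)) \<longlongrightarrow> Ip lebesgue p g) ?F"
    proof (rule Lp_tendsto_Ip[OF p _ g])
      have L: "(\<lambda>x. (w j x + w k x) / 2) \<in> Lp_space lebesgue p" for j k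
        using Lp_space_cmult[OF Lp_space_add(1)[OF wL wL p0], of "1 / 2"] by simp
      then show "\<forall>\<^sub>F z in ?F. (\<lambda>x. (w (fst z) x + w (snd z) x) / 2) \<in> Lp_space lebesgue p" by simp
      show "((\<lambda>z. Ip lebesgue p (\<lambda>x. (w (fst z) x + w (snd z) x) / 2 - g x)) \<longlongrightarrow> 0) ?F"
      proof (rule tendsto_sandwich[OF _ _ tendsto_const up])
        show "\<forall>\<^sub>F z in ?F. Ip lebesgue p (\<lambda>x. (w (fst z) x + w (snd z) x) / 2 - g x)
          \<le> 2 powr p * (Ip lebesgue p (\<lambda>x. w (fst z) x - g x) + Ip lebesgue p (\<lambda>x. w (snd z) x - g x))"
        proof (rule always_eventually, rule allI)
          fix z
          have d: "(\<lambda>x. w k x - g x) \<in> Lp_space lebesgue p" for k by (rule Lp_space_diff(1)[OF wL g p0])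
          have "(\<lambda>x. (w (fst z) x + w (snd z) x) / 2 - g x) = (\<lambda>x. 1 / 2 * ((w (fst z) x - g x) + (w (snd z) x - g x)))"
            by (auto simp: fun_eq_iff field_simps)
          then have "Ip lebesgue p (\<lambda>x. (w (fst z) x + w (snd z) x) / 2 - g x) = (1 / 2) powr p * Ip lebesgue p (\<lambda>x. (w (fst z) x - g x) + (w (snd z) x - g x))"
            by (simp only: Ip_cmult)
          also have "\<dots> \<le> 1 powr p * Ip lebesgue p (\<lambda>x. (w (fst z) x - g x) + (w (snd z) x - g x))"
            by (intro mult_right_mono powr_mono2 p0) auto
          also have "\<dots> \<le> 2 powr p * (Ip lebesgue p (\<lambda>x. w (fst z) x - g x) + Ip lebesgue p (\<lambda>x. w (snd z) x - g x))"
            using Lp_space_add(2)[OF d d p0] by simp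
          finally show "Ip lebesgue p (\<lambda>x. (w (fst z) x + w (snd z) x) / 2 - g x)
            \<le> 2 powr p * (Ip lebesgue p (\<lambda>x. w (fst z) x - g x) + Ip lebesgue p (\<lambda>x. w (snd z) x - g x))" .
        qed
      qed simp
    qed
    then show ?thesis by (simp add: gm)
  qed
  have Gc: "((\<lambda>z. Gag s p (\<lambda>x. w (fst z) x - w (snd z) x)) \<longlongrightarrow> 0) ?F"
    by (rule minimising_Gag_tendsto_0[OF p l _ filterlim_compose[OF wG fst] filterlim_compose[OF wG snd] mid])
       (auto simp: w0)
  obtain q where q: "strict_mono (q :: nat \<Rightarrow> nat)" "AE x in lebesgue. (\<lambda>k. w (q k) x) \<longlonglongrightarrow> g x"
    using Lp_tendsto_AE_subseq[OF WspD(3)[OF wW] Lp_spaceD(2)[OF Lp_space_diff(1)[OF wL g p0]] _ wc] p by auto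
  note gm' = Lp_spaceD(1)[OF g]
  have key: "\<exists>N. \<forall>k\<ge>N. (\<lambda>z. Dq (w k) z - Dq g z) \<in> Lp_space (gag_measure s p) p \<and> Ip (gag_measure s p) p (\<lambda>z. Dq (w k) z - Dq g z) \<le> e"
    if e: "0 < e" for e
  proof -
    have "\<forall>\<^sub>F z in ?F. Gag s p (\<lambda>x. w (fst z) x - w (snd z) x) < e"
      using Gc e by (intro order_tendstoD) auto
    then obtain N where N: "\<And>j k. N \<le> j \<Longrightarrow> N \<le> k \<Longrightarrow> Gag s p (\<lambda>x. w j x - w k x) < e"
      by (auto simp: eventually_prod_sequentially)
    have "(\<lambda>z. Dq (w k) z - Dq g z) \<in> Lp_space (gag_measure s p) p \<and> Ip (gag_measure s p) p (\<lambda>z. Dq (w k) z - Dq g z) \<le> e"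
      if k: "N \<le> k" for k
    proof -
      have lims: "AE z in gag_measure s p. (\<lambda>j. Dq (w k) z - Dq (w (q j)) z) \<longlonglongrightarrow> Dq (w k) z - Dq g z"
        by (rule AE_gagI) (use AE_pair_lebesgueI(1)[OF q(2)] AE_pair_lebesgueI(2)[OF q(2)] in eventually_elim, auto simp: Dq_def intro: tendsto_intros)
      have dL: "(\<lambda>z. Dq (w k) z - Dq (w (q j)) z) \<in> Lp_space (gag_measure s p) p" for j
        by (rule Lp_space_diff(1)[OF WspD(2)[OF wW] WspD(2)[OF wW] p0])
      have m: "(\<lambda>z. Dq (w k) z - Dq g z) \<in> borel_measurable (gag_measure s p)"
        by (intro borel_measurable_diff Dq_measurable_gag WspD(3)[OF wW] gm')
      have ev: "\<forall>\<^sub>F j in sequentially. Ip (gag_measure s p) p (\<lambda>z. Dq (w k) z - Dq (w (q j)) z) \<le> e"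
        unfolding eventually_sequentially
        using N[OF k] seq_suble[OF q(1)] by (intro exI[of _ N]) (auto simp: Gag_def Dq_diff intro: less_imp_le order_trans)
      show ?thesis
        using Ip_Fatou[OF Lp_spaceD(1)[OF dL] m lims dL ev] p by auto
    qed
    then show ?thesis by blast
  qed
  obtain N where N: "(\<lambda>z. Dq (w N) z - Dq g z) \<in> Lp_space (gag_measure s p) p" using key[of 1] by auto
  have "(\<lambda>z. Dq (w N) z - (Dq (w N) z - Dq g z)) \<in> Lp_space (gag_measure s p) p"
    by (rule Lp_space_diff(1)[OF WspD(2)[OF wW] N p0])
  then have "Dq g \<in> Lp_space (gag_measure s p) p" by simp
  then have gW: "g \<in> Wsp s p" using g by (simp add: Wsp_iff)
  have Gconv: "(\<lambda>k. Ip (gag_measure s p) p (\<lambda>z. Dq (w k) z - Dq g z)) \<longlonglongrightarrow> 0"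
  proof (rule LIMSEQ_I)
    fix e :: real assume "0 < e"
    then show "\<exists>N. \<forall>k\<ge>N. norm (Ip (gag_measure s p) p (\<lambda>z. Dq (w k) z - Dq g z) - 0) < e"
      using key[of "e / 2"] by force
  qed
  have "(\<lambda>k. Gag s p (w k)) \<longlonglongrightarrow> Gag s p g"
    unfolding Gag_def by (rule Lp_tendsto_Ip[OF p _ WspD(2)[OF gW] Gconv]) (simp add: WspD(2)[OF wW])
  then have Gg: "Gag s p g = l * m" using wG LIMSEQ_unique by blast
  have tot: "(\<lambda>k. Gag s p (\<lambda>x. w k x - g x) + Ip lebesgue p (\<lambda>x. w k x - g x)) \<longlonglongrightarrow> 0"
    using tendsto_add[OF Gconv wc] by (simp add: Gag_def Dq_diff)
  have "g \<in> Wsp0 \<Omega> s p"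
  proof (rule Wsp0_closed[OF p gW])
    fix e :: real assume "0 < e"
    then have "\<forall>\<^sub>F k in sequentially. Gag s p (\<lambda>x. w k x - g x) + Ip lebesgue p (\<lambda>x. w k x - g x) < e"
      using tot by (intro order_tendstoD) auto
    then obtain k where "Gag s p (\<lambda>x. w k x - g x) + Ip lebesgue p (\<lambda>x. w k x - g x) < e"
      by (auto simp: eventually_sequentially)
    then show "\<exists>v\<in>Wsp0 \<Omega> s p. Gag s p (\<lambda>x. g x - v x) + Ip lebesgue p (\<lambda>x. g x - v x) < e"
      using w0[of k] Gag_minus_commute[of s p g "w k"] Ip_minus_commute[of lebesgue p g "w k"]
      by (intro bexI[of _ "w k"]) auto
  qed
  with r wc Gg gm that show ?thesis by (simp add: w_def)
qed

subsection \<open>Extension by zero and the fundamental lemma of the calculus of variations\<close>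

text \<open>Completeness of the measure: every change on a null set preserves measurability.\<close>

lemma lebesgue_measurable_cong_AE:
  fixes u v :: "'a::euclidean_space \<Rightarrow> real"
  assumes v [measurable]: "v \<in> borel_measurable lebesgue" and ae: "AE x in lebesgue. u x = v x"
  shows "u \<in> borel_measurable lebesgue"
proof -
  obtain N where N: "N \<in> null_sets lebesgue" "{x. u x \<noteq> v x} \<subseteq> N"
    using ae by (auto simp: eventually_ae_filter)
  show ?thesis
  proof (rule measurableI)
    fix B :: "real set" assume B [measurable]: "B \<in> sets borel"
    have "u -` B \<inter> N \<in> null_sets lebesgue"
      using N(1) by (rule completion.complete2[rotated]) auto
    moreover have "v -` B \<inter> space lebesgue \<in> sets lebesgue" by measurable
    ultimately have "(v -` B - N) \<union> (u -` B \<inter> N) \<in> sets lebesgue" using N by auto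
    moreover have "u -` B \<inter> space lebesgue = (v -` B - N) \<union> (u -` B \<inter> N)" using N(2) by auto
    ultimately show "u -` B \<inter> space lebesgue \<in> sets lebesgue" by simp
  qed simp
qed

lemma Lp_space_extend_zero:
  fixes u :: "'a::euclidean_space \<Rightarrow> real"
  assumes \<Omega>: "open \<Omega>" and u: "u \<in> Lp_space (lebesgue_on \<Omega>) p" and ae: "AE x in lebesgue. x \<notin> \<Omega> \<longrightarrow> u x = 0"
  shows "u \<in> Lp_space lebesgue p"
proof -
  have \<Omega>s: "\<Omega> \<inter> space lebesgue \<in> sets lebesgue" using \<Omega> by simp
  have "(\<lambda>x. indicator \<Omega> x *\<^sub>R u x) \<in> borel_measurable lebesgue"
    using Lp_spaceD(1)[OF u] borel_measurable_restrict_space_iff[OF \<Omega>s, of u] by simp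
  then have m: "u \<in> borel_measurable lebesgue"
    by (rule lebesgue_measurable_cong_AE) (use ae in \<open>eventually_elim, auto simp: indicator_def\<close>)
  have "Lp_energy lebesgue p u < \<infinity>"
    using u Lp_energy_lebesgue_on[OF _ ae, of p] \<Omega> by (simp add: Lp_space_def)
  with m show ?thesis by (simp add: Lp_space_def)
qed

text \<open>Open sets form an intersection-stable generator of the Borel sets, so a Dynkin argument
  extends the vanishing to all Borel sets. The argument is run on a Borel representative of
  \<open>g\<close>.\<close>

lemma integral_zero_on_open_imp_AE_zero:
  fixes g :: "'a::euclidean_space \<Rightarrow> real"
  assumes g: "integrable lebesgue g" and U: "\<And>U. open U \<Longrightarrow> (LINT x|lebesgue. indicator U x * g x) = 0"
  shows "AE x in lebesgue. g x = 0"
proof -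
  obtain g' where g' [measurable]: "g' \<in> borel_measurable lborel" and ae: "AE x in lborel. g x = g' x"
    using completion_ex_borel_measurable_real[OF borel_measurable_integrable[OF g]] by blast
  have ae': "AE x in lebesgue. g x = g' x" using ae by (rule AE_completion)
  have gm: "g' \<in> borel_measurable lebesgue" by (rule measurable_completion) simp
  note [measurable] = borel_measurable_integrable[OF g] gm
  have "integrable lebesgue g'" using g ae' by (subst integrable_cong_AE[symmetric, of g]) auto
  then have i: "integrable lborel g'" by (simp add: integrable_completion)
  have iA: "integrable lborel (\<lambda>x. indicator A x * g' x)" if "A \<in> sets borel" for A
    using integrable_mult_indicator[OF _ i, of A] that by simp
  have U': "(LINT x|lborel. indicator U x * g' x) = 0" if "open U" for U
  proof -
    have [measurable]: "U \<in> sets borel" using that by simp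
    have [measurable]: "indicator U \<in> borel_measurable (lebesgue :: 'a measure)" by (rule measurable_completion) measurable
    have "(LINT x|lborel. indicator U x * g' x) = (LINT x|lebesgue. indicator U x * g' x)"
      by (rule integral_completion[symmetric]) measurable
    also have "\<dots> = (LINT x|lebesgue. indicator U x * g x)"
      by (rule integral_cong_AE) (use ae' in \<open>auto elim: eventually_mono\<close>)
    finally show ?thesis using U[OF that] by simp
  qed
  have total: "(LINT x|lborel. g' x) = 0" using U'[of UNIV] by simp
  have "(LINT x|lborel. indicator A x * g' x) = 0" if A: "A \<in> sigma_sets UNIV {S :: 'a set. open S}" for A
  proof -
    have "Int_stable {S :: 'a set. open S}" "{S :: 'a set. open S} \<subseteq> Pow UNIV"
      by (auto simp: Int_stable_def)
    from this A show ?thesis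
  proof (induction A rule: sigma_sets_induct_disjoint)
    case (compl A)
    then have "A \<in> sets borel" by (simp add: borel_def)
    have "(LINT x|lborel. indicator (UNIV - A) x * g' x) = (LINT x|lborel. g' x - indicator A x * g' x)"
      by (intro Bochner_Integration.integral_cong) (auto simp: indicator_def)
    also have "\<dots> = 0" using i iA[OF \<open>A \<in> sets borel\<close>] compl total by simp
    finally show ?case .
  next
    case (union A)
    then have "range A \<subseteq> sets borel" by (simp add: borel_def)
    then have Am: "A i \<in> sets lborel" for i by auto
    have "(LINT x:(\<Union>i. A i)|lborel. g' x) = (\<Sum>i. LINT x:A i|lborel. g' x)"
      using union(1) Am iA[of "\<Union>i. A i"] \<open>range A \<subseteq> sets borel\<close>
      by (intro lebesgue_integral_countable_add) (auto simp: disjoint_family_on_def set_integrable_def)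
    also have "\<dots> = 0" using union(3) by (simp add: set_lebesgue_integral_def)
    finally show ?case by (simp add: set_lebesgue_integral_def)
    qed (auto simp: U')
  qed
  then have "AE x in lborel. g' x = 0"
    by (intro sigma_finite_measure.density_zero[OF sigma_finite_lborel i]) (auto simp: set_lebesgue_integral_def borel_def)
  then have "AE x in lebesgue. g' x = 0" by (rule AE_completion)
  with ae' show ?thesis by eventually_elim simp
qed

text \<open>Test functions between 0 and 1 that converge to the indicator of
  \<open>U \<inter> \<Omega>\<close> transfer the hypothesis to integrals over open sets.\<close>

lemma fundamental_lemma_test_functions:
  fixes g :: "'a::euclidean_space \<Rightarrow> real"
  assumes \<Omega>: "open \<Omega>" and g: "integrable lebesgue g" and g0: "\<And>x. x \<notin> \<Omega> \<Longrightarrow> g x = 0"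
    and test: "\<And>\<phi>. \<phi> \<in> test_functions \<Omega> \<Longrightarrow> (LINT x|lebesgue. g x * \<phi> x) = 0"
  shows "AE x in lebesgue. g x = 0"
proof (rule integral_zero_on_open_imp_AE_zero[OF g])
  fix U :: "'a set" assume "open U"
  then have "open (U \<inter> \<Omega>)" using \<Omega> by blast
  then obtain \<Phi> :: "nat \<Rightarrow> 'a \<Rightarrow> real" where \<Phi>: "\<And>n. \<Phi> n \<in> test_functions (U \<inter> \<Omega>)" "\<And>n x. 0 \<le> \<Phi> n x" "\<And>n x. \<Phi> n x \<le> 1"
    "\<And>x. (\<lambda>n. \<Phi> n x) \<longlonglongrightarrow> indicator (U \<inter> \<Omega>) x"
    by (rule test_functions_approx_indicator) blast
  have t: "\<Phi> n \<in> test_functions \<Omega>" for n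
    using \<Phi>(1)[of n] by (auto simp: test_functions_def)
  have [measurable]: "\<Phi> n \<in> borel_measurable lebesgue" for n
    using test_functions_measurable[OF t] by (auto intro: measurable_completion)
  have [measurable]: "indicator (U \<inter> \<Omega>) \<in> borel_measurable (lebesgue :: 'a measure)"
    using \<open>open (U \<inter> \<Omega>)\<close> by (intro measurable_completion borel_measurable_indicator) simp
  note [measurable] = borel_measurable_integrable[OF g]
  have "(\<lambda>n. LINT x|lebesgue. g x * \<Phi> n x) \<longlonglongrightarrow> (LINT x|lebesgue. g x * indicator (U \<inter> \<Omega>) x)"
  proof (rule integral_dominated_convergence[OF _ _ integrable_norm[OF g]])
    show "AE x in lebesgue. (\<lambda>n. g x * \<Phi> n x) \<longlonglongrightarrow> g x * indicator (U \<inter> \<Omega>) x"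
      by (intro AE_I2 tendsto_intros \<Phi>)
    show "AE x in lebesgue. norm (g x * \<Phi> n x) \<le> norm (g x)" for n
      using \<Phi>(2,3) by (auto simp: abs_mult intro!: mult_left_le)
  qed measurable
  then have "(LINT x|lebesgue. g x * indicator (U \<inter> \<Omega>) x) = 0"
    unfolding test[OF t] using LIMSEQ_unique[OF _ tendsto_const] by metis
  moreover have "g x * indicator (U \<inter> \<Omega>) x = indicator U x * g x" for x
    using g0[of x] by (auto simp: indicator_def)
  ultimately show "(LINT x|lebesgue. indicator U x * g x) = 0" by simp
qed

subsection \<open>The weak time derivative\<close>

lemma AE_lborel_prod_swap:
  assumes "AE z in (lborel :: ('a::euclidean_space \<times> 'b::euclidean_space) measure). P z"
  shows "AE t in lborel. AE x in lborel. P (x, t)"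
proof -
  obtain N where N: "N \<in> null_sets (lborel :: ('a \<times> 'b) measure)" "{z. \<not> P z} \<subseteq> N"
    using assms by (auto simp: eventually_ae_filter)
  have Nm: "N \<in> sets ((lborel :: 'a measure) \<Otimes>\<^sub>M (lborel :: 'b measure))" unfolding lborel_prod using N by auto
  have "AE z in (lborel :: 'a measure) \<Otimes>\<^sub>M (lborel :: 'b measure). z \<notin> N"
    unfolding lborel_prod using N by (intro AE_not_in)
  moreover have S: "{z \<in> space ((lborel :: 'a measure) \<Otimes>\<^sub>M (lborel :: 'b measure)). (fst z, snd z) \<notin> N} \<in> sets (lborel \<Otimes>\<^sub>M lborel)"
    using sets.compl_sets[OF Nm] by (simp add: space_pair_measure Compl_eq_Diff_UNIV[symmetric] Collect_neg_eq)
  ultimately have *: "AE x in lborel. AE t in lborel. (x, t) \<notin> N"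
    using lborel_pair.AE_pair by blast
  have "AE t in lborel. AE x in lborel. (x, t) \<notin> N"
    using lborel_pair.AE_commute[OF S] * by blast
  then show "AE t in lborel. AE x in lborel. P (x, t)"
    by (elim eventually_mono) (use N(2) in blast)
qed

section \<open>From the distributional derivative to increments in time\<close>

lemma smooth_step_deriv_outside:
  assumes "t < 0 \<or> 1 < t"
  shows "deriv smooth_step t = 0"
proof -
  from assms have "(smooth_step has_real_derivative 0) (at t)"
  proof
    assume "t < 0"
    then show ?thesis
      by (intro has_field_derivative_transform_within_open[OF DERIV_const[where k = "0 :: real"], where S = "{..<0}"])
         (auto simp: smooth_step_le_0)
  next
    assume "1 < t"
    then show ?thesis
      by (intro has_field_derivative_transform_within_open[OF DERIV_const[where k = "1 :: real"], where S = "{1<..}"])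
         (auto simp: smooth_step_ge_1)
  qed
  then show ?thesis by (rule DERIV_imp_deriv)
qed

text \<open>The kernel is an approximate identity of mass
  \<open>smooth_step 1 - smooth_step 0 = 1\<close>. It is supported in
  \<open>{c + e k..c + 2 * e k}\<close>, strictly to the right of \<open>c\<close>, so evaluation at
  \<open>c = 0\<close> uses positive times only.\<close>

lemma mollified_evaluation:
  fixes F :: "real \<Rightarrow> real"
  assumes F: "continuous_on UNIV F"
  defines "e \<equiv> \<lambda>k. 1 / real (Suc k)"
  shows "integrable lborel (\<lambda>t. deriv smooth_step ((t - (c + e k)) / e k) / e k * F t)"
    and "(\<lambda>k. LINT t|lborel. deriv smooth_step ((t - (c + e k)) / e k) / e k * F t) \<longlonglongrightarrow> F c"
proof -
  have e: "0 < e k" "e k \<le> 1" for k by (auto simp: e_def)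
  have elim: "e \<longlonglongrightarrow> 0" unfolding e_def by (rule LIMSEQ_Suc[OF lim_1_over_n])
  let ?\<rho> = "deriv smooth_step"
  note \<rho>c = smooth_step_deriv(2)
  have [measurable]: "?\<rho> \<in> borel_measurable borel" "F \<in> borel_measurable borel"
    using \<rho>c F by (auto intro: borel_measurable_continuous_onI)
  have \<rho>ind: "?\<rho> u = ?\<rho> u * indicator {0..1} u" for u
    using smooth_step_deriv_outside[of u] by (cases "u \<in> {0..1}") auto
  have \<rho>ind': "indicator {0..1} u *\<^sub>R ?\<rho> u = ?\<rho> u" for u
    using smooth_step_deriv_outside[of u] by (cases "u \<in> {0..1}") auto
  obtain B1 where B1: "\<And>u. u \<in> {0..1} \<Longrightarrow> \<bar>?\<rho> u\<bar> \<le> B1"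
    using compact_imp_bounded[OF compact_continuous_image[OF continuous_on_subset[OF \<rho>c] compact_Icc[of "0 :: real" 1]]]
    unfolding bounded_iff by (auto intro: that)
  obtain B2 where B2: "\<And>u. u \<in> {c..c + 2} \<Longrightarrow> \<bar>F u\<bar> \<le> B2"
    using compact_imp_bounded[OF compact_continuous_image[OF continuous_on_subset[OF F] compact_Icc[of c "c + 2"]]]
    unfolding bounded_iff by (auto intro: that)
  have iI: "integrable lborel (\<lambda>u. B1 * B2 * indicator {0..1::real} u :: real)"
    by (intro integrable_mult_right integrable_real_indicator) auto
  have dom: "\<bar>?\<rho> u * F (c + e k + e k * u)\<bar> \<le> B1 * B2 * indicator {0..1} u" for u k
  proof (cases "u \<in> {0..1}")
    case True
    have "0 \<le> e k * u" "e k * u \<le> 1" using True e[of k] by (auto intro!: mult_nonneg_nonneg mult_le_one)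
    then have "c + e k + e k * u \<in> {c..c + 2}" using e[of k] by auto
    then show ?thesis using B1[OF True] B2 True by (simp add: abs_mult) (intro mult_mono, auto)
  next
    case False
    then have "?\<rho> u = 0" by (subst \<rho>ind) simp
    with False show ?thesis by simp
  qed
  have sub: "(LINT t|lborel. ?\<rho> ((t - (c + e k)) / e k) / e k * F t) = (LINT u|lborel. ?\<rho> u * F (c + e k + e k * u))" for k
    using e[of k] by (subst lborel_integral_real_affine[where c = "e k" and t = "c + e k"]) (auto simp: algebra_simps)
  have int: "integrable lborel (\<lambda>u. ?\<rho> u * F (c + e k + e k * u))" for k
  proof (rule Bochner_Integration.integrable_bound[OF iI])
    show "AE u in lborel. norm (?\<rho> u * F (c + e k + e k * u)) \<le> norm (B1 * B2 * indicator {0..1} u)"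
      unfolding real_norm_def by (intro AE_I2 order_trans[OF dom] abs_ge_self)
  qed measurable
  show "integrable lborel (\<lambda>t. ?\<rho> ((t - (c + e k)) / e k) / e k * F t)"
    using e[of k] int[of k]
    by (subst lborel_integrable_real_affine_iff[symmetric, where c = "e k" and t = "c + e k"]) (auto simp: algebra_simps)
  have "(\<lambda>k. LINT u|lborel. ?\<rho> u * F (c + e k + e k * u)) \<longlonglongrightarrow> (LINT u|lborel. ?\<rho> u * F c)"
  proof (rule integral_dominated_convergence[OF _ _ iI])
    show "AE u in lborel. (\<lambda>k. ?\<rho> u * F (c + e k + e k * u)) \<longlonglongrightarrow> ?\<rho> u * F c"
    proof (rule AE_I2)
      fix u
      have "(\<lambda>k. c + e k + e k * u) \<longlonglongrightarrow> c + 0 + 0 * u" by (intro tendsto_intros elim)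
      then have "(\<lambda>k. F (c + e k + e k * u)) \<longlonglongrightarrow> F c"
        using continuous_on_tendsto_compose[OF F] by auto
      then show "(\<lambda>k. ?\<rho> u * F (c + e k + e k * u)) \<longlonglongrightarrow> ?\<rho> u * F c" by (intro tendsto_intros)
    qed
    show "AE u in lborel. norm (?\<rho> u * F (c + e k + e k * u)) \<le> B1 * B2 * indicator {0..1} u" for k
      using dom by simp
  qed measurable
  also have "(LINT u|lborel. ?\<rho> u * F c) = F c * (LINT u|lborel. indicator {0..1} u *\<^sub>R ?\<rho> u)"
    unfolding \<rho>ind' by (simp add: mult.commute)
  also have "(LINT u|lborel. indicator {0..1} u *\<^sub>R ?\<rho> u) = smooth_step 1 - smooth_step 0"
  proof (rule integral_FTC_atLeastAtMost)
    show "(smooth_step has_vector_derivative ?\<rho> x) (at x within {0..1})" for x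
      unfolding has_real_derivative_iff_has_vector_derivative[symmetric]
      by (rule has_field_derivative_at_within[OF smooth_step_deriv(1)])
    show "continuous_on {0..1} ?\<rho>" by (rule continuous_on_subset[OF \<rho>c]) simp
  qed simp
  also have "\<dots> = 1" by (simp add: smooth_step_le_0 smooth_step_ge_1)
  finally show "(\<lambda>k. LINT t|lborel. ?\<rho> ((t - (c + e k)) / e k) / e k * F t) \<longlonglongrightarrow> F c"
    unfolding sub by simp
qed

text \<open>The distributional derivative is tested with \<open>\<phi> x * \<eta> k t\<close>, where
  \<open>\<eta> k\<close> is a smoothed indicator of \<open>{a<..b}\<close>. Its time derivative
  consists of two approximate identities of opposite sign, which evaluate the pairing of
  \<open>v\<close> with \<open>\<phi>\<close> at \<open>a\<close> and at \<open>b\<close>.\<close>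

lemma time_increment_test:
  fixes \<Omega> :: "'a::euclidean_space set" and v :: "real \<Rightarrow> 'a \<Rightarrow> real" and f :: "'a \<times> real \<Rightarrow> real"
  assumes \<Omega>: "open \<Omega>" "bounded \<Omega>" and p: "1 < p"
    and weak: "weak_time_deriv \<Omega> v vt"
    and v: "\<And>t. 0 \<le> t \<Longrightarrow> v t \<in> Lp_space lebesgue p"
    and cont: "\<And>t. 0 \<le> t \<Longrightarrow> ((\<lambda>\<tau>. Ip lebesgue p (\<lambda>x. v \<tau> x - v t x)) \<longlongrightarrow> 0) (at t within {0..})"
    and f: "f \<in> Lp_space lborel p" "\<And>x t. x \<notin> \<Omega> \<or> t < 0 \<Longrightarrow> f (x, t) = 0"
    and fvt: "\<And>\<phi>. \<phi> \<in> borel_measurable borel \<Longrightarrow> (LINT z|lebesgue_on (\<Omega> \<times> {0..}). vt z * \<phi> z) = (LINT z|lborel. f z * \<phi> z)"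
    and ab: "0 \<le> a" "a \<le> b" and \<phi>: "\<phi> \<in> test_functions \<Omega>"
  shows "(LINT x|lebesgue. v b x * \<phi> x) - (LINT x|lebesgue. v a x * \<phi> x)
    = (LINT z|lborel. f z * \<phi> (fst z) * indicator {a<..b} (snd z))"
    and "integrable lborel (\<lambda>z. f z * \<phi> (fst z) * indicator {a<..b} (snd z))"
proof -
  have p0: "0 \<le> p" using p by simp
  note \<phi>m [measurable] = test_functions_measurable[OF \<phi>]
  have \<phi>ml [measurable]: "\<phi> \<in> borel_measurable lebesgue" by (rule measurable_completion) simp
  obtain B where B: "\<And>x. \<bar>\<phi> x\<bar> \<le> B" by (rule test_functions_bounded[OF \<phi>]) blast
  have B0: "0 \<le> B" using B[of undefined] by linarith
  have \<phi>0: "\<phi> x = 0" if "x \<notin> \<Omega>" for x using test_functions_outside[OF \<phi> that] .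
  have \<Omega>s [measurable]: "\<Omega> \<in> sets lebesgue" and \<Omega>b [measurable]: "\<Omega> \<in> sets borel" using \<Omega>(1) by auto
  have \<Omega>f: "emeasure lebesgue \<Omega> < \<infinity>" using emeasure_bounded_finite[OF \<Omega>(2)] \<Omega>(1) by simp
  note [measurable] = Lp_spaceD(1)[OF f(1)]
  have pair: "integrable lebesgue (\<lambda>x. u x * \<phi> x)"
    "\<bar>LINT x|lebesgue. u x * \<phi> x\<bar> powr p \<le> measure lebesgue \<Omega> powr (p - 1) * (B powr p * Ip lebesgue p u)"
    if u: "u \<in> Lp_space lebesgue p" for u
  proof -
    note [measurable] = Lp_spaceD(1)[OF u]
    have eq: "u x * \<phi> x = indicator \<Omega> x * (u x * \<phi> x)" for x using \<phi>0[of x] by (auto simp: indicator_def)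
    have L: "(\<lambda>x. indicator \<Omega> x * (u x * \<phi> x)) \<in> Lp_space lebesgue p"
      "Ip lebesgue p (\<lambda>x. indicator \<Omega> x * (u x * \<phi> x)) \<le> Ip lebesgue p (\<lambda>x. B * u x)"
    proof -
      have "\<bar>indicator \<Omega> x * (u x * \<phi> x)\<bar> \<le> \<bar>B * u x\<bar>" for x
        using B[of x] B0 by (auto simp: abs_mult indicator_def mult.commute[of "\<bar>u x\<bar>"] intro!: mult_right_mono)
      then have le: "AE x in lebesgue. \<bar>indicator \<Omega> x * (u x * \<phi> x)\<bar> \<le> \<bar>B * u x\<bar>" by auto
      have m: "(\<lambda>x. indicator \<Omega> x * (u x * \<phi> x)) \<in> borel_measurable lebesgue" by measurable
      show "(\<lambda>x. indicator \<Omega> x * (u x * \<phi> x)) \<in> Lp_space lebesgue p"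
        "Ip lebesgue p (\<lambda>x. indicator \<Omega> x * (u x * \<phi> x)) \<le> Ip lebesgue p (\<lambda>x. B * u x)"
        by (rule Lp_space_dominated[OF Lp_space_cmult[OF u, of B] m le p0])+
    qed
    show "integrable lebesgue (\<lambda>x. u x * \<phi> x)"
      by (subst eq) (rule Ip_indicator_integral_le(2)[OF p \<Omega>s \<Omega>f L(1)])
    have "\<bar>LINT x|lebesgue. indicator \<Omega> x * (u x * \<phi> x)\<bar> powr p \<le> measure lebesgue \<Omega> powr (p - 1) * Ip lebesgue p (\<lambda>x. indicator \<Omega> x * (u x * \<phi> x))"
      by (rule Ip_indicator_integral_le(1)[OF p \<Omega>s \<Omega>f L(1)])
    also have "\<dots> \<le> measure lebesgue \<Omega> powr (p - 1) * (B powr p * Ip lebesgue p u)"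
      using L(2) B0 by (intro mult_left_mono) (simp_all add: Ip_cmult)
    finally show "\<bar>LINT x|lebesgue. u x * \<phi> x\<bar> powr p \<le> measure lebesgue \<Omega> powr (p - 1) * (B powr p * Ip lebesgue p u)"
      by (simp only: eq[symmetric])
  qed
  \<comment> \<open>Freezing the value at time 0 extends the pairing to a continuous function on the
    whole line, as \<open>mollified_evaluation\<close> demands.\<close>
  define F where "F = (\<lambda>t. LINT x|lebesgue. v (max 0 t) x * \<phi> x)"
  have Fdiff: "((\<lambda>\<tau>. LINT x|lebesgue. v \<tau> x * \<phi> x) \<longlongrightarrow> (LINT x|lebesgue. v t x * \<phi> x)) (at t within {0..})" if t: "0 \<le> t" for t
  proof -
    define K where "K = measure lebesgue \<Omega> powr (p - 1) * B powr p"
    have "((\<lambda>\<tau>. K * Ip lebesgue p (\<lambda>x. v \<tau> x - v t x)) \<longlongrightarrow> 0) (at t within {0..})"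
      by (rule tendsto_mult_right_zero[OF cont[OF t]])
    then have "((\<lambda>\<tau>. (K * Ip lebesgue p (\<lambda>x. v \<tau> x - v t x)) powr (1 / p)) \<longlongrightarrow> 0 powr (1 / p)) (at t within {0..})"
      using p by (intro tendsto_powr') (auto simp: K_def)
    then have lim: "((\<lambda>\<tau>. (K * Ip lebesgue p (\<lambda>x. v \<tau> x - v t x)) powr (1 / p)) \<longlongrightarrow> 0) (at t within {0..})" using p by simp
    have "((\<lambda>\<tau>. (LINT x|lebesgue. v \<tau> x * \<phi> x) - (LINT x|lebesgue. v t x * \<phi> x)) \<longlongrightarrow> 0) (at t within {0..})"
    proof (rule Lim_null_comparison[OF _ lim])
      show "\<forall>\<^sub>F \<tau> in at t within {0..}. norm ((LINT x|lebesgue. v \<tau> x * \<phi> x) - (LINT x|lebesgue. v t x * \<phi> x)) \<le> (K * Ip lebesgue p (\<lambda>x. v \<tau> x - v t x)) powr (1 / p)"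
        unfolding eventually_at_filter
      proof (intro always_eventually allI impI)
        fix \<tau> :: real assume "\<tau> \<in> {0..}"
        then have \<tau>: "0 \<le> \<tau>" by simp
        have d: "(\<lambda>x. v \<tau> x - v t x) \<in> Lp_space lebesgue p" by (rule Lp_space_diff(1)[OF v[OF \<tau>] v[OF t] p0])
        have "(LINT x|lebesgue. v \<tau> x * \<phi> x) - (LINT x|lebesgue. v t x * \<phi> x) = (LINT x|lebesgue. (v \<tau> x - v t x) * \<phi> x)"
          using pair(1)[OF v[OF \<tau>]] pair(1)[OF v[OF t]] by (simp add: left_diff_distrib)
        then have "\<bar>(LINT x|lebesgue. v \<tau> x * \<phi> x) - (LINT x|lebesgue. v t x * \<phi> x)\<bar> powr p \<le> K * Ip lebesgue p (\<lambda>x. v \<tau> x - v t x)"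
          using pair(2)[OF d] by (simp add: K_def mult.assoc)
        then have "(\<bar>(LINT x|lebesgue. v \<tau> x * \<phi> x) - (LINT x|lebesgue. v t x * \<phi> x)\<bar> powr p) powr (1 / p) \<le> (K * Ip lebesgue p (\<lambda>x. v \<tau> x - v t x)) powr (1 / p)"
          using p by (intro powr_mono2) auto
        then show "norm ((LINT x|lebesgue. v \<tau> x * \<phi> x) - (LINT x|lebesgue. v t x * \<phi> x)) \<le> (K * Ip lebesgue p (\<lambda>x. v \<tau> x - v t x)) powr (1 / p)"
          using p by (simp add: powr_powr)
      qed
    qed
    then show ?thesis by (simp add: LIM_zero_iff)
  qed
  have Fc: "continuous_on UNIV F"
  proof -
    have "continuous_on {0..} (\<lambda>t. LINT x|lebesgue. v t x * \<phi> x)"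
      unfolding continuous_on_def using Fdiff by auto
    then show ?thesis unfolding F_def
      by (rule continuous_on_compose2) (auto intro!: continuous_intros)
  qed
  note [measurable] = borel_measurable_continuous_onI[OF Fc]
  define e where "e = (\<lambda>k. 1 / real (Suc k))"
  have e: "0 < e k" "e k \<le> 1" for k by (auto simp: e_def)
  have elim: "e \<longlonglongrightarrow> 0" unfolding e_def by (rule LIMSEQ_Suc[OF lim_1_over_n])
  let ?\<rho> = "deriv smooth_step"
  have [measurable]: "?\<rho> \<in> borel_measurable borel"
    using smooth_step_deriv(2) by (rule borel_measurable_continuous_onI)
  \<comment> \<open>The shift by \<open>e k\<close> keeps the support in the open half-line even for
    \<open>a = 0\<close>. As each step is 0 up to its shifted threshold, the limit is the indicator
    of an interval open on the left and closed on the right.\<close>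
  define \<eta> where "\<eta> = (\<lambda>k t. smooth_step ((t - (a + e k)) / e k) - smooth_step ((t - (b + e k)) / e k))"
  have \<eta>t: "\<eta> k \<in> test_functions {0<..}" for k
    unfolding \<eta>_def using ab e[of k] by (intro smooth_window_test_function) auto
  have \<eta>m [measurable]: "\<eta> k \<in> borel_measurable borel" for k by (rule test_functions_measurable[OF \<eta>t])
  define D where "D = (\<lambda>k t. ?\<rho> ((t - (a + e k)) / e k) / e k - ?\<rho> ((t - (b + e k)) / e k) / e k)"
  have \<eta>D: "(\<eta> k has_real_derivative D k t) (at t)" for k t
  proof -
    have "((\<lambda>t. smooth_step ((t - c) / e k)) has_real_derivative ?\<rho> ((t - c) / e k) * (1 / e k)) (at t)" for c
      by (rule DERIV_chain2[OF smooth_step_deriv(1)]) (use e[of k] in \<open>auto intro!: derivative_eq_intros\<close>)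
    from DERIV_diff[OF this this] show ?thesis unfolding \<eta>_def D_def by simp
  qed
  have D0: "D k t = 0" if "t < 0" for k t
    using that ab e[of k] by (auto simp: D_def smooth_step_deriv_outside divide_less_0_iff)
  have prod_test: "(\<lambda>z. \<phi> (fst z) * \<eta> k (snd z)) \<in> test_functions (\<Omega> \<times> {0<..})" for k
    by (rule test_functions_Times[OF \<phi> \<eta>t])
  have LHS: "(LINT t|lebesgue_on {0..}. (LINT x|lebesgue_on \<Omega>. v t x * deriv (\<lambda>\<tau>. \<phi> x * \<eta> k \<tau>) t)) = (LINT t|lborel. D k t * F t)" for k
  proof -
    have dv: "deriv (\<lambda>\<tau>. \<phi> x * \<eta> k \<tau>) t = \<phi> x * D k t" for x t
      by (rule DERIV_imp_deriv) (use DERIV_cmult[OF \<eta>D] in auto)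
    have inner: "(LINT x|lebesgue_on \<Omega>. v t x * deriv (\<lambda>\<tau>. \<phi> x * \<eta> k \<tau>) t) = D k t * (LINT x|lebesgue. v t x * \<phi> x)" for t
    proof -
      have "(LINT x|lebesgue_on \<Omega>. v t x * deriv (\<lambda>\<tau>. \<phi> x * \<eta> k \<tau>) t) = (LINT x|lebesgue. indicator \<Omega> x *\<^sub>R (v t x * (\<phi> x * D k t)))"
        unfolding dv using \<Omega>s by (intro integral_restrict_space) auto
      also have "\<dots> = (LINT x|lebesgue. D k t * (v t x * \<phi> x))"
        by (rule Bochner_Integration.integral_cong) (auto simp: indicator_def \<phi>0)
      finally show ?thesis by simp
    qed
    have "(LINT t|lebesgue_on {0..}. (LINT x|lebesgue_on \<Omega>. v t x * deriv (\<lambda>\<tau>. \<phi> x * \<eta> k \<tau>) t))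
      = (LINT t|lebesgue. indicator {0..} t *\<^sub>R (D k t * (LINT x|lebesgue. v t x * \<phi> x)))"
      unfolding inner by (rule integral_restrict_space) auto
    also have "\<dots> = (LINT t|lebesgue. D k t * F t)"
      by (rule Bochner_Integration.integral_cong) (auto simp: indicator_def F_def D0)
    also have "\<dots> = (LINT t|lborel. D k t * F t)"
      by (rule integral_completion) (auto simp: D_def)
    finally show ?thesis .
  qed
  have RHS: "(LINT z|lebesgue_on (\<Omega> \<times> {0..}). vt z * (\<phi> (fst z) * \<eta> k (snd z))) = (LINT z|lborel. f z * (\<phi> (fst z) * \<eta> k (snd z)))" for k
    by (rule fvt[OF test_functions_measurable[OF prod_test]])
  have eqk: "(LINT t|lborel. D k t * F t) = - (LINT z|lborel. f z * (\<phi> (fst z) * \<eta> k (snd z)))" for k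
    using weak[unfolded weak_time_deriv_def, rule_format, OF prod_test[of k]] by (simp add: LHS RHS)
  have l1: "(\<lambda>k. LINT t|lborel. D k t * F t) \<longlonglongrightarrow> F a - F b"
  proof -
    have "(LINT t|lborel. D k t * F t) = (LINT t|lborel. ?\<rho> ((t - (a + e k)) / e k) / e k * F t) - (LINT t|lborel. ?\<rho> ((t - (b + e k)) / e k) / e k * F t)" for k
      unfolding D_def left_diff_distrib e_def
      by (intro Bochner_Integration.integral_diff mollified_evaluation(1)[OF Fc])
    then show ?thesis
      unfolding e_def by (simp only:) (intro tendsto_diff mollified_evaluation(2)[OF Fc])
  qed
  define Q where "Q = \<Omega> \<times> {0..b + 2}"
  have Qb: "Q \<in> sets borel" unfolding Q_def using \<Omega>(1) by (intro borel_Times) auto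
  have "bounded Q" unfolding Q_def using \<Omega>(2) by (intro bounded_Times) auto
  then have Qf: "emeasure lborel Q < \<infinity>" by (rule emeasure_bounded_finite)
  have Qs: "Q \<in> sets lborel" using Qb by simp
  have iQ: "integrable lborel (\<lambda>z. indicator Q z * f z)"
    by (rule Ip_indicator_integral_le(2)[OF p Qs Qf Lp_indicator_mult(1)[OF f(1) Qs p0]])
  then have iQ': "integrable lborel (\<lambda>z. B * \<bar>indicator Q z * f z\<bar>)" by auto
  have step01: "\<bar>smooth_step x - smooth_step y\<bar> \<le> 1" for x y
    using smooth_step_bounds[of x] smooth_step_bounds[of y] by linarith
  have dom: "\<bar>f z * (\<phi> (fst z) * w)\<bar> \<le> B * \<bar>indicator Q z * f z\<bar>" if "\<bar>w\<bar> \<le> 1" "snd z \<notin> {0..b + 2} \<Longrightarrow> w = 0" for z w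
  proof (cases "z \<in> Q")
    case True
    have "\<bar>\<phi> (fst z) * w\<bar> \<le> B * 1" unfolding abs_mult using that B B0 by (intro mult_mono) auto
    then have "\<bar>f z\<bar> * \<bar>\<phi> (fst z) * w\<bar> \<le> \<bar>f z\<bar> * B" by (intro mult_left_mono) auto
    then show ?thesis using True by (simp add: abs_mult mult.commute)
  next
    case False
    then have "f z = 0 \<or> w = 0" using that(2) f(2)[of "fst z" "snd z"] by (auto simp: Q_def mem_Times_iff)
    then show ?thesis using B0 by auto
  qed
  have \<eta>0: "\<eta> k t = 0" if "t \<notin> {0..b + 2}" for k t
  proof (cases "t < 0")
    case True
    then have "(t - (a + e k)) / e k \<le> 0" "(t - (b + e k)) / e k \<le> 0" using ab e[of k] by (auto simp: divide_le_0_iff)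
    then show ?thesis by (simp add: \<eta>_def smooth_step_le_0)
  next
    case False
    then have "1 \<le> (t - (a + e k)) / e k" "1 \<le> (t - (b + e k)) / e k" using that ab e[of k] by (auto simp: pos_le_divide_eq)
    then show ?thesis by (simp add: \<eta>_def smooth_step_ge_1)
  qed
  have \<eta>lim: "(\<lambda>k. \<eta> k t) \<longlonglongrightarrow> indicator {a<..b} t" for t
  proof -
    have s: "(\<lambda>k. smooth_step ((t - (c + e k)) / e k)) \<longlonglongrightarrow> (if c < t then 1 else 0)" for c
    proof (cases "c < t")
      case True
      have "\<forall>\<^sub>F k in sequentially. e k < (t - c) / 2" using True by (intro order_tendstoD(2)[OF elim]) auto
      then have "\<forall>\<^sub>F k in sequentially. smooth_step ((t - (c + e k)) / e k) = 1"
      proof eventually_elim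
        case (elim k)
        then show ?case using e[of k] by (intro smooth_step_ge_1) (simp add: pos_le_divide_eq)
      qed
      then show ?thesis using True by (simp add: tendsto_eventually)
    next
      case False
      then have "smooth_step ((t - (c + e k)) / e k) = 0" for k
        using e[of k] by (intro smooth_step_le_0) (simp add: divide_le_0_iff)
      then show ?thesis using False by simp
    qed
    have "(\<lambda>k. \<eta> k t) \<longlonglongrightarrow> (if a < t then 1 else 0) - (if b < t then 1 else 0)"
      unfolding \<eta>_def by (intro tendsto_diff s)
    then show ?thesis using ab by (auto simp: indicator_def split: if_splits)
  qed
  have fs [measurable]: "fst \<in> borel_measurable (borel :: ('a \<times> real) measure)" "snd \<in> borel_measurable (borel :: ('a \<times> real) measure)"
    by (intro borel_measurable_continuous_onI continuous_intros)+
  have [measurable]: "(\<lambda>z :: 'a \<times> real. \<phi> (fst z)) \<in> borel_measurable borel"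
    "(\<lambda>z :: 'a \<times> real. \<eta> k (snd z)) \<in> borel_measurable borel" 
    "(\<lambda>z :: 'a \<times> real. indicator {a<..b} (snd z) :: real) \<in> borel_measurable borel" for k
    by (rule measurable_compose[OF fs(1) \<phi>m], rule measurable_compose[OF fs(2) \<eta>m], rule measurable_compose[OF fs(2)]) simp
  have l2: "(\<lambda>k. LINT z|lborel. f z * (\<phi> (fst z) * \<eta> k (snd z))) \<longlonglongrightarrow> (LINT z|lborel. f z * (\<phi> (fst z) * indicator {a<..b} (snd z)))"
  proof (rule integral_dominated_convergence[OF _ _ iQ'])
    show "AE z in lborel. (\<lambda>k. f z * (\<phi> (fst z) * \<eta> k (snd z))) \<longlonglongrightarrow> f z * (\<phi> (fst z) * indicator {a<..b} (snd z))"
      by (intro AE_I2 tendsto_intros \<eta>lim)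
    show "AE z in lborel. norm (f z * (\<phi> (fst z) * \<eta> k (snd z))) \<le> B * \<bar>indicator Q z * f z\<bar>" for k
      unfolding real_norm_def by (intro AE_I2 dom \<eta>0) (simp add: \<eta>_def step01)
  qed measurable
  have "F a - F b = - (LINT z|lborel. f z * (\<phi> (fst z) * indicator {a<..b} (snd z)))"
    using LIMSEQ_unique[OF l1, unfolded eqk, OF tendsto_minus[OF l2]] .
  then show "(LINT x|lebesgue. v b x * \<phi> x) - (LINT x|lebesgue. v a x * \<phi> x)
    = (LINT z|lborel. f z * \<phi> (fst z) * indicator {a<..b} (snd z))"
    using ab by (simp add: F_def mult.assoc)
  have "integrable lborel (\<lambda>z. f z * (\<phi> (fst z) * indicator {a<..b} (snd z)))"
  proof (rule Bochner_Integration.integrable_bound[OF iQ'])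
    show "AE z in lborel. norm (f z * (\<phi> (fst z) * indicator {a<..b} (snd z))) \<le> norm (B * \<bar>indicator Q z * f z\<bar>)"
    proof (rule AE_I2)
      fix z :: "'a \<times> real"
      have "\<bar>f z * (\<phi> (fst z) * indicator {a<..b} (snd z))\<bar> \<le> B * \<bar>indicator Q z * f z\<bar>"
        using ab by (intro dom) (auto simp: indicator_def)
      then show "norm (f z * (\<phi> (fst z) * indicator {a<..b} (snd z))) \<le> norm (B * \<bar>indicator Q z * f z\<bar>)" by simp
    qed
  qed measurable
  then show "integrable lborel (\<lambda>z. f z * \<phi> (fst z) * indicator {a<..b} (snd z))" by (simp add: mult.assoc)
qed

text \<open>The function \<open>vt\<close> is measurable only for the completed measure on
  \<open>\<Omega> \<times> {0..}\<close>. A Borel representative extended by zero can be sliced and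
  integrated iteratively, and the fundamental lemma removes the spatial test function from
  \<open>time_increment_test\<close>.\<close>

lemma time_increment:
  fixes \<Omega> :: "'a::euclidean_space set" and v :: "real \<Rightarrow> 'a \<Rightarrow> real"
  assumes \<Omega>: "open \<Omega>" "bounded \<Omega>" and p: "1 < p"
    and vt: "vt \<in> Lp_space (lebesgue_on (\<Omega> \<times> {0..})) p" and weak: "weak_time_deriv \<Omega> v vt"
    and v: "\<And>t. 0 \<le> t \<Longrightarrow> v t \<in> Lp_space lebesgue p" "\<And>t. 0 \<le> t \<Longrightarrow> AE x in lebesgue. x \<notin> \<Omega> \<longrightarrow> v t x = 0"
    and cont: "\<And>t. 0 \<le> t \<Longrightarrow> ((\<lambda>\<tau>. Ip lebesgue p (\<lambda>x. v \<tau> x - v t x)) \<longlongrightarrow> 0) (at t within {0..})"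
  obtains f :: "'a \<times> real \<Rightarrow> real" where "f \<in> borel_measurable borel" "f \<in> Lp_space lborel p"
    "\<And>x t. x \<notin> \<Omega> \<or> t < 0 \<Longrightarrow> f (x, t) = 0"
    "AE t in lborel. 0 \<le> t \<longrightarrow> (AE x in lborel. x \<in> \<Omega> \<longrightarrow> vt (x, t) = f (x, t))"
    "\<And>a b. 0 \<le> a \<Longrightarrow> a \<le> b \<Longrightarrow> AE x in lebesgue. v b x - v a x = (LINT \<tau>|lborel. indicator {a<..b} \<tau> * f (x, \<tau>))"
proof -
  have p0: "0 \<le> p" using p by simp
  define S where "S = \<Omega> \<times> {0 :: real..}"
  have Sb [measurable]: "S \<in> sets borel" unfolding S_def using \<Omega>(1) by (intro borel_Times) auto
  have Sl: "S \<inter> space lebesgue \<in> sets lebesgue" using Sb by simp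
  have Sl' [measurable]: "S \<in> sets lebesgue" using Sb by simp
  have vtm: "(\<lambda>z. indicator S z *\<^sub>R vt z) \<in> borel_measurable lebesgue"
    using Lp_spaceD(1)[OF vt] borel_measurable_restrict_space_iff[OF Sl, of vt] by (simp add: S_def)
  obtain g where g [measurable]: "g \<in> borel_measurable lborel" and gae: "AE z in lborel. indicator S z *\<^sub>R vt z = g z"
    using completion_ex_borel_measurable_real[OF vtm] by blast
  define f where "f = (\<lambda>z. indicator S z * g z)"
  have fm [measurable]: "f \<in> borel_measurable borel" unfolding f_def using g by simp
  have fml [measurable]: "f \<in> borel_measurable lebesgue" by (rule measurable_completion) simp
  have fae: "AE z in lborel. indicator S z * vt z = f z"
    using gae by eventually_elim (auto simp: f_def indicator_def split: if_splits)
  have fae': "AE z in lebesgue. indicator S z * vt z = f z" by (rule AE_completion[OF fae])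
  have f0: "f (x, t) = 0" if "x \<notin> \<Omega> \<or> t < 0" for x t using that by (auto simp: f_def S_def)
  have "Lp_energy lborel p f = Lp_energy lebesgue p f"
    unfolding Lp_energy_def by (rule nn_integral_completion[symmetric])
  also have "\<dots> = Lp_energy lebesgue p (\<lambda>z. indicator S z * vt z)"
    by (rule Lp_energy_cong_AE) (use fae' in \<open>auto elim: eventually_mono\<close>)
  also have "\<dots> = Lp_energy (lebesgue_on S) p vt"
    unfolding Lp_energy_def using Sl
    by (subst nn_integral_restrict_space) (auto intro!: nn_integral_cong simp: indicator_def)
  also have "\<dots> < \<infinity>" using vt by (simp add: Lp_space_def S_def)
  finally have fL: "f \<in> Lp_space lborel p" by (simp add: Lp_space_def)
  have fvt: "(LINT z|lebesgue_on (\<Omega> \<times> {0..}). vt z * \<phi> z) = (LINT z|lborel. f z * \<phi> z)" if [measurable]: "\<phi> \<in> borel_measurable borel" for \<phi>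
  proof -
    have [measurable]: "\<phi> \<in> borel_measurable lebesgue" by (rule measurable_completion) simp
    note [measurable] = vtm[unfolded real_scaleR_def]
    have "(LINT z|lebesgue_on (\<Omega> \<times> {0..}). vt z * \<phi> z) = (LINT z|lebesgue. indicator S z *\<^sub>R (vt z * \<phi> z))"
      unfolding S_def[symmetric] using Sl by (rule integral_restrict_space)
    also have "\<dots> = (LINT z|lebesgue. (indicator S z * vt z) * \<phi> z)" by (simp add: mult.assoc)
    also have "\<dots> = (LINT z|lebesgue. f z * \<phi> z)"
      by (rule integral_cong_AE) (use fae' in \<open>auto elim: eventually_mono\<close>)
    also have "\<dots> = (LINT z|lborel. f z * \<phi> z)" by (rule integral_completion) simp
    finally show ?thesis .
  qed
  have \<Omega>s [measurable]: "\<Omega> \<in> sets lebesgue" using \<Omega>(1) by auto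
  have \<Omega>f: "emeasure lebesgue \<Omega> < \<infinity>" using emeasure_bounded_finite[OF \<Omega>(2)] \<Omega>(1) by simp
  have inc: "AE x in lebesgue. v b x - v a x = (LINT \<tau>|lborel. indicator {a<..b} \<tau> * f (x, \<tau>))" if ab: "0 \<le> a" "a \<le> b" for a b
  proof -
    have b0: "0 \<le> b" using ab by simp
    define h where "h = (\<lambda>x. LINT \<tau>|lborel. indicator {a<..b} \<tau> * f (x, \<tau>))"
    define Q where "Q = \<Omega> \<times> {a<..b}"
    have Qs: "Q \<in> sets lborel" unfolding Q_def using \<Omega>(1) by (simp, intro borel_Times) auto
    have "bounded Q" unfolding Q_def using \<Omega>(2) by (intro bounded_Times) auto
    then have Qf: "emeasure lborel Q < \<infinity>" by (rule emeasure_bounded_finite)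
    have iQ: "integrable lborel (\<lambda>z. indicator Q z * f z)"
      by (rule Ip_indicator_integral_le(2)[OF p Qs Qf Lp_indicator_mult(1)[OF fL Qs p0]])
    have eqQ: "indicator Q z * f z = indicator {a<..b} (snd z) * f z" for z
      using f0[of "fst z" "snd z"] by (auto simp: Q_def indicator_def mem_Times_iff)
    have i1: "integrable ((lborel :: 'a measure) \<Otimes>\<^sub>M lborel) (\<lambda>z. indicator {a<..b} (snd z) * f z)"
      unfolding lborel_prod using iQ unfolding eqQ .
    have hi: "integrable lborel h"
      using lborel_pair.integrable_fst'[OF i1] by (simp add: h_def)
    have hm [measurable]: "h \<in> borel_measurable borel" using borel_measurable_integrable[OF hi] by simp
    have hil: "integrable lebesgue h" using hi by (simp add: integrable_completion)
    have h0: "h x = 0" if "x \<notin> \<Omega>" for x using f0[of x] that by (simp add: h_def)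
    \<comment> \<open>Outside \<open>\<Omega>\<close> the function \<open>v\<close> vanishes only
      almost everywhere; the indicator makes \<open>d\<close> vanish there at every point, as the
      fundamental lemma requires.\<close>
    define d where "d = (\<lambda>x. indicator \<Omega> x * (v b x - v a x) - h x)"
    have vi: "integrable lebesgue (\<lambda>x. indicator \<Omega> x * (v b x - v a x))"
      by (intro Ip_indicator_integral_le(2)[OF p \<Omega>s \<Omega>f] Lp_indicator_mult(1) Lp_space_diff(1) v ab b0 \<Omega>s p0)
    have di: "integrable lebesgue d" unfolding d_def using vi hil by (rule Bochner_Integration.integrable_diff)
    have "AE x in lebesgue. d x = 0"
    proof (rule fundamental_lemma_test_functions[OF \<Omega>(1) di])
      show "d x = 0" if "x \<notin> \<Omega>" for x using that h0 by (simp add: d_def)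
      fix \<phi> assume \<phi>: "\<phi> \<in> test_functions \<Omega>"
      note tf = time_increment_test[OF \<Omega> p weak v(1) cont fL f0 fvt ab \<phi>]
      note \<phi>m [measurable] = test_functions_measurable[OF \<phi>]
      have \<phi>ml [measurable]: "\<phi> \<in> borel_measurable lebesgue" by (rule measurable_completion) simp
      obtain B where B: "\<And>x. \<bar>\<phi> x\<bar> \<le> B" by (rule test_functions_bounded[OF \<phi>]) blast
      have \<phi>0: "\<phi> x = 0" if "x \<notin> \<Omega>" for x using test_functions_outside[OF \<phi> that] .
      have mi: "integrable lebesgue (\<lambda>x. u x * \<phi> x)" if "integrable lebesgue u" for u
      proof (rule Bochner_Integration.integrable_bound[of lebesgue "\<lambda>x. B * u x"])
        show "AE x in lebesgue. norm (u x * \<phi> x) \<le> norm (B * u x)"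
        proof (rule AE_I2)
          fix x
          have "\<bar>\<phi> x\<bar> \<le> \<bar>B\<bar>" using B[of x] by linarith
          then have "\<bar>u x\<bar> * \<bar>\<phi> x\<bar> \<le> \<bar>u x\<bar> * \<bar>B\<bar>" by (intro mult_left_mono) auto
          then show "norm (u x * \<phi> x) \<le> norm (B * u x)" by (simp add: abs_mult mult.commute)
        qed
      qed (use that in auto)
      have ui: "integrable lebesgue (\<lambda>x. v t x * \<phi> x)" if "0 \<le> t" for t
      proof -
        have "integrable lebesgue (\<lambda>x. indicator \<Omega> x * v t x)"
          by (intro Ip_indicator_integral_le(2)[OF p \<Omega>s \<Omega>f] Lp_indicator_mult(1) v that \<Omega>s p0)
        from mi[OF this] show ?thesis
          by (rule Bochner_Integration.integrable_cong[THEN iffD1, rotated 2]) (auto simp: indicator_def \<phi>0)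
      qed
      have "(LINT x|lebesgue. d x * \<phi> x) = (LINT x|lebesgue. (v b x * \<phi> x - v a x * \<phi> x) - h x * \<phi> x)"
        by (rule Bochner_Integration.integral_cong) (auto simp: d_def indicator_def \<phi>0 algebra_simps)
      also have "\<dots> = (LINT x|lebesgue. v b x * \<phi> x) - (LINT x|lebesgue. v a x * \<phi> x) - (LINT x|lebesgue. h x * \<phi> x)"
        using ui[OF b0] ui[OF ab(1)] mi[OF hil] by simp
      also have "(LINT x|lebesgue. h x * \<phi> x) = (LINT x|lborel. h x * \<phi> x)"
        by (rule integral_completion) simp
      also have "\<dots> = (LINT x|lborel. LINT \<tau>|lborel. f (x, \<tau>) * \<phi> x * indicator {a<..b} \<tau>)"
        unfolding h_def by (intro Bochner_Integration.integral_cong refl) (simp add: mult_ac flip: integral_mult_left_zero)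
      also have "\<dots> = (LINT z|lborel. f z * \<phi> (fst z) * indicator {a<..b} (snd z))"
        using lborel_pair.integral_fst'[of "\<lambda>z. f z * \<phi> (fst z) * indicator {a<..b} (snd z)"] tf(2)
        by (simp add: lborel_prod)
      finally show "(LINT x|lebesgue. d x * \<phi> x) = 0" using tf(1) by simp
    qed
    then show ?thesis
      using v(2)[OF b0] v(2)[OF ab(1)]
    proof eventually_elim
      case (elim x)
      then show ?case using h0[of x] by (cases "x \<in> \<Omega>") (auto simp: d_def h_def)
    qed
  qed
  have "AE t in lborel. 0 \<le> t \<longrightarrow> (AE x in lborel. x \<in> \<Omega> \<longrightarrow> vt (x, t) = f (x, t))"
    using AE_lborel_prod_swap[OF fae]
  proof (eventually_elim, intro impI)
    fix t :: real assume ae: "AE x in lborel. indicator S (x, t) * vt (x, t) = f (x, t)" and t: "0 \<le> t"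
    show "AE x in lborel. x \<in> \<Omega> \<longrightarrow> vt (x, t) = f (x, t)"
      using ae by eventually_elim (use t in \<open>auto simp: S_def\<close>)
  qed
  with fm fL f0 inc that show ?thesis by blast
qed

subsection \<open>Continuity of translations and time averages in \<open>L\<^sup>p\<close>\<close>

lemma Lp_translate:
  fixes f :: "'a::euclidean_space \<Rightarrow> real"
  assumes f: "f \<in> Lp_space lborel p"
  shows "(\<lambda>z. f (c + z)) \<in> Lp_space lborel p" "Ip lborel p (\<lambda>z. f (c + z)) = Ip lborel p f"
proof -
  have fm [measurable]: "f \<in> borel_measurable borel" using Lp_spaceD(1)[OF f] by simp
  have d: "lborel = distr lborel borel ((+) c)" by (rule lborel_distr_plus[symmetric])
  have "integrable lborel (\<lambda>z. \<bar>f (c + z)\<bar> powr p) \<longleftrightarrow> integrable (distr lborel borel ((+) c)) (\<lambda>z. \<bar>f z\<bar> powr p)"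
    by (subst integrable_distr_eq) auto
  then show "(\<lambda>z. f (c + z)) \<in> Lp_space lborel p"
    using Lp_spaceD(2)[OF f] unfolding d[symmetric] by (simp add: Lp_space_iff)
  have "(LINT z|distr lborel borel ((+) c). \<bar>f z\<bar> powr p) = (LINT z|lborel. \<bar>f (c + z)\<bar> powr p)"
    by (subst integral_distr) auto
  then show "Ip lborel p (\<lambda>z. f (c + z)) = Ip lborel p f"
    unfolding Ip_def d[symmetric] by simp
qed

definition transl_cont :: "real \<Rightarrow> (nat \<Rightarrow> 'a::euclidean_space) \<Rightarrow> ('a \<Rightarrow> real) \<Rightarrow> bool" where
  "transl_cont p h f \<longleftrightarrow> f \<in> Lp_space lborel p \<and> (\<lambda>n. Ip lborel p (\<lambda>z. f (h n + z) - f z)) \<longlonglongrightarrow> 0"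

text \<open>Scheffe's argument. At a point of the open set \<open>U\<close>, small translations stay
  in \<open>U\<close>, so the positive part of \<open>indicator U z - indicator U (h n + z)\<close>
  vanishes in the limit under an integrable bound. Translation preserves the total mass, so the
  modulus has exactly twice the integral of the positive part.\<close>

lemma transl_cont_indicator_open:
  fixes U :: "'a::euclidean_space set"
  assumes h: "h \<longlonglongrightarrow> 0" and U: "open U" "emeasure lborel U < \<infinity>"
  shows "(\<lambda>n. LINT z|lborel. \<bar>indicator U (h n + z) - indicator U z :: real\<bar>) \<longlonglongrightarrow> 0"
proof -
  have [measurable]: "U \<in> sets borel" using U by simp
  have iU: "integrable lborel (indicator U :: 'a \<Rightarrow> real)" using U by simp
  have iUh: "integrable lborel (\<lambda>z. indicator U (h n + z) :: real)" "(LINT z|lborel. indicator U (h n + z) :: real) = (LINT z|lborel. indicator U z)" for n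
  proof -
    have d: "lborel = distr lborel borel ((+) (h n))" by (rule lborel_distr_plus[symmetric])
    have "integrable (distr lborel borel ((+) (h n))) (indicator U :: 'a \<Rightarrow> real)" unfolding d[symmetric] by (rule iU)
    then show "integrable lborel (\<lambda>z. indicator U (h n + z) :: real)"
      by (subst (asm) integrable_distr_eq) auto
    have "(LINT z|distr lborel borel ((+) (h n)). indicator U z :: real) = (LINT z|lborel. indicator U (h n + z))"
      by (subst integral_distr) auto
    then show "(LINT z|lborel. indicator U (h n + z) :: real) = (LINT z|lborel. indicator U z)" unfolding d[symmetric] by simp
  qed
  have "(\<lambda>n. LINT z|lborel. max 0 (indicator U z - indicator U (h n + z) :: real)) \<longlonglongrightarrow> (LINT z|(lborel :: 'a measure). 0)"
  proof (rule integral_dominated_convergence[OF _ _ iU])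
    show "AE z in lborel. (\<lambda>n. max 0 (indicator U z - indicator U (h n + z) :: real)) \<longlonglongrightarrow> 0"
    proof (rule AE_I2)
      fix z
      have hz: "(\<lambda>n. h n + z) \<longlonglongrightarrow> z" using tendsto_add[OF h tendsto_const[of z]] by simp
      show "(\<lambda>n. max 0 (indicator U z - indicator U (h n + z) :: real)) \<longlonglongrightarrow> 0"
      proof (cases "z \<in> U")
        case True
        then have "\<forall>\<^sub>F n in sequentially. h n + z \<in> U" using topological_tendstoD[OF hz U(1)] by blast
        then have "\<forall>\<^sub>F n in sequentially. max 0 (indicator U z - indicator U (h n + z) :: real) = 0"
          by eventually_elim (use True in auto)
        then show ?thesis by (rule tendsto_eventually)
      qed (simp add: indicator_def)
    qed
  qed (auto simp: indicator_def)
  then have lim: "(\<lambda>n. 2 * (LINT z|lborel. max 0 (indicator U z - indicator U (h n + z) :: real))) \<longlonglongrightarrow> 0"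
    using tendsto_mult_right_zero by force
  have "(LINT z|lborel. \<bar>indicator U (h n + z) - indicator U z :: real\<bar>) = 2 * (LINT z|lborel. max 0 (indicator U z - indicator U (h n + z) :: real))" for n
  proof -
    have im: "integrable lborel (\<lambda>z. max 0 (indicator U z - indicator U (h n + z) :: real))"
      using iU iUh by (intro integrable_max) auto
    have "(LINT z|lborel. \<bar>indicator U (h n + z) - indicator U z :: real\<bar>)
      = (LINT z|lborel. 2 * max 0 (indicator U z - indicator U (h n + z)) - (indicator U z - indicator U (h n + z)))"
      by (rule Bochner_Integration.integral_cong) (auto simp: max_def)
    also have "\<dots> = 2 * (LINT z|lborel. max 0 (indicator U z - indicator U (h n + z))) - (LINT z|lborel. indicator U z - indicator U (h n + z))"
      using im iU iUh by (subst Bochner_Integration.integral_diff) auto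
    also have "(LINT z|lborel. indicator U z - indicator U (h n + z) :: real) = 0"
      using iU iUh by (subst Bochner_Integration.integral_diff) auto
    finally show ?thesis by simp
  qed
  with lim show ?thesis by simp
qed

text \<open>Outer regularity replaces \<open>A\<close> by an open set up to a small set
  \<open>W\<close>, whose translates have the same small measure. Differences of indicators have
  values \<open>-1\<close>, \<open>0\<close>, \<open>1\<close>, so the power \<open>p\<close> has no
  effect.\<close>

lemma transl_cont_indicator:
  fixes A :: "'a::euclidean_space set"
  assumes p: "1 < p" and h: "h \<longlonglongrightarrow> 0" and A: "A \<in> sets borel" "emeasure lborel A < \<infinity>"
  shows "transl_cont p h (indicator A)"
  unfolding transl_cont_def
proof
  have ab: "\<bar>indicator A z\<bar> powr p = (indicator A z :: real)" for z :: 'a by (auto simp: indicator_def)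
  show "indicator A \<in> Lp_space lborel p"
    unfolding Lp_space_iff ab using A by (auto intro: borel_measurable_indicator)
  have abd: "\<bar>indicator A x - indicator A y\<bar> powr p = \<bar>indicator A x - indicator A y :: real\<bar>" for x y :: 'a
    by (auto simp: indicator_def)
  show "(\<lambda>n. Ip lborel p (\<lambda>z. indicator A (h n + z) - indicator A z)) \<longlonglongrightarrow> 0"
    unfolding Ip_def abd
  proof (rule LIMSEQ_I)
    fix e :: real assume e: "0 < e"
    then have "0 < min (e / 4) 1" by simp
    then obtain U where U: "open U" "A \<subseteq> U" "emeasure lborel (U - A) < ennreal (min (e / 4) 1)"
      by (rule outer_regular_lborel[OF A(1)])
    note [measurable] = A(1) borel_open[OF U(1)]
    have "emeasure lborel U = emeasure lborel A + emeasure lborel (U - A)"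
      using U(2) A by (subst plus_emeasure) (auto simp: Un_absorb1)
    also have "\<dots> < \<infinity>" using A(2) U(3) by (auto simp: ennreal_add_eq_top less_top[symmetric])
    finally have Uf: "emeasure lborel U < \<infinity>" .
    define W where "W = U - A"
    have Wm [measurable]: "W \<in> sets borel" unfolding W_def by measurable
    have Wf: "emeasure lborel W < \<infinity>" using U(3) unfolding W_def by (rule order.strict_trans) simp
    have Wi: "integrable lborel (indicator W :: 'a \<Rightarrow> real)" using Wf by simp
    have Ws: "measure lborel W < e / 4"
    proof -
      have "ennreal (measure lborel W) = emeasure lborel W" using Wf by (simp add: emeasure_eq_ennreal_measure less_top)
      also have "\<dots> < ennreal (min (e / 4) 1)" using U(3) by (simp add: W_def)
      finally show ?thesis using e by (simp add: ennreal_less_iff)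
    qed
    have Wh: "integrable lborel (\<lambda>z. indicator W (c + z) :: real)" "(LINT z|lborel. indicator W (c + z) :: real) = measure lborel W" for c
    proof -
      have d: "lborel = distr lborel borel ((+) c)" by (rule lborel_distr_plus[symmetric])
      have "integrable (distr lborel borel ((+) c)) (indicator W :: 'a \<Rightarrow> real)" unfolding d[symmetric] by (rule Wi)
      then show "integrable lborel (\<lambda>z. indicator W (c + z) :: real)"
        by (subst (asm) integrable_distr_eq) auto
      have "(LINT z|distr lborel borel ((+) c). indicator W z :: real) = (LINT z|lborel. indicator W (c + z))"
        by (subst integral_distr) auto
      then show "(LINT z|lborel. indicator W (c + z) :: real) = measure lborel W" unfolding d[symmetric] by simp
    qed
    have iUd: "integrable lborel (\<lambda>z. \<bar>indicator U (c + z) - indicator U z :: real\<bar>)" for c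
    proof -
      have d: "lborel = distr lborel borel ((+) c)" by (rule lborel_distr_plus[symmetric])
      have "integrable (distr lborel borel ((+) c)) (indicator U :: 'a \<Rightarrow> real)" unfolding d[symmetric] using Uf by simp
      then have "integrable lborel (\<lambda>z. indicator U (c + z) :: real)" by (subst (asm) integrable_distr_eq) auto
      then show ?thesis using Uf by simp
    qed
    obtain N where N: "\<And>n. N \<le> n \<Longrightarrow> \<bar>LINT z|lborel. \<bar>indicator U (h n + z) - indicator U z :: real\<bar>\<bar> < e / 4"
      using LIMSEQ_D[OF transl_cont_indicator_open[OF h U(1) Uf], of "e / 4"] e by auto
    have "norm ((LINT z|lborel. \<bar>indicator A (h n + z) - indicator A z :: real\<bar>) - 0) < e" if n: "N \<le> n" for n
    proof -
      have "(LINT z|lborel. \<bar>indicator A (h n + z) - indicator A z :: real\<bar>)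
        \<le> (LINT z|lborel. indicator W (h n + z) + indicator W z + \<bar>indicator U (h n + z) - indicator U z\<bar>)"
      proof (rule integral_mono_AE')
        show "integrable lborel (\<lambda>z. indicator W (h n + z) + indicator W z + \<bar>indicator U (h n + z) - indicator U z\<bar> :: real)"
          using Wh(1)[of "h n"] Wi iUd[of "h n"] by auto
        show "AE z in lborel. \<bar>indicator A (h n + z) - indicator A z :: real\<bar> \<le> indicator W (h n + z) + indicator W z + \<bar>indicator U (h n + z) - indicator U z\<bar>"
          using U(2) by (intro AE_I2) (auto simp: indicator_def W_def)
      qed auto
      also have "\<dots> = measure lborel W + measure lborel W + (LINT z|lborel. \<bar>indicator U (h n + z) - indicator U z\<bar>)"
        using Wh[of "h n"] Wi iUd[of "h n"] by simp
      also have "\<dots> < e / 4 + e / 4 + e / 4" using Ws N[OF n] by linarith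
      also have "\<dots> < e" using e by simp
      finally show ?thesis by (simp add: integral_nonneg_AE)
    qed
    then show "\<exists>N. \<forall>n\<ge>N. norm ((LINT z|lborel. \<bar>indicator A (h n + z) - indicator A z :: real\<bar>) - 0) < e" by blast
  qed
qed

lemma transl_cont_cmult:
  assumes "transl_cont p h f"
  shows "transl_cont p h (\<lambda>z. c * f z)"
proof -
  have "(\<lambda>n. \<bar>c\<bar> powr p * Ip lborel p (\<lambda>z. f (h n + z) - f z)) \<longlonglongrightarrow> 0"
    using assms by (intro tendsto_mult_right_zero) (simp add: transl_cont_def)
  then show ?thesis
    using assms unfolding Ip_cmult[symmetric] by (auto simp: transl_cont_def right_diff_distrib intro: Lp_space_cmult)
qed

lemma transl_cont_add:
  assumes p: "1 < p" and f: "transl_cont p h f" and g: "transl_cont p h g"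
  shows "transl_cont p h (\<lambda>z. f z + g z)"
proof -
  have p0: "0 \<le> p" using p by simp
  have fL: "f \<in> Lp_space lborel p" and gL: "g \<in> Lp_space lborel p" using f g by (auto simp: transl_cont_def)
  have "(\<lambda>n. 2 powr p * (Ip lborel p (\<lambda>z. f (h n + z) - f z) + Ip lborel p (\<lambda>z. g (h n + z) - g z))) \<longlonglongrightarrow> 2 powr p * (0 + 0)"
    using f g by (intro tendsto_intros) (auto simp: transl_cont_def)
  then have up: "(\<lambda>n. 2 powr p * (Ip lborel p (\<lambda>z. f (h n + z) - f z) + Ip lborel p (\<lambda>z. g (h n + z) - g z))) \<longlonglongrightarrow> 0" by simp
  have "(\<lambda>n. Ip lborel p (\<lambda>z. (f (h n + z) + g (h n + z)) - (f z + g z))) \<longlonglongrightarrow> 0"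
  proof (rule tendsto_sandwich[OF _ _ tendsto_const up])
    show "\<forall>\<^sub>F n in sequentially. Ip lborel p (\<lambda>z. (f (h n + z) + g (h n + z)) - (f z + g z))
      \<le> 2 powr p * (Ip lborel p (\<lambda>z. f (h n + z) - f z) + Ip lborel p (\<lambda>z. g (h n + z) - g z))"
    proof (intro always_eventually allI)
      fix n
      have "(\<lambda>z. (f (h n + z) + g (h n + z)) - (f z + g z)) = (\<lambda>z. (f (h n + z) - f z) + (g (h n + z) - g z))" by auto
      then show "Ip lborel p (\<lambda>z. (f (h n + z) + g (h n + z)) - (f z + g z))
        \<le> 2 powr p * (Ip lborel p (\<lambda>z. f (h n + z) - f z) + Ip lborel p (\<lambda>z. g (h n + z) - g z))"
        using Lp_space_add(2)[OF Lp_space_diff(1)[OF Lp_translate(1)[OF fL] fL p0] Lp_space_diff(1)[OF Lp_translate(1)[OF gL] gL p0] p0, of "h n" "h n"]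
        by simp
    qed
  qed simp
  then show ?thesis using Lp_space_add(1)[OF fL gL p0] by (simp add: transl_cont_def)
qed

lemma transl_cont_closed:
  assumes p: "1 < p" and f: "f \<in> Lp_space lborel p"
    and g: "\<And>i :: nat. transl_cont p h (g i)" and lim: "(\<lambda>i. Ip lborel p (\<lambda>z. g i z - f z)) \<longlonglongrightarrow> 0"
  shows "transl_cont p h f"
  unfolding transl_cont_def
proof (intro conjI f LIMSEQ_I)
  fix e :: real assume e: "0 < e"
  have p0: "0 \<le> p" using p by simp
  define c where "c = (2 :: real) powr p"
  have c: "0 < c" by (simp add: c_def)
  \<comment> \<open>The denominator collects the two uses of \<open>diff_triangle_Ip\<close>:
    \<open>c * (d + c * (d + d)) = d * (c + 2 * c * c)\<close>.\<close>
  define d where "d = e / (c + 2 * c * c)"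
  have d: "0 < d" using e c by (simp add: d_def add_pos_pos)
  obtain i where i: "Ip lborel p (\<lambda>z. g i z - f z) < d"
    using LIMSEQ_D[OF lim d] by force
  have gL: "g i \<in> Lp_space lborel p" using g by (simp add: transl_cont_def)
  have "(\<lambda>n. Ip lborel p (\<lambda>z. g i (h n + z) - g i z)) \<longlonglongrightarrow> 0" using g by (simp add: transl_cont_def)
  then obtain N where N: "\<And>n. N \<le> n \<Longrightarrow> Ip lborel p (\<lambda>z. g i (h n + z) - g i z) < d"
    using LIMSEQ_D[OF _ d] by force
  have "norm (Ip lborel p (\<lambda>z. f (h n + z) - f z) - 0) < e" if n: "N \<le> n" for n
  proof -
    note fh = Lp_translate(1)[OF f, of "h n"] and gh = Lp_translate(1)[OF gL, of "h n"]
    have gf: "(\<lambda>z. g i z - f z) \<in> Lp_space lborel p" by (rule Lp_space_diff(1)[OF gL f p0])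
    have A: "Ip lborel p (\<lambda>z. f (h n + z) - g i (h n + z)) < d"
      using Lp_translate(2)[OF gf, of "h n"] i Ip_minus_commute[of lborel p "\<lambda>z. f (h n + z)" "\<lambda>z. g i (h n + z)"] by simp
    have "Ip lborel p (\<lambda>z. f (h n + z) - f z) \<le> c * (Ip lborel p (\<lambda>z. f (h n + z) - g i (h n + z)) + Ip lborel p (\<lambda>z. g i (h n + z) - f z))"
      unfolding c_def by (rule diff_triangle_Ip[OF fh gh f p0])
    also have "\<dots> \<le> c * (Ip lborel p (\<lambda>z. f (h n + z) - g i (h n + z)) + c * (Ip lborel p (\<lambda>z. g i (h n + z) - g i z) + Ip lborel p (\<lambda>z. g i z - f z)))"
      using c unfolding c_def by (intro mult_left_mono add_left_mono diff_triangle_Ip[OF gh gL f p0]) auto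
    also have "\<dots> < c * (d + c * (d + d))"
      using A N[OF n] i c by (intro mult_strict_left_mono add_strict_mono) auto
    also have "\<dots> = d * (c + 2 * c * c)" by (simp add: algebra_simps)
    also have "\<dots> = e" using c by (simp add: d_def add_pos_pos less_imp_neq[THEN not_sym])
    finally show ?thesis by simp
  qed
  then show "\<exists>N. \<forall>n\<ge>N. norm (Ip lborel p (\<lambda>z. f (h n + z) - f z) - 0) < e" by blast
qed

text \<open>Indicators yield simple functions by linearity, and these are dense; translations
  preserve the energy, so the property passes to limits.\<close>

lemma transl_cont_Lp:
  fixes f :: "'a::euclidean_space \<Rightarrow> real"
  assumes p: "1 < p" and h: "h \<longlonglongrightarrow> 0" and f: "f \<in> Lp_space lborel p"
  shows "transl_cont p h f"
proof -
  have p0: "0 \<le> p" using p by simp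
  have zero: "transl_cont p h (\<lambda>z. 0)" by (simp add: transl_cont_def)
  have simple: "transl_cont p h g" if sg: "simple_function lborel g" and g: "g \<in> Lp_space lborel p" for g
  proof -
    have rep: "g = (\<lambda>z. \<Sum>y\<in>range g. y * indicator (g -` {y}) z)"
    proof (rule ext)
      fix z
      have "g z = (\<Sum>y\<in>g ` space lborel. indicator (g -` {y} \<inter> space lborel) z *\<^sub>R y)"
        by (rule simple_function_indicator_representation_banach[OF sg]) simp
      also have "\<dots> = (\<Sum>y\<in>range g. y * indicator (g -` {y}) z)" by (simp add: mult.commute)
      finally show "g z = (\<Sum>y\<in>range g. y * indicator (g -` {y}) z)" .
    qed
    have fin: "finite (range g)" using simple_functionD(1)[OF sg] by simp
    have term_tc: "transl_cont p h (\<lambda>z. y * indicator (g -` {y}) z)" for y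
    proof (cases "y = 0")
      case False
      have m: "g -` {y} \<in> sets borel" using simple_functionD(2)[OF sg, of "{y}"] by simp
      note [measurable] = m
      have "integrable lborel (\<lambda>z. (1 / \<bar>y\<bar> powr p) * \<bar>g z\<bar> powr p)" using Lp_spaceD(2)[OF g] by simp
      then have "integrable lborel (indicator (g -` {y}) :: 'a \<Rightarrow> real)"
        by (rule Bochner_Integration.integrable_bound) (use False in \<open>auto simp: indicator_def intro!: AE_I2\<close>)
      then have "emeasure lborel (g -` {y}) < \<infinity>"
        by (subst (asm) integrable_indicator_iff) auto
      then show ?thesis by (intro transl_cont_cmult transl_cont_indicator[OF p h m])
    qed (use zero in simp)
    have "transl_cont p h (\<lambda>z. \<Sum>y\<in>Y. y * indicator (g -` {y}) z)" if "finite Y" for Y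
      using that
    proof (induction Y rule: finite_induct)
      case empty
      then show ?case using zero by simp
    next
      case (insert y Y)
      show ?case
        unfolding sum.insert[OF insert(1,2)] by (rule transl_cont_add[OF p term_tc insert(3)])
    qed
    from this[OF fin] show ?thesis using rep by simp
  qed
  obtain s where s: "\<And>i :: nat. simple_function lborel (s i)" "\<And>x. (\<lambda>i. s i x) \<longlonglongrightarrow> f x" "\<And>i x. dist (s i x) 0 \<le> 2 * dist (f x) 0"
    using borel_measurable_implies_sequence_metric[OF Lp_spaceD(1)[OF f], of 0] by auto
  note [measurable] = borel_measurable_simple_function[OF s(1)] Lp_spaceD(1)[OF f]
  have sL: "s i \<in> Lp_space lborel p" for i
    by (rule Lp_space_dominated(1)[OF Lp_space_cmult[OF f, of 2] _ _ p0]) (use s(3) in \<open>auto simp: abs_mult\<close>)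
  have "(\<lambda>i. LINT z|lborel. \<bar>s i z - f z\<bar> powr p) \<longlonglongrightarrow> (LINT z|(lborel :: 'a measure). 0)"
  proof (rule integral_dominated_convergence)
    show "integrable lborel (\<lambda>z. \<bar>3 * f z\<bar> powr p)" using Lp_spaceD(2)[OF Lp_space_cmult[OF f, of 3]] .
    show "AE z in lborel. (\<lambda>i. \<bar>s i z - f z\<bar> powr p) \<longlonglongrightarrow> 0"
    proof (rule AE_I2)
      fix z
      have "(\<lambda>i. \<bar>s i z - f z\<bar> powr p) \<longlonglongrightarrow> \<bar>f z - f z\<bar> powr p"
        using p by (intro tendsto_powr' tendsto_intros s(2)) auto
      then show "(\<lambda>i. \<bar>s i z - f z\<bar> powr p) \<longlonglongrightarrow> 0" by simp
    qed
    show "AE z in lborel. norm (\<bar>s i z - f z\<bar> powr p) \<le> \<bar>3 * f z\<bar> powr p" for i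
    proof (rule AE_I2)
      fix z
      have "\<bar>s i z - f z\<bar> \<le> \<bar>3 * f z\<bar>" using s(3)[of i z] by (simp add: abs_mult)
      then show "norm (\<bar>s i z - f z\<bar> powr p) \<le> \<bar>3 * f z\<bar> powr p" using p by (auto intro: powr_mono2)
    qed
  qed measurable
  then have "(\<lambda>i. Ip lborel p (\<lambda>z. s i z - f z)) \<longlonglongrightarrow> 0" by (simp add: Ip_def)
  then show ?thesis by (rule transl_cont_closed[OF p f simple[OF s(1) sL]])
qed

text \<open>For positive \<open>h\<close>, the mean of \<open>f\<close> over the past interval from
  \<open>t - h\<close> to \<open>t\<close>, matching the backward increment of \<open>v\<close>.
  Rescaling to the unit interval makes each fixed \<open>\<theta>\<close> a single
  translation.\<close>

definition time_avg :: "real \<Rightarrow> ('a \<times> real \<Rightarrow> real) \<Rightarrow> 'a \<times> real \<Rightarrow> real" where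
  "time_avg h f z = (LINT \<theta>|lborel. indicator {0..1} \<theta> * f (fst z, snd z - h * \<theta>))"

text \<open>Hoelder's inequality on a set of measure 1. If the integral on the left is not defined
  and defaults to 0, the right-hand side is infinite.\<close>

lemma unit_interval_Jensen:
  fixes g :: "real \<Rightarrow> real"
  assumes p: "1 < p" and [measurable]: "g \<in> borel_measurable borel"
  shows "ennreal (\<bar>(LINT \<theta>|lborel. indicator {0..1} \<theta> * g \<theta>) - c\<bar> powr p)
    \<le> (\<integral>\<^sup>+ \<theta>. indicator {0..1} \<theta> * ennreal (\<bar>g \<theta> - c\<bar> powr p) \<partial>lborel)"
proof (cases "(\<integral>\<^sup>+ \<theta>. indicator {0..1} \<theta> * ennreal (\<bar>g \<theta> - c\<bar> powr p) \<partial>lborel) < \<infinity>")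
  case True
  have E: "Lp_energy lborel p (\<lambda>\<theta>. indicator {0..1} \<theta> * (g \<theta> - c)) = (\<integral>\<^sup>+ \<theta>. indicator {0..1} \<theta> * ennreal (\<bar>g \<theta> - c\<bar> powr p) \<partial>lborel)"
    unfolding Lp_energy_def by (rule nn_integral_cong) (auto simp: indicator_def)
  have L: "(\<lambda>\<theta>. indicator {0..1} \<theta> * (g \<theta> - c)) \<in> Lp_space lborel p"
    using True E by (simp add: Lp_space_def)
  have I: "{0..1 :: real} \<in> sets lborel" "emeasure lborel {0..1 :: real} < \<infinity>" "measure lborel {0..1 :: real} = 1" by auto
  note J = Ip_indicator_integral_le[OF p I(1,2) L]
  have ic: "integrable lborel (\<lambda>\<theta>. indicator {0..1::real} \<theta> * c :: real)"
    by (intro integrable_mult_left integrable_real_indicator) auto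
  have "(LINT \<theta>|lborel. indicator {0..1} \<theta> * g \<theta>) = (LINT \<theta>|lborel. indicator {0..1} \<theta> * (g \<theta> - c) + indicator {0..1} \<theta> * c)"
    by (rule Bochner_Integration.integral_cong) (auto simp: indicator_def)
  also have "\<dots> = (LINT \<theta>|lborel. indicator {0..1} \<theta> * (g \<theta> - c)) + (LINT \<theta>|lborel. indicator {0..1::real} \<theta> * c)"
    by (rule Bochner_Integration.integral_add[OF J(2) ic])
  also have "(LINT \<theta>|lborel. indicator {0..1::real} \<theta> * c) = c" by simp
  finally have "(LINT \<theta>|lborel. indicator {0..1} \<theta> * g \<theta>) - c = (LINT \<theta>|lborel. indicator {0..1} \<theta> * (g \<theta> - c))" by simp
  then have "\<bar>(LINT \<theta>|lborel. indicator {0..1} \<theta> * g \<theta>) - c\<bar> powr p \<le> Ip lborel p (\<lambda>\<theta>. indicator {0..1} \<theta> * (g \<theta> - c))"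
    using J(1) I(3) by simp
  then show ?thesis unfolding E[symmetric] Lp_energy_eq[OF L] by (rule ennreal_leI)
qed (simp add: less_top[symmetric])

text \<open>Jensen's inequality and Tonelli bound the error by the average over
  \<open>\<theta>\<close> of the errors of translation by \<open>h n * \<theta>\<close>. Each of
  these vanishes, and all are at most \<open>B\<close>, so dominated convergence in
  \<open>\<theta>\<close> finishes.\<close>

lemma time_avg_tendsto:
  fixes f :: "'a::euclidean_space \<times> real \<Rightarrow> real"
  assumes p: "1 < p" and f: "f \<in> Lp_space lborel p" and h: "h \<longlonglongrightarrow> 0"
  shows "time_avg (h n) f \<in> Lp_space lborel p"
    and "(\<lambda>n. Ip lborel p (\<lambda>z. time_avg (h n) f z - f z)) \<longlonglongrightarrow> 0"
proof -
  have p0: "0 \<le> p" using p by simp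
  have fm [measurable]: "f \<in> borel_measurable borel" using Lp_spaceD(1)[OF f] by simp
  let ?L = "lborel :: ('a \<times> real) measure"
  have shift_m: "(\<lambda>w. (fst (fst w), snd (fst w) - c * snd w)) \<in> borel_measurable (borel :: (('a \<times> real) \<times> real) measure)" for c :: real
    by (intro borel_measurable_continuous_onI continuous_intros)
  have fsm: "(\<lambda>w. f (fst (fst w), snd (fst w) - c * snd w)) \<in> borel_measurable (?L \<Otimes>\<^sub>M (lborel :: real measure))" for c
    unfolding lborel_prod using measurable_compose[OF shift_m fm] by simp
  have sndm [measurable]: "snd \<in> ?L \<Otimes>\<^sub>M (lborel :: real measure) \<rightarrow>\<^sub>M borel"
    using measurable_snd[of ?L "lborel :: real measure"] by simp
  have fstm: "fst \<in> ?L \<Otimes>\<^sub>M (lborel :: real measure) \<rightarrow>\<^sub>M borel"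
    using measurable_fst[of ?L "lborel :: real measure"] by simp
  have ffm: "(\<lambda>w. f (fst w)) \<in> borel_measurable (?L \<Otimes>\<^sub>M (lborel :: real measure))"
    by (rule measurable_compose[OF fstm fm])
  have am: "time_avg c f \<in> borel_measurable lborel" for c
  proof -
    have "(\<lambda>w. indicator {0..1} (snd w) * f (fst (fst w), snd (fst w) - c * snd w)) \<in> borel_measurable (?L \<Otimes>\<^sub>M (lborel :: real measure))"
      using fsm by measurable
    then have "case_prod (\<lambda>z \<theta>. indicator {0..1} \<theta> * f (fst z, snd z - c * \<theta>)) \<in> borel_measurable (?L \<Otimes>\<^sub>M (lborel :: real measure))"
      by (simp add: case_prod_beta')
    from lborel.borel_measurable_lebesgue_integral[OF this] show ?thesis by (simp add: time_avg_def[abs_def])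
  qed
  define \<psi> where "\<psi> = (\<lambda>n \<theta>. Lp_energy lborel p (\<lambda>z. f (fst z, snd z - h n * \<theta>) - f z))"
  have tr: "(\<lambda>z. f (fst z, snd z - c)) = (\<lambda>z. f ((0, - c) + z))" for c
    by (auto simp: fun_eq_iff plus_prod_def)
  have dL: "(\<lambda>z. f (fst z, snd z - c) - f z) \<in> Lp_space lborel p" for c
    unfolding tr[THEN fun_cong] using Lp_space_diff(1)[OF Lp_translate(1)[OF f, of "(0, - c)"] f p0] by simp
  have dI: "Ip lborel p (\<lambda>z. f (fst z, snd z - c) - f z) \<le> 2 powr p * (Ip lborel p f + Ip lborel p f)" for c
    unfolding tr[THEN fun_cong] using Lp_space_diff(2)[OF Lp_translate(1)[OF f, of "(0, - c)"] f p0] Lp_translate(2)[OF f, of "(0, - c)"] by simp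
  define B where "B = 2 powr p * (Ip lborel p f + Ip lborel p f)"
  have \<psi>le: "\<psi> n \<theta> \<le> ennreal B" for n \<theta>
    unfolding \<psi>_def Lp_energy_eq[OF dL] B_def by (intro ennreal_leI dI)
  have \<psi>lim: "(\<lambda>n. \<psi> n \<theta>) \<longlonglongrightarrow> 0" for \<theta>
  proof -
    have "(\<lambda>n. (0 :: 'a, - (h n * \<theta>))) \<longlonglongrightarrow> (0, - (0 * \<theta>))" by (intro tendsto_intros h)
    then have "(\<lambda>n. (0 :: 'a, - (h n * \<theta>))) \<longlonglongrightarrow> 0" by (simp add: zero_prod_def)
    from transl_cont_Lp[OF p this f] have "(\<lambda>n. Ip lborel p (\<lambda>z. f (fst z, snd z - h n * \<theta>) - f z)) \<longlonglongrightarrow> 0"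
      unfolding transl_cont_def tr[THEN fun_cong] by simp
    then have "(\<lambda>n. ennreal (Ip lborel p (\<lambda>z. f (fst z, snd z - h n * \<theta>) - f z))) \<longlonglongrightarrow> ennreal 0"
      by (rule tendsto_ennrealI)
    then show ?thesis unfolding \<psi>_def Lp_energy_eq[OF dL] by simp
  qed
  have gm: "(\<lambda>w. indicator {0..1} (snd w) * ennreal (\<bar>f (fst (fst w), snd (fst w) - c * snd w) - f (fst w)\<bar> powr p)) \<in> borel_measurable (?L \<Otimes>\<^sub>M (lborel :: real measure))" for c
    using fsm ffm by measurable
  have \<psi>m: "\<psi> n \<in> borel_measurable lborel" for n
  proof -
    have "(\<lambda>w. ennreal (\<bar>f (fst (fst w), snd (fst w) - h n * snd w) - f (fst w)\<bar> powr p)) \<in> borel_measurable (?L \<Otimes>\<^sub>M (lborel :: real measure))"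
      using fsm ffm by measurable
    from measurable_pair_swap[OF this] have "case_prod (\<lambda>\<theta> z. ennreal (\<bar>f (fst z, snd z - h n * \<theta>) - f z\<bar> powr p)) \<in> borel_measurable ((lborel :: real measure) \<Otimes>\<^sub>M ?L)"
      by (simp add: case_prod_beta')
    from lborel.borel_measurable_nn_integral[OF this] show ?thesis by (simp add: \<psi>_def[abs_def] Lp_energy_def)
  qed
  have main: "Lp_energy lborel p (\<lambda>z. time_avg (h n) f z - f z) \<le> (\<integral>\<^sup>+ \<theta>. indicator {0..1} \<theta> * \<psi> n \<theta> \<partial>lborel)" for n
  proof -
    have "Lp_energy lborel p (\<lambda>z. time_avg (h n) f z - f z)
      \<le> (\<integral>\<^sup>+ z. (\<integral>\<^sup>+ \<theta>. indicator {0..1} \<theta> * ennreal (\<bar>f (fst z, snd z - h n * \<theta>) - f z\<bar> powr p) \<partial>lborel) \<partial>lborel)"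
      unfolding Lp_energy_def time_avg_def
    proof (intro nn_integral_mono unit_interval_Jensen[OF p])
      fix z :: "'a \<times> real"
      have "(\<lambda>\<theta>. (fst z, snd z - h n * \<theta>)) \<in> borel_measurable borel"
        by (intro borel_measurable_continuous_onI continuous_intros)
      from measurable_compose[OF this fm] show "(\<lambda>\<theta>. f (fst z, snd z - h n * \<theta>)) \<in> borel_measurable borel" .
    qed
    also have "\<dots> = (\<integral>\<^sup>+ \<theta>. (\<integral>\<^sup>+ z. indicator {0..1} \<theta> * ennreal (\<bar>f (fst z, snd z - h n * \<theta>) - f z\<bar> powr p) \<partial>lborel) \<partial>lborel)"
    proof -
      show ?thesis
        by (rule lborel_pair.Fubini'[symmetric]) (use gm[of "h n"] in \<open>simp add: case_prod_beta'\<close>)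
    qed
    also have "\<dots> = (\<integral>\<^sup>+ \<theta>. indicator {0..1} \<theta> * \<psi> n \<theta> \<partial>lborel)"
      unfolding \<psi>_def Lp_energy_def by (rule nn_integral_cong) (auto simp: indicator_def)
    finally show ?thesis .
  qed
  have lim: "(\<lambda>n. \<integral>\<^sup>+ \<theta>. indicator {0..1} \<theta> * \<psi> n \<theta> \<partial>lborel) \<longlonglongrightarrow> (\<integral>\<^sup>+ \<theta>. 0 \<partial>(lborel :: real measure))"
  proof (rule nn_integral_dominated_convergence[where w = "\<lambda>\<theta>. ennreal B * indicator {0..1} \<theta>"])
    show "AE \<theta> in lborel. indicator {0..1} \<theta> * \<psi> n \<theta> \<le> ennreal B * indicator {0..1} \<theta>" for n
      using \<psi>le by (auto simp: indicator_def)
    show "(\<integral>\<^sup>+ \<theta>. ennreal B * indicator {0..1::real} \<theta> \<partial>lborel) < \<infinity>"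
      by (subst nn_integral_cmult_indicator) auto
    show "AE \<theta> in lborel. (\<lambda>n. indicator {0..1} \<theta> * \<psi> n \<theta>) \<longlonglongrightarrow> 0"
      using \<psi>lim by (intro AE_I2) (auto simp: indicator_def)
  qed (use \<psi>m in measurable)
  have finn: "(\<integral>\<^sup>+ \<theta>. indicator {0..1} \<theta> * \<psi> n \<theta> \<partial>lborel) \<le> ennreal B" for n
  proof -
    have "(\<integral>\<^sup>+ \<theta>. indicator {0..1} \<theta> * \<psi> n \<theta> \<partial>lborel) \<le> (\<integral>\<^sup>+ \<theta>. ennreal B * indicator {0..1::real} \<theta> \<partial>lborel)"
      using \<psi>le by (intro nn_integral_mono) (auto simp: indicator_def)
    also have "\<dots> = ennreal B" by (subst nn_integral_cmult_indicator) auto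
    finally show ?thesis .
  qed
  have B0: "0 \<le> B" by (simp add: B_def)
  have dm: "(\<lambda>z. time_avg c f z - f z) \<in> borel_measurable lborel" for c using am by measurable
  have avgd: "(\<lambda>z. time_avg (h n) f z - f z) \<in> Lp_space lborel p" for n
    by (rule Lp_energy_less_top(1)[OF dm order_trans[OF main finn] B0])
  have "(\<lambda>z. (time_avg (h n) f z - f z) + f z) \<in> Lp_space lborel p"
    by (rule Lp_space_add(1)[OF avgd f p0])
  then show "time_avg (h n) f \<in> Lp_space lborel p" by simp
  have "(\<lambda>n. ennreal (Ip lborel p (\<lambda>z. time_avg (h n) f z - f z))) \<longlonglongrightarrow> ennreal 0"
  proof -
    have lim0: "(\<lambda>n. \<integral>\<^sup>+ \<theta>. indicator {0..1} \<theta> * \<psi> n \<theta> \<partial>lborel) \<longlonglongrightarrow> ennreal 0" using lim by simp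
    show ?thesis
      by (rule tendsto_sandwich[OF _ _ tendsto_const lim0])
         (use main in \<open>auto simp: Lp_energy_eq[OF avgd]\<close>)
  qed
  then show "(\<lambda>n. Ip lborel p (\<lambda>z. time_avg (h n) f z - f z)) \<longlonglongrightarrow> 0"
    by (subst (asm) tendsto_ennreal_iff) auto
qed

subsection \<open>The energy inequality\<close>

lemma AE_lborel_translate:
  fixes c :: "'a::euclidean_space"
  assumes "AE x in lborel. Q x"
  shows "AE x in lborel. Q (c + x)"
proof -
  have "AE x in distr lborel borel ((+) c). Q x" unfolding lborel_distr_plus by (rule assms)
  then show ?thesis by (rule AE_distrD[rotated]) simp
qed

lemma emeasure_lborel_Ioc_finite [simp]: "emeasure lborel {a<..b :: real} < top"
  using emeasure_bounded_finite[of "{a<..b}"] by simp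

text \<open>
  \<open>f\<close> is a Borel representative of \<open>v\<^sub>t\<close>, and \<open>A\<close> is a set of full measure consisting of times at
  which the equation may be tested with every \<open>v t'\<close>, \<open>t' \<in> A\<close>.
\<close>

locale fractional_flow =
  fixes \<Omega> :: "'a::euclidean_space set" and s p l C :: real
    and v :: "real \<Rightarrow> 'a \<Rightarrow> real" and f :: "'a \<times> real \<Rightarrow> real" and A :: "real set" and P :: "real \<Rightarrow> real"
  assumes \<Omega>: "open \<Omega>" "bounded \<Omega>" and p: "1 < p" and s: "0 < s"
    and l: "0 < l" "\<And>u. u \<in> Wsp0 \<Omega> s p \<Longrightarrow> l * Ip lebesgue p u \<le> Gag s p u"
    and f: "f \<in> Lp_space lborel p"
    and v: "\<And>t. 0 \<le> t \<Longrightarrow> v t \<in> Lp_space lebesgue p"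
    and inc: "\<And>a b. 0 \<le> a \<Longrightarrow> a \<le> b \<Longrightarrow> AE x in lebesgue. v b x - v a x = (LINT \<tau>|lborel. indicator {a<..b} \<tau> * f (x, \<tau>))"
    and A: "A \<subseteq> {0..}" "AE t in lborel. 0 \<le> t \<longrightarrow> t \<in> A"
    and AW: "\<And>t. t \<in> A \<Longrightarrow> v t \<in> Wsp0 \<Omega> s p"
    and P: "P \<in> borel_measurable borel" "\<And>t. t \<in> A \<Longrightarrow> P t = Gag s p (v t)" "\<And>t. t \<in> A \<Longrightarrow> P t \<le> C"
    and Af: "\<And>t. t \<in> A \<Longrightarrow> (\<lambda>x. f (x, t)) \<in> Lp_space lebesgue p"
    and eq: "\<And>t t'. t \<in> A \<Longrightarrow> t' \<in> A \<Longrightarrow>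
       (LINT x|lebesgue. J_op p (f (x, t)) * v t' x) + (LINT z|gag_measure s p. J_op p (Dq (v t) z) * Dq (v t') z) = 0"
begin

lemma p0: "0 \<le> p" using p by simp

lemma A_nonneg: "t \<in> A \<Longrightarrow> 0 \<le> t" using A(1) by auto

lemma P_nonneg: "t \<in> A \<Longrightarrow> 0 \<le> P t" by (simp add: P(2))

lemma f_measurable [measurable]: "f \<in> borel_measurable borel"
  using Lp_spaceD(1)[OF f] by simp

lemma f_slice_measurable' [measurable]: "(\<lambda>x. f (x, t)) \<in> borel_measurable lebesgue"
  by (rule measurable_completion) simp

text \<open>The dissipation rate, the \<open>p\<close>-th power of the norm of the time derivative.
  It is taken over \<open>lborel\<close> so that product integrals apply; \<open>D_eq\<close>
  returns to \<open>lebesgue\<close>.\<close>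

definition D :: "real \<Rightarrow> real" where
  "D t = (LINT x|lborel. \<bar>f (x, t)\<bar> powr p)"

lemma D_nonneg [simp]: "0 \<le> D t" by (simp add: D_def)

lemma D_eq: "D t = Ip lebesgue p (\<lambda>x. f (x, t))"
  unfolding D_def Ip_def by (rule integral_completion[symmetric]) measurable

lemma f_powr_integrable: "integrable ((lborel :: 'a measure) \<Otimes>\<^sub>M (lborel :: real measure)) (\<lambda>z. \<bar>f z\<bar> powr p)"
  unfolding lborel_prod by (rule Lp_spaceD(2)[OF f])

lemma D_integrable: "integrable lborel D"
  using lborel_pair.integrable_snd[of "\<lambda>x t. \<bar>f (x, t)\<bar> powr p"] f_powr_integrable
  by (simp add: D_def[abs_def] case_prod_beta')

lemma D_measurable [measurable]: "D \<in> borel_measurable borel"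
  using borel_measurable_integrable[OF D_integrable] by simp

definition DI :: "real \<Rightarrow> real \<Rightarrow> real" where
  "DI a b = (LINT t|lborel. indicator {a<..b} t * D t)"

lemma D_indicator_integrable: "B \<in> sets borel \<Longrightarrow> integrable lborel (\<lambda>t. indicator B t * D t)"
  using integrable_mult_indicator[OF _ D_integrable, of B] by simp

lemma DI_nonneg [simp]: "0 \<le> DI a b"
  unfolding DI_def by (rule integral_nonneg_AE) auto

lemma DI_mono: "a' \<le> a \<Longrightarrow> b \<le> b' \<Longrightarrow> DI a b \<le> DI a' b'"
  unfolding DI_def by (intro integral_mono D_indicator_integrable) (auto simp: indicator_def)

definition T where "T = (LINT t|lborel. D t)"

lemma DI_le_T: "DI a b \<le> T"
  unfolding DI_def T_def by (intro integral_mono D_indicator_integrable D_integrable) (auto simp: indicator_def)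

text \<open>Hoelder's inequality in time for almost every \<open>x\<close>, then an exchange of the
  integrals. It makes the curve Hoelder continuous in \<open>L\<^sup>p\<close>, with a modulus
  governed by the local dissipation.\<close>

lemma increment_le:
  assumes ab: "0 \<le> a" "a \<le> b"
  shows "Ip lebesgue p (\<lambda>x. v b x - v a x) \<le> (b - a) powr (p - 1) * DI a b"
proof -
  let ?I = "\<lambda>\<tau>. indicator {a<..b} \<tau> :: real"
  have iz: "integrable ((lborel :: 'a measure) \<Otimes>\<^sub>M (lborel :: real measure)) (\<lambda>z. ?I (snd z) * \<bar>f z\<bar> powr p)"
  proof (rule Bochner_Integration.integrable_bound[OF f_powr_integrable])
    have [measurable]: "f \<in> borel_measurable ((lborel :: 'a measure) \<Otimes>\<^sub>M (lborel :: real measure))"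
      unfolding lborel_prod by simp
    show "(\<lambda>z. ?I (snd z) * \<bar>f z\<bar> powr p) \<in> borel_measurable ((lborel :: 'a measure) \<Otimes>\<^sub>M (lborel :: real measure))"
      by measurable
  qed (auto simp: indicator_def)
  define G where "G = (\<lambda>x. LINT \<tau>|lborel. ?I \<tau> * \<bar>f (x, \<tau>)\<bar> powr p)"
  have Gi: "integrable lborel G" using lborel_pair.integrable_fst'[OF iz] by (simp add: G_def)
  have G_int: "(LINT x|lborel. G x) = DI a b"
  proof -
    have "(LINT x|lborel. G x) = integral\<^sup>L ((lborel :: 'a measure) \<Otimes>\<^sub>M (lborel :: real measure)) (\<lambda>z. ?I (snd z) * \<bar>f z\<bar> powr p)"
      using lborel_pair.integral_fst'[OF iz] by (simp add: G_def)
    also have "\<dots> = (LINT t|lborel. LINT x|lborel. ?I t * \<bar>f (x, t)\<bar> powr p)"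
      using lborel_pair.integral_snd[of "\<lambda>x t. ?I t * \<bar>f (x, t)\<bar> powr p"] iz by (simp add: case_prod_beta')
    finally show ?thesis by (simp add: DI_def D_def)
  qed
  have Gil: "integrable lebesgue G" using Gi by (simp add: integrable_completion)
  have "AE x in lborel. integrable lborel (\<lambda>\<tau>. ?I \<tau> * \<bar>f (x, \<tau>)\<bar> powr p)"
    using lborel_pair.AE_integrable_fst'[OF iz] by simp
  then have "AE x in lebesgue. integrable lborel (\<lambda>\<tau>. ?I \<tau> * \<bar>f (x, \<tau>)\<bar> powr p)" by (rule AE_completion)
  then have le: "AE x in lebesgue. \<bar>v b x - v a x\<bar> powr p \<le> (b - a) powr (p - 1) * G x"
    using inc[OF ab]
  proof eventually_elim
    case (elim x)
    have ind: "\<bar>?I \<tau> * f (x, \<tau>)\<bar> powr p = ?I \<tau> * \<bar>f (x, \<tau>)\<bar> powr p" for \<tau>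
      by (auto simp: indicator_def)
    have L: "(\<lambda>\<tau>. ?I \<tau> * f (x, \<tau>)) \<in> Lp_space lborel p"
      unfolding Lp_space_iff ind using elim(1) by auto
    have "\<bar>LINT \<tau>|lborel. ?I \<tau> * f (x, \<tau>)\<bar> powr p \<le> measure lborel {a<..b} powr (p - 1) * Ip lborel p (\<lambda>\<tau>. ?I \<tau> * f (x, \<tau>))"
      by (rule Ip_indicator_integral_le(1)[OF p _ _ L]) auto
    also have "measure lborel {a<..b} = b - a" using ab by simp
    finally show ?case unfolding elim(2)[symmetric] Ip_def ind G_def .
  qed
  have d: "(\<lambda>x. v b x - v a x) \<in> Lp_space lebesgue p" using ab by (intro Lp_space_diff(1) v p0) auto
  have "Ip lebesgue p (\<lambda>x. v b x - v a x) \<le> (LINT x|lebesgue. (b - a) powr (p - 1) * G x)"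
    unfolding Ip_def using Gil by (intro integral_mono_AE[OF Lp_spaceD(2)[OF d] _ le]) auto
  also have "\<dots> = (b - a) powr (p - 1) * DI a b"
    using G_int borel_measurable_integrable[OF Gi] by (simp add: integral_completion)
  finally show ?thesis .
qed

lemma energy_identity: "t \<in> A \<Longrightarrow> P t = - (LINT x|lebesgue. J_op p (f (x, t)) * v t x)"
  using eq[of t t] by (simp add: P(2) Gag_def Ip_def J_op_mult_self)

lemma coercivity:
  assumes t: "t \<in> A"
  shows "P t \<le> D t powr (1 - 1 / p) * Ip lebesgue p (v t) powr (1 / p)"
  using Holder_J_op_abs[OF p Af[OF t] v[OF A_nonneg[OF t]]] energy_identity[OF t] by (simp add: D_eq)

text \<open>The energy lies above its tangent at \<open>v t\<close>, and the equation at time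
  \<open>t\<close>, tested with \<open>v t' - v t\<close>, rewrites the linear term as a pairing
  with \<open>f\<close>. The two times may be in either order and no derivative of \<open>P\<close>
  occurs.\<close>

lemma tangent:
  assumes t: "t \<in> A" and t': "t' \<in> A"
  shows "P t \<le> P t' + p * (LINT x|lebesgue. J_op p (f (x, t)) * (v t' x - v t x))"
proof -
  note W = WspD(2)[OF Wsp0_imp_Wsp[OF AW[OF t]]] and W' = WspD(2)[OF Wsp0_imp_Wsp[OF AW[OF t']]]
  have "(LINT z|gag_measure s p. J_op p (Dq (v t) z) * (Dq (v t') z - Dq (v t) z))
    = (LINT z|gag_measure s p. J_op p (Dq (v t) z) * Dq (v t') z) - (LINT z|gag_measure s p. J_op p (Dq (v t) z) * Dq (v t) z)"
    using Holder_J_op(1)[OF p W W] Holder_J_op(1)[OF p W W'] by (simp add: right_diff_distrib)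
  also have "\<dots> = - ((LINT x|lebesgue. J_op p (f (x, t)) * v t' x) - (LINT x|lebesgue. J_op p (f (x, t)) * v t x))"
    using eq[OF t t'] eq[OF t t] by simp
  also have "\<dots> = - (LINT x|lebesgue. J_op p (f (x, t)) * (v t' x - v t x))"
    using Holder_J_op(1)[OF p Af[OF t] v[OF A_nonneg[OF t]]] Holder_J_op(1)[OF p Af[OF t] v[OF A_nonneg[OF t']]]
    by (simp add: right_diff_distrib)
  finally show ?thesis
    using Ip_tangent[OF p W W'] by (simp add: P(2)[OF t] P(2)[OF t'] Gag_def)
qed

lemma tangent_abs:
  assumes t: "t \<in> A" and t': "t' \<in> A"
  shows "P t \<le> P t' + p * (D t powr (1 - 1 / p) * Ip lebesgue p (\<lambda>x. v t x - v t' x) powr (1 / p))"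
proof -
  have "(LINT x|lebesgue. J_op p (f (x, t)) * (v t' x - v t x)) \<le> D t powr (1 - 1 / p) * Ip lebesgue p (\<lambda>x. v t' x - v t x) powr (1 / p)"
    using Holder_J_op_abs[OF p Af[OF t] Lp_space_diff(1)[OF v[OF A_nonneg[OF t']] v[OF A_nonneg[OF t]] p0]] by (simp add: D_eq)
  then have "p * (LINT x|lebesgue. J_op p (f (x, t)) * (v t' x - v t x)) \<le> p * (D t powr (1 - 1 / p) * Ip lebesgue p (\<lambda>x. v t x - v t' x) powr (1 / p))"
    using p0 Ip_minus_commute[of lebesgue p "v t" "v t'"] by (intro mult_left_mono) auto
  with tangent[OF t t'] show ?thesis by linarith
qed

lemma P_interval_integrable:
  assumes "0 \<le> a"
  shows "integrable lborel (\<lambda>t. indicator {a<..b} t * P t)"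
proof (rule Bochner_Integration.integrable_bound)
  show "integrable lborel (\<lambda>t. \<bar>C\<bar> * indicator {a<..b} t :: real)" by (intro integrable_mult_right integrable_real_indicator) auto
  note [measurable] = P(1)
  show "(\<lambda>t. indicator {a<..b} t * P t) \<in> borel_measurable lborel" by measurable
  show "AE t in lborel. norm (indicator {a<..b} t * P t) \<le> norm (\<bar>C\<bar> * indicator {a<..b} t :: real)"
    using A(2)
  proof eventually_elim
    case (elim t)
    show ?case
    proof (cases "t \<in> {a<..b}")
      case True
      then have "t \<in> A" using elim assms by auto
      then have "\<bar>P t\<bar> \<le> \<bar>C\<bar>" using P(3)[of t] P_nonneg[of t] by linarith
      then show ?thesis using True by simp
    qed simp
  qed
qed

lemma time_avg_increment:
  assumes h: "0 < h" "h \<le> \<tau>"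
  shows "AE x in lebesgue. v \<tau> x - v (\<tau> - h) x = h * time_avg h f (x, \<tau>)"
  using inc[of "\<tau> - h" \<tau>]
proof (rule AE_mp)
  show "0 \<le> \<tau> - h" "\<tau> - h \<le> \<tau>" using h by auto
  show "AE x in lebesgue. v \<tau> x - v (\<tau> - h) x = (LINT r|lborel. indicator {\<tau> - h<..\<tau>} r * f (x, r)) \<longrightarrow>
      v \<tau> x - v (\<tau> - h) x = h * time_avg h f (x, \<tau>)"
  proof (intro AE_I2 impI)
    fix x assume x: "v \<tau> x - v (\<tau> - h) x = (LINT r|lborel. indicator {\<tau> - h<..\<tau>} r * f (x, r))"
    have m: "(\<lambda>\<theta>. f (x, \<tau> - h * \<theta>)) \<in> borel_measurable borel"
      by (rule measurable_compose[OF _ f_measurable]) (intro borel_measurable_continuous_onI continuous_intros)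
    note [measurable] = m
    have "(LINT r|lborel. indicator {\<tau> - h<..\<tau>} r * f (x, r)) = h * (LINT \<theta>|lborel. indicator {\<tau> - h<..\<tau>} (\<tau> - h * \<theta>) * f (x, \<tau> - h * \<theta>))"
      using h lborel_integral_real_affine[of "- h" "\<lambda>r. indicator {\<tau> - h<..\<tau>} r * f (x, r)" \<tau>] by simp
    also have "(LINT \<theta>|lborel. indicator {\<tau> - h<..\<tau>} (\<tau> - h * \<theta>) * f (x, \<tau> - h * \<theta>)) = time_avg h f (x, \<tau>)"
      unfolding time_avg_def fst_conv snd_conv
    proof (rule integral_cong_AE)
      \<comment> \<open>The half-open interval misses the endpoint
        \<open>\<theta> = 1\<close>.\<close>
      show "AE \<theta> in lborel. indicator {\<tau> - h<..\<tau>} (\<tau> - h * \<theta>) * f (x, \<tau> - h * \<theta>) = indicator {0..1} \<theta> * f (x, \<tau> - h * \<theta>)"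
        using AE_lborel_singleton[of "1 :: real"]
      proof eventually_elim
        case (elim \<theta>)
        have "\<tau> - h * \<theta> \<in> {\<tau> - h<..\<tau>} \<longleftrightarrow> \<theta> \<in> {0..1}"
          using h elim mult_less_cancel_left_pos[OF h(1), of \<theta> 1] by (auto simp: zero_le_mult_iff)
        then show ?case by (simp add: indicator_def)
      qed
    qed measurable
    finally show "v \<tau> x - v (\<tau> - h) x = h * time_avg h f (x, \<tau>)" using x by simp
  qed
qed

text \<open>The bound on \<open>P t\<close> contains \<open>D t\<close>, which is merely integrable,
  so only an average just after \<open>a\<close> can be controlled. With \<open>increment_le\<close>
  the correction becomes \<open>(h * D t) powr (1 - 1 / p) * DI a (a + h) powr (1 / p)\<close>;
  Young's inequality bounds it by \<open>h * D t + DI a (a + h)\<close>, and both terms integrate to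
  \<open>h * DI a (a + h)\<close>. Allowing any \<open>a \<ge> 0\<close>, not just times in
  \<open>A\<close>, serves \<open>v_nonzero\<close>.\<close>

lemma window_average_le:
  assumes a: "0 \<le> a" and h: "0 < h"
    and le: "\<And>t. t \<in> A \<Longrightarrow> a < t \<Longrightarrow> P t \<le> B + p * (D t powr (1 - 1 / p) * Ip lebesgue p (\<lambda>x. v t x - v a x) powr (1 / p))"
  shows "(LINT t|lborel. indicator {a<..a + h} t * P t) \<le> h * B + 2 * p * h * DI a (a + h)"
proof -
  let ?I = "\<lambda>t. indicator {a<..a + h} t :: real"
  let ?d = "DI a (a + h)"
  have i1: "integrable lborel (\<lambda>t. ?I t * (B + p * ?d))" by (intro integrable_mult_left integrable_real_indicator) auto
  have i2: "integrable lborel (\<lambda>t. ?I t * D t)" by (rule D_indicator_integrable) auto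
  have "(LINT t|lborel. ?I t * P t) \<le> (LINT t|lborel. ?I t * (B + p * ?d) + p * h * (?I t * D t))"
  proof (rule integral_mono_AE)
    show "integrable lborel (\<lambda>t. ?I t * P t)" by (rule P_interval_integrable[OF a])
    show "integrable lborel (\<lambda>t. ?I t * (B + p * ?d) + p * h * (?I t * D t))" using i1 i2 by auto
    show "AE t in lborel. ?I t * P t \<le> ?I t * (B + p * ?d) + p * h * (?I t * D t)"
      using A(2)
    proof eventually_elim
      case (elim t)
      show ?case
      proof (cases "t \<in> {a<..a + h}")
        case True
        then have t: "t \<in> A" using elim a by auto
        have "Ip lebesgue p (\<lambda>x. v t x - v a x) \<le> (t - a) powr (p - 1) * DI a t"
          using True a by (intro increment_le) auto
        also have "\<dots> \<le> h powr (p - 1) * ?d"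
          using True p by (intro mult_mono powr_mono2 DI_mono) auto
        finally have "D t powr (1 - 1 / p) * Ip lebesgue p (\<lambda>x. v t x - v a x) powr (1 / p) \<le> D t powr (1 - 1 / p) * (h powr (p - 1) * ?d) powr (1 / p)"
          using p by (intro mult_left_mono powr_mono2) auto
        also have "\<dots> = (h * D t) powr (1 - 1 / p) * ?d powr (1 / p)"
          using p by (simp add: powr_mult powr_powr diff_divide_distrib)
        also have "\<dots> \<le> h * D t + ?d"
        proof (cases "h * D t = 0 \<or> ?d = 0")
          case True
          then have "(h * D t) powr (1 - 1 / p) * ?d powr (1 / p) = 0" by auto
          also have "0 \<le> h * D t + ?d" using h by (intro add_nonneg_nonneg mult_nonneg_nonneg) auto
          finally show ?thesis .
        next
          case False
          then have pos: "0 < h * D t" "0 < ?d" using h by (auto simp: less_le)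
          have "(h * D t) powr (1 - 1 / p) * ?d powr (1 / p) \<le> (1 - 1 / p) * (h * D t) + (1 / p) * ?d"
            using p pos by (intro Youngs_inequality_0) auto
          also have "\<dots> \<le> 1 * (h * D t) + 1 * ?d"
            using p pos by (intro add_mono mult_right_mono) auto
          finally show ?thesis by simp
        qed
        finally have "p * (D t powr (1 - 1 / p) * Ip lebesgue p (\<lambda>x. v t x - v a x) powr (1 / p)) \<le> p * (h * D t + ?d)"
          using p0 by (intro mult_left_mono)
        moreover have "a < t" using True by simp
        ultimately have "P t \<le> B + p * (h * D t + ?d)" using le[OF t] by linarith
        then show ?thesis using True by (simp add: algebra_simps)
      qed simp
    qed
  qed
  also have "\<dots> = h * (B + p * ?d) + p * h * ?d"
  proof -
    have "measure lborel {a<..a + h} = h" using h by simp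
    then have "(LINT t|lborel. ?I t * (B + p * ?d)) = h * (B + p * ?d)"
      by (simp only: integral_mult_left_zero) simp
    then show ?thesis using i1 i2 by (simp add: DI_def)
  qed
  finally show ?thesis by (simp add: algebra_simps)
qed

lemma DI_tendsto_0:
  assumes hlim: "h \<longlonglongrightarrow> 0"
  shows "(\<lambda>n. DI a (a + h n)) \<longlonglongrightarrow> 0"
proof -
  have "(\<lambda>n. LINT t|lborel. indicator {a<..a + h n} t * D t) \<longlonglongrightarrow> (LINT t|(lborel :: real measure). 0)"
  proof (rule integral_dominated_convergence[OF _ _ D_integrable])
    show "AE t in lborel. (\<lambda>n. indicator {a<..a + h n} t * D t) \<longlonglongrightarrow> 0"
    proof (rule AE_I2)
      fix t
      have "\<forall>\<^sub>F n in sequentially. indicator {a<..a + h n} t * D t = 0"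
      proof (cases "a < t")
        case True
        then have "\<forall>\<^sub>F n in sequentially. h n < t - a" by (intro order_tendstoD(2)[OF hlim]) auto
        then show ?thesis by eventually_elim auto
      qed auto
      then show "(\<lambda>n. indicator {a<..a + h n} t * D t) \<longlonglongrightarrow> 0" by (rule tendsto_eventually)
    qed
  qed (auto simp: indicator_def)
  then show ?thesis by (simp add: DI_def)
qed

text \<open>Apply \<open>tangent\<close> at \<open>t\<close> with the earlier time
  \<open>t - h\<close> and integrate in \<open>t\<close>. The energies telescope to short windows
  after \<open>a\<close> and after \<open>b\<close>; the increments are \<open>- h\<close> times
  time averages of \<open>f\<close>, so after division by \<open>h\<close> the pairing tends to the
  dissipation integral.\<close>

lemma energy_inequality:
  assumes a: "a \<in> A" and b: "b \<in> A" and ab: "a < b"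
  shows "P b + p * DI a b \<le> P a"
proof -
  define h where "h = (\<lambda>n. 1 / real (Suc n))"
  have h: "0 < h n" "h n \<le> 1" for n by (auto simp: h_def)
  have hlim: "h \<longlonglongrightarrow> 0" unfolding h_def by (rule LIMSEQ_Suc[OF lim_1_over_n])
  have a0: "0 \<le> a" and b0: "0 \<le> b" using a b A_nonneg by auto
  let ?L = "(lborel :: 'a measure) \<Otimes>\<^sub>M (lborel :: real measure)"
  \<comment> \<open>The window is shifted by \<open>h n\<close> so that \<open>t - h n\<close> runs
    through \<open>{a<..b}\<close> and never becomes negative.\<close>
  define g where "g = (\<lambda>n z. indicator {a + h n<..b + h n} (snd z) * f z)"
  define Av where "Av = (\<lambda>n. time_avg (h n) f)"
  have AvL: "Av n \<in> Lp_space lborel p" for n unfolding Av_def by (rule time_avg_tendsto(1)[OF p f hlim])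
  have Avlim: "(\<lambda>n. Ip lborel p (\<lambda>z. Av n z - f z)) \<longlonglongrightarrow> 0" unfolding Av_def by (rule time_avg_tendsto(2)[OF p f hlim])
  have gset: "UNIV \<times> {a + h n<..b + h n} \<in> sets (lborel :: ('a \<times> real) measure)" for n
    by (simp, intro borel_Times) auto
  have gL: "g n \<in> Lp_space lborel p" and gI: "Ip lborel p (g n) \<le> Ip lborel p f" for n
    using Lp_indicator_mult[OF f gset[of n] p0]
    by (auto simp: g_def indicator_def mem_Times_iff cong: if_cong)
  define K where "K = (\<lambda>n. LINT z|lborel. J_op p (g n z) * Av n z)"
  have Ki: "integrable ?L (\<lambda>z. J_op p (g n z) * Av n z)" for n
    unfolding lborel_prod by (rule Holder_J_op(1)[OF p gL AvL])
  have Jg: "J_op p (g n z) = indicator {a + h n<..b + h n} (snd z) * J_op p (f z)" for n z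
    by (auto simp: g_def indicator_def)
  have K_snd: "K n = (LINT t|lborel. indicator {a + h n<..b + h n} t * (LINT x|lborel. J_op p (f (x, t)) * Av n (x, t)))"
    "integrable lborel (\<lambda>t. indicator {a + h n<..b + h n} t * (LINT x|lborel. J_op p (f (x, t)) * Av n (x, t)))" for n
  proof -
    have c: "(\<lambda>(x, t). J_op p (g n (x, t)) * Av n (x, t)) = (\<lambda>z. J_op p (g n z) * Av n z)" by auto
    have e: "(LINT x|lborel. J_op p (g n (x, t)) * Av n (x, t)) = indicator {a + h n<..b + h n} t * (LINT x|lborel. J_op p (f (x, t)) * Av n (x, t))" for t
      unfolding Jg by (simp add: mult.assoc)
    show "K n = (LINT t|lborel. indicator {a + h n<..b + h n} t * (LINT x|lborel. J_op p (f (x, t)) * Av n (x, t)))"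
      using lborel_pair.integral_snd[of "\<lambda>x t. J_op p (g n (x, t)) * Av n (x, t)"] Ki[of n]
      unfolding c e K_def lborel_prod[symmetric] by simp
    show "integrable lborel (\<lambda>t. indicator {a + h n<..b + h n} t * (LINT x|lborel. J_op p (f (x, t)) * Av n (x, t)))"
      using lborel_pair.integrable_snd[of "\<lambda>x t. J_op p (g n (x, t)) * Av n (x, t)"] Ki[of n]
      unfolding c e by simp
  qed
  have step1: "(LINT t|lborel. indicator {b<..b + h n} t * P t) - (LINT t|lborel. indicator {a<..a + h n} t * P t) \<le> - (p * h n * K n)" for n
  proof -
    have Aae: "AE t in lborel. 0 \<le> t \<longrightarrow> t \<in> A" by (rule A(2))
    have Aae': "AE t in lborel. 0 \<le> t - h n \<longrightarrow> t - h n \<in> A"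
      using AE_lborel_translate[OF A(2), of "- h n"] by simp
    let ?I = "\<lambda>t. indicator {a + h n<..b + h n} t :: real"
    have ah0: "0 \<le> a + h n" using a0 h[of n] by simp
    have pt: "AE t in lborel. ?I t * P t - ?I t * P (t - h n) \<le> - (p * h n) * (?I t * (LINT x|lborel. J_op p (f (x, t)) * Av n (x, t)))"
      using Aae Aae'
    proof eventually_elim
      case (elim t)
      show ?case
      proof (cases "t \<in> {a + h n<..b + h n}")
        case True
        then have t: "t \<in> A" "t - h n \<in> A" using elim a0 h[of n] by auto
        have ht: "h n \<le> t" using True a0 by auto
        have m: "(\<lambda>x. Av n (x, t)) \<in> borel_measurable borel"
        proof (rule measurable_compose[of "\<lambda>x. (x, t)"])
          show "(\<lambda>x. (x, t)) \<in> borel_measurable borel" by (intro borel_measurable_continuous_onI continuous_intros)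
          show "Av n \<in> borel_measurable borel" using Lp_spaceD(1)[OF AvL[of n]] by simp
        qed
        have m': "(\<lambda>x. Av n (x, t)) \<in> borel_measurable lebesgue" by (rule measurable_completion) (use m in simp)
        note [measurable] = m m' Lp_spaceD(1)[OF v[OF A_nonneg[OF t(1)]]] Lp_spaceD(1)[OF v[OF A_nonneg[OF t(2)]]]
        have "(LINT x|lebesgue. J_op p (f (x, t)) * (v (t - h n) x - v t x)) = (LINT x|lebesgue. (- h n) * (J_op p (f (x, t)) * Av n (x, t)))"
        proof (rule integral_cong_AE)
          show "AE x in lebesgue. J_op p (f (x, t)) * (v (t - h n) x - v t x) = (- h n) * (J_op p (f (x, t)) * Av n (x, t))"
            using time_avg_increment[OF h(1) ht]
          proof eventually_elim
            case (elim x)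
            then have "v (t - h n) x - v t x = - (h n * Av n (x, t))" by (simp add: Av_def)
            then show ?case by simp
          qed
        qed measurable
        also have "\<dots> = (- h n) * (LINT x|lborel. J_op p (f (x, t)) * Av n (x, t))"
          by (subst integral_completion) auto
        finally have "P t \<le> P (t - h n) + p * ((- h n) * (LINT x|lborel. J_op p (f (x, t)) * Av n (x, t)))"
          using tangent[OF t] by simp
        then show ?thesis using True by (simp add: mult.assoc)
      qed simp
    qed
    have iP1: "integrable lborel (\<lambda>t. ?I t * P t)" by (rule P_interval_integrable[OF ah0])
    have sh: "?I (h n + t) * P (h n + t - h n) = indicator {a<..b} t * P t" for t by (auto simp: indicator_def)
    have iP2: "integrable lborel (\<lambda>t. ?I t * P (t - h n))"
      "(LINT t|lborel. ?I t * P (t - h n)) = (LINT t|lborel. indicator {a<..b} t * P t)"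
      using lborel_integrable_real_affine_iff[of 1 "\<lambda>t. ?I t * P (t - h n)" "h n"]
        lborel_integral_real_affine[of 1 "\<lambda>t. ?I t * P (t - h n)" "h n"] P_interval_integrable[OF a0, of b]
      unfolding mult_1 sh by auto
    have "(LINT t|lborel. ?I t * P t) - (LINT t|lborel. indicator {a<..b} t * P t) = (LINT t|lborel. ?I t * P t - ?I t * P (t - h n))"
      using iP1 iP2 by simp
    also have "\<dots> \<le> (LINT t|lborel. - (p * h n) * (?I t * (LINT x|lborel. J_op p (f (x, t)) * Av n (x, t))))"
      using iP1 iP2 K_snd(2)[of n] by (intro integral_mono_AE pt) auto
    also have "\<dots> = - (p * h n * K n)" by (simp add: K_snd(1))
    finally have 1: "(LINT t|lborel. ?I t * P t) - (LINT t|lborel. indicator {a<..b} t * P t) \<le> - (p * h n * K n)" .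
    have b1: "integrable lborel (\<lambda>t. indicator {b<..b + h n} t * P t)" "integrable lborel (\<lambda>t. indicator {a<..a + h n} t * P t)"
      "integrable lborel (\<lambda>t. indicator {a<..b} t * P t)"
      by (intro P_interval_integrable a0 b0)+
    have "(LINT t|lborel. ?I t * P t + indicator {a<..a + h n} t * P t) = (LINT t|lborel. indicator {a<..b} t * P t + indicator {b<..b + h n} t * P t)"
      by (rule Bochner_Integration.integral_cong) (use h[of n] ab in \<open>auto simp: indicator_def\<close>)
    then have "(LINT t|lborel. ?I t * P t) + (LINT t|lborel. indicator {a<..a + h n} t * P t) = (LINT t|lborel. indicator {a<..b} t * P t) + (LINT t|lborel. indicator {b<..b + h n} t * P t)"
      using b1 iP1 by simp
    with 1 show ?thesis by linarith
  qed
  \<comment> \<open>The window after \<open>b\<close> needs a lower bound, so the tangent is taken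
    at the fixed time \<open>b\<close>; the error involves the constant \<open>D b\<close> and
    vanishes with \<open>h n\<close>.\<close>
  define \<epsilon> where "\<epsilon> = (\<lambda>n. p * (D b powr (1 - 1 / p) * (h n powr (p - 1) * T) powr (1 / p)))"
  have T0: "0 \<le> T" using DI_le_T[of 0 0] DI_nonneg[of 0 0] by linarith
  have step2: "h n * (P b - \<epsilon> n) \<le> (LINT t|lborel. indicator {b<..b + h n} t * P t)" for n
  proof -
    have "(LINT t|lborel. indicator {b<..b + h n} t * (P b - \<epsilon> n)) \<le> (LINT t|lborel. indicator {b<..b + h n} t * P t)"
    proof (rule integral_mono_AE)
      show "integrable lborel (\<lambda>t. indicator {b<..b + h n} t * (P b - \<epsilon> n))"
        by (intro integrable_mult_left integrable_real_indicator) auto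
      show "integrable lborel (\<lambda>t. indicator {b<..b + h n} t * P t)" by (rule P_interval_integrable[OF b0])
      show "AE t in lborel. indicator {b<..b + h n} t * (P b - \<epsilon> n) \<le> indicator {b<..b + h n} t * P t"
        using A(2)
      proof eventually_elim
        case (elim t)
        show ?case
        proof (cases "t \<in> {b<..b + h n}")
          case True
          then have t: "t \<in> A" using elim b0 by auto
          have "Ip lebesgue p (\<lambda>x. v t x - v b x) \<le> (t - b) powr (p - 1) * DI b t"
            using True b0 by (intro increment_le) auto
          also have "\<dots> \<le> h n powr (p - 1) * T"
            using True p T0 by (intro mult_mono powr_mono2 DI_le_T) auto
          finally have "D b powr (1 - 1 / p) * Ip lebesgue p (\<lambda>x. v t x - v b x) powr (1 / p) \<le> D b powr (1 - 1 / p) * (h n powr (p - 1) * T) powr (1 / p)"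
            using p by (intro mult_left_mono powr_mono2) auto
          then have "p * (D b powr (1 - 1 / p) * Ip lebesgue p (\<lambda>x. v b x - v t x) powr (1 / p)) \<le> \<epsilon> n"
            unfolding \<epsilon>_def Ip_minus_commute[of lebesgue p "v b" "v t"] by (rule mult_left_mono[OF _ p0])
          with tangent_abs[OF b t] have "P b - \<epsilon> n \<le> P t" by linarith
          then show ?thesis using True by simp
        qed simp
      qed
    qed
    moreover have "(LINT t|lborel. indicator {b<..b + h n} t * (P b - \<epsilon> n)) = h n * (P b - \<epsilon> n)"
    proof -
      have "measure lborel {b<..b + h n} = h n" using h[of n] by simp
      then show ?thesis by (simp only: integral_mult_left_zero) simp
    qed
    ultimately show ?thesis by linarith
  qed
  \<comment> \<open>The window after \<open>a\<close> needs an upper bound, so the tangent is taken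
    at the moving time; this brings in \<open>D t\<close> and requires averaging.\<close>
  have step3: "(LINT t|lborel. indicator {a<..a + h n} t * P t) \<le> h n * P a + 2 * p * h n * DI a (a + h n)" for n
    by (rule window_average_le[OF a0 h(1)]) (rule tangent_abs[OF _ a])
  have final: "P b - \<epsilon> n + p * K n \<le> P a + 2 * p * DI a (a + h n)" for n
  proof -
    have "h n * (P b - \<epsilon> n) - (h n * P a + 2 * p * h n * DI a (a + h n)) \<le> - (p * h n * K n)"
      using step1[of n] step2[of n] step3[of n] by linarith
    then have "h n * (P b - \<epsilon> n + p * K n) \<le> h n * (P a + 2 * p * DI a (a + h n))"
      by (simp add: algebra_simps)
    then show ?thesis using h[of n] by simp
  qed
  have \<epsilon>lim: "\<epsilon> \<longlonglongrightarrow> 0"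
  proof -
    have "(\<lambda>n. h n powr (p - 1)) \<longlonglongrightarrow> 0 powr (p - 1)"
      using p less_imp_le[OF h(1)] hlim by (intro tendsto_powr') auto
    then have "(\<lambda>n. h n powr (p - 1)) \<longlonglongrightarrow> 0" using p by simp
    then have "(\<lambda>n. (h n powr (p - 1) * T) powr (1 / p)) \<longlonglongrightarrow> (0 * T) powr (1 / p)"
      using p T0 by (intro tendsto_powr' tendsto_intros) auto
    then have "(\<lambda>n. (h n powr (p - 1) * T) powr (1 / p)) \<longlonglongrightarrow> 0" using p by simp
    then show ?thesis unfolding \<epsilon>_def by (intro tendsto_mult_right_zero)
  qed
  have DIlim: "(\<lambda>n. DI a (a + h n)) \<longlonglongrightarrow> 0" by (rule DI_tendsto_0[OF hlim])
  have Klim: "K \<longlonglongrightarrow> DI a b"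
  proof -
    have i1: "integrable lborel (\<lambda>z. J_op p (g n z) * f z)" for n by (rule Holder_J_op(1)[OF p gL f])
    have dL: "(\<lambda>z. Av n z - f z) \<in> Lp_space lborel p" for n by (rule Lp_space_diff(1)[OF AvL f p0])
    have i2: "integrable lborel (\<lambda>z. J_op p (g n z) * (Av n z - f z))" for n by (rule Holder_J_op(1)[OF p gL dL])
    have K_split: "K n = (LINT z|lborel. J_op p (g n z) * f z) + (LINT z|lborel. J_op p (g n z) * (Av n z - f z))" for n
      unfolding K_def Bochner_Integration.integral_add[OF i1 i2, symmetric] by (simp add: right_diff_distrib)
    have r0: "(\<lambda>n. LINT z|lborel. J_op p (g n z) * (Av n z - f z)) \<longlonglongrightarrow> 0"
    proof (rule Lim_null_comparison)
      have "((\<lambda>n. Ip lborel p (\<lambda>z. Av n z - f z) powr (1 / p)) \<longlonglongrightarrow> 0 powr (1 / p))"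
        using p Avlim by (subst tendsto_powr_inverse_iff) auto
      then have "((\<lambda>n. Ip lborel p (\<lambda>z. Av n z - f z) powr (1 / p)) \<longlonglongrightarrow> 0)" using p by simp
      then show "(\<lambda>n. Ip lborel p f powr (1 - 1 / p) * Ip lborel p (\<lambda>z. Av n z - f z) powr (1 / p)) \<longlonglongrightarrow> 0"
        by (intro tendsto_mult_right_zero)
      show "\<forall>\<^sub>F n in sequentially. norm (LINT z|lborel. J_op p (g n z) * (Av n z - f z)) \<le> Ip lborel p f powr (1 - 1 / p) * Ip lborel p (\<lambda>z. Av n z - f z) powr (1 / p)"
      proof (intro always_eventually allI)
        fix n
        have "norm (LINT z|lborel. J_op p (g n z) * (Av n z - f z)) \<le> Ip lborel p (g n) powr (1 - 1 / p) * Ip lborel p (\<lambda>z. Av n z - f z) powr (1 / p)"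
          using Holder_J_op_abs[OF p gL dL] by simp
        also have "\<dots> \<le> Ip lborel p f powr (1 - 1 / p) * Ip lborel p (\<lambda>z. Av n z - f z) powr (1 / p)"
          using p gI by (intro mult_right_mono powr_mono2) auto
        finally show "norm (LINT z|lborel. J_op p (g n z) * (Av n z - f z)) \<le> Ip lborel p f powr (1 - 1 / p) * Ip lborel p (\<lambda>z. Av n z - f z) powr (1 / p)" .
      qed
    qed
    have main_eq: "(LINT z|lborel. J_op p (g n z) * f z) = DI (a + h n) (b + h n)" for n
    proof -
      have e: "J_op p (g n z) * f z = indicator {a + h n<..b + h n} (snd z) * \<bar>f z\<bar> powr p" for z
        unfolding Jg by (simp add: mult.assoc J_op_mult_self)
      have "integrable ?L (\<lambda>z. indicator {a + h n<..b + h n} (snd z) * \<bar>f z\<bar> powr p)"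
        unfolding lborel_prod using i1[of n] unfolding e .
      then show ?thesis
        using lborel_pair.integral_snd[of "\<lambda>x t. indicator {a + h n<..b + h n} t * \<bar>f (x, t)\<bar> powr p"]
        unfolding e lborel_prod[symmetric] by (simp add: case_prod_beta' DI_def D_def)
    qed
    have "(\<lambda>n. LINT t|lborel. indicator {a + h n<..b + h n} t * D t) \<longlonglongrightarrow> (LINT t|lborel. indicator {a<..b} t * D t)"
    proof (rule integral_dominated_convergence[OF _ _ D_integrable])
      show "AE t in lborel. (\<lambda>n. indicator {a + h n<..b + h n} t * D t) \<longlonglongrightarrow> indicator {a<..b} t * D t"
      proof (rule AE_I2)
        fix t
        have "\<forall>\<^sub>F n in sequentially. indicator {a + h n<..b + h n} t * D t = indicator {a<..b} t * D t"
        proof -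
          consider "t \<le> a" | "a < t" "t \<le> b" | "b < t" by linarith
          then show ?thesis
          proof cases
            case 1
            have "indicator {a + h n<..b + h n} t * D t = indicator {a<..b} t * D t" for n
              using 1 h[of n] by (auto simp: indicator_def)
            then show ?thesis by simp
          next
            case 2
            then have "\<forall>\<^sub>F n in sequentially. h n < t - a" by (intro order_tendstoD(2)[OF hlim]) auto
            then show ?thesis
            proof eventually_elim
              case (elim n)
              then show ?case using 2 h[of n] by (auto simp: indicator_def)
            qed
          next
            case 3
            then have "\<forall>\<^sub>F n in sequentially. h n < t - b" by (intro order_tendstoD(2)[OF hlim]) auto
            then show ?thesis by eventually_elim (use 3 in \<open>auto simp: indicator_def\<close>)
          qed
        qed
        then show "(\<lambda>n. indicator {a + h n<..b + h n} t * D t) \<longlonglongrightarrow> indicator {a<..b} t * D t" by (rule tendsto_eventually)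
      qed
    qed (auto simp: indicator_def)
    then have "(\<lambda>n. DI (a + h n) (b + h n)) \<longlonglongrightarrow> DI a b" by (simp add: DI_def)
    then have "(\<lambda>n. DI (a + h n) (b + h n) + (LINT z|lborel. J_op p (g n z) * (Av n z - f z))) \<longlonglongrightarrow> DI a b + 0"
      by (intro tendsto_add r0)
    then show ?thesis unfolding K_split main_eq by simp
  qed
  have "(\<lambda>n. P b - \<epsilon> n + p * K n) \<longlonglongrightarrow> P b - 0 + p * DI a b" by (intro tendsto_intros \<epsilon>lim Klim)
  moreover have "(\<lambda>n. P a + 2 * p * DI a (a + h n)) \<longlonglongrightarrow> P a + 2 * p * 0" by (intro tendsto_intros DIlim)
  ultimately have "P b - 0 + p * DI a b \<le> P a + 2 * p * 0"
    by (rule LIMSEQ_le) (use final in auto)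
  then show ?thesis by simp
qed

end

subsection \<open>Exponential decay of the energy\<close>

context fractional_flow
begin

definition mu :: real where "mu = l powr (1 / (p - 1))"

definition Pw :: "real \<Rightarrow> real" where "Pw t = exp (p * mu * t) * P t"

definition Nw :: "real \<Rightarrow> real" where "Nw t = exp (p * mu * t) * Ip lebesgue p (v t)"

text \<open>The weighted excess of the dissipation over its lower bound. Formally
  \<open>p * q\<close> is minus the derivative of \<open>Pw\<close>.\<close>

definition q :: "real \<Rightarrow> real" where "q t = exp (p * mu * t) * (D t - mu * P t)"

lemma mu_pos: "0 < mu" using l by (simp add: mu_def)

text \<open>The identity for which \<open>mu\<close> is chosen: it absorbs the Poincare constant in
  \<open>dissipation_ge\<close>.\<close>

lemma mu_powr: "mu powr (1 - 1 / p) = l powr (1 / p)"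
proof -
  have "1 / (p - 1) * (1 - 1 / p) = 1 / p" using p by (simp add: field_simps)
  then show ?thesis by (simp add: mu_def powr_powr)
qed

lemma Nw_le_Pw: "t \<in> A \<Longrightarrow> l * Nw t \<le> Pw t"
  using l(2)[OF AW[of t]] by (simp add: Nw_def Pw_def P(2) mult.left_commute)

lemma Nw_nonneg: "0 \<le> Nw t" by (simp add: Nw_def)

text \<open>Coercivity and Poincare's inequality combine to
  \<open>P t \<le> D t powr (1 - 1 / p) * (P t / l) powr (1 / p)\<close>; solving for
  \<open>D t\<close> produces the constant \<open>mu\<close>.\<close>

lemma dissipation_ge:
  assumes t: "t \<in> A"
  shows "mu * P t \<le> D t"
proof (cases "P t = 0")
  case False
  then have Pp: "0 < P t" using P_nonneg[OF t] by simp
  have "Ip lebesgue p (v t) \<le> P t / l" using l(2)[OF AW[OF t]] l(1) by (simp add: P(2)[OF t] pos_le_divide_eq mult.commute)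
  then have "D t powr (1 - 1 / p) * Ip lebesgue p (v t) powr (1 / p) \<le> D t powr (1 - 1 / p) * (P t / l) powr (1 / p)"
    using p by (intro mult_left_mono powr_mono2) auto
  with coercivity[OF t] have "P t \<le> D t powr (1 - 1 / p) * (P t / l) powr (1 / p)" by linarith
  moreover have "P t = P t powr (1 - 1 / p) * P t powr (1 / p)" using Pp by (simp add: powr_add[symmetric])
  moreover have "(P t / l) powr (1 / p) = P t powr (1 / p) / l powr (1 / p)" using Pp l by (simp add: powr_divide)
  ultimately have "P t powr (1 - 1 / p) * P t powr (1 / p) \<le> (D t powr (1 - 1 / p) / l powr (1 / p)) * P t powr (1 / p)" by simp
  then have "P t powr (1 - 1 / p) \<le> D t powr (1 - 1 / p) / l powr (1 / p)" using Pp by (subst (asm) mult_le_cancel_right_pos) auto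
  then have "mu powr (1 - 1 / p) * P t powr (1 - 1 / p) \<le> D t powr (1 - 1 / p)"
    using l by (simp add: mu_powr pos_le_divide_eq mult.commute)
  then have le: "(mu * P t) powr (1 - 1 / p) \<le> D t powr (1 - 1 / p)" using mu_pos Pp by (simp add: powr_mult)
  show ?thesis
  proof (rule ccontr)
    assume "\<not> ?thesis"
    then have "D t powr (1 - 1 / p) < (mu * P t) powr (1 - 1 / p)" using p by (intro powr_less_mono2) auto
    with le show False by simp
  qed
qed simp

lemma q_nonneg: "t \<in> A \<Longrightarrow> 0 \<le> q t"
  using dissipation_ge by (simp add: q_def)

lemma exp_interval_integral:
  fixes a r c :: real
  assumes "a \<le> r" "0 < c"
  shows "(LINT \<tau>|lborel. indicator {a<..r} \<tau> * (c * exp (c * \<tau>))) = exp (c * r) - exp (c * a)"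
proof -
  have "(LINT \<tau>|lborel. indicator {a<..r} \<tau> * (c * exp (c * \<tau>))) = (LINT \<tau>|lborel. indicator {a..r} \<tau> *\<^sub>R (c * exp (c * \<tau>)))"
  proof (rule integral_cong_AE)
    show "AE \<tau> in lborel. indicator {a<..r} \<tau> * (c * exp (c * \<tau>)) = indicator {a..r} \<tau> *\<^sub>R (c * exp (c * \<tau>))"
      using AE_lborel_singleton[of a]
    proof eventually_elim
      case (elim \<tau>)
      have "indicator {a<..r} \<tau> = (indicator {a..r} \<tau> :: real)"
        using elim by (cases "a < \<tau>"; cases "\<tau> \<le> r") (auto simp: indicator_def)
      then show ?case by simp
    qed
  qed measurable
  also have "\<dots> = exp (c * r) - exp (c * a)"
  proof (rule integral_FTC_atLeastAtMost[OF assms(1)])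
    show "((\<lambda>\<tau>. exp (c * \<tau>)) has_vector_derivative c * exp (c * x)) (at x within {a..r})" for x
      unfolding has_real_derivative_iff_has_vector_derivative[symmetric]
      by (auto intro!: derivative_eq_intros)
  qed (intro continuous_intros)
  finally show ?thesis .
qed

lemma exp_weight_integrable:
  fixes a b c :: real and g :: "real \<Rightarrow> real"
  assumes "integrable lborel (\<lambda>t. indicator {a<..b} t * g t)" and [measurable]: "g \<in> borel_measurable borel" and "0 < c"
  shows "integrable lborel (\<lambda>t. indicator {a<..b} t * (exp (c * t) * g t))"
proof (rule Bochner_Integration.integrable_bound)
  show "integrable lborel (\<lambda>t. exp (c * b) * (indicator {a<..b} t * g t))" using assms(1) by simp
  show "AE t in lborel. norm (indicator {a<..b} t * (exp (c * t) * g t)) \<le> norm (exp (c * b) * (indicator {a<..b} t * g t))"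
  proof (rule AE_I2)
    fix t
    show "norm (indicator {a<..b} t * (exp (c * t) * g t)) \<le> norm (exp (c * b) * (indicator {a<..b} t * g t))"
    proof (cases "t \<in> {a<..b}")
      case True
      have "exp (c * t) * \<bar>g t\<bar> \<le> exp (c * b) * \<bar>g t\<bar>" using True assms(3) by (intro mult_right_mono) auto
      then show ?thesis using True by (simp add: abs_mult)
    qed simp
  qed
qed measurable

text \<open>
  The energy inequality on \<open>(\<tau>, b]\<close>, multiplied by the derivative of the exponential weight and
  integrated over \<open>\<tau>\<close>: exchanging the integrals plays the role of Gronwall's lemma.
\<close>

lemma weighted_energy_inequality:
  assumes a: "a \<in> A" and b: "b \<in> A" and ab: "a < b"
  shows "Pw b + p * (LINT t|lborel. indicator {a<..b} t * q t) \<le> Pw a"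
    and "integrable lborel (\<lambda>t. indicator {a<..b} t * q t)"
proof -
  define c where "c = p * mu"
  have c: "0 < c" using p mu_pos by (simp add: c_def)
  have a0: "0 \<le> a" using a A_nonneg by auto
  let ?I = "\<lambda>t. indicator {a<..b} t :: real"
  note [measurable] = P(1)
  have iP: "integrable lborel (\<lambda>t. ?I t * P t)" by (rule P_interval_integrable[OF a0])
  have iD: "integrable lborel (\<lambda>t. ?I t * D t)" by (rule D_indicator_integrable) auto
  have iEP: "integrable lborel (\<lambda>t. ?I t * (exp (c * t) * P t))" by (rule exp_weight_integrable[OF iP _ c]) measurable
  have iED: "integrable lborel (\<lambda>t. ?I t * (exp (c * t) * D t))" by (rule exp_weight_integrable[OF iD _ c]) measurable
  have qeq: "?I t * q t = ?I t * (exp (c * t) * D t) - mu * (?I t * (exp (c * t) * P t))" for t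
    by (simp add: q_def c_def algebra_simps)
  show iq: "integrable lborel (\<lambda>t. ?I t * q t)" unfolding qeq using iED iEP by auto
  let ?L = "(lborel :: real measure) \<Otimes>\<^sub>M (lborel :: real measure)"
  \<comment> \<open>The integrand on the triangle \<open>a < \<tau> \<le> r \<le> b\<close>.
    Integration over \<open>r\<close> gives the weighted \<open>DI \<tau> b\<close>, integration
    over \<open>\<tau>\<close> gives \<open>D r\<close> times an increment of the
    exponential.\<close>
  define k where "k = (\<lambda>\<tau> r. if a < \<tau> \<and> \<tau> \<le> r \<and> r \<le> b then c * exp (c * \<tau>) * D r else 0)"
  have prod: "integrable ?L (\<lambda>z. (c * exp (c * b)) * (?I (fst z) * D (snd z)))"
  proof (intro integrable_mult_right lborel_pair.Fubini_integrable)
    show "(\<lambda>z. ?I (fst z) * D (snd z)) \<in> borel_measurable ?L" by measurable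
    have "(LINT y|lborel. norm (?I (fst (x, y)) * D (snd (x, y)))) = ?I x * T" for x
      by (simp add: abs_mult T_def)
    then show "integrable lborel (\<lambda>x. LINT y|lborel. norm (?I (fst (x, y)) * D (snd (x, y))))"
      by simp
    show "AE x in lborel. integrable lborel (\<lambda>y. ?I (fst (x, y)) * D (snd (x, y)))"
      using D_integrable by simp
  qed
  have km: "(\<lambda>z. k (fst z) (snd z)) \<in> borel_measurable ?L" unfolding k_def by measurable
  have ki: "integrable ?L (case_prod k)"
    unfolding case_prod_beta'
  proof (rule Bochner_Integration.integrable_bound[OF prod km])
    show "AE z in ?L. norm (k (fst z) (snd z)) \<le> norm (c * exp (c * b) * (?I (fst z) * D (snd z)))"
    proof (rule AE_I2)
      fix z
      show "norm (k (fst z) (snd z)) \<le> norm (c * exp (c * b) * (?I (fst z) * D (snd z)))"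
      proof (cases "a < fst z \<and> fst z \<le> snd z \<and> snd z \<le> b")
        case True
        have "c * exp (c * fst z) * D (snd z) \<le> c * exp (c * b) * D (snd z)"
          using True c by (intro mult_right_mono mult_left_mono) auto
        then show ?thesis using True c by (simp add: k_def abs_mult)
      next
        case False
        then have "k (fst z) (snd z) = 0" unfolding k_def by (rule if_not_P)
        then show ?thesis by simp
      qed
    qed
  qed
  have k_r: "(LINT r|lborel. k \<tau> r) = ?I \<tau> * (c * exp (c * \<tau>)) * DI \<tau> b" for \<tau>
  proof -
    have "(LINT r|lborel. k \<tau> r) = (LINT r|lborel. ?I \<tau> * (c * exp (c * \<tau>)) * (indicator {\<tau><..b} r * D r))"
    proof (rule integral_cong_AE)
      show "AE r in lborel. k \<tau> r = ?I \<tau> * (c * exp (c * \<tau>)) * (indicator {\<tau><..b} r * D r)"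
        using AE_lborel_singleton[of \<tau>] by eventually_elim (auto simp: k_def indicator_def)
      show "k \<tau> \<in> borel_measurable lborel" unfolding k_def by measurable
    qed measurable
    then show ?thesis by (simp add: DI_def)
  qed
  have k_\<tau>: "(LINT \<tau>|lborel. k \<tau> r) = ?I r * (exp (c * r) * D r) - exp (c * a) * (?I r * D r)" for r
  proof -
    have "(LINT \<tau>|lborel. k \<tau> r) = (LINT \<tau>|lborel. (?I r * D r) * (indicator {a<..r} \<tau> * (c * exp (c * \<tau>))))"
      by (rule Bochner_Integration.integral_cong) (auto simp: k_def indicator_def)
    also have "\<dots> = (?I r * D r) * (LINT \<tau>|lborel. indicator {a<..r} \<tau> * (c * exp (c * \<tau>)))" by simp
    also have "\<dots> = (?I r * D r) * (exp (c * r) - exp (c * a))"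
      using exp_interval_integral[of a r c] c by (cases "r \<in> {a<..b}") auto
    finally show ?thesis by (simp add: algebra_simps)
  qed
  have swap: "(LINT \<tau>|lborel. ?I \<tau> * (c * exp (c * \<tau>)) * DI \<tau> b) = (LINT r|lborel. ?I r * (exp (c * r) * D r)) - exp (c * a) * DI a b"
  proof -
    have "(LINT \<tau>|lborel. LINT r|lborel. k \<tau> r) = (LINT r|lborel. LINT \<tau>|lborel. k \<tau> r)"
      by (rule lborel_pair.Fubini_integral[OF ki, symmetric])
    then show ?thesis unfolding k_r k_\<tau> using iED iD by (simp add: DI_def)
  qed
  have i1: "integrable lborel (\<lambda>\<tau>. ?I \<tau> * (c * exp (c * \<tau>)) * DI \<tau> b)"
    using lborel_pair.integrable_fst[OF ki] unfolding k_r .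
  have i2: "integrable lborel (\<lambda>\<tau>. ?I \<tau> * (c * exp (c * \<tau>)))"
    using exp_weight_integrable[of a b "\<lambda>_. c" c] c by (simp add: mult.commute)
  have i3: "integrable lborel (\<lambda>\<tau>. c * (?I \<tau> * (exp (c * \<tau>) * P \<tau>)))" using iEP by simp
  have "(LINT \<tau>|lborel. (?I \<tau> * (c * exp (c * \<tau>))) * P b + p * (?I \<tau> * (c * exp (c * \<tau>)) * DI \<tau> b)) \<le> (LINT \<tau>|lborel. c * (?I \<tau> * (exp (c * \<tau>) * P \<tau>)))"
  proof (rule integral_mono_AE)
    show "integrable lborel (\<lambda>\<tau>. (?I \<tau> * (c * exp (c * \<tau>))) * P b + p * (?I \<tau> * (c * exp (c * \<tau>)) * DI \<tau> b))"
      using i1 i2 by auto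
    show "AE \<tau> in lborel. (?I \<tau> * (c * exp (c * \<tau>))) * P b + p * (?I \<tau> * (c * exp (c * \<tau>)) * DI \<tau> b) \<le> c * (?I \<tau> * (exp (c * \<tau>) * P \<tau>))"
      using A(2)
    proof eventually_elim
      case (elim \<tau>)
      show ?case
      proof (cases "\<tau> \<in> {a<..b}")
        case True
        then have \<tau>: "\<tau> \<in> A" using elim a0 by auto
        have "P b + p * DI \<tau> b \<le> P \<tau>"
        proof (cases "\<tau> = b")
          case True
          then show ?thesis by (simp add: DI_def)
        next
          case False
          then show ?thesis using True by (intro energy_inequality \<tau> b) auto
        qed
        then have "(c * exp (c * \<tau>)) * (P b + p * DI \<tau> b) \<le> (c * exp (c * \<tau>)) * P \<tau>"
          using c by (intro mult_left_mono) auto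
        then show ?thesis using True by (simp add: algebra_simps)
      qed simp
    qed
  qed (rule i3)
  then have "(exp (c * b) - exp (c * a)) * P b + p * ((LINT r|lborel. ?I r * (exp (c * r) * D r)) - exp (c * a) * DI a b)
      \<le> c * (LINT \<tau>|lborel. ?I \<tau> * (exp (c * \<tau>) * P \<tau>))"
    using i1 i2 exp_interval_integral[of a b c] c ab swap by simp
  \<comment> \<open>The unintegrated inequality, weighted by the initial value of the exponential,
    supplies the boundary terms at \<open>a\<close> that the triangle integral leaves over.\<close>
  moreover have "exp (c * a) * (P b + p * DI a b) \<le> exp (c * a) * P a"
    using energy_inequality[OF a b ab] by (intro mult_left_mono) auto
  moreover have "p * (LINT t|lborel. ?I t * q t) = p * (LINT r|lborel. ?I r * (exp (c * r) * D r)) - c * (LINT \<tau>|lborel. ?I \<tau> * (exp (c * \<tau>) * P \<tau>))"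
    unfolding qeq using iED iEP by (simp add: c_def right_diff_distrib)
  ultimately show "Pw b + p * (LINT t|lborel. ?I t * q t) \<le> Pw a"
    unfolding Pw_def c_def[symmetric] by (simp add: algebra_simps)
qed

section \<open>Times in \<open>A\<close> and limits along them\<close>

lemma A_meets:
  assumes "0 \<le> x" "x < y" and "AE t in lborel. x < t \<and> t < y \<longrightarrow> t \<in> A \<longrightarrow> \<not> Q t"
  shows "\<exists>t\<in>A. x < t \<and> t < y \<and> \<not> Q t"
proof (rule ccontr)
  assume *: "\<not> ?thesis"
  have "AE t in lborel. t \<notin> {x<..<y}"
    using A(2) assms(3) by eventually_elim (use * assms(1) in auto)
  then have "emeasure lborel {x<..<y} = 0" by (subst (asm) AE_iff_measurable[of "{x<..<y}"]) auto
  with assms show False by simp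
qed

lemma A_dense: "0 \<le> x \<Longrightarrow> x < y \<Longrightarrow> \<exists>t\<in>A. x < t \<and> t < y"
  using A_meets[of x y "\<lambda>_. False"] by auto

text \<open>The equation and the energy bounds are available on \<open>A\<close> only, so limits are
  first taken along this filter; \<open>full_limit\<close> passes to \<open>at_top\<close>.\<close>

definition FA :: "real filter" where "FA = inf at_top (principal A)"

lemma eventually_FA: "eventually Q FA \<longleftrightarrow> (\<exists>T. \<forall>t\<in>A. T \<le> t \<longrightarrow> Q t)"
  unfolding FA_def eventually_inf_principal eventually_at_top_linorder by blast

lemma Pw_nonneg: "t \<in> A \<Longrightarrow> 0 \<le> Pw t" by (simp add: Pw_def P_nonneg)

lemma Pw_antimono:
  assumes "a \<in> A" "b \<in> A" "a \<le> b"
  shows "Pw b \<le> Pw a"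
proof (cases "a = b")
  case False
  then have ab: "a < b" using assms by simp
  have "0 \<le> (LINT t|lborel. indicator {a<..b} t * q t)"
    by (rule integral_nonneg_AE) (use A(2) A_nonneg[OF assms(1)] q_nonneg in \<open>auto elim!: eventually_mono simp: indicator_def\<close>)
  then have "0 \<le> p * (LINT t|lborel. indicator {a<..b} t * q t)" using p0 by simp
  with weighted_energy_inequality(1)[OF assms(1,2) ab] show ?thesis by linarith
qed simp

definition S :: real where "S = Inf (Pw ` A)"

lemma A_nonempty: "A \<noteq> {}" using A_dense[of 0 1] by auto

lemma S_le: "t \<in> A \<Longrightarrow> S \<le> Pw t"
  unfolding S_def by (rule cInf_lower) (auto intro!: bdd_belowI[of _ 0] Pw_nonneg)

lemma S_nonneg: "0 \<le> S"
  unfolding S_def using A_nonempty by (intro cInf_greatest) (auto intro: Pw_nonneg)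

lemma S_approx: "0 < e \<Longrightarrow> \<exists>a\<in>A. Pw a < S + e"
  using cInf_lessD[of "Pw ` A" "S + e"] A_nonempty by (auto simp: S_def)

lemma Pw_tendsto: "(Pw \<longlongrightarrow> S) FA"
proof (rule tendstoI)
  fix e :: real assume "0 < e"
  then obtain a where a: "a \<in> A" "Pw a < S + e" using S_approx by blast
  show "\<forall>\<^sub>F t in FA. dist (Pw t) S < e"
    unfolding eventually_FA
  proof (intro exI ballI impI)
    fix t assume t: "t \<in> A" "a \<le> t"
    show "dist (Pw t) S < e" using Pw_antimono[OF a(1) t] S_le[OF t(1)] a(2) by (simp add: dist_real_def)
  qed
qed

lemma exp_mu_powr: "exp (p * mu * t) powr (1 / p) = exp (mu * t)"
  using p by (simp add: powr_def)

lemma Nw_powr: "Nw t powr (1 / p) = exp (mu * t) * Ip lebesgue p (v t) powr (1 / p)"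
  by (simp add: Nw_def powr_mult exp_mu_powr)

lemma weighted_DI_le:
  assumes a: "a \<in> A" and b: "b \<in> A" and ab: "a < b"
  shows "exp (p * mu * a) * DI a b \<le> Pw a"
proof -
  have "DI a b \<le> p * DI a b" using p mult_right_mono[of 1 p "DI a b"] by simp
  also have "\<dots> \<le> P a" using energy_inequality[OF assms] P_nonneg[OF b] by linarith
  finally show ?thesis unfolding Pw_def by (intro mult_left_mono) auto
qed

text \<open>Minkowski's inequality bounds the loss by the increment, and the increment by the
  dissipation after \<open>a\<close>, hence by \<open>Pw a\<close>. The growing exponential weight
  acts in the favourable direction.\<close>

lemma Nw_lower:
  assumes a: "a \<in> A" and b: "b \<in> A" and ab: "a < b" and h: "b - a \<le> h"
  shows "Nw a powr (1 / p) - (h powr (p - 1) * Pw a) powr (1 / p) \<le> Nw b powr (1 / p)"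
proof -
  have a0: "0 \<le> a" and b0: "0 \<le> b" using a b A_nonneg by auto
  have "Ip lebesgue p (v a) powr (1 / p) - Ip lebesgue p (v b) powr (1 / p) \<le> Ip lebesgue p (\<lambda>x. v b x - v a x) powr (1 / p)"
    using Minkowski_Ip_diff[OF p v[OF b0] v[OF a0]] by linarith
  then have "exp (mu * a) * (Ip lebesgue p (v a) powr (1 / p) - Ip lebesgue p (v b) powr (1 / p)) \<le> exp (mu * a) * Ip lebesgue p (\<lambda>x. v b x - v a x) powr (1 / p)"
    by (intro mult_left_mono) auto
  also have "\<dots> \<le> exp (mu * a) * ((b - a) powr (p - 1) * DI a b) powr (1 / p)"
    using increment_le[OF a0, of b] ab p by (intro mult_left_mono powr_mono2) auto
  also have "\<dots> = ((b - a) powr (p - 1) * (exp (p * mu * a) * DI a b)) powr (1 / p)"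
    by (simp add: powr_mult exp_mu_powr[symmetric])
  also have "\<dots> \<le> (h powr (p - 1) * Pw a) powr (1 / p)"
    using weighted_DI_le[OF a b ab] h ab p by (intro powr_mono2 mult_mono) auto
  finally have "Nw a powr (1 / p) - (h powr (p - 1) * Pw a) powr (1 / p) \<le> exp (mu * a) * Ip lebesgue p (v b) powr (1 / p)"
    by (simp add: Nw_powr right_diff_distrib)
  also have "\<dots> \<le> Nw b powr (1 / p)"
    unfolding Nw_powr using ab mu_pos by (intro mult_right_mono) auto
  finally show ?thesis .
qed

text \<open>At a time of small excess the weighted dissipation is at most
  \<open>\<delta> + mu * (S + \<delta>)\<close>. Coercivity, read as a lower bound for the other
  factor, then keeps the \<open>L\<^sup>p\<close> norm away from zero.\<close>

lemma Nw_lower_good: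
  assumes t: "t \<in> A" and qt: "q t \<le> \<delta>" and Sp: "0 < S" and P\<delta>: "Pw t \<le> S + \<delta>"
  shows "S / (\<delta> + mu * (S + \<delta>)) powr (1 - 1 / p) \<le> Nw t powr (1 / p)"
proof -
  have \<delta>: "0 \<le> \<delta>" using S_le[OF t] P\<delta> by linarith
  define W where "W = \<delta> + mu * (S + \<delta>)"
  have W: "0 < W" unfolding W_def using Sp \<delta> mu_pos by (intro add_nonneg_pos) auto
  have "exp (p * mu * t) * D t = q t + mu * Pw t" by (simp add: q_def Pw_def algebra_simps)
  also have "\<dots> \<le> W" unfolding W_def using qt P\<delta> mu_pos by (intro add_mono mult_left_mono) auto
  finally have DW: "exp (p * mu * t) * D t \<le> W" .
  have "S \<le> Pw t" by (rule S_le[OF t])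
  also have "Pw t \<le> exp (p * mu * t) * (D t powr (1 - 1 / p) * Ip lebesgue p (v t) powr (1 / p))"
    unfolding Pw_def by (intro mult_left_mono coercivity t) auto
  also have "exp (p * mu * t) = exp (p * mu * t) powr (1 - 1 / p) * exp (p * mu * t) powr (1 / p)"
    by (simp add: powr_add[symmetric])
  also have "exp (p * mu * t) powr (1 - 1 / p) * exp (p * mu * t) powr (1 / p) * (D t powr (1 - 1 / p) * Ip lebesgue p (v t) powr (1 / p))
      = (exp (p * mu * t) * D t) powr (1 - 1 / p) * Nw t powr (1 / p)"
    by (simp add: powr_mult Nw_def)
  also have "\<dots> \<le> W powr (1 - 1 / p) * Nw t powr (1 / p)"
    using DW p by (intro mult_right_mono powr_mono2) auto
  finally show ?thesis unfolding W_def[symmetric] using W by (simp add: pos_divide_le_eq mult.commute)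
qed

text \<open>The upper bound is Poincare's inequality. For the lower bound, every late window of
  length \<open>\<delta>\<close> contains a time of excess at most \<open>\<delta>\<close>, where
  \<open>Nw_lower_good\<close> applies; \<open>Nw_lower\<close> carries the bound to the end of the
  window.\<close>

lemma Nw_tendsto: "(Nw \<longlongrightarrow> S / l) FA"
proof (cases "S = 0")
  case True
  have "((\<lambda>t. Pw t / l) \<longlongrightarrow> S / l) FA" using l by (intro tendsto_intros Pw_tendsto) auto
  then have up: "((\<lambda>t. Pw t / l) \<longlongrightarrow> 0) FA" using True by simp
  have "(Nw \<longlongrightarrow> 0) FA"
  proof (rule tendsto_sandwich[OF _ _ tendsto_const up])
    show "\<forall>\<^sub>F t in FA. Nw t \<le> Pw t / l"
      unfolding eventually_FA using Nw_le_Pw l(1) by (auto simp: pos_le_divide_eq mult.commute)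
  qed (simp add: Nw_nonneg)
  with True show ?thesis by simp
next
  case False
  then have Sp: "0 < S" using S_nonneg by simp
  \<comment> \<open>The lower bound resulting from \<open>Nw_lower_good\<close> and
    \<open>Nw_lower\<close>. By \<open>mu_powr\<close> its limit as \<open>\<delta>\<close> vanishes
    is exactly the value allowed by Poincare's inequality.\<close>
  define H where "H = (\<lambda>\<delta>. S / (\<delta> + mu * (S + \<delta>)) powr (1 - 1 / p) - (\<delta> powr (p - 1) * (S + 1)) powr (1 / p))"
  have Hlim: "(H \<longlongrightarrow> (S / l) powr (1 / p)) (at_right 0)"
  proof -
    have pos: "0 < mu * S" using mu_pos Sp by simp
    have "((\<lambda>\<delta>. \<delta> powr (p - 1)) \<longlongrightarrow> 0 powr (p - 1)) (at_right 0)"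
      using p by (intro tendsto_powr' tendsto_ident_at tendsto_const) (auto simp: eventually_at_filter)
    then have z: "((\<lambda>\<delta>. \<delta> powr (p - 1)) \<longlongrightarrow> 0) (at_right 0)" using p by simp
    have "((\<lambda>\<delta>. (\<delta> powr (p - 1) * (S + 1)) powr (1 / p)) \<longlongrightarrow> (0 * (S + 1)) powr (1 / p)) (at_right 0)"
      using p Sp by (intro tendsto_powr' tendsto_intros z) (auto simp: eventually_at_filter)
    then have z': "((\<lambda>\<delta>. (\<delta> powr (p - 1) * (S + 1)) powr (1 / p)) \<longlongrightarrow> 0) (at_right 0)" using p by simp
    have "((\<lambda>\<delta>. S / (\<delta> + mu * (S + \<delta>)) powr (1 - 1 / p)) \<longlongrightarrow> S / (0 + mu * (S + 0)) powr (1 - 1 / p)) (at_right 0)"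
      using pos by (intro tendsto_intros) auto
    moreover have "S / (0 + mu * (S + 0)) powr (1 - 1 / p) = (S / l) powr (1 / p)"
    proof -
      have "(mu * S) powr (1 - 1 / p) = l powr (1 / p) * S powr (1 - 1 / p)"
        using mu_pos Sp by (simp add: powr_mult mu_powr)
      moreover have "S = S powr (1 - 1 / p) * S powr (1 / p)" using Sp by (simp add: powr_add[symmetric])
      ultimately have "S / (mu * S) powr (1 - 1 / p) = (S powr (1 - 1 / p) * S powr (1 / p)) / (l powr (1 / p) * S powr (1 - 1 / p))"
        by simp
      also have "\<dots> = S powr (1 / p) / l powr (1 / p)" using Sp by simp
      finally show ?thesis using Sp l by (simp add: powr_divide)
    qed
    ultimately show ?thesis unfolding H_def using tendsto_diff[OF _ z'] by fastforce
  qed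
  have low: "\<forall>\<^sub>F t in FA. (S / l) powr (1 / p) - e < Nw t powr (1 / p)" if e: "0 < e" for e
  proof -
    have "\<forall>\<^sub>F \<delta> in at_right 0. (S / l) powr (1 / p) - e < H \<delta>" using e by (intro order_tendstoD(1)[OF Hlim]) auto
    moreover have "\<forall>\<^sub>F \<delta> in at_right (0 :: real). 0 < \<delta> \<and> \<delta> < 1"
      unfolding eventually_at_right_field by (intro exI[of _ 1]) auto
    ultimately have "\<forall>\<^sub>F \<delta> in at_right (0 :: real). 0 < \<delta> \<and> \<delta> < 1 \<and> (S / l) powr (1 / p) - e < H \<delta>"
      by eventually_elim auto
    then obtain \<delta> where \<delta>: "0 < \<delta>" "\<delta> < 1" "(S / l) powr (1 / p) - e < H \<delta>"
      using eventually_happens[of _ "at_right (0 :: real)"] by auto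
    \<comment> \<open>The first entry of the minimum gives \<open>Pw \<le> S + \<delta>\<close>
      after \<open>a\<close>. The second leaves a total excess below
      \<open>\<delta> * \<delta>\<close>, which an excess above \<open>\<delta>\<close> throughout a
      window of length \<open>\<delta>\<close> would violate.\<close>
    obtain a where a: "a \<in> A" "Pw a < S + min \<delta> (p * \<delta> * \<delta>)"
      using S_approx[of "min \<delta> (p * \<delta> * \<delta>)"] \<delta> p by auto
    show ?thesis
      unfolding eventually_FA
    proof (intro exI[of _ "a + \<delta>"] ballI impI)
      fix t assume t: "t \<in> A" "a + \<delta> \<le> t"
      have a0: "0 \<le> a" using a A_nonneg by auto
      have at: "a < t" using t \<delta> by simp
      have "\<exists>t'\<in>A. t - \<delta> < t' \<and> t' < t \<and> q t' \<le> \<delta>"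
      proof (rule ccontr)
        assume no: "\<not> ?thesis"
        have iq: "integrable lborel (\<lambda>\<tau>. indicator {a<..t} \<tau> * q \<tau>)" by (rule weighted_energy_inequality(2)[OF a(1) t(1) at])
        have "(LINT \<tau>|lborel. indicator {t - \<delta><..<t} \<tau> * \<delta>) \<le> (LINT \<tau>|lborel. indicator {a<..t} \<tau> * q \<tau>)"
        proof (rule integral_mono_AE[OF _ iq])
          show "integrable lborel (\<lambda>\<tau>. indicator {t - \<delta><..<t} \<tau> * \<delta>)"
            using \<delta> by (intro integrable_mult_left integrable_real_indicator) auto
          show "AE \<tau> in lborel. indicator {t - \<delta><..<t} \<tau> * \<delta> \<le> indicator {a<..t} \<tau> * q \<tau>"
            using A(2)
          proof eventually_elim
            case (elim \<tau>)
            show ?case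
            proof (cases "\<tau> \<in> {a<..t}")
              case True
              then have "\<tau> \<in> A" using elim a0 by auto
              then show ?thesis using True no q_nonneg[of \<tau>] by (auto simp: indicator_def not_le intro: less_imp_le)
            next
              case False
              then show ?thesis using t \<delta> by (auto simp: indicator_def)
            qed
          qed
        qed
        moreover have "(LINT \<tau>|lborel. indicator {t - \<delta><..<t} \<tau> * \<delta>) = \<delta> * \<delta>" 
        proof -
          have "measure lborel {t - \<delta><..<t} = \<delta>" using \<delta> by simp
          then show ?thesis by (simp only: integral_mult_left_zero) simp
        qed
        ultimately have "\<delta> * \<delta> \<le> (LINT \<tau>|lborel. indicator {a<..t} \<tau> * q \<tau>)" by linarith
        then have "p * (\<delta> * \<delta>) \<le> p * (LINT \<tau>|lborel. indicator {a<..t} \<tau> * q \<tau>)" using p by (intro mult_left_mono) auto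
        with weighted_energy_inequality(1)[OF a(1) t(1) at] S_le[OF t(1)] a(2) show False by (simp add: mult.assoc)
      qed
      then obtain t' where t': "t' \<in> A" "t - \<delta> < t'" "t' < t" "q t' \<le> \<delta>" by blast
      have Pt': "Pw t' \<le> S + \<delta>" using Pw_antimono[OF a(1) t'(1)] t' t a(2) by auto
      have "(\<delta> powr (p - 1) * Pw t') powr (1 / p) \<le> (\<delta> powr (p - 1) * (S + 1)) powr (1 / p)"
        using Pt' \<delta> p Pw_nonneg[OF t'(1)] by (intro powr_mono2 mult_left_mono) auto
      moreover have "Nw t' powr (1 / p) - (\<delta> powr (p - 1) * Pw t') powr (1 / p) \<le> Nw t powr (1 / p)"
        using t' by (intro Nw_lower t) auto
      moreover have "S / (\<delta> + mu * (S + \<delta>)) powr (1 - 1 / p) \<le> Nw t' powr (1 / p)"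
        by (rule Nw_lower_good[OF t'(1,4) Sp Pt'])
      ultimately have "H \<delta> \<le> Nw t powr (1 / p)" unfolding H_def by linarith
      with \<delta>(3) show "(S / l) powr (1 / p) - e < Nw t powr (1 / p)" by linarith
    qed
  qed
  have up: "\<forall>\<^sub>F t in FA. Nw t powr (1 / p) < (S / l) powr (1 / p) + e" if e: "0 < e" for e
  proof -
    have "((\<lambda>t. (Pw t / l) powr (1 / p)) \<longlongrightarrow> (S / l) powr (1 / p)) FA"
      using l Sp by (intro tendsto_intros Pw_tendsto) auto
    then have "\<forall>\<^sub>F t in FA. (Pw t / l) powr (1 / p) < (S / l) powr (1 / p) + e" using e by (intro order_tendstoD) auto
    moreover have "\<forall>\<^sub>F t in FA. Nw t powr (1 / p) \<le> (Pw t / l) powr (1 / p)"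
      unfolding eventually_FA
      using Nw_le_Pw l(1) Nw_nonneg p by (auto intro!: powr_mono2 simp: pos_le_divide_eq mult.commute)
    ultimately show ?thesis by eventually_elim linarith
  qed
  have "((\<lambda>t. Nw t powr (1 / p)) \<longlongrightarrow> (S / l) powr (1 / p)) FA"
  proof (rule tendstoI)
    fix e :: real assume e: "0 < e"
    show "\<forall>\<^sub>F t in FA. dist (Nw t powr (1 / p)) ((S / l) powr (1 / p)) < e"
      using low[OF e] up[OF e] by eventually_elim (auto simp: dist_real_def)
  qed
  then show ?thesis
    by (subst (asm) tendsto_powr_inverse_iff) (use p Nw_nonneg Sp l in auto)
qed

end

subsection \<open>Convergence of the rescaled flow\<close>

context fractional_flow
begin

definition W :: "real \<Rightarrow> 'a \<Rightarrow> real" where "W t x = exp (mu * t) * v t x"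

lemma W_fun: "W t = (\<lambda>x. exp (mu * t) * v t x)" by (simp add: W_def fun_eq_iff)

lemma exp_mu_abs_powr: "\<bar>exp (mu * t)\<bar> powr p = exp (p * mu * t)"
  by (simp add: powr_def mult.assoc)

lemma W_Lp: "0 \<le> t \<Longrightarrow> W t \<in> Lp_space lebesgue p"
  unfolding W_fun by (intro Lp_space_cmult v)

lemma W_Wsp0: "t \<in> A \<Longrightarrow> W t \<in> Wsp0 \<Omega> s p"
  unfolding W_fun by (intro Wsp0_cmult AW p)

lemma W_Wsp: "t \<in> A \<Longrightarrow> W t \<in> Wsp s p"
  by (rule Wsp0_imp_Wsp[OF W_Wsp0])

lemma Gag_W: "t \<in> A \<Longrightarrow> Gag s p (W t) = Pw t"
  unfolding W_fun Gag_cmult exp_mu_abs_powr by (simp add: Pw_def P(2))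

lemma Ip_W: "Ip lebesgue p (W t) = Nw t"
  unfolding W_fun Ip_cmult exp_mu_abs_powr by (simp add: Nw_def)

lemma v_dist_le:
  assumes "0 \<le> t" "0 \<le> t'"
  shows "Ip lebesgue p (\<lambda>x. v t' x - v t x) \<le> \<bar>t' - t\<bar> powr (p - 1) * T"
proof -
  have *: "Ip lebesgue p (\<lambda>x. v b x - v a x) \<le> \<bar>b - a\<bar> powr (p - 1) * T" if "0 \<le> a" "a \<le> b" for a b
  proof -
    have "Ip lebesgue p (\<lambda>x. v b x - v a x) \<le> (b - a) powr (p - 1) * DI a b" by (rule increment_le[OF that])
    also have "\<dots> \<le> \<bar>b - a\<bar> powr (p - 1) * T" using that by (intro mult_mono DI_le_T) auto
    finally show ?thesis .
  qed
  show ?thesis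
  proof (cases "t \<le> t'")
    case True
    then show ?thesis using *[OF assms(1)] by simp
  next
    case False
    then show ?thesis using *[OF assms(2), of t] by (simp add: Ip_minus_commute[of lebesgue p "v t'"] abs_minus_commute)
  qed
qed

lemma W_continuous:
  assumes t: "0 \<le> t"
  shows "((\<lambda>\<tau>. Ip lebesgue p (\<lambda>x. W \<tau> x - W t x)) \<longlongrightarrow> 0) (at t within {0..})"
proof -
  have id: "((\<lambda>\<tau>. \<tau>) \<longlongrightarrow> t) (at t within {0..})" by (rule tendsto_ident_at)
  have "((\<lambda>\<tau>. \<bar>\<tau> - t\<bar> powr (p - 1)) \<longlongrightarrow> \<bar>t - t\<bar> powr (p - 1)) (at t within {0..})"
    using p by (intro tendsto_powr' tendsto_intros id) auto
  then have 1: "((\<lambda>\<tau>. \<bar>\<tau> - t\<bar> powr (p - 1)) \<longlongrightarrow> 0) (at t within {0..})" using p by simp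
  have "((\<lambda>\<tau>. \<bar>exp (mu * \<tau>) - exp (mu * t)\<bar> powr p) \<longlongrightarrow> \<bar>exp (mu * t) - exp (mu * t)\<bar> powr p) (at t within {0..})"
    using p by (intro tendsto_powr' tendsto_intros id) auto
  then have 2: "((\<lambda>\<tau>. \<bar>exp (mu * \<tau>) - exp (mu * t)\<bar> powr p) \<longlongrightarrow> 0) (at t within {0..})" using p by simp
  have "((\<lambda>\<tau>. 2 powr p * (exp (p * mu * \<tau>) * (\<bar>\<tau> - t\<bar> powr (p - 1) * T) + \<bar>exp (mu * \<tau>) - exp (mu * t)\<bar> powr p * Ip lebesgue p (v t)))
     \<longlongrightarrow> 2 powr p * (exp (p * mu * t) * (0 * T) + 0 * Ip lebesgue p (v t))) (at t within {0..})"
    by (intro tendsto_intros id 1 2)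
  then have up: "((\<lambda>\<tau>. 2 powr p * (exp (p * mu * \<tau>) * (\<bar>\<tau> - t\<bar> powr (p - 1) * T) + \<bar>exp (mu * \<tau>) - exp (mu * t)\<bar> powr p * Ip lebesgue p (v t)))
     \<longlongrightarrow> 0) (at t within {0..})" by simp
  show ?thesis
  proof (rule tendsto_sandwich[OF _ _ tendsto_const up])
    show "\<forall>\<^sub>F \<tau> in at t within {0..}. Ip lebesgue p (\<lambda>x. W \<tau> x - W t x)
      \<le> 2 powr p * (exp (p * mu * \<tau>) * (\<bar>\<tau> - t\<bar> powr (p - 1) * T) + \<bar>exp (mu * \<tau>) - exp (mu * t)\<bar> powr p * Ip lebesgue p (v t))"
      unfolding eventually_at_filter
    proof (intro always_eventually allI impI)
      fix \<tau> :: real assume "\<tau> \<in> {0..}"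
      then have \<tau>: "0 \<le> \<tau>" by simp
      have e: "(\<lambda>x. W \<tau> x - W t x) = (\<lambda>x. exp (mu * \<tau>) * (v \<tau> x - v t x) + (exp (mu * \<tau>) - exp (mu * t)) * v t x)"
        by (auto simp: W_def fun_eq_iff algebra_simps)
      have L: "(\<lambda>x. exp (mu * \<tau>) * (v \<tau> x - v t x)) \<in> Lp_space lebesgue p" "(\<lambda>x. (exp (mu * \<tau>) - exp (mu * t)) * v t x) \<in> Lp_space lebesgue p"
        by (intro Lp_space_cmult Lp_space_diff(1) v t \<tau> p0)+
      have "Ip lebesgue p (\<lambda>x. W \<tau> x - W t x) \<le> 2 powr p * (Ip lebesgue p (\<lambda>x. exp (mu * \<tau>) * (v \<tau> x - v t x)) + Ip lebesgue p (\<lambda>x. (exp (mu * \<tau>) - exp (mu * t)) * v t x))"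
        unfolding e by (rule Lp_space_add(2)[OF L p0])
      also have "\<dots> = 2 powr p * (exp (p * mu * \<tau>) * Ip lebesgue p (\<lambda>x. v \<tau> x - v t x) + \<bar>exp (mu * \<tau>) - exp (mu * t)\<bar> powr p * Ip lebesgue p (v t))"
        unfolding Ip_cmult exp_mu_abs_powr ..
      also have "\<dots> \<le> 2 powr p * (exp (p * mu * \<tau>) * (\<bar>\<tau> - t\<bar> powr (p - 1) * T) + \<bar>exp (mu * \<tau>) - exp (mu * t)\<bar> powr p * Ip lebesgue p (v t))"
        by (intro mult_left_mono add_right_mono v_dist_le t \<tau>) auto
      finally show "Ip lebesgue p (\<lambda>x. W \<tau> x - W t x) \<le> 2 powr p * (exp (p * mu * \<tau>) * (\<bar>\<tau> - t\<bar> powr (p - 1) * T) + \<bar>exp (mu * \<tau>) - exp (mu * t)\<bar> powr p * Ip lebesgue p (v t))" .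
    qed
  qed simp
qed

lemma W_dist_continuous:
  assumes g: "g \<in> Lp_space lebesgue p"
  shows "continuous_on {0..} (\<lambda>t. Ip lebesgue p (\<lambda>x. W t x - g x))"
  unfolding continuous_on_def
proof
  fix t :: real assume "t \<in> {0..}"
  then have t: "0 \<le> t" by simp
  show "((\<lambda>\<tau>. Ip lebesgue p (\<lambda>x. W \<tau> x - g x)) \<longlongrightarrow> Ip lebesgue p (\<lambda>x. W t x - g x)) (at t within {0..})"
  proof (rule Lp_tendsto_Ip[OF p])
    show "(\<lambda>x. W t x - g x) \<in> Lp_space lebesgue p" by (rule Lp_space_diff(1)[OF W_Lp[OF t] g p0])
    show "\<forall>\<^sub>F \<tau> in at t within {0..}. (\<lambda>x. W \<tau> x - g x) \<in> Lp_space lebesgue p"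
      unfolding eventually_at_filter
      by (intro always_eventually allI impI Lp_space_diff(1)[OF W_Lp g p0]) simp
    show "((\<lambda>\<tau>. Ip lebesgue p (\<lambda>x. W \<tau> x - g x - (W t x - g x))) \<longlongrightarrow> 0) (at t within {0..})"
      using W_continuous[OF t] by simp
  qed
qed

lemma A_sequence:
  assumes t: "0 \<le> t"
  obtains a :: "nat \<Rightarrow> real" where "\<And>n. a n \<in> A" "\<And>n. t < a n" "\<And>n. a n < t + 1" "a \<longlonglongrightarrow> t"
proof -
  have "\<exists>y\<in>A. t < y \<and> y < t + 1 / real (Suc n)" for n by (rule A_dense[OF t]) simp
  then obtain a where a: "\<And>n. a n \<in> A" "\<And>n. t < a n" "\<And>n. a n < t + 1 / real (Suc n)" by metis
  have "(\<lambda>n. t + 1 / real (Suc n)) \<longlonglongrightarrow> t + 0" by (intro tendsto_intros LIMSEQ_Suc[OF lim_1_over_n])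
  then have up: "(\<lambda>n. t + 1 / real (Suc n)) \<longlonglongrightarrow> t" by simp
  have "a \<longlonglongrightarrow> t"
    by (rule tendsto_sandwich[OF _ _ tendsto_const up]) (use a in \<open>auto intro!: always_eventually less_imp_le\<close>)
  moreover have "a n < t + 1" for n
  proof -
    have "1 / real (Suc n) \<le> 1" by simp
    with a(3)[of n] show ?thesis by linarith
  qed
  ultimately show ?thesis using that a by blast
qed

lemma W_sequence_tendsto:
  assumes t: "0 \<le> t" and a: "\<And>n. a n \<in> A" "a \<longlonglongrightarrow> t" and g: "g \<in> Lp_space lebesgue p"
  shows "(\<lambda>n. Ip lebesgue p (\<lambda>x. W (a n) x - g x)) \<longlonglongrightarrow> Ip lebesgue p (\<lambda>x. W t x - g x)"
  by (rule continuous_on_tendsto_compose[OF W_dist_continuous[OF g] a(2)]) (use t A_nonneg[OF a(1)] in auto)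

text \<open>A time outside \<open>A\<close> is approached from the right by times in
  \<open>A\<close>. The curve is continuous in \<open>L\<^sup>p\<close>, so a subsequence converges
  almost everywhere and Fatou's lemma passes the seminorm bound to the limit.\<close>

lemma Gag_limit_closed:
  assumes t: "0 \<le> t" and u: "u \<in> Wsp s p"
    and le: "\<And>t'. t' \<in> A \<Longrightarrow> t < t' \<Longrightarrow> t' < t + 1 \<Longrightarrow> Gag s p (\<lambda>x. W t' x - u x) \<le> e"
  shows "W t \<in> Wsp s p" "Gag s p (\<lambda>x. W t x - u x) \<le> e"
proof -
  obtain a :: "nat \<Rightarrow> real" where a: "\<And>n. a n \<in> A" "\<And>n. t < a n" "\<And>n. a n < t + 1" "a \<longlonglongrightarrow> t"
    by (rule A_sequence[OF t]) blast
  have "(\<lambda>n. Ip lebesgue p (\<lambda>x. W (a n) x - W t x)) \<longlonglongrightarrow> Ip lebesgue p (\<lambda>x. W t x - W t x)"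
    by (rule W_sequence_tendsto[OF t a(1,4) W_Lp[OF t]])
  then have lim: "(\<lambda>n. Ip lebesgue p (\<lambda>x. W (a n) x - W t x)) \<longlonglongrightarrow> 0" by simp
  note WL = W_Lp[OF A_nonneg[OF a(1)]]
  obtain r where r: "strict_mono (r :: nat \<Rightarrow> nat)" "AE x in lebesgue. (\<lambda>n. W (a (r n)) x) \<longlonglongrightarrow> W t x"
    using Lp_tendsto_AE_subseq[where f = "\<lambda>n. W (a n)", OF Lp_spaceD(1)[OF WL] Lp_spaceD(2)[OF Lp_space_diff(1)[OF WL W_Lp[OF t] p0]] _ lim] p by auto
  have limD: "AE z in gag_measure s p. (\<lambda>n. Dq (W (a (r n))) z - Dq u z) \<longlonglongrightarrow> Dq (W t) z - Dq u z"
    by (rule AE_gagI) (use AE_pair_lebesgueI(1)[OF r(2)] AE_pair_lebesgueI(2)[OF r(2)] in eventually_elim, auto simp: Dq_def intro!: tendsto_intros)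
  have dL: "(\<lambda>z. Dq (W (a (r n))) z - Dq u z) \<in> Lp_space (gag_measure s p) p" for n
    by (rule Lp_space_diff(1)[OF WspD(2)[OF W_Wsp[OF a(1)]] WspD(2)[OF u] p0])
  have m: "(\<lambda>z. Dq (W t) z - Dq u z) \<in> borel_measurable (gag_measure s p)"
    by (intro borel_measurable_diff Dq_measurable_gag Lp_spaceD(1)[OF W_Lp[OF t]] WspD(3)[OF u])
  have ev: "\<forall>\<^sub>F n in sequentially. Ip (gag_measure s p) p (\<lambda>z. Dq (W (a (r n))) z - Dq u z) \<le> e"
    using le[OF a(1-3)] by (intro always_eventually) (simp add: Gag_def Dq_diff)
  have *: "(\<lambda>z. Dq (W t) z - Dq u z) \<in> Lp_space (gag_measure s p) p" "Ip (gag_measure s p) p (\<lambda>z. Dq (W t) z - Dq u z) \<le> e"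
    using Ip_Fatou[OF Lp_spaceD(1)[OF dL] m limD dL ev] p by auto
  show "Gag s p (\<lambda>x. W t x - u x) \<le> e" using *(2) by (simp add: Gag_def Dq_diff)
  have "(\<lambda>z. (Dq (W t) z - Dq u z) + Dq u z) \<in> Lp_space (gag_measure s p) p"
    by (rule Lp_space_add(1)[OF *(1) WspD(2)[OF u] p0])
  then have "Dq (W t) \<in> Lp_space (gag_measure s p) p" by simp
  then show "W t \<in> Wsp s p" using W_Lp[OF t] by (simp add: Wsp_iff)
qed

lemma W_Wsp_all:
  assumes t: "0 \<le> t"
  shows "W t \<in> Wsp s p"
proof (rule Gag_limit_closed(1)[OF t Wsp_zero, where e = "exp (p * mu * (t + 1)) * \<bar>C\<bar>"])
  fix t' assume t': "t' \<in> A" "t < t'" "t' < t + 1"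
  have "Gag s p (W t') = exp (p * mu * t') * P t'" using Gag_W[OF t'(1)] by (simp add: Pw_def)
  also have "\<dots> \<le> exp (p * mu * (t + 1)) * \<bar>C\<bar>"
    using t' p mu_pos P(3)[OF t'(1)] P_nonneg[OF t'(1)] by (intro mult_mono) auto
  finally show "Gag s p (\<lambda>x. W t' x - 0) \<le> exp (p * mu * (t + 1)) * \<bar>C\<bar>" by simp
qed

lemma v_Wsp_all: "0 \<le> t \<Longrightarrow> v t \<in> Wsp s p"
  using Wsp_cmult[OF W_Wsp_all, of t "exp (- (mu * t))"]
  by (simp add: W_def mult.assoc[symmetric] exp_add[symmetric])

text \<open>Bounds on \<open>A\<close> extend to all times, by lower semicontinuity for the seminorm
  and by continuity of the curve for the \<open>L\<^sup>p\<close> part.\<close>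

lemma full_limit:
  assumes u: "u \<in> Wsp s p"
    and G: "((\<lambda>t. Gag s p (\<lambda>x. W t x - u x)) \<longlongrightarrow> 0) FA" and I: "((\<lambda>t. Ip lebesgue p (\<lambda>x. W t x - u x)) \<longlongrightarrow> 0) FA"
  shows "((\<lambda>t. Gag s p (\<lambda>x. W t x - u x)) \<longlongrightarrow> 0) at_top" "((\<lambda>t. Ip lebesgue p (\<lambda>x. W t x - u x)) \<longlongrightarrow> 0) at_top"
proof -
  have "\<forall>\<^sub>F t in at_top. dist (Gag s p (\<lambda>x. W t x - u x)) 0 < e" if e: "0 < e" for e
  proof -
    have "\<forall>\<^sub>F t in FA. Gag s p (\<lambda>x. W t x - u x) < e / 2" using e by (intro order_tendstoD(2)[OF G]) auto
    then obtain t0 where t0: "\<And>t. t \<in> A \<Longrightarrow> t0 \<le> t \<Longrightarrow> Gag s p (\<lambda>x. W t x - u x) < e / 2"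
      unfolding eventually_FA by blast
    show ?thesis
      unfolding eventually_at_top_linorder
    proof (intro exI[of _ "max 0 t0"] allI impI)
      fix t assume t: "max 0 t0 \<le> t"
      have "Gag s p (\<lambda>x. W t x - u x) \<le> e / 2"
        by (rule Gag_limit_closed(2)[OF _ u]) (use t t0 in \<open>auto intro: less_imp_le\<close>)
      then show "dist (Gag s p (\<lambda>x. W t x - u x)) 0 < e" using e by simp
    qed
  qed
  then show "((\<lambda>t. Gag s p (\<lambda>x. W t x - u x)) \<longlongrightarrow> 0) at_top" by (rule tendstoI)
  have "\<forall>\<^sub>F t in at_top. dist (Ip lebesgue p (\<lambda>x. W t x - u x)) 0 < e" if e: "0 < e" for e
  proof -
    have "\<forall>\<^sub>F t in FA. Ip lebesgue p (\<lambda>x. W t x - u x) < e / 2" using e by (intro order_tendstoD(2)[OF I]) auto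
    then obtain t0 where t0: "\<And>t. t \<in> A \<Longrightarrow> t0 \<le> t \<Longrightarrow> Ip lebesgue p (\<lambda>x. W t x - u x) < e / 2"
      unfolding eventually_FA by blast
    show ?thesis
      unfolding eventually_at_top_linorder
    proof (intro exI[of _ "max 0 t0"] allI impI)
      fix t assume t: "max 0 t0 \<le> t"
      then have t': "0 \<le> t" by simp
      obtain a :: "nat \<Rightarrow> real" where a: "\<And>n. a n \<in> A" "\<And>n. t < a n" "\<And>n. a n < t + 1" "a \<longlonglongrightarrow> t"
        by (rule A_sequence[OF t']) blast
      have "Ip lebesgue p (\<lambda>x. W t x - u x) \<le> e / 2"
      proof (rule LIMSEQ_le_const2[OF W_sequence_tendsto[OF t' a(1,4) WspD(1)[OF u]]])
        show "\<exists>N. \<forall>n\<ge>N. Ip lebesgue p (\<lambda>x. W (a n) x - u x) \<le> e / 2"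
          using t0[OF a(1)] a(2) t by (intro exI[of _ 0]) (meson less_imp_le max.boundedE order_trans)
      qed
      then show "dist (Ip lebesgue p (\<lambda>x. W t x - u x)) 0 < e" using e by simp
    qed
  qed
  then show "((\<lambda>t. Ip lebesgue p (\<lambda>x. W t x - u x)) \<longlongrightarrow> 0) at_top" by (rule tendstoI)
qed

lemma FA_sequence_limit:
  assumes a: "\<And>n. a n \<in> A" "\<And>n. real n \<le> a n" and h: "(h \<longlongrightarrow> c) FA"
  shows "(\<lambda>n. h (a n)) \<longlonglongrightarrow> c"
proof -
  have "filterlim a at_top sequentially"
    by (rule filterlim_at_top_mono[OF filterlim_real_sequentially]) (use a in auto)
  then have "filterlim a FA sequentially"
    unfolding FA_def filterlim_inf filterlim_principal using a by auto
  from filterlim_compose[OF h this] show ?thesis .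
qed

lemma subsequential_limit:
  assumes a: "\<And>n. a n \<in> A" "\<And>n. real n \<le> a n"
  obtains r g where "strict_mono (r :: nat \<Rightarrow> nat)" "g \<in> Wsp0 \<Omega> s p"
    "(\<lambda>n. Ip lebesgue p (\<lambda>x. W (a (r n)) x - g x)) \<longlonglongrightarrow> 0" "Gag s p g = S" "Ip lebesgue p g = S / l"
proof -
  have 1: "(\<lambda>n. Gag s p (W (a n))) \<longlonglongrightarrow> l * (S / l)"
    using FA_sequence_limit[OF a Pw_tendsto] l(1) by (simp add: Gag_W[OF a(1)])
  have 2: "(\<lambda>n. Ip lebesgue p (W (a n))) \<longlonglongrightarrow> S / l"
    using FA_sequence_limit[OF a Nw_tendsto] by (simp add: Ip_W)
  obtain r g where "strict_mono (r :: nat \<Rightarrow> nat)" "g \<in> Wsp0 \<Omega> s p"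
    "(\<lambda>n. Ip lebesgue p (\<lambda>x. W (a (r n)) x - g x)) \<longlonglongrightarrow> 0" "Gag s p g = l * (S / l)" "Ip lebesgue p g = S / l"
    by (rule minimising_sequence_compact[where u = "\<lambda>n. W (a n)", OF \<Omega> p s l(2) W_Wsp0[OF a(1)] 1 2]) blast+
  then show ?thesis using that l(1) by simp
qed

text \<open>
  The subsequential limits are \<open>u\<^sub>0\<close> and \<open>- u\<^sub>0\<close>.  Since \<open>t \<mapsto> W t\<close> is continuous in \<open>L\<^sup>p\<close>, it cannot
  switch between neighbourhoods of the two.
\<close>

lemma positive_limit:
  assumes Sp: "0 < S"
  obtains w where "w \<in> Wsp0 \<Omega> s p" "Gag s p w = S" "Ip lebesgue p w = S / l"
    "((\<lambda>t. Gag s p (\<lambda>x. W t x - w x)) \<longlongrightarrow> 0) FA" "((\<lambda>t. Ip lebesgue p (\<lambda>x. W t x - w x)) \<longlongrightarrow> 0) FA"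
proof -
  note intro = that
  define m where "m = S / l"
  have m: "0 < m" "l * m = S" using Sp l by (auto simp: m_def)
  have "\<exists>y\<in>A. real n < y \<and> y < real n + 1" for n by (rule A_dense) auto
  then obtain a0 where a0: "\<And>n. a0 n \<in> A" "\<And>n. real n < a0 n" by metis
  obtain r0 u0 where u0: "u0 \<in> Wsp0 \<Omega> s p" "Gag s p u0 = S" "Ip lebesgue p u0 = m"
    unfolding m_def by (rule subsequential_limit[OF a0(1) less_imp_le[OF a0(2)]]) blast
  note u0L = WspD(1)[OF Wsp0_imp_Wsp[OF u0(1)]]
  define u1 where "u1 = (\<lambda>x. - u0 x)"
  have u1: "u1 \<in> Wsp0 \<Omega> s p" "Gag s p u1 = S" "Ip lebesgue p u1 = m"
    using Wsp0_cmult[OF u0(1) p, of "-1"] Gag_cmult[of s p "-1" u0] u0(2,3) by (auto simp: u1_def Ip_uminus)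
  note u1L = WspD(1)[OF Wsp0_imp_Wsp[OF u1(1)]]
  define d where "d = (\<lambda>t. Ip lebesgue p (\<lambda>x. W t x - u0 x))"
  define e where "e = (\<lambda>t. Ip lebesgue p (\<lambda>x. W t x - u1 x))"
  \<comment> \<open>Otherwise some sequence of times stays away from both functions, while its
    subsequential limit is a minimiser of the same norm and hence one of the two.\<close>
  have near: "\<forall>\<^sub>F t in FA. min (d t) (e t) < \<epsilon>" if \<epsilon>: "0 < \<epsilon>" for \<epsilon>
  proof (rule ccontr)
    assume "\<not> ?thesis"
    then have "\<forall>n. \<exists>t\<in>A. real n \<le> t \<and> \<not> min (d t) (e t) < \<epsilon>"
      unfolding eventually_FA by blast
    then obtain a where a: "\<And>n. a n \<in> A" "\<And>n. real n \<le> a n" "\<And>n. \<not> min (d (a n)) (e (a n)) < \<epsilon>" by metis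
    obtain r g where rg: "strict_mono (r :: nat \<Rightarrow> nat)" "g \<in> Wsp0 \<Omega> s p"
      "(\<lambda>n. Ip lebesgue p (\<lambda>x. W (a (r n)) x - g x)) \<longlonglongrightarrow> 0" "Gag s p g = S" "Ip lebesgue p g = m"
      unfolding m_def by (rule subsequential_limit[OF a(1,2)]) blast
    note [measurable] = WspD(3)[OF Wsp0_imp_Wsp[OF rg(2)]] Lp_spaceD(1)[OF u0L] Lp_spaceD(1)[OF u1L]
    have Wm [measurable]: "W (a n) \<in> borel_measurable lebesgue" for n
      by (rule Lp_spaceD(1)[OF W_Lp[OF A_nonneg[OF a(1)]]])
    have "(AE x in lebesgue. g x = u0 x) \<or> (AE x in lebesgue. g x = - u0 x)"
      using rg u0 m by (intro minimisers_unique_up_to_sign[OF p l(2)]) auto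
    then have "(\<forall>n. Ip lebesgue p (\<lambda>x. W (a (r n)) x - g x) = d (a (r n))) \<or> (\<forall>n. Ip lebesgue p (\<lambda>x. W (a (r n)) x - g x) = e (a (r n)))"
    proof
      assume ae: "AE x in lebesgue. g x = u0 x"
      have "Ip lebesgue p (\<lambda>x. W (a (r n)) x - g x) = d (a (r n))" for n
        unfolding d_def by (rule Ip_cong_AE) (use ae in \<open>auto elim: eventually_mono\<close>)
      then show ?thesis by blast
    next
      assume ae: "AE x in lebesgue. g x = - u0 x"
      have "Ip lebesgue p (\<lambda>x. W (a (r n)) x - g x) = e (a (r n))" for n
        unfolding e_def by (rule Ip_cong_AE) (use ae in \<open>auto elim: eventually_mono simp: u1_def\<close>)
      then show ?thesis by blast
    qed
    then have "\<epsilon> \<le> Ip lebesgue p (\<lambda>x. W (a (r n)) x - g x)" for n using a(3)[of "r n"] by auto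
    then have "\<epsilon> \<le> 0" using LIMSEQ_le_const[OF rg(3)] by blast
    with \<epsilon> show False by simp
  qed
  \<comment> \<open>The distance between \<open>u0\<close> and \<open>- u0\<close> has energy
    \<open>2 powr p * m\<close>, which cancels the constant of the triangle inequality.\<close>
  have sep: "m \<le> d t + e t" if t: "0 \<le> t" for t
  proof -
    have "Ip lebesgue p (\<lambda>x. 2 * u0 x) = Ip lebesgue p (\<lambda>x. u0 x - u1 x)" by (simp add: u1_def)
    also have "\<dots> \<le> 2 powr p * (Ip lebesgue p (\<lambda>x. u0 x - W t x) + Ip lebesgue p (\<lambda>x. W t x - u1 x))"
      by (rule diff_triangle_Ip[OF u0L W_Lp[OF t] u1L p0])
    finally have "2 powr p * m \<le> 2 powr p * (d t + e t)"
      by (simp add: Ip_cmult u0(3) d_def e_def Ip_minus_commute[of lebesgue p u0])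
    then show ?thesis by simp
  qed
  have cont: "continuous_on {0..} d" "continuous_on {0..} e"
    unfolding d_def e_def by (intro W_dist_continuous u0L u1L)+
  \<comment> \<open>The threshold \<open>m / 4\<close> makes the two distances unequal: equality
    would bound their sum by \<open>m / 2\<close>, against \<open>sep\<close>.\<close>
  obtain t0 where t0: "\<And>t. t \<in> A \<Longrightarrow> t0 \<le> t \<Longrightarrow> min (d t) (e t) < m / 4"
    using near[of "m / 4"] m(1) unfolding eventually_FA by auto
  define t1 where "t1 = max 0 t0"
  have close: "min (d t) (e t) \<le> m / 4" if t: "t1 \<le> t" for t
  proof -
    have t': "0 \<le> t" using t by (simp add: t1_def)
    obtain a :: "nat \<Rightarrow> real" where a: "\<And>n. a n \<in> A" "\<And>n. t < a n" "\<And>n. a n < t + 1" "a \<longlonglongrightarrow> t"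
      by (rule A_sequence[OF t']) blast
    have "(\<lambda>n. min (d (a n)) (e (a n))) \<longlonglongrightarrow> min (d t) (e t)"
      unfolding d_def e_def by (intro tendsto_min W_sequence_tendsto[OF t' a(1,4)] u0L u1L)
    then show ?thesis
    proof (rule LIMSEQ_le_const2)
      have "min (d (a n)) (e (a n)) \<le> m / 4" for n
        using t0[OF a(1)[of n]] a(2)[of n] t by (auto simp: t1_def intro: less_imp_le)
      then show "\<exists>N. \<forall>n\<ge>N. min (d (a n)) (e (a n)) \<le> m / 4" by blast
    qed
  qed
  have ne: "d t \<noteq> e t" if t: "t1 \<le> t" for t
    using close[OF t] sep[of t] t m(1) by (auto simp: t1_def)
  have t1A: "t1 \<ge> 0" by (simp add: t1_def)
  \<comment> \<open>By connectedness of \<open>{t1..}\<close> the continuous function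
    \<open>d - e\<close>, having no zero, keeps its sign.\<close>
  have const: "(\<forall>t\<ge>t1. d t < e t) \<or> (\<forall>t\<ge>t1. e t < d t)"
  proof -
    have "connected ((\<lambda>t. d t - e t) ` {t1..})"
      by (intro connected_continuous_image continuous_on_diff continuous_on_subset[OF cont(1)] continuous_on_subset[OF cont(2)])
         (use t1A in auto)
    moreover have "0 \<notin> (\<lambda>t. d t - e t) ` {t1..}" using ne by auto
    ultimately have no: "\<not> (k \<le> 0 \<and> 0 \<le> k')" if "k \<in> (\<lambda>t. d t - e t) ` {t1..}" "k' \<in> (\<lambda>t. d t - e t) ` {t1..}" for k k'
      using that unfolding connected_iff_interval by blast
    show ?thesis
    proof (rule ccontr)
      assume "\<not> ?thesis"
      then obtain x y where xy: "t1 \<le> x" "\<not> d x < e x" "t1 \<le> y" "\<not> e y < d y" by auto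
      then show False using no[of "d y - e y" "d x - e x"] by auto
    qed
  qed
  \<comment> \<open>Convergence in \<open>L\<^sup>p\<close> is upgraded to the seminorm by comparing
    \<open>W\<close> with the constant family \<open>w\<close>.\<close>
  have concl: thesis if w: "w \<in> Wsp0 \<Omega> s p" "Gag s p w = S" "Ip lebesgue p w = m"
    and small: "\<And>\<epsilon>. 0 < \<epsilon> \<Longrightarrow> \<forall>\<^sub>F t in FA. Ip lebesgue p (\<lambda>x. W t x - w x) < \<epsilon>" for w
  proof -
    note wL = WspD(1)[OF Wsp0_imp_Wsp[OF w(1)]]
    have I: "((\<lambda>t. Ip lebesgue p (\<lambda>x. W t x - w x)) \<longlongrightarrow> 0) FA"
      by (rule tendstoI) (use small in simp)
    have evA: "\<forall>\<^sub>F t in FA. t \<in> A" unfolding eventually_FA by blast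
    have "((\<lambda>t. Ip lebesgue p (\<lambda>x. (W t x + w x) / 2)) \<longlongrightarrow> Ip lebesgue p w) FA"
    proof (rule Lp_tendsto_Ip[OF p _ wL])
      show "\<forall>\<^sub>F t in FA. (\<lambda>x. (W t x + w x) / 2) \<in> Lp_space lebesgue p"
        using evA
      proof eventually_elim
        case (elim t)
        show ?case using Lp_space_cmult[OF Lp_space_add(1)[OF W_Lp[OF A_nonneg[OF elim]] wL p0], of "1 / 2"] by simp
      qed
      have "((\<lambda>t. \<bar>1 / 2\<bar> powr p * Ip lebesgue p (\<lambda>x. W t x - w x)) \<longlongrightarrow> 0) FA" by (rule tendsto_mult_right_zero[OF I])
      moreover have "(\<lambda>x. (W t x + w x) / 2 - w x) = (\<lambda>x. 1 / 2 * (W t x - w x))" for t by (auto simp: fun_eq_iff field_simps)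
      ultimately show "((\<lambda>t. Ip lebesgue p (\<lambda>x. (W t x + w x) / 2 - w x)) \<longlongrightarrow> 0) FA"
        by (simp only: Ip_cmult)
    qed
    then have mid: "((\<lambda>t. Ip lebesgue p (\<lambda>x. (W t x + w x) / 2)) \<longlongrightarrow> m) FA" by (simp add: w(3))
    have "((\<lambda>t. Gag s p (W t)) \<longlongrightarrow> l * m) FA"
    proof (rule Lim_transform_eventually[OF Pw_tendsto[folded m(2)]])
      show "\<forall>\<^sub>F t in FA. Pw t = Gag s p (W t)" using evA by eventually_elim (simp add: Gag_W)
    qed
    moreover have "((\<lambda>t. Gag s p w) \<longlongrightarrow> l * m) FA" by (simp add: w(2) m(2))
    moreover have "\<forall>\<^sub>F t in FA. W t \<in> Wsp0 \<Omega> s p \<and> w \<in> Wsp0 \<Omega> s p" using evA by eventually_elim (use W_Wsp0 w in blast)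
    ultimately have "((\<lambda>t. Gag s p (\<lambda>x. W t x - w x)) \<longlongrightarrow> 0) FA"
      using minimising_Gag_tendsto_0[OF p l(2), where f = W and g = "\<lambda>t. w"] mid by blast
    then show thesis using intro[OF w(1,2)] w(3) I by (simp add: m_def)
  qed
  from const show thesis
  proof
    assume lt: "\<forall>t\<ge>t1. d t < e t"
    show thesis
    proof (rule concl[OF u0])
      fix \<epsilon> :: real assume "0 < \<epsilon>"
      have "\<forall>\<^sub>F t in FA. t1 \<le> t" unfolding eventually_FA by blast
      with near[OF \<open>0 < \<epsilon>\<close>] show "\<forall>\<^sub>F t in FA. Ip lebesgue p (\<lambda>x. W t x - u0 x) < \<epsilon>"
      proof eventually_elim
        case (elim t)
        then have "d t < e t" using lt by blast
        with elim have "d t < \<epsilon>" by simp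
        then show ?case by (simp add: d_def)
      qed
    qed
  next
    assume lt: "\<forall>t\<ge>t1. e t < d t"
    show thesis
    proof (rule concl[OF u1])
      fix \<epsilon> :: real assume "0 < \<epsilon>"
      have "\<forall>\<^sub>F t in FA. t1 \<le> t" unfolding eventually_FA by blast
      with near[OF \<open>0 < \<epsilon>\<close>] show "\<forall>\<^sub>F t in FA. Ip lebesgue p (\<lambda>x. W t x - u1 x) < \<epsilon>"
      proof eventually_elim
        case (elim t)
        then have "e t < d t" using lt by blast
        with elim have "e t < \<epsilon>" by simp
        then show ?case by (simp add: e_def)
      qed
    qed
  qed
qed

text \<open>If \<open>v t\<close> vanished, coercivity would bound the energy after \<open>t\<close>
  by increments from \<open>t\<close>, so its averages over shrinking windows would tend to 0. The
  energy does not increase along \<open>A\<close>, so it would be zero at a later time, against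
  \<open>0 < S\<close>.\<close>

lemma v_nonzero:
  assumes Sp: "0 < S" and t: "0 \<le> t"
  shows "\<not> ae_zero (v t)"
proof
  assume z: "ae_zero (v t)"
  \<comment> \<open>Coercivity in the form required by \<open>window_average_le\<close>, with base
    value 0; the factor 1 is relaxed to \<open>p\<close> to match.\<close>
  have le: "P \<tau> \<le> 0 + p * (D \<tau> powr (1 - 1 / p) * Ip lebesgue p (\<lambda>x. v \<tau> x - v t x) powr (1 / p))" if \<tau>: "\<tau> \<in> A" "t < \<tau>" for \<tau>
  proof -
    note [measurable] = Lp_spaceD(1)[OF v[OF t]] Lp_spaceD(1)[OF v[OF A_nonneg[OF \<tau>(1)]]]
    have "Ip lebesgue p (v \<tau>) = Ip lebesgue p (\<lambda>x. v \<tau> x - v t x)"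
      by (rule Ip_cong_AE) (use z in \<open>auto simp: ae_zero_def elim: eventually_mono\<close>)
    then have "P \<tau> \<le> 1 * (D \<tau> powr (1 - 1 / p) * Ip lebesgue p (\<lambda>x. v \<tau> x - v t x) powr (1 / p))"
      using coercivity[OF \<tau>(1)] by simp
    also have "\<dots> \<le> p * (D \<tau> powr (1 - 1 / p) * Ip lebesgue p (\<lambda>x. v \<tau> x - v t x) powr (1 / p))"
      using p by (intro mult_right_mono) auto
    finally show ?thesis by simp
  qed
  obtain b where b: "b \<in> A" "t + 1 < b" using A_dense[of "t + 1" "t + 2"] t by auto
  define h where "h = (\<lambda>n. 1 / real (Suc n))"
  have h: "0 < h n" "h n \<le> 1" for n by (auto simp: h_def)
  have hlim: "h \<longlonglongrightarrow> 0" unfolding h_def by (rule LIMSEQ_Suc[OF lim_1_over_n])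
  have Pb: "P b \<le> 2 * p * DI t (t + h n)" for n
  proof -
    have "(LINT \<tau>|lborel. indicator {t<..t + h n} \<tau> * P b) \<le> (LINT \<tau>|lborel. indicator {t<..t + h n} \<tau> * P \<tau>)"
    proof (rule integral_mono_AE)
      show "integrable lborel (\<lambda>\<tau>. indicator {t<..t + h n} \<tau> * P b)" by (intro integrable_mult_left integrable_real_indicator) auto
      show "integrable lborel (\<lambda>\<tau>. indicator {t<..t + h n} \<tau> * P \<tau>)" by (rule P_interval_integrable[OF t])
      show "AE \<tau> in lborel. indicator {t<..t + h n} \<tau> * P b \<le> indicator {t<..t + h n} \<tau> * P \<tau>"
        using A(2)
      proof eventually_elim
        case (elim \<tau>)
        show ?case
        proof (cases "\<tau> \<in> {t<..t + h n}")
          case True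
          then have \<tau>: "\<tau> \<in> A" "\<tau> < b" using elim t b h[of n] by auto
          have "P b + p * DI \<tau> b \<le> P \<tau>" by (rule energy_inequality[OF \<tau>(1) b(1) \<tau>(2)])
          moreover have "0 \<le> p * DI \<tau> b" using p0 by simp
          ultimately have "P b \<le> P \<tau>" by linarith
          then show ?thesis using True by simp
        qed simp
      qed
    qed
    moreover have "(LINT \<tau>|lborel. indicator {t<..t + h n} \<tau> * P b) = h n * P b"
    proof -
      have "measure lborel {t<..t + h n} = h n" using h[of n] by simp
      then show ?thesis by (simp only: integral_mult_left_zero) simp
    qed
    moreover have "(LINT \<tau>|lborel. indicator {t<..t + h n} \<tau> * P \<tau>) \<le> h n * 0 + 2 * p * h n * DI t (t + h n)"
      by (rule window_average_le[OF t h(1) le])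
    ultimately have "h n * P b \<le> 2 * p * h n * DI t (t + h n)" by linarith
    also have "\<dots> = h n * (2 * p * DI t (t + h n))" by simp
    finally have "h n * P b \<le> h n * (2 * p * DI t (t + h n))" .
    then show ?thesis using h[of n] by simp
  qed
  have "(\<lambda>n. 2 * p * DI t (t + h n)) \<longlonglongrightarrow> 2 * p * 0" by (intro tendsto_intros DI_tendsto_0[OF hlim])
  then have "P b \<le> 2 * p * 0" by (rule LIMSEQ_le_const) (use Pb in auto)
  then have "Pw b \<le> 0" by (simp add: Pw_def mult_le_0_iff)
  with S_le[OF b(1)] Sp show False by simp
qed

lemma rescaled_flow_converges:
  obtains w where "w \<in> Wsp s p" "((\<lambda>t. Wsp_norm s p (\<lambda>x. W t x - w x)) \<longlongrightarrow> 0) at_top"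
    "\<not> ae_zero w \<Longrightarrow> w \<in> Wsp0 \<Omega> s p \<and> Gag s p w = l * Ip lebesgue p w \<and> (\<forall>t\<ge>0. \<not> ae_zero (v t))"
proof -
  have norm_lim: "((\<lambda>t. Wsp_norm s p (\<lambda>x. W t x - w x)) \<longlongrightarrow> 0) at_top"
    if w: "w \<in> Wsp s p" and G: "((\<lambda>t. Gag s p (\<lambda>x. W t x - w x)) \<longlongrightarrow> 0) FA" and I: "((\<lambda>t. Ip lebesgue p (\<lambda>x. W t x - w x)) \<longlongrightarrow> 0) FA" for w
  proof -
    have "\<forall>\<^sub>F t in at_top. (\<lambda>x. W t x - w x) \<in> Wsp s p"
      using eventually_ge_at_top[of 0] by eventually_elim (intro Wsp_diff W_Wsp_all w p0)
    from Wsp_norm_tendsto_0_iff[OF p this] full_limit[OF w G I] show ?thesis by blast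
  qed
  have evA: "\<forall>\<^sub>F t in FA. t \<in> A" unfolding eventually_FA by blast
  show thesis
  proof (cases "S = 0")
    \<comment> \<open>Here the limit is the zero function and the conditional third claim is
      empty.\<close>
    case True
    have "((\<lambda>t. Gag s p (W t)) \<longlongrightarrow> 0) FA"
    proof (rule Lim_transform_eventually[OF Pw_tendsto[unfolded True]])
      show "\<forall>\<^sub>F t in FA. Pw t = Gag s p (W t)" using evA by eventually_elim (simp add: Gag_W)
    qed
    moreover have "((\<lambda>t. Ip lebesgue p (W t)) \<longlongrightarrow> 0) FA" using Nw_tendsto True by (simp add: Ip_W)
    ultimately show thesis
      using norm_lim[OF Wsp_zero] by (intro that[OF Wsp_zero]) (auto simp: ae_zero_def)
  next
    case False
    then have Sp: "0 < S" using S_nonneg by simp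
    obtain w where w: "w \<in> Wsp0 \<Omega> s p" "Gag s p w = S" "Ip lebesgue p w = S / l"
      "((\<lambda>t. Gag s p (\<lambda>x. W t x - w x)) \<longlongrightarrow> 0) FA" "((\<lambda>t. Ip lebesgue p (\<lambda>x. W t x - w x)) \<longlongrightarrow> 0) FA"
      by (rule positive_limit[OF Sp]) blast
    show thesis
      by (rule that[OF Wsp0_imp_Wsp[OF w(1)] norm_lim[OF Wsp0_imp_Wsp[OF w(1)] w(4,5)]])
         (use w v_nonzero[OF Sp] l in auto)
  qed
qed

end

subsection \<open>Weak solutions as flows\<close>

lemma J_op_pairing_tendsto:
  assumes p: "1 < p" and F: "F \<in> Lp_space M p" and g: "\<And>k :: nat. g k \<in> Lp_space M p" "g' \<in> Lp_space M p"
    and lim: "(\<lambda>k. Ip M p (\<lambda>x. g k x - g' x)) \<longlonglongrightarrow> 0"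
  shows "(\<lambda>k. LINT x|M. J_op p (F x) * g k x) \<longlonglongrightarrow> (LINT x|M. J_op p (F x) * g' x)"
proof -
  have d: "(\<lambda>x. g k x - g' x) \<in> Lp_space M p" for k using p by (intro Lp_space_diff(1) g) auto
  have "(\<lambda>k. Ip M p (\<lambda>x. g k x - g' x) powr (1 / p)) \<longlonglongrightarrow> 0 powr (1 / p)"
    using p lim by (subst tendsto_powr_inverse_iff) auto
  then have "(\<lambda>k. Ip M p (\<lambda>x. g k x - g' x) powr (1 / p)) \<longlonglongrightarrow> 0" using p by simp
  then have up: "(\<lambda>k. Ip M p F powr (1 - 1 / p) * Ip M p (\<lambda>x. g k x - g' x) powr (1 / p)) \<longlonglongrightarrow> 0"
    by (rule tendsto_mult_right_zero)
  have "(\<lambda>k. (LINT x|M. J_op p (F x) * g k x) - (LINT x|M. J_op p (F x) * g' x)) \<longlonglongrightarrow> 0"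
  proof (rule Lim_null_comparison[OF _ up], intro always_eventually allI)
    fix k
    have "(LINT x|M. J_op p (F x) * g k x) - (LINT x|M. J_op p (F x) * g' x) = (LINT x|M. J_op p (F x) * (g k x - g' x))"
      using Holder_J_op(1)[OF p F g(1)] Holder_J_op(1)[OF p F g(2)] by (simp add: right_diff_distrib)
    then show "norm ((LINT x|M. J_op p (F x) * g k x) - (LINT x|M. J_op p (F x) * g' x)) \<le> Ip M p F powr (1 - 1 / p) * Ip M p (\<lambda>x. g k x - g' x) powr (1 / p)"
      using Holder_J_op_abs[OF p F d] by simp
  qed
  then show ?thesis by (simp add: LIM_zero_iff)
qed

text \<open>The iterated integral of the weak formulation becomes one pairing over
  \<open>gag_measure\<close>. Hoelder's inequality provides the integrability that Fubini's theorem
  requires.\<close>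

lemma gagliardo_form_eq:
  fixes u \<phi> :: "'a::euclidean_space \<Rightarrow> real"
  assumes p: "1 < p" and u: "u \<in> Wsp s p" and \<phi>: "\<phi> \<in> Wsp s p"
  shows "(LINT x|lebesgue. (LINT y|lebesgue. J_op p (u x - u y) * (\<phi> x - \<phi> y) / norm (x - y) powr (real DIM('a) + s * p)))
    = (LINT z|gag_measure s p. J_op p (Dq u z) * Dq \<phi> z)"
proof -
  let ?M = "(lebesgue :: 'a measure) \<Otimes>\<^sub>M (lebesgue :: 'a measure)"
  let ?k = "\<lambda>z :: 'a \<times> 'a. 1 / norm (fst z - snd z) powr (real DIM('a) + s * p)"
  note [measurable] = Dq_measurable[OF WspD(3)[OF u]] Dq_measurable[OF WspD(3)[OF \<phi>]]
  have m: "(\<lambda>z. J_op p (Dq u z) * Dq \<phi> z) \<in> borel_measurable ?M" by measurable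
  have "integrable (gag_measure s p) (\<lambda>z. J_op p (Dq u z) * Dq \<phi> z)"
    by (rule Holder_J_op(1)[OF p WspD(2)[OF u] WspD(2)[OF \<phi>]])
  then have i: "integrable ?M (\<lambda>z. ?k z *\<^sub>R (J_op p (Dq u z) * Dq \<phi> z))"
    unfolding gag_measure_def by (subst (asm) integrable_density) (use m in auto)
  have "(LINT z|gag_measure s p. J_op p (Dq u z) * Dq \<phi> z) = (LINT z|?M. ?k z *\<^sub>R (J_op p (Dq u z) * Dq \<phi> z))"
    unfolding gag_measure_def by (rule integral_density) (use m in auto)
  also have "\<dots> = (LINT x|lebesgue. LINT y|lebesgue. ?k (x, y) *\<^sub>R (J_op p (Dq u (x, y)) * Dq \<phi> (x, y)))"
    by (rule leb_pair.integral_fst'[OF i, symmetric])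
  finally show ?thesis by (simp add: Dq_def)
qed

lemma AE_lebesgue_on_real:
  assumes "AE t in lebesgue_on I. Q t" "I \<in> sets (borel :: real measure)"
  shows "AE t in lborel. t \<in> I \<longrightarrow> Q t"
proof -
  have "AE t in lebesgue. t \<in> I \<longrightarrow> Q t"
    using assms by (subst (asm) AE_restrict_space_iff) auto
  then show ?thesis by (simp add: AE_completion_iff)
qed

text \<open>The essential change is one of quantifiers: a null set of times for each test function
  becomes one null set for all the tests that the flow performs.\<close>

lemma weak_solution_is_flow:
  fixes \<Omega> :: "'a::euclidean_space set"
  assumes \<Omega>: "open \<Omega>" "bounded \<Omega>" and p: "1 < p" and s: "0 < s"
    and l: "0 < l" "\<And>u. u \<in> Wsp0 \<Omega> s p \<Longrightarrow> l * Ip lebesgue p u \<le> Gag s p u"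
    and sol: "weak_solution \<Omega> s p g v"
  obtains f A P C where "fractional_flow \<Omega> s p l C v f A P"
proof -
  have p0: "0 \<le> p" using p by simp
  note sol' = sol[unfolded weak_solution_def Linf_Wsp0_def]
  have aeW0: "AE t in lebesgue_on {0..}. v t \<in> Wsp0 \<Omega> s p" using sol' by blast
  obtain S :: "nat \<Rightarrow> real \<Rightarrow> 'a \<Rightarrow> real" where S: "\<And>k. simple_function (lebesgue_on {0..}) (S k)" "\<And>k t. 0 \<le> t \<Longrightarrow> S k t \<in> Wsp0 \<Omega> s p"
    "AE t in lebesgue_on {0..}. (\<lambda>k. Wsp_norm s p (\<lambda>x. S k t x - v t x)) \<longlonglongrightarrow> 0"
    using sol' by blast
  obtain C0 :: real where C0: "AE t in lebesgue_on {0..}. Wsp_norm s p (v t) \<le> ennreal C0" using sol' by blast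
  have v\<Omega>: "v t \<in> Lp_space (lebesgue_on \<Omega>) p" if "0 \<le> t" for t using sol' that by blast
  have v0: "AE x in lebesgue. x \<notin> \<Omega> \<longrightarrow> v t x = 0" if "0 \<le> t" for t using sol' that by blast
  have vL: "v t \<in> Lp_space lebesgue p" if "0 \<le> t" for t
    by (rule Lp_space_extend_zero[OF \<Omega>(1) v\<Omega>[OF that] v0[OF that]])
  have cont: "((\<lambda>\<tau>. Ip lebesgue p (\<lambda>x. v \<tau> x - v t x)) \<longlongrightarrow> 0) (at t within {0..})" if t: "0 \<le> t" for t
  proof -
    have E: "Lp_energy (lebesgue_on \<Omega>) p (\<lambda>x. v \<tau> x - v t x) = ennreal (Ip lebesgue p (\<lambda>x. v \<tau> x - v t x))" if \<tau>: "0 \<le> \<tau>" for \<tau>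
    proof -
      have "AE x in lebesgue. x \<notin> \<Omega> \<longrightarrow> v \<tau> x - v t x = 0" using v0[OF t] v0[OF \<tau>] by eventually_elim auto
      then have "Lp_energy (lebesgue_on \<Omega>) p (\<lambda>x. v \<tau> x - v t x) = Lp_energy lebesgue p (\<lambda>x. v \<tau> x - v t x)"
        using \<Omega>(1) by (intro Lp_energy_lebesgue_on) auto
      then show ?thesis using Lp_energy_eq[OF Lp_space_diff(1)[OF vL[OF \<tau>] vL[OF t] p0]] by simp
    qed
    have "((\<lambda>\<tau>. Lp_energy (lebesgue_on \<Omega>) p (\<lambda>x. v \<tau> x - v t x)) \<longlongrightarrow> 0) (at t within {0..})" using sol' t by blast
    then have "((\<lambda>\<tau>. ennreal (Ip lebesgue p (\<lambda>x. v \<tau> x - v t x))) \<longlongrightarrow> ennreal 0) (at t within {0..})"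
      unfolding ennreal_0
      by (rule Lim_transform_eventually) (auto simp: eventually_at_filter E intro!: always_eventually)
    then show ?thesis by (subst (asm) tendsto_ennreal_iff) auto
  qed
  obtain vt where vt: "vt \<in> Lp_space (lebesgue_on (\<Omega> \<times> {0..})) p" "weak_time_deriv \<Omega> v vt"
    and eqn: "\<And>\<phi>. \<phi> \<in> Wsp0 \<Omega> s p \<Longrightarrow> AE t in lebesgue_on {0<..}.
      (LINT x|lebesgue_on \<Omega>. J_op p (vt (x, t)) * \<phi> x) + (LINT x|lebesgue. (LINT y|lebesgue.
          J_op p (v t x - v t y) * (\<phi> x - \<phi> y) / norm (x - y) powr (real DIM('a) + s * p))) = 0"
    using sol' by blast
  obtain f :: "'a \<times> real \<Rightarrow> real" where f: "f \<in> borel_measurable borel" "f \<in> Lp_space lborel p"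
    "\<And>x t. x \<notin> \<Omega> \<or> t < 0 \<Longrightarrow> f (x, t) = 0"
    "AE t in lborel. 0 \<le> t \<longrightarrow> (AE x in lborel. x \<in> \<Omega> \<longrightarrow> vt (x, t) = f (x, t))"
    "\<And>a b. 0 \<le> a \<Longrightarrow> a \<le> b \<Longrightarrow> AE x in lebesgue. v b x - v a x = (LINT \<tau>|lborel. indicator {a<..b} \<tau> * f (x, \<tau>))"
    by (rule time_increment[OF \<Omega> p vt vL v0 cont]) blast+
  \<comment> \<open>The values of the approximating simple functions. Outside one null set the
    equation holds for all of these countably many functions, and for almost every \<open>t'\<close>
    the function \<open>v t'\<close> is a norm limit of elements of \<open>K\<close>.\<close>
  define K where "K = (\<Union>k. S k ` {0..})"
  have Kc: "countable K"
    unfolding K_def using simple_functionD(1)[OF S(1)] by (intro countable_UN) (auto intro: countable_finite)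
  have KW: "\<phi> \<in> Wsp0 \<Omega> s p" if "\<phi> \<in> K" for \<phi> using that S(2) by (auto simp: K_def)
  define EQ where "EQ = (\<lambda>t \<phi>. (LINT x|lebesgue_on \<Omega>. J_op p (vt (x, t)) * \<phi> x) + (LINT x|lebesgue. (LINT y|lebesgue.
          J_op p (v t x - v t y) * (\<phi> x - \<phi> y) / norm (x - y) powr (real DIM('a) + s * p))) = 0)"
  have aeEQ: "AE t in lborel. t \<in> {0<..} \<longrightarrow> (\<forall>\<phi>\<in>K. EQ t \<phi>)"
  proof (rule AE_lebesgue_on_real)
    show "AE t in lebesgue_on {0<..}. \<forall>\<phi>\<in>K. EQ t \<phi>"
      unfolding EQ_def using Kc KW eqn by (subst AE_ball_countable) auto
  qed simp
  have aeS: "AE t in lborel. t \<in> {0..} \<longrightarrow> (\<lambda>k. Wsp_norm s p (\<lambda>x. S k t x - v t x)) \<longlonglongrightarrow> 0"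
    by (rule AE_lebesgue_on_real[OF S(3)]) simp
  have aeW: "AE t in lborel. t \<in> {0..} \<longrightarrow> v t \<in> Wsp0 \<Omega> s p" by (rule AE_lebesgue_on_real[OF aeW0]) simp
  have aeC: "AE t in lborel. t \<in> {0..} \<longrightarrow> Wsp_norm s p (v t) \<le> ennreal C0" by (rule AE_lebesgue_on_real[OF C0]) simp
  have Gm: "(\<lambda>t. indicator {0..} t *\<^sub>R Gag s p (S k t)) \<in> borel_measurable lebesgue" for k
  proof -
    have "simple_function (lebesgue_on {0..}) (\<lambda>t. Gag s p (S k t))"
      using simple_function_compose[OF S(1), of "Gag s p"] by (simp add: o_def)
    then have "(\<lambda>t. Gag s p (S k t)) \<in> borel_measurable (lebesgue_on {0..})" by (rule borel_measurable_simple_function)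
    then show ?thesis by (subst (asm) borel_measurable_restrict_space_iff) auto
  qed
  \<comment> \<open>Measurability of the energy in time is inherited from the simple functions
    through this pointwise limit; \<open>P\<close> is then a Borel representative of it.\<close>
  define P0 where "P0 = (\<lambda>t. lim (\<lambda>k. indicator {0..} t *\<^sub>R Gag s p (S k t)))"
  have "P0 \<in> borel_measurable lebesgue"
    unfolding P0_def using Gm by (rule borel_measurable_lim_metric)
  from completion_ex_borel_measurable_real[OF this]
  obtain P where P: "P \<in> borel_measurable lborel" "AE t in lborel. P0 t = P t" by blast
  have conv: "(\<lambda>k. Gag s p (\<lambda>x. S k t x - v t x)) \<longlonglongrightarrow> 0" "(\<lambda>k. Ip lebesgue p (\<lambda>x. S k t x - v t x)) \<longlonglongrightarrow> 0"
    "(\<lambda>k. Gag s p (S k t)) \<longlonglongrightarrow> Gag s p (v t)"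
    if t: "0 \<le> t" "v t \<in> Wsp0 \<Omega> s p" "(\<lambda>k. Wsp_norm s p (\<lambda>x. S k t x - v t x)) \<longlonglongrightarrow> 0" for t
  proof -
    note SW = Wsp0_imp_Wsp[OF S(2)[OF t(1)]] and vW = Wsp0_imp_Wsp[OF t(2)]
    have d: "(\<lambda>x. S k t x - v t x) \<in> Wsp s p" for k by (rule Wsp_diff[OF SW vW p0])
    show 1: "(\<lambda>k. Gag s p (\<lambda>x. S k t x - v t x)) \<longlonglongrightarrow> 0" "(\<lambda>k. Ip lebesgue p (\<lambda>x. S k t x - v t x)) \<longlonglongrightarrow> 0"
      using Wsp_norm_tendsto_0_iff[where F = sequentially and f = "\<lambda>k x. S k t x - v t x", OF p always_eventually[OF allI[OF d]]] t(3) by blast+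
    show "(\<lambda>k. Gag s p (S k t)) \<longlonglongrightarrow> Gag s p (v t)"
      unfolding Gag_def
      by (rule Lp_tendsto_Ip[OF p _ WspD(2)[OF vW]]) (use 1(1) WspD(2)[OF SW] in \<open>auto simp: Gag_def Dq_diff\<close>)
  qed
  have slice: "AE t in lborel. (\<lambda>x. f (x, t)) \<in> Lp_space lebesgue p"
  proof -
    have "integrable ((lborel :: 'a measure) \<Otimes>\<^sub>M (lborel :: real measure)) (case_prod (\<lambda>x t. \<bar>f (x, t)\<bar> powr p))"
      using Lp_spaceD(2)[OF f(2)] by (simp add: lborel_prod case_prod_beta')
    from lborel_pair.AE_integrable_snd[OF this] show ?thesis
    proof eventually_elim
      case (elim t)
      have m: "(\<lambda>x. f (x, t)) \<in> borel_measurable borel"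
        by (rule measurable_compose[OF _ f(1)]) (intro borel_measurable_continuous_onI continuous_intros)
      have "(\<lambda>x. f (x, t)) \<in> borel_measurable lebesgue" by (rule measurable_completion) (use m in simp)
      moreover have "integrable lebesgue (\<lambda>x. \<bar>f (x, t)\<bar> powr p)"
        using elim m by (subst integrable_completion) auto
      ultimately show ?case by (simp add: Lp_space_iff)
    qed
  qed
  \<comment> \<open>All requirements that hold at almost every time are collected here;
    \<open>0 < t\<close> because the equation is posed on \<open>{0<..}\<close>.\<close>
  define A where "A = {t. 0 < t \<and> v t \<in> Wsp0 \<Omega> s p \<and> Wsp_norm s p (v t) \<le> ennreal C0 \<and>
     (\<lambda>k. Wsp_norm s p (\<lambda>x. S k t x - v t x)) \<longlonglongrightarrow> 0 \<and> (\<forall>\<phi>\<in>K. EQ t \<phi>) \<and> P t = Gag s p (v t) \<and>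
     (\<lambda>x. f (x, t)) \<in> Lp_space lebesgue p \<and> (AE x in lborel. x \<in> \<Omega> \<longrightarrow> vt (x, t) = f (x, t))}"
  have aeA: "AE t in lborel. 0 \<le> t \<longrightarrow> t \<in> A"
    using aeEQ aeS aeW aeC P(2) slice f(4) AE_lborel_singleton[of "0 :: real"]
  proof eventually_elim
    case (elim t)
    show ?case
    proof
      assume "0 \<le> t"
      then have t: "0 < t" "0 \<le> t" using elim by auto
      have "(\<lambda>k. Gag s p (S k t)) \<longlonglongrightarrow> Gag s p (v t)" using t elim by (intro conv) auto
      then have "P0 t = Gag s p (v t)" using t by (simp add: P0_def limI)
      then show "t \<in> A" using t elim by (simp add: A_def)
    qed
  qed
  have form: "(LINT x|lebesgue. J_op p (f (x, t)) * \<phi> x) + (LINT z|gag_measure s p. J_op p (Dq (v t) z) * Dq \<phi> z) = 0"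
    if t: "t \<in> A" and \<phi>: "\<phi> \<in> K" for t \<phi>
  proof -
    note \<phi>W = Wsp0_imp_Wsp[OF KW[OF \<phi>]]
    have tA: "EQ t \<phi>" "v t \<in> Wsp0 \<Omega> s p" "(\<lambda>x. f (x, t)) \<in> Lp_space lebesgue p" "AE x in lborel. x \<in> \<Omega> \<longrightarrow> vt (x, t) = f (x, t)"
      using t \<phi> by (auto simp: A_def)
    have ae: "AE x in lebesgue. x \<in> \<Omega> \<longrightarrow> vt (x, t) = f (x, t)" by (rule AE_completion[OF tA(4)])
    note [measurable] = WspD(3)[OF \<phi>W] Lp_spaceD(1)[OF tA(3)]
    have ae': "AE x in lebesgue. indicator \<Omega> x *\<^sub>R (J_op p (vt (x, t)) * \<phi> x) = J_op p (f (x, t)) * \<phi> x"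
      using ae by eventually_elim (auto simp: indicator_def f(3))
    have m: "(\<lambda>x. J_op p (f (x, t)) * \<phi> x) \<in> borel_measurable lebesgue" by measurable
    have "(LINT x|lebesgue_on \<Omega>. J_op p (vt (x, t)) * \<phi> x) = (LINT x|lebesgue. indicator \<Omega> x *\<^sub>R (J_op p (vt (x, t)) * \<phi> x))"
      using \<Omega>(1) by (intro integral_restrict_space) auto
    also have "\<dots> = (LINT x|lebesgue. J_op p (f (x, t)) * \<phi> x)"
      by (rule integral_cong_AE[OF lebesgue_measurable_cong_AE[OF m ae'] m ae'])
    finally show ?thesis
      using tA(1) gagliardo_form_eq[OF p Wsp0_imp_Wsp[OF tA(2)] \<phi>W] by (simp add: EQ_def)
  qed
  \<comment> \<open>Passage from \<open>K\<close> to \<open>v t'\<close> by Hoelder continuity of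
    both pairings; the time \<open>t\<close> of the equation stays fixed.\<close>
  have form': "(LINT x|lebesgue. J_op p (f (x, t)) * v t' x) + (LINT z|gag_measure s p. J_op p (Dq (v t) z) * Dq (v t') z) = 0"
    if t: "t \<in> A" and t': "t' \<in> A" for t t'
  proof -
    have tA: "v t \<in> Wsp0 \<Omega> s p" "(\<lambda>x. f (x, t)) \<in> Lp_space lebesgue p" using t by (auto simp: A_def)
    have t'A: "0 \<le> t'" "v t' \<in> Wsp0 \<Omega> s p" "(\<lambda>k. Wsp_norm s p (\<lambda>x. S k t' x - v t' x)) \<longlonglongrightarrow> 0" using t' by (auto simp: A_def)
    note SW = Wsp0_imp_Wsp[OF S(2)[OF t'A(1)]] and vW = Wsp0_imp_Wsp[OF t'A(2)]
    have "(\<lambda>k. LINT x|lebesgue. J_op p (f (x, t)) * S k t' x) \<longlonglongrightarrow> (LINT x|lebesgue. J_op p (f (x, t)) * v t' x)"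
      by (rule J_op_pairing_tendsto[OF p tA(2) WspD(1)[OF SW] WspD(1)[OF vW] conv(2)[OF t'A]])
    moreover have "(\<lambda>k. LINT z|gag_measure s p. J_op p (Dq (v t) z) * Dq (S k t') z) \<longlonglongrightarrow> (LINT z|gag_measure s p. J_op p (Dq (v t) z) * Dq (v t') z)"
      by (rule J_op_pairing_tendsto[OF p WspD(2)[OF Wsp0_imp_Wsp[OF tA(1)]] WspD(2)[OF SW] WspD(2)[OF vW]])
         (use conv(1)[OF t'A] in \<open>simp add: Gag_def Dq_diff\<close>)
    ultimately have "(\<lambda>k. (LINT x|lebesgue. J_op p (f (x, t)) * S k t' x) + (LINT z|gag_measure s p. J_op p (Dq (v t) z) * Dq (S k t') z)) \<longlonglongrightarrow>
      (LINT x|lebesgue. J_op p (f (x, t)) * v t' x) + (LINT z|gag_measure s p. J_op p (Dq (v t) z) * Dq (v t') z)"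
      by (rule tendsto_add)
    moreover have "(LINT x|lebesgue. J_op p (f (x, t)) * S k t' x) + (LINT z|gag_measure s p. J_op p (Dq (v t) z) * Dq (S k t') z) = 0" for k
      by (rule form[OF t]) (use t'A in \<open>auto simp: K_def\<close>)
    ultimately have "(\<lambda>k :: nat. 0) \<longlonglongrightarrow> (LINT x|lebesgue. J_op p (f (x, t)) * v t' x) + (LINT z|gag_measure s p. J_op p (Dq (v t) z) * Dq (v t') z)"
      by simp
    from LIMSEQ_unique[OF this tendsto_const] show ?thesis .
  qed
  have bound: "Gag s p (v t) \<le> (max C0 0) powr p" if t: "t \<in> A" for t
  proof -
    have W: "v t \<in> Wsp s p" using t by (auto simp: A_def intro: Wsp0_imp_Wsp)
    have "ennreal ((Gag s p (v t) + Ip lebesgue p (v t)) powr (1 / p)) \<le> ennreal (max C0 0)"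
      using t unfolding Wsp_norm_eq[OF W, symmetric] by (auto simp: A_def intro: order_trans ennreal_leI)
    then have "(Gag s p (v t) + Ip lebesgue p (v t)) powr (1 / p) \<le> max C0 0" by simp
    then have "((Gag s p (v t) + Ip lebesgue p (v t)) powr (1 / p)) powr p \<le> (max C0 0) powr p"
      using p by (intro powr_mono2) auto
    then have "Gag s p (v t) + Ip lebesgue p (v t) \<le> (max C0 0) powr p" using p by (simp add: powr_powr)
    then show ?thesis using Ip_nonneg[of lebesgue p "v t"] by linarith
  qed
  have "fractional_flow \<Omega> s p l ((max C0 0) powr p) v f A P"
  proof
    show "P \<in> borel_measurable borel" using P(1) by simp
    show "P t = Gag s p (v t)" if "t \<in> A" for t using that by (simp add: A_def)
    then show "P t \<le> (max C0 0) powr p" if "t \<in> A" for t using that bound by simp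
    show "A \<subseteq> {0..}" by (auto simp: A_def)
    show "v t \<in> Wsp0 \<Omega> s p" "(\<lambda>x. f (x, t)) \<in> Lp_space lebesgue p" if "t \<in> A" for t using that by (auto simp: A_def)
  qed (fact \<Omega> p s l f vL aeA form')+
  then show ?thesis by (rule that)
qed

text \<open>Covers the alternative that \<open>Wsp0\<close> has only zero elements, in which no
  \<open>u0\<close> for \<open>lambda_sp_properties\<close> exists. Almost every
  \<open>v \<tau>\<close> is then zero, and continuity in time extends this to every
  \<open>t\<close>.\<close>

lemma weak_solution_trivial_space:
  assumes \<Omega>: "open \<Omega>" and p: "1 < p" and triv: "\<And>u. u \<in> Wsp0 \<Omega> s p \<Longrightarrow> ae_zero u"
    and sol: "weak_solution \<Omega> s p g v" and t: "0 \<le> t"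
  shows "AE x in lebesgue. v t x = 0"
proof -
  note sol' = sol[unfolded weak_solution_def Linf_Wsp0_def]
  have aeW0: "AE t in lebesgue_on {0..}. v t \<in> Wsp0 \<Omega> s p" using sol' by blast
  have aeW: "AE t in lborel. t \<in> {0..} \<longrightarrow> v t \<in> Wsp0 \<Omega> s p" by (rule AE_lebesgue_on_real[OF aeW0]) simp
  have vL: "v t \<in> Lp_space lebesgue p" using Lp_space_extend_zero[OF \<Omega>] sol' t by blast
  have v0: "AE x in lebesgue. x \<notin> \<Omega> \<longrightarrow> v t x = 0" using sol' t by blast
  have lim: "((\<lambda>\<tau>. Lp_energy (lebesgue_on \<Omega>) p (\<lambda>x. v \<tau> x - v t x)) \<longlongrightarrow> 0) (at t within {0..})" using sol' t by blast
  have E: "Lp_energy (lebesgue_on \<Omega>) p (\<lambda>x. v \<tau> x - v t x) = ennreal (Ip lebesgue p (v t))" if \<tau>: "v \<tau> \<in> Wsp0 \<Omega> s p" for \<tau>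
  proof -
    have z: "AE x in lebesgue. v \<tau> x = 0" using triv[OF \<tau>] by (simp add: ae_zero_def)
    have "AE x in lebesgue. x \<notin> \<Omega> \<longrightarrow> v \<tau> x - v t x = 0" using z v0 by eventually_elim auto
    then have "Lp_energy (lebesgue_on \<Omega>) p (\<lambda>x. v \<tau> x - v t x) = Lp_energy lebesgue p (\<lambda>x. v \<tau> x - v t x)"
      using \<Omega> by (intro Lp_energy_lebesgue_on) auto
    also have "\<dots> = Lp_energy lebesgue p (\<lambda>x. - v t x)"
      by (rule Lp_energy_cong_AE) (use z in \<open>auto elim: eventually_mono\<close>)
    also have "\<dots> = ennreal (Ip lebesgue p (v t))" using Lp_energy_eq[OF vL] by (simp add: Lp_energy_def)
    finally show ?thesis .
  qed
  have "Ip lebesgue p (v t) = 0"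
  proof (rule ccontr)
    assume "Ip lebesgue p (v t) \<noteq> 0"
    then have "0 < ennreal (Ip lebesgue p (v t))" by (simp add: less_le)
    from order_tendstoD(2)[OF lim this] obtain d where d: "0 < d"
      "\<And>\<tau>. 0 \<le> \<tau> \<Longrightarrow> \<tau> \<noteq> t \<Longrightarrow> dist \<tau> t < d \<Longrightarrow> Lp_energy (lebesgue_on \<Omega>) p (\<lambda>x. v \<tau> x - v t x) < ennreal (Ip lebesgue p (v t))"
      unfolding eventually_at by auto
    have "AE \<tau> in lborel. \<tau> \<notin> {t<..<t + d}"
      using aeW
    proof eventually_elim
      case (elim \<tau>)
      show ?case
      proof
        assume \<tau>: "\<tau> \<in> {t<..<t + d}"
        then have "v \<tau> \<in> Wsp0 \<Omega> s p" using elim t by auto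
        then show False using E[of \<tau>] d(2)[of \<tau>] \<tau> t by (auto simp: dist_real_def)
      qed
    qed
    then have "emeasure lborel {t<..<t + d} = 0" by (subst (asm) AE_iff_measurable[of "{t<..<t + d}"]) auto
    with d(1) show False by simp
  qed
  then show ?thesis using Ip_eq_0_iff[OF vL] by simp
qed

theorem theorem1p2:
  fixes \<Omega> :: "'a::euclidean_space set"
    and p s :: real
    and g :: "'a \<Rightarrow> real"
    and v :: "real \<Rightarrow> 'a \<Rightarrow> real"
  assumes "open \<Omega>" "connected \<Omega>" "\<Omega> \<noteq> {}" "bounded \<Omega>"
    and "1 < p"
    and "0 < s" "s < 1"
    and "g \<in> Wsp0 \<Omega> s p"
    and "weak_solution \<Omega> s p g v"
  shows "\<exists>w \<in> Wsp s p.
           ((\<lambda>t. Wsp_norm s p (\<lambda>x. exp (mu_sp \<Omega> s p * t) * v t x - w x)) \<longlongrightarrow> 0) at_top \<and>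
           (\<not> ae_zero w \<longrightarrow>
              ground_state \<Omega> s p w \<and>
              (\<forall>t\<ge>0. \<not> ae_zero (v t)) \<and>
              ((\<lambda>t. gagliardo s p (v t) / Lp_energy (lebesgue_on \<Omega>) p (v t))
                 \<longlongrightarrow> lambda_sp \<Omega> s p) at_top)"
proof (cases "\<exists>u\<in>Wsp0 \<Omega> s p. \<not> ae_zero u")
  \<comment> \<open>Without nonzero elements the solution vanishes at all times, and the zero
    function is the limit whatever value \<open>mu_sp\<close> takes.\<close>
  case False
  have z: "AE x in lebesgue. 0 = exp (mu_sp \<Omega> s p * t) * v t x" if "0 \<le> t" for t
    using weak_solution_trivial_space[OF assms(1,5) _ assms(9) that] False by (auto elim: eventually_mono)
  have "Wsp_norm s p (\<lambda>x. exp (mu_sp \<Omega> s p * t) * v t x - 0) = 0" if t: "0 \<le> t" for t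
  proof -
    have z': "AE x in lebesgue. exp (mu_sp \<Omega> s p * t) * v t x = 0" using z[OF t] by eventually_elim simp
    have m: "(\<lambda>x. exp (mu_sp \<Omega> s p * t) * v t x) \<in> borel_measurable lebesgue"
      by (rule lebesgue_measurable_cong_AE[OF _ z']) simp
    have W: "(\<lambda>x. exp (mu_sp \<Omega> s p * t) * v t x) \<in> Wsp s p" "Gag s p (\<lambda>x. exp (mu_sp \<Omega> s p * t) * v t x) = 0"
      using Wsp_cong_AE[OF z[OF t] Wsp_zero m] by (simp_all add: Gag_def Dq_zero)
    have "Ip lebesgue p (\<lambda>x. exp (mu_sp \<Omega> s p * t) * v t x) = 0"
      using Ip_cong_AE[OF z[OF t] _ m, of p] by simp
    then show ?thesis using Wsp_norm_eq[OF W(1)] W(2) by simp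
  qed
  then have "((\<lambda>t. Wsp_norm s p (\<lambda>x. exp (mu_sp \<Omega> s p * t) * v t x - 0)) \<longlongrightarrow> 0) at_top"
    by (intro tendsto_eventually) (auto simp: eventually_at_top_linorder)
  then show ?thesis by (intro bexI[OF _ Wsp_zero]) (simp add: ae_zero_def)
next
  case True
  then obtain u0 where u0: "u0 \<in> Wsp0 \<Omega> s p" "\<not> ae_zero u0" by blast
  obtain l where lam: "0 < l" "lambda_sp \<Omega> s p = ennreal l" "\<And>u. u \<in> Wsp0 \<Omega> s p \<Longrightarrow> l * Ip lebesgue p u \<le> Gag s p u"
    by (rule lambda_sp_properties[OF assms(1,4,5,6) u0]) blast
  obtain f A P C where flow: "fractional_flow \<Omega> s p l C v f A P"
    by (rule weak_solution_is_flow[OF assms(1,4,5,6) lam(1,3) assms(9)]) blast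
  interpret fractional_flow \<Omega> s p l C v f A P by (rule flow)
  have mu_eq: "mu_sp \<Omega> s p = mu" using lam by (simp add: mu_sp_def mu_def)
  obtain w where w: "w \<in> Wsp s p" "((\<lambda>t. Wsp_norm s p (\<lambda>x. W t x - w x)) \<longlongrightarrow> 0) at_top"
    "\<not> ae_zero w \<Longrightarrow> w \<in> Wsp0 \<Omega> s p \<and> Gag s p w = l * Ip lebesgue p w \<and> (\<forall>t\<ge>0. \<not> ae_zero (v t))"
    by (rule rescaled_flow_converges) blast
  have "ground_state \<Omega> s p w \<and> (\<forall>t\<ge>0. \<not> ae_zero (v t)) \<and>
     ((\<lambda>t. gagliardo s p (v t) / Lp_energy (lebesgue_on \<Omega>) p (v t)) \<longlongrightarrow> lambda_sp \<Omega> s p) at_top"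
    if nz: "\<not> ae_zero w"
  proof (intro conjI)
    have w0: "w \<in> Wsp0 \<Omega> s p" "Gag s p w = l * Ip lebesgue p w" and vnz: "\<forall>t\<ge>0. \<not> ae_zero (v t)" using w(3)[OF nz] by auto
    show "\<forall>t\<ge>0. \<not> ae_zero (v t)" by (rule vnz)
    have wpos: "0 < Ip lebesgue p w" using Ip_pos_iff_not_ae_zero[OF WspD(1)[OF w(1)]] nz by simp
    have "rayleigh \<Omega> s p w = ennreal l"
      using wpos lam(1) by (simp add: rayleigh_Wsp0[OF assms(1,5) w0(1)] w0(2) divide_ennreal)
    moreover have "ennreal l \<le> rayleigh \<Omega> s p u" if "u \<in> Wsp0 \<Omega> s p" "\<not> ae_zero u" for u
      unfolding lam(2)[symmetric] lambda_sp_def using that by (intro INF_lower) auto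
    ultimately show "ground_state \<Omega> s p w"
      unfolding ground_state_def is_arg_min_def using w0(1) nz by (auto simp: not_less)
    have evW: "\<forall>\<^sub>F t in at_top. (\<lambda>x. W t x - w x) \<in> Wsp s p"
      using eventually_ge_at_top[of 0] by eventually_elim (intro Wsp_diff W_Wsp_all w(1) p0)
    have lims: "((\<lambda>t. Gag s p (\<lambda>x. W t x - w x)) \<longlongrightarrow> 0) at_top" "((\<lambda>t. Ip lebesgue p (\<lambda>x. W t x - w x)) \<longlongrightarrow> 0) at_top"
      using Wsp_norm_tendsto_0_iff[OF assms(5) evW] w(2) by auto
    have evW': "\<forall>\<^sub>F t in at_top. W t \<in> Wsp s p" using eventually_ge_at_top[of 0] by eventually_elim (rule W_Wsp_all)
    have I: "((\<lambda>t. Ip lebesgue p (W t)) \<longlongrightarrow> Ip lebesgue p w) at_top"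
      by (rule Lp_tendsto_Ip[OF assms(5) _ WspD(1)[OF w(1)] lims(2)]) (use evW' in \<open>auto elim: eventually_mono intro: WspD(1)\<close>)
    have G: "((\<lambda>t. Gag s p (W t)) \<longlongrightarrow> Gag s p w) at_top"
      unfolding Gag_def
      by (rule Lp_tendsto_Ip[OF assms(5) _ WspD(2)[OF w(1)]])
         (use evW' lims(1) in \<open>auto elim: eventually_mono intro: WspD(2) simp: Gag_def Dq_diff\<close>)
    \<comment> \<open>The quotient is invariant under scaling, so it may be computed along
      \<open>W\<close>, whose two energies converge to those of \<open>w\<close>.\<close>
    have "((\<lambda>t. Gag s p (W t) / Ip lebesgue p (W t)) \<longlongrightarrow> Gag s p w / Ip lebesgue p w) at_top"
      using wpos by (intro tendsto_divide G I) auto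
    then have "((\<lambda>t. Gag s p (W t) / Ip lebesgue p (W t)) \<longlongrightarrow> l) at_top" using wpos w0(2) by simp
    then have "((\<lambda>t. ennreal (Gag s p (W t) / Ip lebesgue p (W t))) \<longlongrightarrow> lambda_sp \<Omega> s p) at_top"
      unfolding lam(2) by (rule tendsto_ennrealI)
    moreover have "\<forall>\<^sub>F t in at_top. ennreal (Gag s p (W t) / Ip lebesgue p (W t)) = gagliardo s p (v t) / Lp_energy (lebesgue_on \<Omega>) p (v t)"
      using eventually_ge_at_top[of 0]
    proof eventually_elim
      case (elim t)
      have vW: "v t \<in> Wsp s p" by (rule v_Wsp_all[OF elim])
      have v0: "AE x in lebesgue. x \<notin> \<Omega> \<longrightarrow> v t x = 0"
        using assms(9) elim unfolding weak_solution_def by blast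
      have pos: "0 < Ip lebesgue p (v t)" using Ip_pos_iff_not_ae_zero[OF WspD(1)[OF vW]] vnz elim by simp
      have "gagliardo s p (v t) / Lp_energy (lebesgue_on \<Omega>) p (v t) = ennreal (Gag s p (v t)) / ennreal (Ip lebesgue p (v t))"
        using Lp_energy_lebesgue_on[OF _ v0, of p] assms(1) by (simp add: gagliardo_Wsp[OF vW] Lp_energy_eq[OF WspD(1)[OF vW]])
      also have "\<dots> = ennreal (Gag s p (v t) / Ip lebesgue p (v t))" using pos by (simp add: divide_ennreal)
      also have "Gag s p (v t) / Ip lebesgue p (v t) = Gag s p (W t) / Ip lebesgue p (W t)"
        unfolding W_fun Gag_cmult Ip_cmult by simp
      finally show ?case by simp
    qed
    ultimately show "((\<lambda>t. gagliardo s p (v t) / Lp_energy (lebesgue_on \<Omega>) p (v t)) \<longlongrightarrow> lambda_sp \<Omega> s p) at_top"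
      by (rule Lim_transform_eventually)
  qed
  moreover have "((\<lambda>t. Wsp_norm s p (\<lambda>x. exp (mu_sp \<Omega> s p * t) * v t x - w x)) \<longlongrightarrow> 0) at_top"
    using w(2) by (simp add: W_def mu_eq)
  ultimately show ?thesis using w(1) by blast
qed

end
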